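(* Let $S=\{\alpha_1,\alpha_2,\alpha_3\}$ be the set of Arnoux-Rauzy substitutions over the three letters $\mathcal{A}=\{1,2,3\}$, where $\alpha_i: i\mapsto i,\ j\mapsto ji$ for $j\in\mathcal{A}\setminus\{i\}$, and consider the shift $(S^{\mathbb{N}},\Sigma,\nu)$ for some shift invariant ergodic probability measure $\nu$ which assigns positive measure to each cylinder. Then $(S^{\mathbb{N}},\Sigma,\nu)$ satisfies the Pisot condition. Moreover, for $\nu$-almost all sequences $\boldsymbol{\sigma}\in S^{\mathbb{N}}$ the collection $\mathcal{C}_{\mathbf{1}}$ forms a tiling of $\mathbf{1}^\bot$, the $S$-adic shift $(X_{\boldsymbol{\sigma}},\Sigma)$ is measurably conjugate to a translation on the torus $\mathbb{T}^2$, and the words in $X_{\boldsymbol{\sigma}}$ form natural codings of this translation.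
   Context: $\mathbb{N}=\{0,1,2,\ldots\}$, $d=3$. The incidence matrix of a substitution $\sigma$ is $M_\sigma=(|\sigma(j)|_i)_{i,j\in\mathcal{A}}$, where $|w|_i$ counts occurrences of $i$ in $w$; $\mathbf{l}(w)={}^t(|w|_1,|w|_2,|w|_3)$. For $\boldsymbol{\sigma}=(\sigma_n)_{n\in\mathbb{N}}\in S^{\mathbb{N}}$ put $M_n=M_{\sigma_n}$, $\sigma_{[k,\ell)}=\sigma_k\cdots\sigma_{\ell-1}$, $M_{[k,\ell)}=M_k\cdots M_{\ell-1}$. Pisot condition: with the cocycle $A(\boldsymbol{\sigma})={}^tM_0$, the Lyapunov exponents $\theta_1,\theta_2,\theta_3$ of $(S^{\mathbb{N}},\Sigma,\nu)$ are defined recursively by $\theta_1+\cdots+\theta_k=\lim_{n\to\infty}\frac1n\int_{S^{\mathbb{N}}}\log\|\wedge^k(A(\Sigma^{n-1}(x))\cdots A(\Sigma(x))A(x))\|\,d\nu(x)$ ($\wedge^k$ the $k$-fold wedge product), and the Pisot condition is $\theta_1>0>\theta_2\ge\theta_3$. $X_{\boldsymbol{\sigma}}$ is the set of infinite words in $\mathcal{A}^{\mathbb{N}}$ each of whose factors is a factor of $\sigma_{[0,n)}(i)$ for some $i\in\mathcal{A}$, $n\in\mathbb{N}$; $\Sigma$ also denotes the shift on $X_{\boldsymbol{\sigma}}$, which is (for $\nu$-almost all $\boldsymbol{\sigma}$) uniquely ergodic and is equipped with its unique shift invariant probability measure. A limit word of $\boldsymbol{\sigma}$ is an infinite word $\omega=\omega^{(0)}$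 for which there are infinite words $\omega^{(n)}$ with $\omega^{(n)}=\sigma_n(\omega^{(n+1)})$ for all $n$. $\mathbf{u}$ is a positive vector with $\bigcap_nM_{[0,n)}\mathbb{R}_+^3=\mathbb{R}_+\mathbf{u}$ (it exists for $\nu$-almost all $\boldsymbol{\sigma}$). $\mathbf{1}={}^t(1,1,1)$, $\mathbf{1}^\bot$ is the plane orthogonal to $\mathbf{1}$, and $\pi_{\mathbf{u},\mathbf{1}}$ is the projection along $\mathbf{u}$ onto $\mathbf{1}^\bot$. $\mathcal{R}(i)$ is the closure of $\{\pi_{\mathbf{u},\mathbf{1}}\mathbf{l}(p):p\in\mathcal{A}^*,\ p\,i\text{ is a prefix of a limit word of }\boldsymbol{\sigma}\}$, and $\mathcal{C}_{\mathbf{1}}=\{\mathbf{x}+\mathcal{R}(i):\mathbf{x}\in\mathbb{Z}^3\cap\mathbf{1}^\bot,\ i\in\mathcal{A}\}$. A collection of compact sets is a tiling of $\mathbf{1}^\bot$ if each set is the closure of its interior and almost every point of $\mathbf{1}^\bot$ lies in exactly one of the sets. Natural coding: for a full-rank lattice $\Lambda$ in a Euclidean space, a translation $T_{\mathbf{t}}$ on the quotient torus, a fundamental domain $R$ of $\Lambda$ with induced map $\tilde T_{\mathbf{t}}:R\to R$, and a partition (up to measure zero) $R=R_1\cup\cdots\cup R_k$ such that each restriction $\tilde T_{\mathbf{t}}|_{R_i}$ is a translation $\mathbf{x}\mapsto\mathbf{x}+\mathbf{t}_i$, a coding of (the orbit of) a point of $R$ with respect to this partition is called a natural coding of $T_{\mathbf{t}}$;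 here one fixed partition serves for all words of $X_{\boldsymbol{\sigma}}$. *)

theory Defs
  imports "HOL-Probability.Probability" "HOL-Library.Sublist"
begin


section \<open>Words, substitutions, and directive sequences\<close>

text \<open>Letters are the elements \<open>1\<close>, \<open>2\<close>, \<open>3\<close> of the three-element numeral type
  (where \<open>3 = 0\<close>), so that abelianised words live in \<^typ>\<open>real^3\<close>. Infinite words and
  directive sequences are streams, and the shift on both is \<^const>\<open>stl\<close>.\<close>

type_synonym letter = 3
type_synonym subst = "letter \<Rightarrow> letter list"

definition arnoux_rauzy :: "letter \<Rightarrow> subst" where
  "arnoux_rauzy i j = (if j = i then [i] else [j, i])"

definition AR_substs :: "subst set" where
  "AR_substs = {arnoux_rauzy 1, arnoux_rauzy 2, arnoux_rauzy 3}"

definition subst_word :: "subst \<Rightarrow> letter list \<Rightarrow> letter list" where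
  "subst_word \<sigma> w = concat (map \<sigma> w)"

text \<open>\<^const>\<open>flat\<close> is concatenation only for streams of nonempty words; all substitutions
  in \<open>AR_substs\<close> are non-erasing.\<close>

definition subst_stream :: "subst \<Rightarrow> letter stream \<Rightarrow> letter stream" where
  "subst_stream \<sigma> \<omega> = flat (smap \<sigma> \<omega>)"

text \<open>\<open>subst_block s n\<close> is \<open>\<sigma>\<^sub>0 \<sigma>\<^sub>1 \<dots> \<sigma>\<^bsub>n-1\<^esub>\<close>, acting on finite words.\<close>

primrec subst_block :: "subst stream \<Rightarrow> nat \<Rightarrow> letter list \<Rightarrow> letter list" where
  "subst_block s 0 w = w"
| "subst_block s (Suc n) w = subst_block s n (subst_word (s !! n) w)"

definition abelian :: "letter list \<Rightarrow> real^3" where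
  "abelian w = (\<chi> i. real (count_list w i))"

definition incidence :: "subst \<Rightarrow> real^3^3" where
  "incidence \<sigma> = (\<chi> i j. real (count_list (\<sigma> j) i))"

primrec incidence_block :: "subst stream \<Rightarrow> nat \<Rightarrow> real^3^3" where
  "incidence_block s 0 = mat 1"
| "incidence_block s (Suc n) = incidence_block s n ** incidence (s !! n)"


section \<open>Lyapunov exponents and the Pisot condition\<close>

text \<open>The coordinate of \<open>v\<^sub>1 \<and> \<dots> \<and> v\<^sub>k\<close> at the basis vector
  \<open>e\<^bsub>i1\<^esub> \<and> \<dots> \<and> e\<^bsub>ik\<^esub>\<close>, for \<open>I = {i1 < \<dots> < ik}\<close>. The order chosen on the
  index type only affects signs.\<close>

definition wedge :: "(real^'n::{finite,linorder}) list \<Rightarrow> 'n set \<Rightarrow> real" where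
  "wedge vs I = (\<Sum>p | p permutes {..<length vs}.
     of_int (sign p) * (\<Prod>a<length vs. (vs ! p a) $ (sorted_list_of_set I ! a)))"

text \<open>The matrix of the \<open>k\<close>-fold wedge product of \<open>A\<close>: its column at \<open>J = {j1 < \<dots> < jk}\<close>
  consists of the coordinates of \<open>A e\<^bsub>j1\<^esub> \<and> \<dots> \<and> A e\<^bsub>jk\<^esub>\<close>.\<close>

definition wedge_matrix :: "real^('n::{finite,linorder})^('n::{finite,linorder}) \<Rightarrow> 'n set \<Rightarrow> 'n set \<Rightarrow> real" where
  "wedge_matrix A I J = wedge (map (\<lambda>j. A *v axis j 1) (sorted_list_of_set J)) I"

text \<open>The Euclidean (Frobenius) norm of that matrix. All norms on this finite-dimensional
  space define the same Lyapunov exponents.\<close>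

definition wedge_norm :: "nat \<Rightarrow> real^('n::{finite,linorder})^('n::{finite,linorder}) \<Rightarrow> real" where
  "wedge_norm k A = sqrt (\<Sum>I | card I = k. \<Sum>J | card J = k. (wedge_matrix A I J)\<^sup>2)"

definition cocycle :: "subst stream \<Rightarrow> real^3^3" where
  "cocycle s = transpose (incidence (shd s))"

primrec cocycle_iter :: "nat \<Rightarrow> subst stream \<Rightarrow> real^3^3" where
  "cocycle_iter 0 s = mat 1"
| "cocycle_iter (Suc n) s = cocycle (sdrop n s) ** cocycle_iter n s"

definition lyapunov_exponents :: "subst stream measure \<Rightarrow> (nat \<Rightarrow> real) \<Rightarrow> bool" where
  "lyapunov_exponents \<nu> \<theta> \<longleftrightarrow> (\<forall>k\<in>{1..3}.
     (\<forall>n. integrable \<nu> (\<lambda>x. ln (wedge_norm k (cocycle_iter n x)))) \<and>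
     (\<lambda>n. (1 / real n) * (\<integral>x. ln (wedge_norm k (cocycle_iter n x)) \<partial>\<nu>))
       \<longlonglongrightarrow> (\<Sum>j=1..k. \<theta> j))"

definition pisot_condition :: "subst stream measure \<Rightarrow> bool" where
  "pisot_condition \<nu> \<longleftrightarrow>
     (\<exists>\<theta>. lyapunov_exponents \<nu> \<theta> \<and> \<theta> 1 > 0 \<and> 0 > \<theta> 2 \<and> \<theta> 2 \<ge> \<theta> 3)"


section \<open>The S-adic shift\<close>

definition sadic_shift :: "subst stream \<Rightarrow> letter stream set" where
  "sadic_shift s =
     {\<omega>. \<forall>k l. \<exists>i n. sublist (stake l (sdrop k \<omega>)) (subst_block s n [i])}"

definition limit_word :: "subst stream \<Rightarrow> letter stream \<Rightarrow> bool" where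
  "limit_word s w \<longleftrightarrow> (\<exists>\<omega> :: nat \<Rightarrow> letter stream.
     w = \<omega> 0 \<and> (\<forall>n. \<omega> n = subst_stream (s !! n) (\<omega> (Suc n))))"

text \<open>The \<open>\<sigma>\<close>-algebra is the Borel \<open>\<sigma>\<close>-algebra of the product topology, traced on the shift space.\<close>

definition shift_invariant_measure :: "letter stream set \<Rightarrow> letter stream measure \<Rightarrow> bool" where
  "shift_invariant_measure X \<mu> \<longleftrightarrow> prob_space \<mu> \<and>
     sets \<mu> = sets (restrict_space (stream_space (count_space UNIV)) X) \<and>
     stl \<in> measurable \<mu> \<mu> \<and> distr \<mu> \<mu> stl = \<mu>"


section \<open>Rauzy fractals and tilings\<close>

definition generalized_right_eigenvector :: "subst stream \<Rightarrow> real^3 \<Rightarrow> bool" where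
  "generalized_right_eigenvector s u \<longleftrightarrow> (\<forall>i. u $ i > 0) \<and>
     (\<Inter>n. (\<lambda>x. incidence_block s n *v x) ` {x. \<forall>i. x $ i \<ge> 0}) = {c *\<^sub>R u | c. c \<ge> 0}"

definition ones :: "real^3" where
  "ones = (\<chi> i. 1)"

definition ones_perp :: "(real^3) set" where
  "ones_perp = {x. x \<bullet> ones = 0}"

definition proj_ones :: "real^3 \<Rightarrow> real^3 \<Rightarrow> real^3" where
  "proj_ones u x = x - ((x \<bullet> ones) / (u \<bullet> ones)) *\<^sub>R u"

definition integer_lattice :: "(real^'n) set" where
  "integer_lattice = {x. \<forall>i. x $ i \<in> \<int>}"

definition rauzy_fractal :: "subst stream \<Rightarrow> real^3 \<Rightarrow> letter \<Rightarrow> (real^3) set" where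
  "rauzy_fractal s u i = closure {proj_ones u (abelian p) | p.
     \<exists>w. limit_word s w \<and> stake (Suc (length p)) w = p @ [i]}"

definition rauzy_collection :: "subst stream \<Rightarrow> real^3 \<Rightarrow> (real^3) set set" where
  "rauzy_collection s u =
     {(+) x ` rauzy_fractal s u i | x i. x \<in> integer_lattice \<inter> ones_perp}"

text \<open>Area on the plane, up to the constant factor \<open>\<surd>3\<close>, which does not change null sets.\<close>

definition ones_perp_measure :: "(real^3) measure" where
  "ones_perp_measure =
     distr (lborel :: (real^2) measure) borel (\<lambda>y. vector [y $ 1, y $ 2, - y $ 1 - y $ 2])"

definition tiling_ones_perp :: "(real^3) set set \<Rightarrow> bool" where
  "tiling_ones_perp \<C> \<longleftrightarrow>
     (\<forall>C\<in>\<C>. C \<subseteq> ones_perp \<and> compact C \<and>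
        closure (top_of_set ones_perp interior_of C) = C) \<and>
     (AE x in ones_perp_measure. \<exists>!C. C \<in> \<C> \<and> x \<in> C)"


section \<open>Torus translations and measurable conjugacy\<close>

definition measurably_conjugate ::
    "'a measure \<Rightarrow> ('a \<Rightarrow> 'a) \<Rightarrow> 'b measure \<Rightarrow> ('b \<Rightarrow> 'b) \<Rightarrow> bool" where
  "measurably_conjugate M T N S \<longleftrightarrow> (\<exists>M0 N0 \<phi>.
     M0 \<in> sets M \<and> emeasure M (space M - M0) = 0 \<and> T ` M0 \<subseteq> M0 \<and>
     N0 \<in> sets N \<and> emeasure N (space N - N0) = 0 \<and> S ` N0 \<subseteq> N0 \<and>
     bij_betw \<phi> M0 N0 \<and>
     \<phi> \<in> measurable (restrict_space M M0) (restrict_space N N0) \<and>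
     the_inv_into M0 \<phi> \<in> measurable (restrict_space N N0) (restrict_space M M0) \<and>
     distr (restrict_space M M0) (restrict_space N N0) \<phi> = restrict_space N N0 \<and>
     (\<forall>x\<in>M0. \<phi> (T x) = S (\<phi> x)))"

text \<open>The points of the torus are the cosets of \<open>\<int>\<^sup>2\<close> in \<open>\<real>\<^sup>2\<close>; the torus carries the quotient
  Borel \<open>\<sigma>\<close>-algebra and the image of Lebesgue measure on the unit square (Haar measure).\<close>

definition torus_proj :: "real^2 \<Rightarrow> (real^2) set" where
  "torus_proj x = (+) x ` integer_lattice"

definition torus_algebra :: "(real^2) set measure" where
  "torus_algebra = sigma (range torus_proj)
     {A. A \<subseteq> range torus_proj \<and> torus_proj -` A \<in> sets borel}"

definition torus :: "(real^2) set measure" where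
  "torus = distr (restrict_space lborel {x. \<forall>i. 0 \<le> x $ i \<and> x $ i < 1}) torus_algebra torus_proj"

definition torus_translation :: "real^2 \<Rightarrow> (real^2) set \<Rightarrow> (real^2) set" where
  "torus_translation t C = (+) t ` C"


section \<open>Natural codings\<close>

definition full_rank_lattice :: "'a::euclidean_space set \<Rightarrow> bool" where
  "full_rank_lattice \<Lambda> \<longleftrightarrow> (\<exists>B. independent B \<and> span B = UNIV \<and>
     \<Lambda> = {(\<Sum>b\<in>B. real_of_int (c b) *\<^sub>R b) | c. True})"

text \<open>Fundamental domains are understood up to measure zero.\<close>

definition fundamental_domain :: "'a::euclidean_space set \<Rightarrow> 'a set \<Rightarrow> bool" where
  "fundamental_domain \<Lambda> R \<longleftrightarrow> R \<in> sets borel \<and>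
     (AE x in lborel. \<exists>!l. l \<in> \<Lambda> \<and> x + l \<in> R)"

text \<open>The induced map on a fundamental domain; well-defined at almost every point.\<close>

definition induced_translation :: "'a::euclidean_space set \<Rightarrow> 'a set \<Rightarrow> 'a \<Rightarrow> 'a \<Rightarrow> 'a" where
  "induced_translation \<Lambda> R t x = (THE y. y \<in> R \<and> y - (x + t) \<in> \<Lambda>)"

text \<open>The pieces are required to be compact and the closure of their interior (as for tiles).
  Without such regularity they could be enlarged by null sets, for instance by a countable set
  containing an orbit, and then every word would be a coding.\<close>

definition natural_partition ::
    "'a::euclidean_space set \<Rightarrow> 'a \<Rightarrow> 'a set \<Rightarrow> ('i::finite \<Rightarrow> 'a set) \<Rightarrow> ('i \<Rightarrow> 'a) \<Rightarrow> bool" where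
  "natural_partition \<Lambda> t R P \<tau> \<longleftrightarrow>
     full_rank_lattice \<Lambda> \<and> fundamental_domain \<Lambda> R \<and>
     (\<forall>i. compact (P i) \<and> closure (interior (P i)) = P i) \<and>
     R = (\<Union>i. P i) \<and> (AE x in lborel. x \<in> R \<longrightarrow> (\<exists>!i. x \<in> P i)) \<and>
     (\<forall>i. AE x in lborel. x \<in> P i \<longrightarrow> induced_translation \<Lambda> R t x = x + \<tau> i)"

text \<open>\<open>w\<close> is a coding of the orbit of \<open>x\<close>. On the null set where pieces overlap, the induced map
  is multivalued and \<open>x \<mapsto> x + \<tau> i\<close> is the branch attached to the piece \<open>P i\<close>, so the orbit
  follows the branches selected by \<open>w\<close>; such a point may have several codings.\<close>

definition is_coding ::
    "('i \<Rightarrow> 'a::euclidean_space set) \<Rightarrow> ('i \<Rightarrow> 'a) \<Rightarrow> 'a \<Rightarrow> 'i stream \<Rightarrow> bool" where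
  "is_coding P \<tau> x w \<longleftrightarrow> (\<forall>n. x + (\<Sum>k<n. \<tau> (w !! k)) \<in> P (w !! n))"

text \<open>All words of \<open>W\<close> are natural codings, with respect to one partition, of the translation
  by \<open>t\<close> modulo \<open>\<Lambda>\<close>.\<close>

definition natural_codings ::
    "'a::euclidean_space set \<Rightarrow> 'a \<Rightarrow> 'i::finite stream set \<Rightarrow> bool" where
  "natural_codings \<Lambda> t W \<longleftrightarrow> (\<exists>R P \<tau>. natural_partition \<Lambda> t R P \<tau> \<and>
     (\<forall>w\<in>W. \<exists>x\<in>R. is_coding P \<tau> x w))"


section \<open>Ergodic shift invariant measures\<close>

definition ergodic_shift_measure :: "'a set \<Rightarrow> 'a stream measure \<Rightarrow> bool" where
  "ergodic_shift_measure S \<nu> \<longleftrightarrow> prob_space \<nu> \<and>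
     sets \<nu> = sets (stream_space (count_space S)) \<and> distr \<nu> \<nu> stl = \<nu> \<and>
     (\<forall>A\<in>sets \<nu>. stl -` A \<inter> space \<nu> = A \<longrightarrow> measure \<nu> A = 0 \<or> measure \<nu> A = 1)"

end

theory Submission
  imports Defs
begin

text \<open>The transposed incidence matrices contract the spread \<open>max \<bar>y\<^sub>i - y\<^sub>j\<bar>\<close> of a vector orthogonal to the
  generalized right eigenvector, by a fixed factor at every occurrence of the block \<open>(123)\<^sup>3\<close>. Hence
  the \<open>2 \<times> 2\<close> minors of the cocycle grow at a strictly smaller exponential rate than its entries;
  as the determinant is \<open>1\<close>, this gives the Pisot condition. Reading the block occurrences backwards in
  time bounds the integral of the sum of all contraction factors, so by ergodicity almost every
  directive sequence has infinitely many tails whose contraction factors have a common bound on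
  their sum, that is, tails whose languages are uniformly balanced.

  The images of two words \<open>ab\<close> and \<open>ba\<close> decompose into coincidences and pieces on which a letter is moved from
  the end of a word to its front. Each block turns a fixed proportion of every piece into
  coincidences, so the proportion of positions where the images differ tends to \<open>0\<close>. Together
  with balance this shows that different lattice translates of the subtiles overlap in null sets,
  while density of the projected prefixes shows that the translates cover the plane. The translates thus
  tile, every word of the shift codes an orbit of the torus translation, almost every point has
  exactly one coding, and unique ergodicity of the shift follows from this.\<close>

section \<open>Swapped pairs of letters\<close>

text \<open>Contraction is gained only at blocks, and the gaps between blocks need not be bounded,
  so no balance constant serves all levels. All estimates are therefore made at levels
  \<open>n = k + 3\<close> with a block at \<open>k\<close> and contraction sum of the tail at most
  one fixed \<open>C\<close>. There the words of level \<open>n\<close> have comparable lengths, and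
  the tiles of level \<open>n\<close> lie in one square. If two different translated tiles overlap,
  the base points of their overlapping subtiles differ, in level-\<open>n\<close> coordinates, by
  one of finitely many integer vectors, a number independent of \<open>n\<close>. Each such vector
  is realised by completing two letters to words with equal letter counts, which is how the swaps
  \<open>ab\<close>, \<open>ba\<close> control all overlaps. The number of overlapping subtiles is
  then a small multiple of the word length, and the area of each is of the order of its inverse.
  Density rests on the same contraction: a real target is pulled back by the matrix of a high level,
  rounded, and pushed forward with vanishing error. For unique ergodicity an invariant measure is
  moved to the plane, where density of the multiples of \<open>t\<close> modulo the lattice compares
  it with Lebesgue measure.\<close>

abbreviation ar :: "letter \<Rightarrow> letter list \<Rightarrow> letter list" where
  "ar i w \<equiv> subst_word (arnoux_rauzy i) w"

lemma ar_Nil [simp]: "ar i [] = []"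
  by (simp add: subst_word_def)

lemma ar_Cons: "ar i (a # w) = (if a = i then i # ar i w else a # i # ar i w)"
  by (simp add: subst_word_def arnoux_rauzy_def)

lemma subst_word_append [simp]: "subst_word \<sigma> (v @ w) = subst_word \<sigma> v @ subst_word \<sigma> w"
  by (simp add: subst_word_def)

text \<open>An unsplit piece is the pair \<open>x # U\<close>, \<open>b # V\<close>: a word whose only \<open>b\<close> is its last letter, and a
  rearrangement of it whose only \<open>b\<close> is its first letter.\<close>

inductive trail :: "letter \<Rightarrow> letter \<Rightarrow> letter list \<Rightarrow> letter list \<Rightarrow> bool" for b where
  base: "x \<noteq> b \<Longrightarrow> trail b x [b] [x]"
| par: "trail b x U V \<Longrightarrow> x \<noteq> b \<Longrightarrow> p \<noteq> b \<Longrightarrow> trail b x (p # U) (p # V)"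
| exch: "trail b p U V \<Longrightarrow> x \<noteq> b \<Longrightarrow> p \<noteq> b \<Longrightarrow> trail b x (p # U) (x # V)"

lemma trail_neq: "trail b x U V \<Longrightarrow> x \<noteq> b"
  by (induction rule: trail.induct) auto

lemma trail_mset: "trail b x U V \<Longrightarrow> mset (x # U) = mset (b # V)"
  by (induction rule: trail.induct) auto

lemma trail_length: "trail b x U V \<Longrightarrow> length U = length V"
  by (induction rule: trail.induct) auto

lemma trail_not_in: "trail b x U V \<Longrightarrow> b \<notin> set V"
  by (induction rule: trail.induct) auto

text \<open>Every image under \<open>ar a\<close> ends in \<open>a\<close>, so the two last letters
  coincide and are split off. No new \<open>b\<close> appears, so what remains is again one unsplit
  piece; it may only have grown.\<close>

lemma trail_other:
  assumes "trail b x U V" "a \<noteq> b"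
  shows "\<exists>U' V'. trail b x U' V' \<and> ar a (x # U) = x # U' @ [a] \<and> ar a (b # V) = b # V' @ [a]"
  using assms
proof (induction rule: trail.induct)
  case (base x)
  show ?case
  proof (cases "x = a")
    case True
    then show ?thesis using base
      by (intro exI[of _ "[b]"] exI[of _ "[a]"]) (auto simp: ar_Cons intro: trail.intros)
  next
    case False
    then show ?thesis using base
      by (intro exI[of _ "[a,b]"] exI[of _ "[a,x]"]) (auto simp: ar_Cons intro: trail.intros)
  qed
next
  case (par x U V p)
  then obtain U' V' where I: "trail b x U' V'" "ar a (x # U) = x # U' @ [a]" "ar a (b # V) = b # V' @ [a]"
    by auto
  show ?case
  proof (cases "x = a")
    case True
    then have u: "ar a U = U' @ [a]" and v: "a # ar a V = V' @ [a]"
      using I par by (auto simp: ar_Cons split: if_splits)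
    show ?thesis
    proof (cases "p = a")
      case p: True
      show ?thesis
        by (intro exI[of _ "a # U'"] exI[of _ "a # V'"])
          (use I par p True u v in \<open>auto simp: ar_Cons intro: trail.intros\<close>)
    next
      case False
      \<comment> \<open>The image of \<open>x = a\<close> has no appended \<open>a\<close>, so one
        word runs a letter ahead of the other; two exchanges instead of parallel steps absorb
        this.\<close>
      have "trail b a (p # a # U') (a # p # V')"
        using I par False True by (auto intro!: trail.intros)
      then show ?thesis
        by (intro exI[of _ "p # a # U'"] exI[of _ "a # p # V'"])
          (use I par False True u v in \<open>auto simp: ar_Cons\<close>)
    qed
  next
    case False
    then have u: "a # ar a U = U' @ [a]" and v: "a # ar a V = V' @ [a]"
      using I par by (auto simp: ar_Cons split: if_splits)
    show ?thesis
    proof (cases "p = a")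
      case p: True
      show ?thesis
        by (intro exI[of _ "a # U'"] exI[of _ "a # V'"])
          (use I par p False u v in \<open>auto simp: ar_Cons intro: trail.intros\<close>)
    next
      case p: False
      have "trail b x (a # p # U') (a # p # V')"
        using I par False p by (auto intro!: trail.intros(2))
      then show ?thesis
        by (intro exI[of _ "a # p # U'"] exI[of _ "a # p # V'"])
          (use I par False p u v in \<open>auto simp: ar_Cons\<close>)
    qed
  qed
next
  case (exch p U V x)
  then obtain U' V' where I: "trail b p U' V'" "ar a (p # U) = p # U' @ [a]" "ar a (b # V) = b # V' @ [a]"
    by auto
  have v: "a # ar a V = V' @ [a]" using I exch by (auto simp: ar_Cons split: if_splits)
  have T: "trail b x (p # U') (x # V')" using I exch by (auto intro: trail.intros)
  show ?case
  proof (cases "x = a")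
    case True
    then show ?thesis
      by (intro exI[of _ "p # U'"] exI[of _ "x # V'"]) (use I exch v T in \<open>auto simp: ar_Cons\<close>)
  next
    case False
    have "trail b x (a # p # U') (a # x # V')" using T exch by (auto intro: trail.intros)
    then show ?thesis
      by (intro exI[of _ "a # p # U'"] exI[of _ "a # x # V'"]) (use I exch v False in \<open>auto simp: ar_Cons\<close>)
  qed
qed

text \<open>In \<open>splits Q U V N r\<close> the pair \<open>U\<close>, \<open>V\<close> is cut into coincidences and \<open>r\<close> unsplit pieces; \<open>N\<close>
  collects the part of \<open>U\<close> lying in the pieces, and \<open>Q\<close> restricts the letter moved in a piece and the length of the piece.\<close>

inductive splits :: "(letter \<Rightarrow> nat \<Rightarrow> bool) \<Rightarrow> letter list \<Rightarrow> letter list \<Rightarrow> letter list \<Rightarrow> nat \<Rightarrow> bool" for Q where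
  nil: "splits Q [] [] [] 0"
| same: "splits Q U V N r \<Longrightarrow> splits Q (a # U) (a # V) N r"
| piece: "splits Q U V N r \<Longrightarrow> trail b x U1 V1 \<Longrightarrow> Q b (Suc (length U1)) \<Longrightarrow>
    splits Q (x # U1 @ U) (b # V1 @ V) (x # U1 @ N) (Suc r)"
| piece': "splits Q U V N r \<Longrightarrow> trail b x U1 V1 \<Longrightarrow> Q b (Suc (length U1)) \<Longrightarrow>
    splits Q (b # V1 @ U) (x # U1 @ V) (b # V1 @ N) (Suc r)"

lemma splits_append:
  assumes "splits Q U V N r" "splits Q U' V' N' r'"
  shows "splits Q (U @ U') (V @ V') (N @ N') (r + r')"
  using assms(1)
proof (induction rule: splits.induct)
  case nil
  show ?case using assms(2) by simp
next
  case same
  then show ?case by (simp add: splits.same)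
next
  case (piece U V N r b x U1 V1)
  show ?case using splits.piece[OF piece.IH piece.hyps(2,3)] by simp
next
  case (piece' U V N r b x U1 V1)
  show ?case using splits.piece'[OF piece'.IH piece'.hyps(2,3)] by simp
qed

lemma splits_sym:
  "splits Q U V N r \<Longrightarrow> \<exists>N'. splits Q V U N' r \<and> mset N' = mset N"
proof (induction rule: splits.induct)
  case nil
  show ?case by (auto intro: splits.intros)
next
  case (same U V N r a)
  then show ?case by (auto intro: splits.intros)
next
  case (piece U V N r b x U1 V1)
  then obtain N' where N: "splits Q V U N' r" "mset N' = mset N" by auto
  have "mset ((b # V1) @ N') = mset ((x # U1) @ N)"
    by (simp only: mset_append trail_mset[OF piece(2)] N(2))
  then show ?case using splits.piece'[OF N(1) piece(2,3)] by auto
next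
  case (piece' U V N r b x U1 V1)
  then obtain N' where N: "splits Q V U N' r" "mset N' = mset N" by auto
  have "mset ((x # U1) @ N') = mset ((b # V1) @ N)"
    by (simp only: mset_append trail_mset[OF piece'(2)] N(2))
  then show ?case using splits.piece[OF N(1) piece'(2,3)] by auto
qed

lemma splits_mset_subset: "splits Q U V N r \<Longrightarrow> mset N \<subseteq># mset U"
  by (induction rule: splits.induct) (auto intro: subset_mset.order_trans)

text \<open>Applying \<open>b\<close> puts a \<open>b\<close> behind every other letter, and the
  piece breaks up. A new piece moves a letter \<open>y \<noteq> b\<close> and ends at the next
  \<open>y\<close> in \<open>V\<close>, with letters \<open>b\<close> interspersed; hence its length
  is twice a run of \<open>V\<close> free of \<open>y\<close>, plus 2. The premise on
  \<open>Q\<close> admits exactly these lengths. The first new piece, which moves \<open>x\<close>,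
  is kept apart because the induction extends it at the front.\<close>

lemma trail_same:
  assumes "trail b x U V"
    and "\<And>y V'. suffix V' V \<Longrightarrow> y \<noteq> b \<Longrightarrow> Q y (2 * length (takeWhile (\<lambda>z. z \<noteq> y) V') + 2)"
  shows "\<exists>U1 V1 U2 V2 N r. b # ar b U = U1 @ U2 @ [b] \<and> ar b V = V1 @ V2 @ [b] \<and>
     trail x b V1 U1 \<and> length V1 = 2 * length (takeWhile (\<lambda>z. z \<noteq> x) V) + 1 \<and> splits Q U2 V2 N r"
  using assms
proof (induction rule: trail.induct)
  case (base x)
  then show ?case
    by (intro exI[of _ "[b]"] exI[of _ "[x]"] exI[of _ "[]"] exI[of _ "0"])
       (auto simp: ar_Cons intro: trail.intros splits.intros)
next
  case (par x U V p)
  have pre: "\<And>y V'. suffix V' V \<Longrightarrow> y \<noteq> b \<Longrightarrow> Q y (2 * length (takeWhile (\<lambda>z. z \<noteq> y) V') + 2)"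
    using par.prems by (meson suffix_ConsI)
  obtain U1 V1 U2 V2 N r where I: "b # ar b U = U1 @ U2 @ [b]" "ar b V = V1 @ V2 @ [b]"
     "trail x b V1 U1" "length V1 = 2 * length (takeWhile (\<lambda>z. z \<noteq> x) V) + 1" "splits Q U2 V2 N r"
    using par.IH[OF pre] by blast
  show ?case
  proof (cases "p = x")
    case True
    \<comment> \<open>The letter \<open>x\<close> recurs at \<open>p\<close>, so the new first piece
      is only \<open>b x\<close> against \<open>x b\<close>, and the former first piece joins the
      finished ones.\<close>
    have q: "Q x (Suc (length V1))" using pre[of V x] par.hyps I by auto
    have "splits Q (x # U1 @ U2) (b # V1 @ V2) (x # U1 @ N) (Suc r)"
      using splits.piece'[OF I(5) I(3) q] by simp
    then show ?thesis
      by (intro exI[of _ "[b]"] exI[of _ "[x]"] exI[of _ "x # U1 @ U2"] exI[of _ "b # V1 @ V2"] exI[of _ "x # U1 @ N"] exI[of _ "Suc r"])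
        (use I par.hyps True in \<open>simp add: ar_Cons trail.base\<close>)
  next
    case False
    have "trail x b (p # b # V1) (b # p # U1)"
      using I(3) par.hyps False by (auto intro!: trail.exch)
    then show ?thesis
      by (intro exI[of _ "b # p # U1"] exI[of _ "p # b # V1"] exI[of _ "U2"] exI[of _ "V2"] exI[of _ "N"] exI[of _ r])
        (use I par.hyps False in \<open>simp add: ar_Cons\<close>)
  qed
next
  case (exch p U V x)
  have pre: "\<And>y V'. suffix V' V \<Longrightarrow> y \<noteq> b \<Longrightarrow> Q y (2 * length (takeWhile (\<lambda>z. z \<noteq> y) V') + 2)"
    using exch.prems by (meson suffix_ConsI)
  obtain U1 V1 U2 V2 N r where I: "b # ar b U = U1 @ U2 @ [b]" "ar b V = V1 @ V2 @ [b]"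
     "trail p b V1 U1" "length V1 = 2 * length (takeWhile (\<lambda>z. z \<noteq> p) V) + 1" "splits Q U2 V2 N r"
    using exch.IH[OF pre] by blast
  have q: "Q p (Suc (length V1))" using pre[of V p] exch.hyps I by auto
  have "splits Q (p # U1 @ U2) (b # V1 @ V2) (p # U1 @ N) (Suc r)"
    using splits.piece'[OF I(5) I(3) q] by simp
  then show ?case
    by (intro exI[of _ "[b]"] exI[of _ "[x]"] exI[of _ "p # U1 @ U2"] exI[of _ "b # V1 @ V2"] exI[of _ "p # U1 @ N"] exI[of _ "Suc r"])
      (use I exch.hyps in \<open>simp add: ar_Cons trail.base\<close>)
qed

section \<open>Weighted length of the pieces and one substitution step\<close>

definition weight :: "(letter \<Rightarrow> nat) \<Rightarrow> letter list \<Rightarrow> nat" where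
  "weight h w = sum_list (map h w)"

lemma weight_simps [simp]: "weight h [] = 0" "weight h (a # w) = h a + weight h w" "weight h (v @ w) = weight h v + weight h w"
  by (auto simp: weight_def)

lemma weight_mset: "mset v = mset w \<Longrightarrow> weight h v = weight h w"
  unfolding weight_def by (metis mset_map sum_mset_sum_list)

lemma weight_mset_mono: "mset v \<subseteq># mset w \<Longrightarrow> weight h v \<le> weight h w"
proof -
  assume "mset v \<subseteq># mset w"
  then obtain C where C: "mset w = mset v + C" by (metis subset_mset.le_iff_add)
  obtain c where "mset c = C" using ex_mset by blast
  with C have "weight h w = weight h (v @ c)" by (intro weight_mset) simp
  then show ?thesis by simp
qed

text \<open>The weight of a letter when \<open>h\<close> is measured only after \<open>ar i\<close>;
  with \<open>h\<close> the word lengths at one level this is the recursion to the next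
  level.\<close>

definition push :: "(letter \<Rightarrow> nat) \<Rightarrow> letter \<Rightarrow> letter \<Rightarrow> nat" where
  "push h i a = (if a = i then h i else h a + h i)"

lemma weight_ar: "weight h (ar i w) = weight (push h i) w"
  by (induction w) (auto simp: ar_Cons push_def)

lemma length_ar_le: "length (ar i w) \<le> 2 * length w"
  by (induction w) (auto simp: ar_Cons)

text \<open>Whether or not the moved letter is \<open>i\<close>, both images end in
  \<open>i\<close>. This common final letter is the coincidence that every piece yields at every
  step.\<close>

lemma piece_step:
  assumes t: "trail b x U V"
    and H1: "\<And>m. i \<noteq> b \<Longrightarrow> m \<le> 2 * Suc (length U) \<Longrightarrow> Q b m"
    and H2: "\<And>y W. i = b \<Longrightarrow> suffix W V \<Longrightarrow> y \<noteq> b \<Longrightarrow> Q y (2 * length (takeWhile (\<lambda>z. z \<noteq> y) W) + 2)"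
  shows "\<exists>A A' N r. ar i (x # U) = A @ [i] \<and> ar i (b # V) = A' @ [i] \<and> splits Q A A' N r"
proof (cases "i = b")
  case False
  then obtain U' V' where I: "trail b x U' V'" "ar i (x # U) = x # U' @ [i]" "ar i (b # V) = b # V' @ [i]"
    using trail_other[OF t False] by auto
  have "Q b (Suc (length U'))"
    using H1[OF False, of "Suc (length U')"] length_ar_le[of i "x # U"] I(2) by simp
  from splits.piece[where Q=Q and U="[]" and V="[]" and N="[]", OF splits.nil I(1) this] show ?thesis using I by fastforce
next
  case True
  obtain U1 V1 U2 V2 N r where I: "b # ar b U = U1 @ U2 @ [b]" "ar b V = V1 @ V2 @ [b]"
     "trail x b V1 U1" "length V1 = 2 * length (takeWhile (\<lambda>z. z \<noteq> x) V) + 1" "splits Q U2 V2 N r"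
    using trail_same[where Q=Q, OF t H2[OF True]] by blast
  have xb: "x \<noteq> b" using trail_neq[OF t] .
  have q: "Q x (Suc (length V1))" using H2[OF True, of V x] xb I by auto
  have "splits Q (x # U1 @ U2) (b # V1 @ V2) (x # U1 @ N) (Suc r)"
    using splits.piece'[OF I(5) I(3) q] by simp
  moreover have "ar i (x # U) = (x # U1 @ U2) @ [i]" "ar i (b # V) = (b # V1 @ V2) @ [i]"
    using I xb True by (auto simp: ar_Cons)
  ultimately show ?thesis by blast
qed

lemma sublist_trans: "sublist a b \<Longrightarrow> sublist b c \<Longrightarrow> sublist a c"
  unfolding sublist_def by (metis append_assoc)

lemma sublist_into: "sublist W U \<Longrightarrow> sublist W (x # A @ U)" "sublist W A \<Longrightarrow> sublist W (x # A @ U)"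
  unfolding sublist_def by (metis append_Cons append_assoc)+

text \<open>The term \<open>r * h i\<close> is the gain: each of the \<open>r\<close> pieces gives
  up a final \<open>i\<close>. Of the premises on \<open>Q'\<close>, the first concerns pieces that
  survive and at most double, the second the pieces born when the moved letter is applied. All
  weights \<open>h\<close> are treated with one decomposition, because later steps choose the
  weight.\<close>

lemma splits_step:
  assumes "splits Q U V N r"
    and H1: "\<And>b n m. Q b n \<Longrightarrow> b \<noteq> i \<Longrightarrow> m \<le> 2 * n \<Longrightarrow> Q' b m"
    and "\<And>y W. sublist W U \<or> sublist W V \<Longrightarrow> i \<notin> set W \<Longrightarrow> y \<noteq> i \<Longrightarrow>
           Q' y (2 * length (takeWhile (\<lambda>z. z \<noteq> y) W) + 2)"
  shows "\<exists>N' r'. splits Q' (ar i U) (ar i V) N' r' \<and> (\<forall>h. weight h N' + r * h i \<le> weight (push h i) N)"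
  using assms(1,3)
proof (induction rule: splits.induct)
  case nil
  then show ?case by (auto intro!: exI splits.nil)
next
  case (same U V N r a)
  have "\<exists>N' r'. splits Q' (ar i U) (ar i V) N' r' \<and> (\<forall>h. weight h N' + r * h i \<le> weight (push h i) N)"
    by (rule same.IH) (use same.prems in \<open>meson sublist_Cons_right\<close>)
  then show ?case by (auto simp: ar_Cons intro: splits.same)
next
  case (piece U V N r b x U1 V1)
  have "\<exists>N' r'. splits Q' (ar i U) (ar i V) N' r' \<and> (\<forall>h. weight h N' + r * h i \<le> weight (push h i) N)"
    by (rule piece.IH) (use piece.prems in \<open>meson sublist_into\<close>)
  then obtain N' r' where I: "splits Q' (ar i U) (ar i V) N' r'"
    and w: "\<And>h. weight h N' + r * h i \<le> weight (push h i) N" by auto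
  have "\<exists>A A' N r. ar i (x # U1) = A @ [i] \<and> ar i (b # V1) = A' @ [i] \<and> splits Q' A A' N r"
  proof (rule piece_step[OF piece.hyps(2)])
    show "Q' b m" if "i \<noteq> b" "m \<le> 2 * Suc (length U1)" for m
      using H1[OF piece.hyps(3)] that by auto
    show "Q' y (2 * length (takeWhile (\<lambda>z. z \<noteq> y) W) + 2)" if "i = b" "suffix W V1" "y \<noteq> b" for y W
    proof (rule piece.prems)
      have "sublist W (b # V1 @ V)"
        using sublist_into(2)[OF suffix_imp_sublist[OF that(2)]] .
      then show "sublist W (x # U1 @ U) \<or> sublist W (b # V1 @ V)" ..
      show "i \<notin> set W" using trail_not_in[OF piece.hyps(2)] that set_mono_suffix by blast
    qed (use that in auto)
  qed
  then obtain A A' N1 r1 where A: "ar i (x # U1) = A @ [i]" "ar i (b # V1) = A' @ [i]" "splits Q' A A' N1 r1"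
    by auto
  have "splits Q' (A @ [i] @ ar i U) (A' @ [i] @ ar i V) (N1 @ N') (r1 + r')"
    using splits_append[OF A(3) splits.same[OF I]] by simp
  moreover have "ar i (x # U1 @ U) = A @ [i] @ ar i U" "ar i (b # V1 @ V) = A' @ [i] @ ar i V"
    using A(1,2) by (metis append_Cons append_assoc subst_word_append)+
  moreover have "weight h (N1 @ N') + Suc r * h i \<le> weight (push h i) (x # U1 @ N)" for h
  proof -
    have "weight h N1 + h i \<le> weight h (A @ [i])"
      using weight_mset_mono[OF splits_mset_subset[OF A(3)], of h] by simp
    also have "\<dots> = weight (push h i) (x # U1)" using A(1) weight_ar by metis
    finally show ?thesis using w[of h] by simp
  qed
  ultimately show ?case by metis
next
  case (piece' U V N r b x U1 V1)
  have "\<exists>N' r'. splits Q' (ar i U) (ar i V) N' r' \<and> (\<forall>h. weight h N' + r * h i \<le> weight (push h i) N)"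
    by (rule piece'.IH) (use piece'.prems in \<open>meson sublist_into\<close>)
  then obtain N' r' where I: "splits Q' (ar i U) (ar i V) N' r'"
    and w: "\<And>h. weight h N' + r * h i \<le> weight (push h i) N" by auto
  have "\<exists>A A' N r. ar i (x # U1) = A @ [i] \<and> ar i (b # V1) = A' @ [i] \<and> splits Q' A A' N r"
  proof (rule piece_step[OF piece'.hyps(2)])
    show "Q' b m" if "i \<noteq> b" "m \<le> 2 * Suc (length U1)" for m
      using H1[OF piece'.hyps(3)] that by auto
    show "Q' y (2 * length (takeWhile (\<lambda>z. z \<noteq> y) W) + 2)" if "i = b" "suffix W V1" "y \<noteq> b" for y W
    proof (rule piece'.prems)
      have "sublist W (b # V1 @ U)"
        using sublist_into(2)[OF suffix_imp_sublist[OF that(2)]] .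
      then show "sublist W (b # V1 @ U) \<or> sublist W (x # U1 @ V)" ..
      show "i \<notin> set W" using trail_not_in[OF piece'.hyps(2)] that set_mono_suffix by blast
    qed (use that in auto)
  qed
  then obtain A A' N1 r1 where A: "ar i (x # U1) = A @ [i]" "ar i (b # V1) = A' @ [i]" "splits Q' A A' N1 r1"
    by auto
  obtain N2 where N2: "splits Q' A' A N2 r1" using splits_sym[OF A(3)] by auto
  have "splits Q' (A' @ [i] @ ar i U) (A @ [i] @ ar i V) (N2 @ N') (r1 + r')"
    using splits_append[OF N2 splits.same[OF I]] by simp
  moreover have "ar i (x # U1 @ V) = A @ [i] @ ar i V" "ar i (b # V1 @ U) = A' @ [i] @ ar i U"
    using A(1,2) by (metis append_Cons append_assoc subst_word_append)+
  moreover have "weight h (N2 @ N') + Suc r * h i \<le> weight (push h i) (b # V1 @ N)" for h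
  proof -
    have "weight h N2 + h i \<le> weight h (A' @ [i])"
      using weight_mset_mono[OF splits_mset_subset[OF N2], of h] by simp
    also have "\<dots> = weight (push h i) (b # V1)" using A(2) weight_ar by metis
    finally show ?thesis using w[of h] by simp
  qed
  ultimately show ?case by metis
qed

section \<open>Bounded pieces from words without cubes\<close>

lemma no_square_ar: "a \<noteq> j \<Longrightarrow> \<not> sublist [a, a] (ar j w)"
  by (induction w) (auto simp: ar_Cons sublist_Cons_right)

text \<open>Behind a letter other than \<open>i\<close>, the run of \<open>i\<close> in
  \<open>ar i v\<close> is one longer than the run of \<open>i\<close> in \<open>v\<close>; cubes of
  other letters are excluded since \<open>i\<close> follows each of them.\<close>

lemma no_cube_ar:
  assumes "\<not> sublist [i, i] v"
  shows "\<not> sublist [p, p, p] (ar i v)"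
proof (cases "p = i")
  case False
  have "sublist [p, p] [p, p, p]" by (simp add: sublist_Cons_right)
  then show ?thesis using no_square_ar[OF False] sublist_trans by blast
next
  case True
  show ?thesis using assms unfolding True
  proof (induction v)
    case (Cons a v)
    have n: "\<not> sublist [i, i] v" using Cons.prems by (simp add: sublist_Cons_right)
    have *: "ar i v \<noteq> i # i # t" for t
      using n by (cases v; cases "tl v") (auto simp: ar_Cons sublist_Cons_right)
    have **: "ar i v \<noteq> i # t" if "a = i" for t
      using Cons.prems that by (cases v) (auto simp: ar_Cons sublist_Cons_right)
    show ?case using Cons.IH[OF n] * **
      by (auto simp: ar_Cons sublist_Cons_right prefix_Cons) (metis prefixE append_Cons)+
  qed simp
qed

lemma letters_not_four: "False" if "i \<noteq> y" "z \<noteq> i" "z \<noteq> y" "z' \<noteq> i" "z' \<noteq> y" "z \<noteq> z'" for i y z z' :: letter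
proof -
  have "card {i, y, z, z'} \<le> CARD(3)" by (rule card_mono) simp_all
  moreover have "card {i, y, z, z'} = 4" using that by (simp add: card_insert_if)
  ultimately show False by simp
qed
lemma third_letter: "\<exists>p::letter. \<forall>z. z \<noteq> i \<longrightarrow> z \<noteq> y \<longrightarrow> z = p" if "y \<noteq> i"
  using letters_not_four[OF that] by blast

text \<open>Without \<open>i\<close> and \<open>y\<close> only one letter is left, so a longer run
  would be a cube. A newborn piece therefore has length at most 2 * 2 + 2.\<close>

lemma run_bound:
  assumes n: "\<And>p. \<not> sublist [p, p, p] (W :: letter list)" and "i \<notin> set W" "y \<noteq> i"
  shows "length (takeWhile (\<lambda>z. z \<noteq> y) W) \<le> 2"
proof (rule ccontr)
  define T where "T = takeWhile (\<lambda>z. z \<noteq> y) W"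
  assume "\<not> ?thesis"
  then have "3 \<le> length T" unfolding T_def by linarith
  then obtain a b c r where T: "T = a # b # c # r"
    unfolding numeral_3_eq_3 Suc_le_length_iff by blast
  obtain p where p: "\<forall>z. z \<noteq> i \<longrightarrow> z \<noteq> y \<longrightarrow> z = p" using third_letter assms(3) by blast
  have "z = p" if "z \<in> set T" for z
    using p assms(2) set_takeWhileD[OF that[unfolded T_def]] by metis
  from this[of a] this[of b] this[of c] T have "T = [p, p, p] @ r" by simp
  then have "sublist [p, p, p] T" by simp
  moreover have "sublist T W" unfolding T_def by (rule prefix_imp_sublist[OF takeWhile_is_prefix])
  ultimately show False using n sublist_trans by blast
qed

lemma splits_step_le:
  assumes "splits Q U V N r"
    and "\<And>b n m. Q b n \<Longrightarrow> b \<noteq> i \<Longrightarrow> m \<le> 2 * n \<Longrightarrow> Q' b m"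
    and "\<And>y W. sublist W U \<or> sublist W V \<Longrightarrow> i \<notin> set W \<Longrightarrow> y \<noteq> i \<Longrightarrow>
           Q' y (2 * length (takeWhile (\<lambda>z. z \<noteq> y) W) + 2)"
  obtains N' r' where "splits Q' (ar i U) (ar i V) N' r'" "\<And>h. weight h N' \<le> weight (push h i) N"
proof -
  have "\<exists>N' r'. splits Q' (ar i U) (ar i V) N' r' \<and> (\<forall>h. weight h N' + r * h i \<le> weight (push h i) N)"
    by (rule splits_step[OF assms(1), where Q'=Q']) (fact assms(2), fact assms(3))
  then obtain N' r' where *: "splits Q' (ar i U) (ar i V) N' r'" "\<forall>h. weight h N' + r * h i \<le> weight (push h i) N"
    by blast
  have "weight h N' \<le> weight (push h i) N" for h using *(2) add_leD1 by blast
  then show thesis by (rule that[OF *(1)])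
qed

text \<open>Pieces behind \<open>b\<close> stay unsplit, and may grow, until the letter \<open>b\<close> itself is applied.\<close>

lemma splits_five:
  assumes s: "splits (\<lambda>_ _. True) U0 V0 N0 r0"
    and d: "j \<noteq> j0" "i1 \<noteq> j" "i1 \<noteq> i2" "i1 \<noteq> i3" "i2 \<noteq> i3"
  defines "g \<equiv> \<lambda>w. ar i3 (ar i2 (ar i1 (ar j (ar j0 w))))"
  obtains N r where "splits (\<lambda>b n. n \<le> 24) (g U0) (g V0) N r"
     "\<And>h. weight h N \<le> weight (push (push (push (push (push h i3) i2) i1) j) j0) N0"
proof -
  \<comment> \<open>The word to be substituted is always an image under two distinct letters, hence
    free of cubes; the letters \<open>j0\<close> and \<open>j\<close> are applied first to secure
    this.\<close>
  have bnd: "2 * length (takeWhile (\<lambda>z. z \<noteq> y) W) + 2 \<le> 6"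
    if "a \<noteq> a'" "sublist W (ar a (ar a' v)) \<or> sublist W (ar a (ar a' v'))" "i \<notin> set W" "y \<noteq> i"
    for W v v' a a' i y
  proof -
    have "\<not> sublist [p, p, p] W" for p
      using that(2) no_cube_ar[OF no_square_ar[OF that(1)]] sublist_trans by blast
    from run_bound[OF this that(3,4)] show ?thesis by simp
  qed
  obtain N1 r1 where 1: "splits (\<lambda>_ _. True) (ar j0 U0) (ar j0 V0) N1 r1"
    "\<And>h. weight h N1 \<le> weight (push h j0) N0"
    by (rule splits_step_le[OF s, where Q'="\<lambda>_ _. True"]) (rule TrueI, rule TrueI, rule that)
  obtain N2 r2 where 2: "splits (\<lambda>_ _. True) (ar j (ar j0 U0)) (ar j (ar j0 V0)) N2 r2"
    "\<And>h. weight h N2 \<le> weight (push h j) N1"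
    by (rule splits_step_le[OF 1(1), where Q'="\<lambda>_ _. True"]) (rule TrueI, rule TrueI, rule that)
  \<comment> \<open>From here on each piece either was born at one of the last steps, with length at
    most 6 and doubling afterwards, or still awaits its letter. After three distinct letters nothing
    awaits, which leaves the bound 24.\<close>
  obtain N3 r3 where 3: "splits (\<lambda>b n. n \<le> 6 \<or> b \<noteq> i1) (ar i1 (ar j (ar j0 U0))) (ar i1 (ar j (ar j0 V0))) N3 r3"
    "\<And>h. weight h N3 \<le> weight (push h i1) N2"
  proof (rule splits_step_le[OF 2(1), where Q'="\<lambda>b n. n \<le> 6 \<or> b \<noteq> i1" and i=i1], goal_cases)
    case (2 y W)
    from bnd[OF d(1) 2(2,3,4)] show ?case by (rule disjI1)
  next
    case (3 N' r')
    from 3(1)[OF 3(2,3)] show ?case .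
  qed simp
  obtain N4 r4 where 4: "splits (\<lambda>b n. n \<le> 12 \<or> (b \<noteq> i1 \<and> b \<noteq> i2)) (ar i2 (ar i1 (ar j (ar j0 U0)))) (ar i2 (ar i1 (ar j (ar j0 V0)))) N4 r4"
    "\<And>h. weight h N4 \<le> weight (push h i2) N3"
  proof (rule splits_step_le[OF 3(1), where Q'="\<lambda>b n. n \<le> 12 \<or> (b \<noteq> i1 \<and> b \<noteq> i2)" and i=i2], goal_cases)
    case (2 y W)
    have "2 * length (takeWhile (\<lambda>z. z \<noteq> y) W) + 2 \<le> 12"
      by (rule order.trans[OF bnd[OF d(2) 2(2,3,4)]]) simp
    then show ?case by (rule disjI1)
  next
    case (1 b n m)
    from 1(2) show ?case
    proof
      assume "n \<le> 6"
      then have "m \<le> 12" using 1(4) by linarith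
      then show ?case ..
    next
      assume "b \<noteq> i1"
      then have "b \<noteq> i1 \<and> b \<noteq> i2" using 1(3) ..
      then show ?case ..
    qed
  next
    case (3 N' r')
    from 3(1)[OF 3(2,3)] show ?case .
  qed
  have tri: "b = i1 \<or> b = i2 \<or> b = i3" for b :: letter
    using d(3,4,5) letters_not_four[of i1 i2 i3 b] by metis
  obtain N5 r5 where 5: "splits (\<lambda>b n. n \<le> 24) (ar i3 (ar i2 (ar i1 (ar j (ar j0 U0))))) (ar i3 (ar i2 (ar i1 (ar j (ar j0 V0))))) N5 r5"
    "\<And>h. weight h N5 \<le> weight (push h i3) N4"
  proof (rule splits_step_le[OF 4(1), where Q'="\<lambda>b n. n \<le> 24" and i=i3], goal_cases)
    case (1 b n m)
    from 1(2,3) have "n \<le> 12" using tri[of b] by metis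
    then show ?case using 1(4) by linarith
  next
    case (2 y W)
    show ?case by (rule order.trans[OF bnd[OF d(3)[symmetric] 2(2,3,4)]]) simp
  next
    case (3 N' r')
    from 3(1)[OF 3(2,3)] show ?case .
  qed
  have w: "weight h N5 \<le> weight (push (push (push (push (push h i3) i2) i1) j) j0) N0" for h
    by (rule order.trans[OF 5(2)] order.trans[OF 4(2)] order.trans[OF 3(2)] order.trans[OF 2(2)] 1(2))+
  show thesis by (rule that[unfolded g_def, OF 5(1) w])
qed

section \<open>Mismatches between images of rearranged words\<close>

text \<open>A coincidence asks for equal letters behind prefixes with equal letter counts: the
  broken lines of the two words share a vertex and the edge leaving it. Only this stronger form has
  a meaning for tiles.\<close>

definition mismatches :: "letter list \<Rightarrow> letter list \<Rightarrow> nat set" where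
  "mismatches U V = {n. n < length U \<and> \<not> (mset (take n U) = mset (take n V) \<and> U ! n = V ! n)}"

lemma finite_mismatches [simp]: "finite (mismatches U V)"
  by (simp add: mismatches_def)

lemma mismatches_refl [simp]: "mismatches U U = {}"
  by (simp add: mismatches_def)

lemma card_mismatches_le: "card (mismatches U V) \<le> length U"
proof -
  have "mismatches U V \<subseteq> {..<length U}" by (auto simp: mismatches_def)
  from card_mono[OF _ this] show ?thesis by simp
qed

lemma mismatches_append:
  assumes "mset A = mset A'"
  shows "mismatches (A @ U) (A' @ V) \<subseteq> mismatches A A' \<union> (+) (length A) ` mismatches U V"
proof
  fix n assume n: "n \<in> mismatches (A @ U) (A' @ V)"
  have l: "length A' = length A" using assms by (metis size_mset)
  show "n \<in> mismatches A A' \<union> (+) (length A) ` mismatches U V"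
  proof (cases "n < length A")
    case True
    then have "n \<in> mismatches A A'" using n l by (auto simp: mismatches_def nth_append)
    then show ?thesis ..
  next
    case False
    then obtain m where m: "n = length A + m" by (metis le_iff_add not_le)
    have "(A' @ V) ! (length A + m) = V ! m" by (simp add: l[symmetric])
    then have "m \<in> mismatches U V" using n l assms unfolding m by (auto simp: mismatches_def)
    then show ?thesis using m by blast
  qed
qed

lemma card_mismatches_append:
  assumes "mset A = mset A'"
  shows "card (mismatches (A @ U) (A' @ V)) \<le> card (mismatches A A') + card (mismatches U V)"
proof -
  have "card (mismatches (A @ U) (A' @ V)) \<le> card (mismatches A A' \<union> (+) (length A) ` mismatches U V)"
    by (intro card_mono mismatches_append assms) auto
  also have "\<dots> \<le> card (mismatches A A') + card ((+) (length A) ` mismatches U V)" by (rule card_Un_le)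
  also have "card ((+) (length A) ` mismatches U V) = card (mismatches U V)" by (simp add: card_image)
  finally show ?thesis by simp
qed

lemma card_mismatches_trans:
  assumes "length U = length V"
  shows "card (mismatches U W) \<le> card (mismatches U V) + card (mismatches V W)"
proof -
  have "mismatches U W \<subseteq> mismatches U V \<union> mismatches V W" using assms by (auto simp: mismatches_def)
  then have "card (mismatches U W) \<le> card (mismatches U V \<union> mismatches V W)" by (intro card_mono) auto
  also have "\<dots> \<le> card (mismatches U V) + card (mismatches V W)" by (rule card_Un_le)
  finally show ?thesis .
qed

lemma splits_mismatches: "splits Q U V N r \<Longrightarrow> card (mismatches U V) \<le> length N"
proof (induction rule: splits.induct)
  case (same U V N r a)
  then show ?case using card_mismatches_append[of "[a]" "[a]" U V] by simp
next
  case (piece U V N r b x U1 V1)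
  have "card (mismatches ((x # U1) @ U) ((b # V1) @ V)) \<le> card (mismatches (x # U1) (b # V1)) + card (mismatches U V)"
    by (rule card_mismatches_append[OF trail_mset[OF piece(2)]])
  also have "\<dots> \<le> length (x # U1) + length N"
    by (intro add_mono card_mismatches_le piece.IH)
  finally show ?case by simp
next
  case (piece' U V N r b x U1 V1)
  have "card (mismatches ((b # V1) @ U) ((x # U1) @ V)) \<le> card (mismatches (b # V1) (x # U1)) + card (mismatches U V)"
    by (rule card_mismatches_append[OF trail_mset[OF piece'(2), symmetric]])
  also have "\<dots> \<le> length (b # V1) + length N"
    by (intro add_mono card_mismatches_le piece'.IH)
  finally show ?case by simp
qed simp

lemma mset_concat_map_cong: "mset U = mset V \<Longrightarrow> mset (concat (map f U)) = mset (concat (map f V))"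
proof -
  have "mset (concat (map f W)) = sum_mset (image_mset (\<lambda>a. mset (f a)) (mset W))" for W
    by (induction W) auto
  then show "mset U = mset V \<Longrightarrow> ?thesis" by simp
qed

lemma subst_block_append [simp]: "subst_block s n (v @ w) = subst_block s n v @ subst_block s n w"
  by (induction n arbitrary: v w) auto

lemma subst_block_Nil [simp]: "subst_block s n [] = []"
  by (induction n) (auto simp: subst_word_def)

lemma subst_block_concat: "subst_block s n w = concat (map (\<lambda>a. subst_block s n [a]) w)"
proof (induction w)
  case (Cons a w)
  then show ?case using subst_block_append[of s n "[a]" w] by simp
qed simp

lemma mset_subst_block: "mset U = mset V \<Longrightarrow> mset (subst_block s n U) = mset (subst_block s n V)"
  using mset_concat_map_cong subst_block_concat by metis

context
  fixes s :: "subst stream" and n m :: nat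
  assumes swap: "\<And>a b. card (mismatches (subst_block s n [a, b]) (subst_block s n [b, a])) \<le> m"
begin

text \<open>The letter \<open>a\<close> passes through \<open>V\<close> by one adjacent swap per
  letter, each costing at most \<open>m\<close>.\<close>

lemma mismatches_move: "card (mismatches (subst_block s n (V @ [a])) (subst_block s n (a # V))) \<le> length V * m"
proof (induction V)
  case (Cons b V)
  let ?f = "subst_block s n"
  have a1: "?f (b # V @ [a]) = ?f [b] @ ?f (V @ [a])" and a2: "?f (b # a # V) = ?f [b] @ ?f (a # V)"
    and a3: "?f (b # a # V) = ?f [b,a] @ ?f V" and a4: "?f (a # b # V) = ?f [a,b] @ ?f V"
    using subst_block_append[of s n "[b]" "V @ [a]"] subst_block_append[of s n "[b]" "a # V"]
      subst_block_append[of s n "[b,a]" V] subst_block_append[of s n "[a,b]" V] by (simp_all del: subst_block_append)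
  have e: "mset (?f (V @ [a])) = mset (?f (a # V))" "mset (?f [b,a]) = mset (?f [a,b])"
    by (rule mset_subst_block; simp)+
  have l: "length (?f (b # V @ [a])) = length (?f (b # a # V))"
    unfolding a1 a2 using mset_eq_length[OF e(1)] by simp
  have "card (mismatches (?f (b # V @ [a])) (?f (a # b # V)))
     \<le> card (mismatches (?f (b # V @ [a])) (?f (b # a # V))) + card (mismatches (?f (b # a # V)) (?f (a # b # V)))"
    by (rule card_mismatches_trans[OF l])
  also have "card (mismatches (?f (b # V @ [a])) (?f (b # a # V))) \<le> length V * m"
    unfolding a1 a2 using card_mismatches_append[of "?f [b]" "?f [b]" "?f (V @ [a])" "?f (a # V)"] Cons.IH by simp
  also have "card (mismatches (?f (b # a # V)) (?f (a # b # V))) \<le> m"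
    unfolding a3 a4 using card_mismatches_append[OF e(2), of "?f V" "?f V"] swap[of b a] by simp
  finally show ?case by simp
qed simp

text \<open>Insertion sort: each letter of \<open>U\<close> is moved into place past fewer than
  \<open>length U\<close> others.\<close>

lemma mismatches_permute:
  "mset U = mset V \<Longrightarrow> card (mismatches (subst_block s n U) (subst_block s n V)) \<le> (length U)\<^sup>2 * m"
proof (induction U arbitrary: V)
  case (Cons a U)
  let ?f = "subst_block s n"
  have "a \<in> set V" using Cons.prems by (metis list.set_intros(1) set_mset_mset)
  then obtain V1 V2 where V: "V = V1 @ a # V2" by (meson split_list)
  have mU: "mset U = mset (V1 @ V2)" using Cons.prems V by simp
  have lU: "length U = length V1 + length V2" using mU by (metis length_append size_mset)
  have a1: "?f (a # U) = ?f [a] @ ?f U" "?f (a # V1 @ V2) = ?f [a] @ ?f (V1 @ V2)"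
    "?f (a # V1 @ V2) = ?f (a # V1) @ ?f V2" "?f V = ?f (V1 @ [a]) @ ?f V2"
    using subst_block_append[of s n "[a]" U] subst_block_append[of s n "[a]" "V1 @ V2"]
      subst_block_append[of s n "a # V1" V2] subst_block_append[of s n "V1 @ [a]" V2] V
    by (simp_all del: subst_block_append)
  have e: "mset (?f (V1 @ [a])) = mset (?f (a # V1))" "mset (?f (a # U)) = mset (?f (a # V1 @ V2))"
    "mset (?f V) = mset (?f (a # V1 @ V2))"
    using mU V by (intro mset_subst_block; simp)+
  have sym: "card (mismatches (?f (a # V1)) (?f (V1 @ [a]))) = card (mismatches (?f (V1 @ [a])) (?f (a # V1)))"
    using mset_eq_length[OF e(1)] by (intro arg_cong[where f=card]) (auto simp: mismatches_def)
  have "card (mismatches (?f (a # U)) (?f V)) \<le> card (mismatches (?f (a # U)) (?f (a # V1 @ V2))) + card (mismatches (?f (a # V1 @ V2)) (?f V))"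
    by (rule card_mismatches_trans[OF mset_eq_length[OF e(2)]])
  also have "card (mismatches (?f (a # U)) (?f (a # V1 @ V2))) \<le> (length U)\<^sup>2 * m"
    unfolding a1(1,2) using card_mismatches_append[of "?f [a]" "?f [a]" "?f U" "?f (V1 @ V2)"] Cons.IH[OF mU] by simp
  also have "card (mismatches (?f (a # V1 @ V2)) (?f V)) \<le> length V1 * m"
    unfolding a1(3,4) using card_mismatches_append[OF e(1)[symmetric], of "?f V2" "?f V2"] mismatches_move[of V1 a] sym by simp
  also have "(length U)\<^sup>2 * m + length V1 * m \<le> (length (a # U))\<^sup>2 * m"
  proof -
    have "(length U)\<^sup>2 + length V1 \<le> (length (a # U))\<^sup>2"
      using lU by (simp add: power2_eq_square)
    then have "((length U)\<^sup>2 + length V1) * m \<le> (length (a # U))\<^sup>2 * m" by (rule mult_right_mono) simp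
    then show ?thesis by (simp only: add_mult_distrib)
  qed
  finally show ?case by simp
qed simp

end

section \<open>Directive sequences, word lengths and the block\<close>

definition AR_dir :: "subst stream \<Rightarrow> bool" where
  "AR_dir s \<longleftrightarrow> (\<forall>n. s !! n \<in> AR_substs)"

definition dir_letter :: "subst stream \<Rightarrow> nat \<Rightarrow> letter" where
  "dir_letter s n = (SOME i. s !! n = arnoux_rauzy i)"

lemma dir_letter: "AR_dir s \<Longrightarrow> s !! n = arnoux_rauzy (dir_letter s n)"
proof -
  assume "AR_dir s"
  then have "\<exists>i. s !! n = arnoux_rauzy i" unfolding AR_dir_def AR_substs_def by blast
  then show ?thesis unfolding dir_letter_def by (rule someI_ex)
qed

lemma arnoux_rauzy_inject: "arnoux_rauzy i = arnoux_rauzy j \<longleftrightarrow> i = j"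
proof
  assume "arnoux_rauzy i = arnoux_rauzy j"
  then have "arnoux_rauzy i i = arnoux_rauzy j i" by simp
  then show "i = j" by (simp add: arnoux_rauzy_def split: if_splits)
qed simp

lemma dir_letter_eq: "s !! n = arnoux_rauzy i \<Longrightarrow> dir_letter s n = i"
  unfolding dir_letter_def by (simp add: arnoux_rauzy_inject)

lemma AR_dir_sdrop: "AR_dir s \<Longrightarrow> AR_dir (sdrop n s)"
  by (simp add: AR_dir_def sdrop_snth)

lemma subst_block_Suc: "AR_dir s \<Longrightarrow> subst_block s (Suc n) w = subst_block s n (ar (dir_letter s n) w)"
  by (simp flip: dir_letter)

lemma subst_block_add: "subst_block s (m + n) w = subst_block s m (subst_block (sdrop m s) n w)"
  by (induction n arbitrary: w) (simp_all add: sdrop_snth)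

definition height :: "subst stream \<Rightarrow> nat \<Rightarrow> letter \<Rightarrow> nat" where
  "height s n a = length (subst_block s n [a])"

lemma length_subst_block: "length (subst_block s n w) = weight (height s n) w"
proof (induction w)
  case (Cons a w)
  then show ?case using subst_block_append[of s n "[a]" w] by (simp add: height_def)
qed simp

lemma height_0 [simp]: "height s 0 a = 1"
  by (simp add: height_def)

lemma height_Suc: "AR_dir s \<Longrightarrow> height s (Suc n) = push (height s n) (dir_letter s n)"
proof
  fix a assume "AR_dir s"
  then have "height s (Suc n) a = weight (height s n) (ar (dir_letter s n) [a])"
    by (simp only: height_def subst_block_Suc length_subst_block)
  then show "height s (Suc n) a = push (height s n) (dir_letter s n) a" by (simp add: weight_ar)
qed

lemma height_pos: "AR_dir s \<Longrightarrow> height s n a \<ge> 1"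
  by (induction n arbitrary: a) (auto simp: height_Suc push_def intro: le_SucI trans_le_add1)

text \<open>Substitutions are applied from the last letter of the block to the first. The letters 3,
  2, 1, 3, 2 cut all pieces down to length 24, the next 1 creates a coincidence in each piece, and
  the initial 1, 2, 3 make the word lengths comparable. The initial letters also give a positive
  matrix product and the two distinct letters needed for contraction.\<close>

definition pattern :: "letter list" where
  "pattern = [1, 2, 3, 1, 2, 3, 1, 2, 3]"

definition block_at :: "subst stream \<Rightarrow> nat \<Rightarrow> bool" where
  "block_at s k \<longleftrightarrow> stake 9 (sdrop k s) = map arnoux_rauzy pattern"

lemma block_at_nth: "block_at s k \<Longrightarrow> j < 9 \<Longrightarrow> s !! (k + j) = arnoux_rauzy (pattern ! j)"
proof -
  assume "block_at s k" "j < 9"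
  then have "stake 9 (sdrop k s) ! j = map arnoux_rauzy pattern ! j" unfolding block_at_def by simp
  moreover have "j < length pattern" using \<open>j < 9\<close> by (simp add: pattern_def)
  ultimately show ?thesis using \<open>j < 9\<close> by (simp add: sdrop_snth)
qed

lemma block_at_dir_letter:
  assumes "block_at s k"
  shows "dir_letter s k = 1" "dir_letter s (k+1) = 2" "dir_letter s (k+2) = 3" "dir_letter s (k+3) = 1" "dir_letter s (k+4) = 2"
    "dir_letter s (k+5) = 3" "dir_letter s (k+6) = 1" "dir_letter s (k+7) = 2" "dir_letter s (k+8) = 3"
  using block_at_nth[OF assms, of 0] block_at_nth[OF assms, of 1] block_at_nth[OF assms, of 2] block_at_nth[OF assms, of 3]
    block_at_nth[OF assms, of 4] block_at_nth[OF assms, of 5] block_at_nth[OF assms, of 6] block_at_nth[OF assms, of 7] block_at_nth[OF assms, of 8]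
  by (auto intro!: dir_letter_eq simp: pattern_def)

lemma weight_le: "(\<And>a. h a \<le> M) \<Longrightarrow> weight h N \<le> M * length N"
  by (induction N) (auto intro: add_mono)

text \<open>Lengths a, b, c at level \<open>k\<close> become 4a+2b+c, 3a+2b+c, 2a+b+c at level
  \<open>k + 3\<close>.\<close>

lemma height_block_at_ratio:
  assumes "AR_dir s" "block_at s k"
  shows "height s (k + 3) a \<le> 2 * height s (k + 3) b"
proof -
  have "height s (k + 3) = push (push (push (height s k) 1) 2) 3"
    using height_Suc[OF assms(1), of k] height_Suc[OF assms(1), of "k+1"] height_Suc[OF assms(1), of "k+2"] block_at_dir_letter[OF assms(2)]
    by (simp add: numeral_3_eq_3)
  then show ?thesis
    using exhaust_3[of a] exhaust_3[of b] by (auto simp: push_def)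
qed

lemma splits_length: "splits Q U V N r \<Longrightarrow> (\<And>b n. Q b n \<Longrightarrow> n \<le> K) \<Longrightarrow> length N \<le> K * r"
proof (induction rule: splits.induct)
  case (piece U V N r b x U1 V1)
  have "Suc (length U1) \<le> K" by (rule piece.prems[OF piece.hyps(3)])
  moreover have "length N \<le> K * r" by (rule piece.IH) (rule piece.prems)
  ultimately show ?case by simp
next
  case (piece' U V N r b x U1 V1)
  have "Suc (length V1) \<le> K"
    using piece'.prems[OF piece'.hyps(3)] trail_length[OF piece'.hyps(2)] by simp
  moreover have "length N \<le> K * r" by (rule piece'.IH) (rule piece'.prems)
  ultimately show ?case by simp
qed auto

section \<open>Decay of the mass in unsplit pieces\<close>

abbreviation splits_any :: "letter list \<Rightarrow> letter list \<Rightarrow> letter list \<Rightarrow> nat \<Rightarrow> bool" where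
  "splits_any \<equiv> splits (\<lambda>_ _. True)"

text \<open>Without any block the mass in the pieces still does not increase, provided it is
  measured at every level by the lengths of the images at level 0.\<close>

lemma splits_down:
  assumes "AR_dir s" "splits_any U V N r"
  shows "\<exists>N' r'. splits_any (subst_block (sdrop k s) n U) (subst_block (sdrop k s) n V) N' r' \<and>
     weight (height s k) N' \<le> weight (height s (k + n)) N"
  using assms(2)
proof (induction n arbitrary: U V N r)
  case (Suc n)
  let ?i = "dir_letter s (k + n)"
  obtain N1 r1 where 1: "splits_any (ar ?i U) (ar ?i V) N1 r1" "\<And>h. weight h N1 \<le> weight (push h ?i) N"
    by (rule splits_step_le[OF Suc.prems, where Q'="\<lambda>_ _. True"]) (rule TrueI, rule TrueI, rule that)
  obtain N' r' where 2: "splits_any (subst_block (sdrop k s) n (ar ?i U)) (subst_block (sdrop k s) n (ar ?i V)) N' r'"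
     "weight (height s k) N' \<le> weight (height s (k + n)) N1" using Suc.IH[OF 1(1)] by blast
  have "weight (height s (k + n)) N1 \<le> weight (height s (k + Suc n)) N"
    using 1(2)[of "height s (k + n)"] height_Suc[OF assms(1), of "k + n"] by simp
  moreover have "subst_block (sdrop k s) (Suc n) w = subst_block (sdrop k s) n (ar ?i w)" for w
    by (simp add: sdrop_snth flip: dir_letter[OF assms(1)])
  ultimately show ?case using 2 by (metis order.trans)
qed (auto simp: splits.nil)

text \<open>Let \<open>h\<close> be the lengths at \<open>k + 3\<close>. Before the sixth letter a
  piece has at most 24 letters, each of weight at most \<open>4 * h 1\<close> under
  \<open>push h 1\<close>, and it then gives up a letter of weight \<open>h 1\<close>. So at least
  one part in 24 * 4 = 96 of the mass is lost.\<close>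

lemma splits_block:
  assumes s: "AR_dir s" and b: "block_at s k" and sp: "splits_any U V N r"
  shows "\<exists>N' r'. splits_any (subst_block (sdrop k s) 9 U) (subst_block (sdrop k s) 9 V) N' r' \<and>
     96 * weight (height s k) N' \<le> 95 * weight (height s (k + 9)) N"
proof -
  let ?h = "height s (k + 3)"
  note d = block_at_dir_letter[OF b]
  have hS: "height s (Suc n) = push (height s n) (dir_letter s n)" for n by (rule height_Suc[OF s])
  let ?g = "\<lambda>w. ar 2 (ar 3 (ar 1 (ar 2 (ar 3 w))))"
  obtain N1 r1 where 1: "splits (\<lambda>b n. n \<le> 24) (?g U) (?g V) N1 r1"
     "\<And>h. weight h N1 \<le> weight (push (push (push (push (push h 2) 3) 1) 2) 3) N"
    by (rule splits_five[OF sp, of 2 3 1 3 2]) auto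
  have "\<exists>N' r'. splits (\<lambda>_ _. True) (ar 1 (?g U)) (ar 1 (?g V)) N' r' \<and> (\<forall>h. weight h N' + r1 * h 1 \<le> weight (push h 1) N1)"
    by (rule splits_step[OF 1(1)]) (rule TrueI)+
  then obtain N2 r2 where 2: "splits_any (ar 1 (?g U)) (ar 1 (?g V)) N2 r2"
     "\<And>h. weight h N2 + r1 * h 1 \<le> weight (push h 1) N1" by blast
  have h9: "height s (k + 9) = push (push (push (push (push (push ?h 1) 2) 3) 1) 2) 3"
    using hS[of "k+3"] hS[of "k+4"] hS[of "k+5"] hS[of "k+6"] hS[of "k+7"] hS[of "k+8"] d
    by (simp add: eval_nat_numeral)
  have mass: "96 * weight ?h N2 \<le> 95 * weight (height s (k + 9)) N"
  proof -
    let ?W = "weight (push ?h 1) N1"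
    have "?W \<le> (4 * ?h 1) * length N1"
    proof (rule weight_le)
      show "push ?h 1 a \<le> 4 * ?h 1" for a
        using height_block_at_ratio[OF s b, of a 1] by (simp add: push_def)
    qed
    also have "\<dots> \<le> (4 * ?h 1) * (24 * r1)"
      by (intro mult_left_mono splits_length[OF 1(1)]) auto
    finally have "?W \<le> 96 * (r1 * ?h 1)" by (simp add: mult.commute)
    moreover have "weight ?h N2 + r1 * ?h 1 \<le> ?W" by (rule 2(2))
    ultimately have "96 * weight ?h N2 \<le> 95 * ?W" by linarith
    moreover have "?W \<le> weight (height s (k + 9)) N" using 1(2)[of "push ?h 1"] h9 by simp
    ultimately show ?thesis by linarith
  qed
  obtain N3 r3 where 3: "splits_any (subst_block (sdrop k s) 3 (ar 1 (?g U))) (subst_block (sdrop k s) 3 (ar 1 (?g V))) N3 r3"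
     "weight (height s k) N3 \<le> weight ?h N2" using splits_down[OF s 2(1), of k 3] by blast
  have e: "subst_block (sdrop k s) 9 w = subst_block (sdrop k s) 3 (ar 1 (?g w))" for w
  proof -
    define t where "t = sdrop k s"
    have t: "t !! 3 = arnoux_rauzy 1" "t !! 4 = arnoux_rauzy 2" "t !! 5 = arnoux_rauzy 3"
      "t !! 6 = arnoux_rauzy 1" "t !! 7 = arnoux_rauzy 2" "t !! 8 = arnoux_rauzy 3"
      unfolding t_def sdrop_snth dir_letter[OF s] d by (rule refl)+
    have "subst_block t 9 w = subst_block t 3 (subst_word (t !! 3) (subst_word (t !! 4) (subst_word (t !! 5)
       (subst_word (t !! 6) (subst_word (t !! 7) (subst_word (t !! 8) w))))))"
      by (simp add: eval_nat_numeral)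
    then show ?thesis unfolding t t_def[symmetric] .
  qed
  have "96 * weight (height s k) N3 \<le> 95 * weight (height s (k + 9)) N" using 3(2) mass by linarith
  with 3(1) show ?thesis unfolding e by blast
qed

definition blocks_recur :: "subst stream \<Rightarrow> bool" where
  "blocks_recur s \<longleftrightarrow> (\<forall>m. \<exists>k\<ge>m. block_at s k)"

text \<open>The number \<open>m\<close> counts the blocks used. The next block is chosen above the
  level \<open>n0\<close> found for the earlier ones, so that their estimate applies to the pieces
  which this block leaves over.\<close>

lemma splits_decay:
  assumes s: "AR_dir s" and i: "blocks_recur s"
  shows "\<exists>n0. \<forall>n\<ge>n0. \<forall>U V N r. splits_any U V N r \<longrightarrow>
    (\<exists>N' r'. splits_any (subst_block s n U) (subst_block s n V) N' r' \<and> 96 ^ m * length N' \<le> 95 ^ m * weight (height s n) N)"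
proof (induction m)
  case 0
  have "length N = weight (height s 0) N" for N by (induction N) auto
  then show ?case using splits_down[OF s, where k=0] by (intro exI[of _ 0]) fastforce
next
  case (Suc m)
  then obtain n0 where n0: "\<And>n U V N r. n \<ge> n0 \<Longrightarrow> splits_any U V N r \<Longrightarrow>
    \<exists>N' r'. splits_any (subst_block s n U) (subst_block s n V) N' r' \<and> 96 ^ m * length N' \<le> 95 ^ m * weight (height s n) N"
    by blast
  obtain k where k: "k \<ge> n0" "block_at s k" using i unfolding blocks_recur_def by blast
  have "\<exists>N' r'. splits_any (subst_block s n U) (subst_block s n V) N' r' \<and> 96 ^ Suc m * length N' \<le> 95 ^ Suc m * weight (height s n) N"
    if n: "n \<ge> k + 9" and sp: "splits_any U V N r" for n U V N r
  proof -
    obtain j where j: "n = k + 9 + j" using n le_Suc_ex by blast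
    let ?f = "subst_block (sdrop (k + 9) s) j" let ?g = "subst_block (sdrop k s) 9"
    obtain N1 r1 where 1: "splits_any (?f U) (?f V) N1 r1" "weight (height s (k + 9)) N1 \<le> weight (height s n) N"
      using splits_down[OF s sp, of "k + 9" j] j by blast
    obtain N2 r2 where 2: "splits_any (?g (?f U)) (?g (?f V)) N2 r2" "96 * weight (height s k) N2 \<le> 95 * weight (height s (k + 9)) N1"
      using splits_block[OF s k(2) 1(1)] by blast
    obtain N3 r3 where 3: "splits_any (subst_block s k (?g (?f U))) (subst_block s k (?g (?f V))) N3 r3"
       "96 ^ m * length N3 \<le> 95 ^ m * weight (height s k) N2" using n0[OF k(1) 2(1)] by blast
    have e: "subst_block s n w = subst_block s k (?g (?f w))" for w
      unfolding j using subst_block_add[of s "k + 9" j w] subst_block_add[of s k 9] by simp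
    have "96 ^ Suc m * length N3 = 96 * (96 ^ m * length N3)" by simp
    also have "\<dots> \<le> 96 * (95 ^ m * weight (height s k) N2)" using 3(2) by simp
    also have "\<dots> = 95 ^ m * (96 * weight (height s k) N2)" by simp
    also have "\<dots> \<le> 95 ^ m * (95 * weight (height s (k + 9)) N1)" using 2(2) by simp
    also have "\<dots> \<le> 95 ^ m * (95 * weight (height s n) N)" using 1(2) by simp
    also have "\<dots> = 95 ^ Suc m * weight (height s n) N" by simp
    finally show ?thesis using 3(1) unfolding e by blast
  qed
  then show ?case by blast
qed

text \<open>The pair \<open>[a, b]\<close>, \<open>[b, a]\<close> is a single piece carrying the
  whole mass \<open>height s n a + height s n b\<close>.\<close>

lemma swap_decay:
  assumes s: "AR_dir s" and i: "blocks_recur s" and "\<epsilon> > 0"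
  shows "\<exists>n0. \<forall>n\<ge>n0. \<forall>a b. real (card (mismatches (subst_block s n [a, b]) (subst_block s n [b, a])))
     \<le> \<epsilon> * (real (height s n a) + real (height s n b))"
proof -
  obtain m where m: "(95 / 96 :: real) ^ m < \<epsilon>" using real_arch_pow_inv[OF \<open>\<epsilon> > 0\<close>, of "95/96"] by auto
  obtain n0 where n0: "\<And>n U V N r. n \<ge> n0 \<Longrightarrow> splits_any U V N r \<Longrightarrow>
    \<exists>N' r'. splits_any (subst_block s n U) (subst_block s n V) N' r' \<and> 96 ^ m * length N' \<le> 95 ^ m * weight (height s n) N"
    using splits_decay[OF s i, of m] by blast
  show ?thesis
  proof (intro exI[of _ n0] allI impI)
    fix n a b assume n: "n0 \<le> n"
    show "real (card (mismatches (subst_block s n [a, b]) (subst_block s n [b, a]))) \<le> \<epsilon> * (real (height s n a) + real (height s n b))"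
    proof (cases "a = b")
      case False
      have "splits_any (a # [b] @ []) (b # [a] @ []) (a # [b] @ []) (Suc 0)"
        by (rule splits.piece[OF splits.nil trail.base[OF False]]) (rule TrueI)
      then have "splits_any [a, b] [b, a] [a, b] (Suc 0)" by simp
      from n0[OF n this] obtain N' r' where N': "splits_any (subst_block s n [a, b]) (subst_block s n [b, a]) N' r'"
        "96 ^ m * length N' \<le> 95 ^ m * weight (height s n) [a, b]" by blast
      have "real (96 ^ m * length N') \<le> real (95 ^ m * weight (height s n) [a, b])" using N'(2) by (rule of_nat_mono)
      then have "real (length N') \<le> (95/96)^m * (real (height s n a) + real (height s n b))"
        by (simp add: power_divide field_simps)
      also have "\<dots> \<le> \<epsilon> * (real (height s n a) + real (height s n b))" using m by (intro mult_right_mono) auto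
      finally show ?thesis using splits_mismatches[OF N'(1)] by linarith
    qed (use \<open>\<epsilon> > 0\<close> in simp)
  qed
qed

section \<open>Contraction orthogonal to the eigenvector\<close>

definition AR_mat :: "letter \<Rightarrow> real^3 \<Rightarrow> real^3" where
  "AR_mat i x = (\<chi> k. if k = i then x $ 1 + x $ 2 + x $ 3 else x $ k)"

definition AR_mat_tr :: "letter \<Rightarrow> real^3 \<Rightarrow> real^3" where
  "AR_mat_tr i y = (\<chi> k. if k = i then y $ i else y $ k + y $ i)"

lemma AR_mat_nth [simp]: "AR_mat i x $ k = (if k = i then x $ 1 + x $ 2 + x $ 3 else x $ k)"
  by (simp add: AR_mat_def)

lemma AR_mat_tr_nth [simp]: "AR_mat_tr i y $ k = (if k = i then y $ i else y $ k + y $ i)"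
  by (simp add: AR_mat_tr_def)

lemma sum_letters: "i \<noteq> j \<Longrightarrow> i \<noteq> k \<Longrightarrow> j \<noteq> k \<Longrightarrow> (x $ 1 + x $ 2 + x $ 3 :: real) = x $ i + x $ j + x $ k"
  for i j k :: letter
  using exhaust_3[of i] exhaust_3[of j] exhaust_3[of k] by (elim disjE) simp_all

lemma other_letters: obtains j k :: letter where "i \<noteq> j" "i \<noteq> k" "j \<noteq> k"
proof -
  have "i = 1 \<or> i = 2 \<or> i = 3" by (rule exhaust_3)
  then show thesis
    by (elim disjE) (simp_all add: that[of 2 3] that[of 1 3] that[of 1 2])
qed

lemma incidence_AR_mat: "incidence (arnoux_rauzy i) *v x = AR_mat i x"
  using exhaust_3[of i]
  by (elim disjE) (simp_all add: vec_eq_iff forall_3 matrix_vector_mult_def incidence_def sum_3 arnoux_rauzy_def)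

lemma incidence_AR_mat_tr: "transpose (incidence (arnoux_rauzy i)) *v y = AR_mat_tr i y"
  using exhaust_3[of i]
  by (elim disjE) (simp_all add: vec_eq_iff forall_3 matrix_vector_mult_def transpose_def incidence_def sum_3 arnoux_rauzy_def)

lemma inner_AR_mat: "AR_mat i x \<bullet> y = x \<bullet> AR_mat_tr i y"
  using exhaust_3[of i]
  by (elim disjE) (simp_all add: inner_vec_def sum_3 algebra_simps)


section \<open>The spread of a vector and its contraction\<close>

text \<open>A seminorm that vanishes on constant vectors; by \<open>coord_le_spread\<close> it
  controls all coordinates on the plane orthogonal to a positive vector.\<close>

definition spread :: "real^3 \<Rightarrow> real" where
  "spread y = max (max \<bar>y $ 1 - y $ 2\<bar> \<bar>y $ 1 - y $ 3\<bar>) \<bar>y $ 2 - y $ 3\<bar>"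

lemma spread_ge: "\<bar>y $ i - y $ j\<bar> \<le> spread y"
  using exhaust_3[of i] exhaust_3[of j]
  by (elim disjE) (simp_all add: spread_def le_max_iff_disj abs_minus_commute)

lemma spread_nonneg [simp]: "0 \<le> spread y"
  using spread_ge[of y 1 1] by simp

lemma spread_le:
  assumes "i \<noteq> j" "i \<noteq> k" "j \<noteq> k" "\<bar>y $ i - y $ j\<bar> \<le> c" "\<bar>y $ i - y $ k\<bar> \<le> c" "\<bar>y $ j - y $ k\<bar> \<le> c"
  shows "spread y \<le> c"
  using assms exhaust_3[of i] exhaust_3[of j] exhaust_3[of k]
  by (elim disjE) (simp_all add: spread_def abs_minus_commute)

text \<open>Orthogonality to a positive vector excludes that all products
  \<open>y $ i * y $ j\<close> are positive; against a coordinate \<open>j\<close> of weakly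
  opposite sign, \<open>\<bar>y $ i\<bar> \<le> \<bar>y $ i - y $ j\<bar>\<close>.\<close>

lemma coord_le_spread:
  assumes u: "\<And>i. u $ i > 0" and y: "y \<bullet> u = 0"
  shows "\<bar>y $ i\<bar> \<le> spread y"
proof -
  have s: "y $ 1 * u $ 1 + y $ 2 * u $ 2 + y $ 3 * u $ 3 = 0"
    using y by (simp add: inner_vec_def sum_3)
  have "\<exists>j. y $ i * y $ j \<le> 0"
  proof (rule ccontr)
    assume "\<not> ?thesis"
    then have p: "0 < y $ i * y $ j" for j by (simp add: not_le)
    have "0 < y $ i * y $ 1 * u $ 1 + y $ i * y $ 2 * u $ 2 + y $ i * y $ 3 * u $ 3"
      using p u by (simp add: add_pos_pos)
    also have "\<dots> = y $ i * (y $ 1 * u $ 1 + y $ 2 * u $ 2 + y $ 3 * u $ 3)" by (simp add: algebra_simps)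
    finally show False using s by simp
  qed
  then obtain j where j: "y $ i * y $ j \<le> 0" by blast
  then have "\<bar>y $ i\<bar> \<le> \<bar>y $ i - y $ j\<bar>" by (auto simp: mult_le_0_iff)
  then show ?thesis using spread_ge[of y i j] by linarith
qed

text \<open>Adding the pivot \<open>y $ i\<close> to the other coordinates makes the new differences
  with the pivot equal to the old coordinates \<open>y $ j\<close> and \<open>y $ k\<close>.\<close>

lemma spread_AR_mat_tr_eq:
  assumes "i \<noteq> j" "i \<noteq> k" "j \<noteq> k"
  shows "\<bar>y $ j\<bar> \<le> c \<Longrightarrow> \<bar>y $ k\<bar> \<le> c \<Longrightarrow> \<bar>y $ j - y $ k\<bar> \<le> c \<Longrightarrow> spread (AR_mat_tr i y) \<le> c"
  by (rule spread_le[of i j k]) (use assms in auto)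

lemma AR_mat_pos: "(\<And>j. x $ j > 0) \<Longrightarrow> AR_mat i x $ k > 0"
  by (simp add: add_pos_pos)

lemma AR_mat_tr_perp: "y \<bullet> AR_mat i u = 0 \<Longrightarrow> AR_mat_tr i y \<bullet> u = 0"
  using inner_AR_mat[of i u y] by (simp add: inner_commute)

lemma spread_AR_mat_tr:
  assumes u: "\<And>j. u $ j > 0" and y: "y \<bullet> AR_mat i u = 0"
  shows "spread (AR_mat_tr i y) \<le> spread y"
proof -
  obtain j k where d: "i \<noteq> j" "i \<noteq> k" "j \<noteq> k" using other_letters by blast
  have "\<bar>y $ m\<bar> \<le> spread y" for m by (rule coord_le_spread[OF AR_mat_pos[OF u] y])
  then show ?thesis by (intro spread_AR_mat_tr_eq[OF d] spread_ge)
qed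

text \<open>The contraction over two steps with distinct letters, in the coordinates \<open>a, b\<close> of a vector
  other than the pivot \<open>y\<close>, which is minus a subconvex combination of \<open>a\<close> and \<open>b\<close>.\<close>

lemma contract_scalar_aux:
  fixes a b ta tb \<eta> D :: real
  assumes \<eta>: "0 < \<eta>" "\<eta> \<le> 1" and t: "\<eta> \<le> ta" "\<eta> \<le> tb" "ta + tb \<le> 1"
    and y: "y = - (ta * a + tb * b)"
    and D: "\<bar>y - a\<bar> \<le> D" "\<bar>y - b\<bar> \<le> D" "\<bar>a - b\<bar> \<le> D" and a: "a \<ge> 0"
  shows "\<bar>b\<bar> \<le> (1 - \<eta>/6) * D" "\<bar>y\<bar> \<le> (1 - \<eta>/6) * D" "\<bar>b + y\<bar> \<le> (1 - \<eta>/6) * D"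
proof -
  have D0: "0 \<le> D" using D(3) by linarith
  \<comment> \<open>\<open>h2\<close>, \<open>h1\<close> and \<open>h0\<close> treat the three forms
    in which the bounds arise below; \<open>1 - \<eta>/6\<close> is a factor that all of them
    imply.\<close>
  have h2: "X \<le> (1 - \<eta>/6) * D" if "X * (1 + \<eta>/2) \<le> D" for X
  proof -
    have "(1 - \<eta>/6) * (1 + \<eta>/2) - 1 = \<eta> * (1/3 - \<eta>/12)" by (simp add: field_simps)
    also have "\<dots> \<ge> 0" using \<eta> by simp
    finally have g: "1 \<le> (1 - \<eta>/6) * (1 + \<eta>/2)" by simp
    show ?thesis
    proof (cases "X \<ge> 0")
      case True
      have "X \<le> X * ((1 - \<eta>/6) * (1 + \<eta>/2))" using g True by (simp add: mult_le_cancel_left1)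
      also have "\<dots> = (1 - \<eta>/6) * (X * (1 + \<eta>/2))" by simp
      also have "\<dots> \<le> (1 - \<eta>/6) * D" using that \<eta> by (intro mult_left_mono) auto
      finally show ?thesis .
    next
      case False
      moreover have "0 \<le> (1 - \<eta>/6) * D" using \<eta> D0 by simp
      ultimately show ?thesis by linarith
    qed
  qed
  have h1: "X \<le> (1 - \<eta>/6) * D" if "X \<le> (1 - \<eta>) * D" for X
  proof -
    have "(1 - \<eta>) * D \<le> (1 - \<eta>/6) * D" using \<eta> D0 by (intro mult_right_mono) auto
    then show ?thesis using that by linarith
  qed
  have h0: "X \<le> (1 - \<eta>/6) * D" if "2 * X \<le> D" for X
  proof (rule h2)
    show "X * (1 + \<eta>/2) \<le> D"
    proof (cases "X \<ge> 0")
      case True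
      then have "X * (1 + \<eta>/2) \<le> X * 2" using \<eta> by (intro mult_left_mono) auto
      then show ?thesis using that by linarith
    next
      case False
      then have "X * (1 + \<eta>/2) \<le> 0" using \<eta> by (simp add: mult_le_0_iff)
      then show ?thesis using D0 by linarith
    qed
  qed
  define p q where "p = ta * a" and "q = tb * b"
  have yp: "y = - (p + q)" using y by (simp add: p_def q_def)
  have ta1: "ta \<le> 1 - \<eta>" and tb1: "tb \<le> 1 - \<eta>" using t by linarith+
  have p: "\<eta> * a \<le> p" "p \<le> (1 - \<eta>) * a" "0 \<le> p"
    unfolding p_def using t ta1 a \<eta> by (auto intro: mult_right_mono)
  have "\<bar>b\<bar> \<le> (1 - \<eta>/6) * D \<and> \<bar>y\<bar> \<le> (1 - \<eta>/6) * D \<and> \<bar>b + y\<bar> \<le> (1 - \<eta>/6) * D"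
  proof (cases "b \<ge> 0")
    case True
    have q: "\<eta> * b \<le> q" "0 \<le> q" "q \<le> b"
      unfolding q_def using t True \<eta> tb1 by (auto intro: mult_right_mono mult_left_le_one_le)
    have "p + q \<le> ta * max a b + tb * max a b"
      unfolding p_def q_def using t \<eta> by (intro add_mono mult_left_mono) auto
    also have "\<dots> = (ta + tb) * max a b" by (simp add: algebra_simps)
    also have "\<dots> \<le> max a b" using t \<eta> a by (intro mult_left_le_one_le) auto
    finally have pq: "p + q \<le> max a b" .
    have "b * (1 + \<eta>/2) \<le> b + \<eta> * b" using True \<eta> by (simp add: algebra_simps)
    also have "\<dots> \<le> D" using D(2) p q yp by linarith
    finally have 1: "b \<le> (1 - \<eta>/6) * D" by (rule h2)
    have "2 * (p + q) \<le> D" using pq D yp by (auto simp: max_def split: if_splits)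
    then have 2: "p + q \<le> (1 - \<eta>/6) * D" by (rule h0)
    show ?thesis using 1 2 True p q yp by (simp add: abs_le_iff)
  next
    case False
    define \<beta> where "\<beta> = - b"
    have b: "b = - \<beta>" and \<beta>: "\<beta> > 0" using False by (auto simp: \<beta>_def)
    have q: "q \<le> - (\<eta> * \<beta>)" "- ((1 - \<eta>) * \<beta>) \<le> q"
      unfolding q_def b using t tb1 \<beta> by (auto intro: mult_right_mono)
    have ea: "0 \<le> \<eta> * a" "0 \<le> \<eta> * \<beta>" using \<eta> a \<beta> by auto
    \<comment> \<open>If \<open>a\<close> is not small against \<open>\<beta>\<close>, then
      \<open>a + \<beta>\<close>, the distance of \<open>a\<close> and \<open>b\<close>, exceeds
      \<open>\<beta>\<close> by enough. Otherwise \<open>a \<le> \<eta> * \<beta> / 5\<close>, and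
      the distance of \<open>b\<close> and \<open>y\<close> does.\<close>
    have 1: "\<beta> \<le> (1 - \<eta>/6) * D"
    proof (cases "\<beta> \<le> (1 - \<eta>/6) * (a + \<beta>)")
      case True
      moreover have "(1 - \<eta>/6) * (a + \<beta>) \<le> (1 - \<eta>/6) * D"
        using D(3) b \<eta> by (intro mult_left_mono) auto
      ultimately show ?thesis by linarith
    next
      case f: False
      have "a * (5/6) \<le> a * (1 - \<eta>/6)" using \<eta> a by (intro mult_left_mono) auto
      moreover have "a * (1 - \<eta>/6) \<le> (\<eta>/6) * \<beta>" using f by (simp add: algebra_simps)
      ultimately have "a \<le> \<eta> * \<beta> / 5" by simp
      then have "\<beta> * (1 + \<eta>/2) \<le> D" using D(2) yp b p q ea by (simp add: algebra_simps)
      then show ?thesis by (rule h2)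
    qed
    have ab: "(1 - \<eta>) * (a + \<beta>) \<le> (1 - \<eta>) * D" using D(3) b \<eta> by (intro mult_left_mono) auto
    have n: "0 \<le> (1 - \<eta>) * a" "0 \<le> (1 - \<eta>) * \<beta>" using \<eta> a \<beta> by auto
    have s: "(1 - \<eta>) * (a + \<beta>) = (1 - \<eta>) * a + (1 - \<eta>) * \<beta>" by (simp add: algebra_simps)
    have "\<bar>y\<bar> \<le> (1 - \<eta>) * D" using yp p q ab n ea s by (simp add: abs_le_iff)
    moreover have "\<bar>b + y\<bar> \<le> (1 - \<eta>) * D"
      using yp b p q ab n ea s by (simp add: abs_le_iff algebra_simps)
    ultimately show ?thesis using 1 h1 b \<beta> by auto
  qed
  then show "\<bar>b\<bar> \<le> (1 - \<eta>/6) * D" "\<bar>y\<bar> \<le> (1 - \<eta>/6) * D" "\<bar>b + y\<bar> \<le> (1 - \<eta>/6) * D" by auto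
qed

lemma contract_scalar:
  fixes a b ta tb \<eta> D :: real
  assumes \<eta>: "0 < \<eta>" "\<eta> \<le> 1" and t: "\<eta> \<le> ta" "\<eta> \<le> tb" "ta + tb \<le> 1"
    and y: "y = - (ta * a + tb * b)"
    and D: "\<bar>y - a\<bar> \<le> D" "\<bar>y - b\<bar> \<le> D" "\<bar>a - b\<bar> \<le> D"
  shows "\<bar>b\<bar> \<le> (1 - \<eta>/6) * D \<and> \<bar>y\<bar> \<le> (1 - \<eta>/6) * D \<and> \<bar>b + y\<bar> \<le> (1 - \<eta>/6) * D"
proof (cases "a \<ge> 0")
  case True
  then show ?thesis using contract_scalar_aux[OF assms True] by blast
next
  case False
  have y': "- y = - (ta * (- a) + tb * (- b))" using y by simp
  have D': "\<bar>- y - (- a)\<bar> \<le> D" "\<bar>- y - (- b)\<bar> \<le> D" "\<bar>- a - (- b)\<bar> \<le> D" using D by linarith+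
  have "- a \<ge> 0" using False by simp
  note contract_scalar_aux[OF \<eta> t y' D' this]
  moreover have "\<bar>- b + - y\<bar> = \<bar>b + y\<bar>" by linarith
  ultimately show ?thesis by auto
qed

text \<open>One step can leave \<open>\<bar>y $ j - y $ k\<bar>\<close> as it is, so two steps with
  distinct letters are taken; the resulting differences are \<open>y $ k\<close>,
  \<open>y $ i\<close> and \<open>y $ k + y $ i\<close>. Orthogonality expresses
  \<open>y $ i\<close> by the other coordinates with weights \<open>ta\<close>, \<open>tb\<close>;
  they are at least \<open>\<eta>\<close> by the ratio assumption, and
  \<open>ta + tb \<le> 1\<close> because coordinate \<open>i\<close> of \<open>AR_mat i u\<close> is
  the sum of all coordinates of \<open>u\<close>.\<close>

lemma spread_contract:
  assumes u: "\<And>k. u $ k > 0" and r: "\<And>k l. AR_mat i u $ k \<ge> \<eta> * AR_mat i u $ l"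
    and \<eta>: "0 < \<eta>" "\<eta> \<le> 1" and ij: "i \<noteq> j" and y: "y \<bullet> AR_mat i u = 0"
  shows "spread (AR_mat_tr j (AR_mat_tr i y)) \<le> (1 - \<eta>/6) * spread y"
proof -
  obtain k where d: "i \<noteq> k" "j \<noteq> k"
  proof -
    obtain j' k' where o: "i \<noteq> j'" "i \<noteq> k'" "j' \<noteq> k'" using other_letters by blast
    show thesis
    proof (cases "j = j'")
      case True then show thesis using that[of k'] o by simp
    next
      case False then show thesis using that[of j'] o by simp
    qed
  qed
  define v where "v = AR_mat i u"
  have vi: "v $ i = u $ i + u $ j + u $ k" using sum_letters[OF ij d, of u] by (simp add: v_def)
  have vj: "v $ j = u $ j" and vk: "v $ k = u $ k" using ij d by (simp_all add: v_def)
  have vpos: "v $ i > 0" unfolding v_def by (rule AR_mat_pos[OF u])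
  have "y $ 1 * v $ 1 + y $ 2 * v $ 2 + y $ 3 * v $ 3 = 0" using y by (simp add: v_def[symmetric] inner_vec_def sum_3)
  then have s: "y $ i * v $ i + y $ j * v $ j + y $ k * v $ k = 0"
    using sum_letters[OF ij d, of "\<chi> m. y $ m * v $ m"] by simp
  define ta tb where "ta = v $ j / v $ i" and "tb = v $ k / v $ i"
  have t: "\<eta> \<le> ta" "\<eta> \<le> tb" "ta + tb \<le> 1"
  proof -
    show "\<eta> \<le> ta" "\<eta> \<le> tb" unfolding ta_def tb_def using r[of i j] r[of i k] vpos
      by (simp_all add: v_def[symmetric] pos_le_divide_eq)
    show "ta + tb \<le> 1" unfolding ta_def tb_def using vpos vi vj vk u[of i]
      by (simp add: add_divide_distrib[symmetric])
  qed
  have yi: "y $ i = - (ta * y $ j + tb * y $ k)"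
    unfolding ta_def tb_def using s vpos by (simp add: field_simps)
  have c: "\<bar>y $ k\<bar> \<le> (1 - \<eta>/6) * spread y \<and> \<bar>y $ i\<bar> \<le> (1 - \<eta>/6) * spread y \<and> \<bar>y $ k + y $ i\<bar> \<le> (1 - \<eta>/6) * spread y"
    by (rule contract_scalar[OF \<eta> t yi spread_ge spread_ge spread_ge])
  show ?thesis
    by (rule spread_AR_mat_tr_eq[of j i k]) (use c ij d in auto)
qed


section \<open>Iterated contraction along a directive sequence\<close>

definition block_mat_tr :: "subst stream \<Rightarrow> nat \<Rightarrow> real^3 \<Rightarrow> real^3" where
  "block_mat_tr s n y = transpose (incidence_block s n) *v y"

definition block_mat :: "subst stream \<Rightarrow> nat \<Rightarrow> real^3 \<Rightarrow> real^3" where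
  "block_mat s n x = incidence_block s n *v x"

lemma block_mat_0 [simp]: "block_mat s 0 x = x" and block_mat_tr_0 [simp]: "block_mat_tr s 0 x = x"
  by (simp_all add: block_mat_def block_mat_tr_def transpose_mat)

lemma block_mat_Suc: "AR_dir s \<Longrightarrow> block_mat s (Suc n) x = block_mat s n (AR_mat (dir_letter s n) x)"
  by (simp add: block_mat_def dir_letter incidence_AR_mat flip: matrix_vector_mul_assoc)

lemma block_mat_tr_Suc: "AR_dir s \<Longrightarrow> block_mat_tr s (Suc n) y = AR_mat_tr (dir_letter s n) (block_mat_tr s n y)"
  by (simp only: block_mat_tr_def incidence_block.simps matrix_transpose_mul dir_letter incidence_AR_mat_tr flip: matrix_vector_mul_assoc)

lemma linear_block_mat: "linear (block_mat s n)"
  unfolding block_mat_def[abs_def] by simp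

lemma block_mat_inner: "block_mat s n x \<bullet> y = x \<bullet> block_mat_tr s n y"
proof -
  have "x \<bullet> block_mat_tr s n y = (y v* incidence_block s n) \<bullet> x" by (simp add: block_mat_tr_def inner_commute)
  also have "\<dots> = y \<bullet> block_mat s n x" unfolding block_mat_def by (rule dot_lmul_matrix)
  finally show ?thesis by (simp add: inner_commute)
qed

lemma dir_letter_sdrop [simp]: "dir_letter (sdrop m s) n = dir_letter s (m + n)"
  by (simp add: dir_letter_def sdrop_snth)

lemma block_at_sdrop [simp]: "block_at (sdrop m s) n = block_at s (m + n)"
  by (simp add: block_at_def sdrop_add)

text \<open>Right eigenvectors of all tails at once, scaled so that each is the matrix image of the
  next; every statement about \<open>s\<close> then passes to its tails.\<close>

definition eigseq :: "subst stream \<Rightarrow> (nat \<Rightarrow> real^3) \<Rightarrow> bool" where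
  "eigseq s u \<longleftrightarrow> (\<forall>n i. u n $ i > 0) \<and> (\<forall>n. u n = AR_mat (dir_letter s n) (u (Suc n)))"

lemma eigseq_pos: "eigseq s u \<Longrightarrow> u n $ i > 0"
  unfolding eigseq_def by (drule conjunct1) (drule spec, erule spec)

lemma eigseq_step: "eigseq s u \<Longrightarrow> u n = AR_mat (dir_letter s n) (u (Suc n))"
  unfolding eigseq_def by (elim conjE) (erule spec)

lemma eigseq_block_mat: "AR_dir s \<Longrightarrow> eigseq s u \<Longrightarrow> block_mat s n (u n) = u 0"
proof (induction n)
  case (Suc n)
  have "block_mat s (Suc n) (u (Suc n)) = block_mat s n (u n)"
    by (rule trans[OF block_mat_Suc[OF Suc.prems(1)] arg_cong[where f="block_mat s n", OF eigseq_step[OF Suc.prems(2), symmetric]]])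
  also have "\<dots> = u 0" by (rule Suc.IH[OF Suc.prems])
  finally show ?case .
qed simp

lemma eigseq_sdrop: "eigseq s u \<Longrightarrow> eigseq (sdrop m s) (\<lambda>n. u (m + n))"
  unfolding eigseq_def[of "sdrop m s"]
proof (intro conjI allI)
  assume e: "eigseq s u"
  show "u (m + n) $ i > 0" for n i by (rule eigseq_pos[OF e])
  show "u (m + n) = AR_mat (dir_letter (sdrop m s) n) (u (m + Suc n))" for n
    unfolding dir_letter_sdrop add_Suc_right by (rule eigseq_step[OF e])
qed

text \<open>The matrices of 1, 2, 3 together send (a, b, c) to (4a+3b+2c, 2a+2b+c, a+b+c), whose
  coordinates have ratios at most 4 for positive a, b, c.\<close>

lemma eigseq_block_at_ratio:
  assumes "eigseq s u" "block_at s n"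
  shows "u n $ k \<ge> 1/4 * u n $ l"
proof -
  have e: "u n = AR_mat 1 (AR_mat 2 (AR_mat 3 (u (n + 3))))"
  proof -
    have "u n = AR_mat 1 (u (n + 1))" using eigseq_step[OF assms(1), of n] block_at_dir_letter(1)[OF assms(2)] by simp
    moreover have "u (n + 1) = AR_mat 2 (u (n + 2))"
      using eigseq_step[OF assms(1), of "n + 1"] block_at_dir_letter(2)[OF assms(2)] by simp
    moreover have "u (n + 2) = AR_mat 3 (u (n + 3))"
      using eigseq_step[OF assms(1), of "n + 2"] block_at_dir_letter(3)[OF assms(2)] by (simp add: numeral_3_eq_3)
    ultimately show ?thesis by (simp only:)
  qed
  have p: "u (n + 3) $ j > 0" for j using eigseq_pos[OF assms(1)] .
  show ?thesis unfolding e using exhaust_3[of k] exhaust_3[of l] p[of 1] p[of 2] p[of 3]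
    by (elim disjE) simp_all
qed

definition block_count :: "subst stream \<Rightarrow> nat \<Rightarrow> nat" where
  "block_count s n = card {k. k < n \<and> block_at s k}"

lemma block_count_0 [simp]: "block_count s 0 = 0"
  by (simp add: block_count_def)

lemma block_count_Suc: "block_count s (Suc n) = (if block_at s n then Suc (block_count s n) else block_count s n)"
proof -
  have "{k. k < Suc n \<and> block_at s k} = (if block_at s n then insert n {k. k < n \<and> block_at s k} else {k. k < n \<and> block_at s k})"
    by (auto simp: less_Suc_eq)
  then show ?thesis by (simp add: block_count_def)
qed

text \<open>\<open>23/24\<close> is \<open>1 - \<eta>/6\<close> for \<open>\<eta> = 1/4\<close>. The
  square root appears because the factor is collected on a product of two consecutive
  spreads.\<close>

definition contr_rate :: real where "contr_rate = sqrt (23/24)"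

lemma contr_rate: "0 < contr_rate" "contr_rate < 1"
  by (simp_all add: contr_rate_def)

text \<open>The index is shifted because the contraction at a block beginning at \<open>k\<close> takes the two steps \<open>k\<close>
  and \<open>k + 1\<close>.\<close>

definition contr_bound :: "subst stream \<Rightarrow> nat \<Rightarrow> real" where
  "contr_bound s n = contr_rate ^ block_count s (n - 1)"

lemma contr_bound_pos: "0 < contr_bound s n" and contr_bound_le_1: "contr_bound s n \<le> 1"
  using contr_rate by (simp_all add: contr_bound_def power_le_one)

context
  fixes s :: "subst stream" and u :: "nat \<Rightarrow> real^3" and y :: "real^3"
  assumes s: "AR_dir s" and u: "eigseq s u" and y: "y \<bullet> u 0 = 0"
begin

lemma block_mat_tr_perp: "block_mat_tr s n y \<bullet> u n = 0"
proof (induction n)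
  case (Suc n)
  then show ?case using AR_mat_tr_perp eigseq_step[OF u, of n] block_mat_tr_Suc[OF s] by metis
qed (use y in simp)

lemma spread_block_mat_tr_step: "spread (block_mat_tr s (Suc n) y) \<le> spread (block_mat_tr s n y)"
  unfolding block_mat_tr_Suc[OF s]
  by (rule spread_AR_mat_tr[OF eigseq_pos[OF u, of "Suc n"]]) (use block_mat_tr_perp[of n] eigseq_step[OF u, of n] in simp)

lemma spread_block_mat_tr_block_at: "block_at s n \<Longrightarrow> spread (block_mat_tr s (Suc (Suc n)) y) \<le> 23/24 * spread (block_mat_tr s n y)"
proof -
  assume b: "block_at s n"
  have *: "spread (AR_mat_tr (dir_letter s (Suc n)) (AR_mat_tr (dir_letter s n) (block_mat_tr s n y))) \<le> (1 - (1/4)/6) * spread (block_mat_tr s n y)"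
  proof (rule spread_contract[OF eigseq_pos[OF u, of "Suc n"]])
    show "AR_mat (dir_letter s n) (u (Suc n)) $ k \<ge> 1/4 * AR_mat (dir_letter s n) (u (Suc n)) $ l" for k l
      using eigseq_block_at_ratio[OF u b] eigseq_step[OF u, of n] by simp
    show "dir_letter s n \<noteq> dir_letter s (Suc n)" using block_at_dir_letter[OF b] by simp
    show "block_mat_tr s n y \<bullet> AR_mat (dir_letter s n) (u (Suc n)) = 0" using block_mat_tr_perp[of n] eigseq_step[OF u, of n] by simp
  qed simp_all
  then show ?thesis by (simp add: block_mat_tr_Suc[OF s])
qed

text \<open>The contraction spans two steps. On products of consecutive spreads each block
  contributes its factor once, with no need to keep track of how the two-step intervals lie to each
  other.\<close>

lemma spread_block_mat_tr_prod:
  "spread (block_mat_tr s n y) * spread (block_mat_tr s (Suc n) y) \<le> (23/24) ^ block_count s n * (spread y)\<^sup>2"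
proof (induction n)
  case 0
  have "spread (block_mat_tr s 0 y) * spread (block_mat_tr s (Suc 0) y) \<le> spread (block_mat_tr s 0 y) * spread (block_mat_tr s 0 y)"
    by (intro mult_left_mono spread_block_mat_tr_step) simp
  then show ?case by (simp add: power2_eq_square)
next
  case (Suc n)
  let ?D = "\<lambda>n. spread (block_mat_tr s n y)"
  show ?case
  proof (cases "block_at s n")
    case True
    have "?D (Suc n) * ?D (Suc (Suc n)) \<le> ?D (Suc n) * (23/24 * ?D n)"
      by (intro mult_left_mono spread_block_mat_tr_block_at[OF True]) simp
    also have "\<dots> = 23/24 * (?D n * ?D (Suc n))" by simp
    also have "\<dots> \<le> 23/24 * ((23/24) ^ block_count s n * (spread y)\<^sup>2)" using Suc.IH by simp
    finally show ?thesis using True by (simp add: block_count_Suc)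
  next
    case False
    have "?D (Suc n) * ?D (Suc (Suc n)) \<le> ?D n * ?D (Suc n)"
      by (subst mult.commute) (intro mult_right_mono order.trans[OF spread_block_mat_tr_step spread_block_mat_tr_step], simp)
    then show ?thesis using False Suc.IH by (simp add: block_count_Suc)
  qed
qed

lemma spread_block_mat_tr: "spread (block_mat_tr s n y) \<le> contr_bound s n * spread y"
proof (cases n)
  case (Suc m)
  have "(spread (block_mat_tr s n y))\<^sup>2 \<le> spread (block_mat_tr s m y) * spread (block_mat_tr s n y)"
    unfolding power2_eq_square Suc by (intro mult_right_mono spread_block_mat_tr_step) simp
  also have "\<dots> \<le> (23/24) ^ block_count s m * (spread y)\<^sup>2" unfolding Suc by (rule spread_block_mat_tr_prod)
  also have "\<dots> = (contr_bound s n * spread y)\<^sup>2"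
    by (simp add: Suc contr_bound_def contr_rate_def power_mult_distrib power2_eq_square flip: power_mult_distrib real_sqrt_mult)
  finally show ?thesis
    by (rule power2_le_imp_le) (simp add: contr_bound_pos less_imp_le)
qed (simp add: contr_bound_def)

lemma block_mat_tr_coord: "\<bar>block_mat_tr s n y $ i\<bar> \<le> contr_bound s n * spread y"
  using coord_le_spread[OF eigseq_pos[OF u] block_mat_tr_perp] spread_block_mat_tr by (meson order.trans)

end

lemma contr_bound_tendsto_0:
  assumes "blocks_recur s"
  shows "contr_bound s \<longlonglongrightarrow> 0"
proof -
  have mono: "block_count s m \<le> block_count s n" if "m \<le> n" for m n
    using that by (induction rule: dec_induct) (auto simp: block_count_Suc)
  have ex: "\<exists>n. block_count s n \<ge> m" for m
  proof (induction m)
    case (Suc m)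
    then obtain n where n: "block_count s n \<ge> m" by blast
    obtain k where k: "k \<ge> n" "block_at s k" using assms unfolding blocks_recur_def by blast
    have "block_count s (Suc k) \<ge> Suc m" using k n mono[OF k(1)] by (simp add: block_count_Suc)
    then show ?case by blast
  qed auto
  have "filterlim (block_count s) at_top sequentially"
    unfolding filterlim_at_top eventually_sequentially using ex mono by (meson order.trans)
  then have *: "filterlim (\<lambda>n. block_count s (n - 1)) at_top sequentially"
    by (rule filterlim_compose) (auto simp: filterlim_minus_const_nat_at_top)
  have "(\<lambda>m. contr_rate ^ m) \<longlonglongrightarrow> 0" using contr_rate by (intro LIMSEQ_realpow_zero) auto
  from filterlim_compose[OF this *] show ?thesis by (simp add: contr_bound_def[abs_def])
qed

section \<open>Prefixes of limit words\<close>

text \<open>A finite form of the prefixes of limit words (see \<open>pre_limit_word\<close>), which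
  can be cut at any level.\<close>

definition pre :: "subst stream \<Rightarrow> letter \<Rightarrow> letter list set" where
  "pre s i = {p. \<exists>a m. prefix (p @ [i]) (subst_block s m [a])}"

lemma subst_block_mono_prefix:
  assumes "AR_dir s"
  shows "prefix (subst_block s m [a]) (subst_block s (m + n) [a])"
proof (induction n)
  case (Suc n)
  have "prefix [a] (ar (dir_letter s (m + n)) [a])" by (simp add: ar_Cons)
  then obtain w where "ar (dir_letter s (m + n)) [a] = [a] @ w" by (elim prefixE)
  then have "subst_block s (m + Suc n) [a] = subst_block s (m + n) [a] @ subst_block s (m + n) w"
    using subst_block_Suc[OF assms, of "m + n" "[a]"] subst_block_append[of s "m + n" "[a]" w]
    by (simp del: subst_block.simps)
  then show ?case using Suc.IH prefix_order.order_trans prefixI by metis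
qed simp

lemma prefix_concat_decomp:
  assumes "prefix (p @ [i]) (subst_block s n W)"
  obtains W1 b W2 q where "W = W1 @ b # W2" "p = subst_block s n W1 @ q" "prefix (q @ [i]) (subst_block s n [b])"
  using assms
proof (induction W arbitrary: p thesis)
  case (Cons c W)
  let ?f = "subst_block s n"
  have c: "?f (c # W) = ?f [c] @ ?f W" using subst_block_append[of s n "[c]" W] by simp
  then have "prefix (p @ [i]) (?f [c] @ ?f W)" using Cons.prems(2) by simp
  then consider "prefix (p @ [i]) (?f [c])" | us where "p @ [i] = ?f [c] @ us" "prefix us (?f W)"
    unfolding prefix_append by blast
  then show ?case
  proof cases
    case 1
    show ?thesis by (rule Cons.prems(1)[of "[]" c W p]) (use 1 in simp_all)
  next
    case 2
    show ?thesis
    proof (cases "us = []")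
      case True
      show ?thesis by (rule Cons.prems(1)[of "[]" c W p]) (use 2 True in simp_all)
    next
      case False
      then obtain us' where us: "us = us' @ [i]" "p = ?f [c] @ us'"
        using 2(1) by (metis append_butlast_last_id last_appendR last_snoc butlast_append butlast_snoc)
      obtain W1 b W2 q where I: "W = W1 @ b # W2" "us' = ?f W1 @ q" "prefix (q @ [i]) (?f [b])"
        using Cons.IH[of us'] 2(2) us(1) by blast
      have "p = ?f (c # W1) @ q" using us(2) I(2) subst_block_append[of s n "[c]" W1] by simp
      then show ?thesis using I by (intro Cons.prems(1)[of "c # W1" b W2 q]) simp_all
    qed
  qed
qed simp

text \<open>Desubstitution of a prefix: the combinatorial form of the decomposition of a tile into
  subtiles, with \<open>pre_comp\<close> as converse. The level of the surrounding word is first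
  raised by \<open>n\<close>, so that there is something to desubstitute.\<close>

lemma pre_decomp:
  assumes s: "AR_dir s" and p: "p \<in> pre s i"
  obtains W b q where "W \<in> pre (sdrop n s) b" "p = subst_block s n W @ q" "prefix (q @ [i]) (subst_block s n [b])"
proof -
  obtain a m where "prefix (p @ [i]) (subst_block s m [a])" using p by (auto simp: pre_def)
  then have "prefix (p @ [i]) (subst_block s (m + n) [a])"
    using subst_block_mono_prefix[OF s] prefix_order.order_trans by blast
  then have "prefix (p @ [i]) (subst_block s n (subst_block (sdrop n s) m [a]))"
    using subst_block_add[of s n m "[a]"] by (simp only: add.commute[of m n])
  then obtain W1 b W2 q where 1: "subst_block (sdrop n s) m [a] = W1 @ b # W2" "p = subst_block s n W1 @ q"
      "prefix (q @ [i]) (subst_block s n [b])" by (rule prefix_concat_decomp)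
  have "prefix (W1 @ [b]) (subst_block (sdrop n s) m [a])" unfolding 1(1) by simp
  then have "W1 \<in> pre (sdrop n s) b" unfolding pre_def by blast
  then show thesis using that 1(2,3) by blast
qed

lemma pre_comp:
  assumes W: "W \<in> pre (sdrop n s) b" and q: "prefix (q @ [i]) (subst_block s n [b])"
  shows "subst_block s n W @ q \<in> pre s i"
proof -
  obtain a m where "prefix (W @ [b]) (subst_block (sdrop n s) m [a])" using W by (auto simp: pre_def)
  then obtain V where V: "subst_block (sdrop n s) m [a] = (W @ [b]) @ V" by (elim prefixE)
  have "subst_block s (n + m) [a] = subst_block s n W @ subst_block s n [b] @ subst_block s n V"
    unfolding subst_block_add V subst_block_append by simp
  moreover obtain q' where "subst_block s n [b] = (q @ [i]) @ q'" using q by (elim prefixE)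
  ultimately have "subst_block s (n + m) [a] = ((subst_block s n W @ q) @ [i]) @ q' @ subst_block s n V" by simp
  then have "prefix ((subst_block s n W @ q) @ [i]) (subst_block s (n + m) [a])" by (metis prefixI)
  then show ?thesis unfolding pre_def by blast
qed

lemma height_mono: "AR_dir s \<Longrightarrow> height s m a \<le> height s (m + n) a"
  unfolding height_def by (rule prefix_length_le[OF subst_block_mono_prefix])

lemma height_block_at_grow:
  assumes "AR_dir s" "block_at s k"
  shows "height s k a + 1 \<le> height s (k + 3) a"
proof -
  have "height s (k + 3) = push (push (push (height s k) 1) 2) 3"
    using height_Suc[OF assms(1), of k] height_Suc[OF assms(1), of "k+1"] height_Suc[OF assms(1), of "k+2"] block_at_dir_letter[OF assms(2)]
    by (simp add: numeral_3_eq_3)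
  then show ?thesis
    using exhaust_3[of a] height_pos[OF assms(1), of k 1] height_pos[OF assms(1), of k 2] height_pos[OF assms(1), of k 3]
    by (elim disjE) (simp_all add: push_def)
qed

lemma height_unbounded:
  assumes s: "AR_dir s" and i: "blocks_recur s"
  shows "\<exists>n0. \<forall>n\<ge>n0. \<forall>a. m \<le> height s n a"
proof (induction m)
  case (Suc m)
  then obtain n0 where n0: "\<And>n a. n \<ge> n0 \<Longrightarrow> m \<le> height s n a" by blast
  obtain k where k: "k \<ge> n0" "block_at s k" using i unfolding blocks_recur_def by blast
  have "Suc m \<le> height s n a" if n: "n \<ge> k + 3" for n a
  proof -
    obtain j where j: "n = (k + 3) + j" using le_Suc_ex[OF n] by blast
    have "Suc m \<le> height s (k + 3) a" using height_block_at_grow[OF s k(2), of a] n0[OF k(1), of a] by linarith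
    also have "\<dots> \<le> height s n a" unfolding j by (rule height_mono[OF s])
    finally show ?thesis .
  qed
  then show ?case by blast
qed simp

lemma blocks_recur_sdrop: "blocks_recur s \<Longrightarrow> blocks_recur (sdrop n s)"
proof -
  assume i: "blocks_recur s"
  have "\<exists>k\<ge>m. block_at (sdrop n s) k" for m
  proof -
    obtain k where k: "k \<ge> n + m" "block_at s k" using i unfolding blocks_recur_def by blast
    then have "block_at (sdrop n s) (k - n)" "k - n \<ge> m" by simp_all
    then show ?thesis by blast
  qed
  then show ?thesis unfolding blocks_recur_def by blast
qed

section \<open>Limit words and their prefixes\<close>

lemma subst_stream_shift:
  assumes "\<And>a. \<sigma> a \<noteq> []"
  shows "subst_stream \<sigma> (w @- \<omega>) = subst_word \<sigma> w @- subst_stream \<sigma> \<omega>"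
proof (induction w)
  case (Cons a w)
  have "subst_stream \<sigma> ((a # w) @- \<omega>) = \<sigma> a @- subst_stream \<sigma> (w @- \<omega>)"
    using assms unfolding subst_stream_def by (simp add: flat_unfold)
  then show ?case using Cons.IH by (simp add: subst_word_def)
qed (simp add: subst_word_def)

lemma AR_nonempty: "AR_dir s \<Longrightarrow> (s !! n) a \<noteq> []"
  by (simp add: dir_letter arnoux_rauzy_def)

lemma limit_word_block:
  assumes s: "AR_dir s" and w: "\<And>n. \<omega> n = subst_stream (s !! n) (\<omega> (Suc n))"
  shows "\<exists>\<omega>'. \<omega> 0 = subst_block s n (stake l (\<omega> n)) @- \<omega>'"
proof (induction n arbitrary: l)
  case 0
  show ?case by (intro exI[of _ "sdrop l (\<omega> 0)"]) (simp add: stake_sdrop)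
next
  case (Suc n)
  let ?v = "subst_word (s !! n) (stake l (\<omega> (Suc n)))"
  have "\<omega> n = ?v @- subst_stream (s !! n) (sdrop l (\<omega> (Suc n)))"
    using w[of n] subst_stream_shift[where \<sigma>="s !! n" and w="stake l (\<omega> (Suc n))" and \<omega>="sdrop l (\<omega> (Suc n))", OF AR_nonempty[OF s]]
    by (simp add: stake_sdrop)
  then have "stake (length ?v) (\<omega> n) = ?v" by (simp add: stake_shift)
  then show ?case using Suc.IH[of "length ?v"] by simp
qed

text \<open>Each \<open>\<sigma>\<^sub>j(a)\<close> begins with \<open>a\<close>, so the words \<open>\<sigma>\<^sub>0 \<dots> \<sigma>\<^bsub>j-1\<^esub>(a)\<close> are prefixes of each other; any \<open>j\<close> for
  which the word is long enough determines the letter.\<close>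

definition lword :: "subst stream \<Rightarrow> letter \<Rightarrow> letter stream" where
  "lword s a = smap (\<lambda>k. subst_block s (SOME j. k < height s j a) [a] ! k) nats"

lemma lword_nth:
  assumes s: "AR_dir s" and k: "k < height s j a"
  shows "lword s a !! k = subst_block s j [a] ! k"
proof -
  define j' where "j' = (SOME j. k < height s j a)"
  have j': "k < height s j' a" unfolding j'_def by (rule someI[of _ j]) (rule k)
  have "subst_block s i [a] ! k = subst_block s (i + n) [a] ! k" if "k < height s i a" for i n
    using subst_block_mono_prefix[OF s, of i a n] that by (auto simp: height_def nth_append elim!: prefixE)
  from this[OF j', of j] this[OF k, of j'] have "subst_block s j' [a] ! k = subst_block s j [a] ! k"
    by (simp only: add.commute)
  then show ?thesis by (simp add: lword_def j'_def[symmetric])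
qed

lemma lword_stake:
  assumes s: "AR_dir s"
  shows "stake (height s j a) (lword s a) = subst_block s j [a]"
  by (rule nth_equalityI) (simp_all add: height_def lword_nth[OF s, of _ j a, unfolded height_def] stake_nth)

lemma snth_ext: "(\<And>k. v !! k = w !! k) \<Longrightarrow> v = w"
proof -
  assume "\<And>k. v !! k = w !! k"
  then have "(!!) v = (!!) w" by (rule ext)
  then have "smap ((!!) v) nats = smap ((!!) w) nats" by simp
  then show ?thesis by (simp flip: stream_smap_nats)
qed

lemma length_subst_word_ge:
  assumes "\<And>a. \<sigma> a \<noteq> []"
  shows "length w \<le> length (subst_word \<sigma> w)"
proof (induction w)
  case (Cons a w)
  have "1 \<le> length (\<sigma> a)" using assms[of a] by (cases "\<sigma> a") auto
  then show ?case using Cons.IH by (simp add: subst_word_def)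
qed simp

lemma lword_subst:
  assumes s: "AR_dir s" and i: "blocks_recur s"
  shows "lword s a = subst_stream (s !! 0) (lword (sdrop 1 s) a)"
proof (rule snth_ext)
  fix k
  let ?t = "sdrop 1 s"
  have t: "AR_dir ?t" "blocks_recur ?t" by (rule AR_dir_sdrop[OF s], rule blocks_recur_sdrop[OF i])
  obtain j where j: "Suc k \<le> height ?t j a" using height_unbounded[OF t] by blast
  let ?B = "subst_block ?t j [a]"
  have "lword ?t a = ?B @- sdrop (height ?t j a) (lword ?t a)"
    using lword_stake[OF t(1), of j a] by (metis stake_sdrop)
  then have "subst_stream (s !! 0) (lword ?t a) = subst_stream (s !! 0) (?B @- sdrop (height ?t j a) (lword ?t a))"
    by (rule arg_cong)
  also have "\<dots> = subst_word (s !! 0) ?B @- subst_stream (s !! 0) (sdrop (height ?t j a) (lword ?t a))"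
    by (rule subst_stream_shift[OF AR_nonempty[OF s]])
  finally have e: "subst_stream (s !! 0) (lword ?t a) = subst_word (s !! 0) ?B @- subst_stream (s !! 0) (sdrop (height ?t j a) (lword ?t a))" .
  have b: "subst_block s (1 + j) [a] = subst_word (s !! 0) ?B" unfolding subst_block_add by simp
  have "length ?B \<le> length (subst_word (s !! 0) ?B)" by (rule length_subst_word_ge[OF AR_nonempty[OF s]])
  then have l: "k < length (subst_word (s !! 0) ?B)" using j by (simp add: height_def)
  then have l': "k < height s (1 + j) a" unfolding height_def b .
  show "lword s a !! k = subst_stream (s !! 0) (lword ?t a) !! k"
    unfolding e lword_nth[OF s l'] b using l by (simp add: shift_snth_less)
qed

lemma limit_word_lword:
  assumes s: "AR_dir s" and i: "blocks_recur s"
  shows "limit_word s (lword s a)"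
  unfolding limit_word_def
proof (intro exI[of _ "\<lambda>n. lword (sdrop n s) a"] conjI allI)
  show "lword (sdrop n s) a = subst_stream (s !! n) (lword (sdrop (Suc n) s) a)" for n
    using lword_subst[OF AR_dir_sdrop[OF s] blocks_recur_sdrop[OF i], of n a]
    by (simp add: sdrop_snth sdrop_add)
qed simp

text \<open>From right to left: a limit word begins with the level-\<open>n\<close> word of the
  first letter of \<open>\<omega> n\<close>, and for large \<open>n\<close> this word is longer than
  \<open>p\<close>. From left to right, \<open>lword s a\<close> supplies the limit word.\<close>

lemma pre_limit_word:
  assumes s: "AR_dir s" and i: "blocks_recur s"
  shows "p \<in> pre s j \<longleftrightarrow> (\<exists>w. limit_word s w \<and> stake (Suc (length p)) w = p @ [j])"
proof
  assume "p \<in> pre s j"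
  then obtain a m where p: "prefix (p @ [j]) (subst_block s m [a])" by (auto simp: pre_def)
  then have "p @ [j] = take (Suc (length p)) (subst_block s m [a])"
    by (auto elim!: prefixE)
  also have "\<dots> = stake (Suc (length p)) (lword s a)"
  proof -
    have "Suc (length p) \<le> height s m a" using prefix_length_le[OF p] by (simp add: height_def)
    then have "take (Suc (length p)) (stake (height s m a) (lword s a)) = stake (Suc (length p)) (lword s a)"
      by (simp add: take_stake min_def)
    then show ?thesis unfolding lword_stake[OF s] .
  qed
  finally show "\<exists>w. limit_word s w \<and> stake (Suc (length p)) w = p @ [j]"
    using limit_word_lword[OF s i, of a] by auto
next
  assume "\<exists>w. limit_word s w \<and> stake (Suc (length p)) w = p @ [j]"
  then obtain \<omega> where \<omega>: "\<And>n. \<omega> n = subst_stream (s !! n) (\<omega> (Suc n))" and p: "stake (Suc (length p)) (\<omega> 0) = p @ [j]"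
    unfolding limit_word_def by blast
  obtain n where n: "\<And>a. Suc (length p) \<le> height s n a" using height_unbounded[OF s i, of "Suc (length p)"] by blast
  let ?a = "shd (\<omega> n)"
  obtain \<omega>' where w: "\<omega> 0 = subst_block s n [?a] @- \<omega>'"
    using limit_word_block[where \<omega>=\<omega> and n=n and l="Suc 0", OF s \<omega>] by auto
  have "p @ [j] = take (Suc (length p)) (subst_block s n [?a])"
    using p n[of ?a] unfolding w by (simp add: stake_shift height_def)
  then have "prefix (p @ [j]) (subst_block s n [?a])" by (metis take_is_prefix)
  then show "p \<in> pre s j" unfolding pre_def by blast
qed

section \<open>Rauzy fractals in planar coordinates\<close>

definition coord_sum :: "real^3 \<Rightarrow> real" where "coord_sum x = x $ 1 + x $ 2 + x $ 3"

text \<open>The projection along \<open>u\<close>, in the chart of the plane given by the first two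
  coordinates; \<open>plane_emb\<close> is the inverse chart. Lattice points of the plane become
  \<open>integer_lattice\<close> in dimension 2.\<close>

definition plane_proj :: "real^3 \<Rightarrow> real^3 \<Rightarrow> real^2" where
  "plane_proj u x = (\<chi> k. if k = 1 then x $ 1 - coord_sum x / coord_sum u * u $ 1 else x $ 2 - coord_sum x / coord_sum u * u $ 2)"

definition plane_emb :: "real^2 \<Rightarrow> real^3" where
  "plane_emb y = vector [y $ 1, y $ 2, - y $ 1 - y $ 2]"

lemma plane_emb_nth [simp]: "plane_emb y $ 1 = y $ 1" "plane_emb y $ 2 = y $ 2" "plane_emb y $ 3 = - y $ 1 - y $ 2"
  by (simp_all add: plane_emb_def)

lemma plane_proj_nth [simp]: "plane_proj u x $ 1 = x $ 1 - coord_sum x / coord_sum u * u $ 1" "plane_proj u x $ 2 = x $ 2 - coord_sum x / coord_sum u * u $ 2"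
  by (simp_all add: plane_proj_def)

lemma coord_sum_simps [simp]: "coord_sum (x + y) = coord_sum x + coord_sum y" "coord_sum (x - y) = coord_sum x - coord_sum y" "coord_sum (c *\<^sub>R x) = c * coord_sum x"
  "coord_sum (plane_emb v) = 0" "coord_sum 0 = 0" "coord_sum (- x) = - coord_sum x"
  by (simp_all add: coord_sum_def algebra_simps)

lemma linear_plane_emb: "linear plane_emb"
  by (rule linearI) (simp_all add: vec_eq_iff forall_3 algebra_simps)

lemma linear_plane_proj: "linear (plane_proj u)"
  by (rule linearI) (simp_all add: vec_eq_iff forall_2 algebra_simps add_divide_distrib)

lemma plane_proj_plane_emb [simp]: "plane_proj u (plane_emb y) = y"
  by (simp add: vec_eq_iff forall_2)

lemma plane_proj_self: "coord_sum u \<noteq> 0 \<Longrightarrow> plane_proj u u = 0"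
  by (simp add: vec_eq_iff forall_2)

lemma plane_proj_decomp: "coord_sum u \<noteq> 0 \<Longrightarrow> x = plane_emb (plane_proj u x) + (coord_sum x / coord_sum u) *\<^sub>R u"
proof -
  assume "coord_sum u \<noteq> 0"
  then have "coord_sum x / coord_sum u * coord_sum u = coord_sum x" by simp
  then have "coord_sum x / coord_sum u * u $ 3 = coord_sum x - coord_sum x / coord_sum u * u $ 1 - coord_sum x / coord_sum u * u $ 2"
    by (simp add: coord_sum_def algebra_simps add_divide_distrib)
  then show ?thesis by (simp add: vec_eq_iff forall_3 coord_sum_def)
qed

lemma coord_sum_pos: "(\<And>i. u $ i > 0) \<Longrightarrow> coord_sum u > 0"
  by (simp add: coord_sum_def add_pos_pos)

lemma norm_2_le: "norm (y :: real^2) \<le> \<bar>y $ 1\<bar> + \<bar>y $ 2\<bar>"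
  using norm_le_l1_cart[of y] by (simp add: sum_2)

lemma abelian_simps [simp]: "abelian [] = 0" "abelian (v @ w) = abelian v + abelian w"
  by (simp_all add: abelian_def vec_eq_iff)

lemma abelian_nth: "abelian w $ i = real (count_list w i)"
  by (simp add: abelian_def)

lemma abelian_Cons: "abelian (a # w) = axis a 1 + abelian w"
  by (simp add: abelian_def vec_eq_iff axis_def)

lemma coord_sum_abelian: "coord_sum (abelian w) = real (length w)"
proof (induction w)
  case (Cons a w)
  have "coord_sum (axis a 1) = 1" using exhaust_3[of a] by (elim disjE) (simp_all add: coord_sum_def axis_def)
  then show ?case using Cons.IH by (simp add: abelian_Cons)
qed simp

lemma linear_AR_mat: "linear (AR_mat i)"
  by (rule linearI) (simp_all add: vec_eq_iff algebra_simps)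

lemma abelian_ar: "abelian (ar i w) = AR_mat i (abelian w)"
proof (induction w)
  case Nil
  show ?case using linear_0[OF linear_AR_mat] by simp
next
  case (Cons a w)
  have "AR_mat i (axis a 1) = (if a = i then axis i 1 else axis a 1 + axis i 1)"
    using exhaust_3[of a] exhaust_3[of i] by (elim disjE) (simp_all add: vec_eq_iff forall_3 axis_def)
  then show ?case using Cons.IH linear_add[OF linear_AR_mat]
    by (simp add: ar_Cons abelian_Cons)
qed

lemma abelian_block: "AR_dir s \<Longrightarrow> abelian (subst_block s n w) = block_mat s n (abelian w)"
  by (induction n arbitrary: w) (simp_all add: subst_block_Suc block_mat_Suc abelian_ar del: subst_block.simps(2))

lemma axis_sum: "x = x $ 1 *\<^sub>R axis 1 1 + x $ 2 *\<^sub>R axis 2 1 + x $ 3 *\<^sub>R (axis 3 1 :: real^3)"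
  by (simp add: vec_eq_iff forall_3 axis_def)

lemma abelian_single: "abelian [a] = axis a 1"
  by (simp add: abelian_Cons)

lemma coord_sum_block_mat: "AR_dir s \<Longrightarrow> coord_sum (block_mat s n x) = height s n 1 * x $ 1 + height s n 2 * x $ 2 + height s n 3 * x $ 3"
proof -
  assume s: "AR_dir s"
  have h: "coord_sum (block_mat s n (axis a 1)) = height s n a" for a
    using coord_sum_abelian[of "subst_block s n [a]"] by (simp add: abelian_block[OF s] abelian_single height_def)
  have "block_mat s n x = x $ 1 *\<^sub>R block_mat s n (axis 1 1) + x $ 2 *\<^sub>R block_mat s n (axis 2 1) + x $ 3 *\<^sub>R block_mat s n (axis 3 1)"
    by (subst axis_sum[of x]) (simp add: linear_add[OF linear_block_mat] linear_cmul[OF linear_block_mat] del: vector_add_component)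
  then show ?thesis by (simp add: h mult.commute)
qed

definition AR_mat_inv :: "letter \<Rightarrow> real^3 \<Rightarrow> real^3" where
  "AR_mat_inv i z = (\<chi> k. if k = i then 2 * z $ i - coord_sum z else z $ k)"

lemma AR_mat_AR_mat_inv [simp]: "AR_mat i (AR_mat_inv i z) = z"
  using exhaust_3[of i] by (elim disjE) (simp_all add: vec_eq_iff forall_3 AR_mat_inv_def coord_sum_def)

lemma AR_mat_inv_AR_mat [simp]: "AR_mat_inv i (AR_mat i z) = z"
  using exhaust_3[of i] by (elim disjE) (simp_all add: vec_eq_iff forall_3 AR_mat_inv_def coord_sum_def)

lemma AR_mat_inv_int: "z \<in> integer_lattice \<Longrightarrow> AR_mat_inv i z \<in> integer_lattice"
  by (simp add: integer_lattice_def AR_mat_inv_def coord_sum_def)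

lemma AR_mat_int: "z \<in> integer_lattice \<Longrightarrow> AR_mat i z \<in> integer_lattice"
  by (simp add: integer_lattice_def)

lemma block_mat_inj: "AR_dir s \<Longrightarrow> block_mat s n x = block_mat s n y \<Longrightarrow> x = y"
proof (induction n arbitrary: x y)
  case (Suc n)
  then have "AR_mat (dir_letter s n) x = AR_mat (dir_letter s n) y" by (simp add: block_mat_Suc)
  then show ?case by (metis AR_mat_inv_AR_mat)
qed simp

lemma block_mat_surj: "AR_dir s \<Longrightarrow> \<exists>y. block_mat s n y = z \<and> (z \<in> integer_lattice \<longrightarrow> y \<in> integer_lattice)"
proof (induction n arbitrary: z)
  case (Suc n)
  then obtain y where y: "block_mat s n y = z" "z \<in> integer_lattice \<longrightarrow> y \<in> integer_lattice" by blast
  have "block_mat s (Suc n) (AR_mat_inv (dir_letter s n) y) = z" using y(1) by (simp add: block_mat_Suc[OF Suc.prems])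
  then show ?case using y(2) AR_mat_inv_int by blast
qed (auto intro!: exI[of _ z])

lemma block_mat_int: "AR_dir s \<Longrightarrow> z \<in> integer_lattice \<Longrightarrow> block_mat s n z \<in> integer_lattice"
  by (induction n arbitrary: z) (simp_all add: block_mat_Suc AR_mat_int)

lemma block_mat_nonneg: "AR_dir s \<Longrightarrow> (\<And>i. x $ i \<ge> 0) \<Longrightarrow> block_mat s n x $ j \<ge> 0"
proof (induction n arbitrary: x)
  case (Suc n)
  show ?case unfolding block_mat_Suc[OF Suc.prems(1)] by (rule Suc.IH[OF Suc.prems(1)]) (simp add: Suc.prems(2))
qed simp

definition tile :: "subst stream \<Rightarrow> real^3 \<Rightarrow> letter \<Rightarrow> (real^2) set" where
  "tile s u i = closure ((\<lambda>p. plane_proj u (abelian p)) ` pre s i)"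

text \<open>A bound on this sum is a bound on the diameters of the tiles, hence a balance constant of the
  language.\<close>

definition contr_summable :: "subst stream \<Rightarrow> real \<Rightarrow> bool" where
  "contr_summable s C \<longleftrightarrow> summable (contr_bound s) \<and> suminf (contr_bound s) \<le> C"

text \<open>At level \<open>k + 3\<close> the letters 1, 2, 3 at the start of the block make the
  word lengths comparable, and \<open>C\<close> bounds the tiles of the tail. One \<open>C\<close>
  for infinitely many levels is what makes the count of overlaps uniform.\<close>

definition good :: "subst stream \<Rightarrow> bool" where
  "good s \<longleftrightarrow> AR_dir s \<and> (\<exists>C. \<forall>m. \<exists>k\<ge>m. block_at s k \<and> contr_summable (sdrop (k + 3) s) C)"

lemma good_AR: "good s \<Longrightarrow> AR_dir s"
  by (simp add: good_def)

lemma good_blocks_recur: "good s \<Longrightarrow> blocks_recur s"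
  unfolding good_def blocks_recur_def by blast

lemma good_sdrop: "good s \<Longrightarrow> good (sdrop n s)"
proof -
  assume g: "good s"
  then obtain C where C: "\<And>m. \<exists>k\<ge>m. block_at s k \<and> contr_summable (sdrop (k + 3) s) C" unfolding good_def by blast
  have "\<exists>k\<ge>m. block_at (sdrop n s) k \<and> contr_summable (sdrop (k + 3) (sdrop n s)) C" for m
  proof -
    obtain k where k: "k \<ge> n + m" "block_at s k" "contr_summable (sdrop (k + 3) s) C" using C by blast
    have "sdrop (k - n + 3) (sdrop n s) = sdrop (k + 3) s" using k(1) by (simp add: sdrop_add)
    then have "k - n \<ge> m" "block_at (sdrop n s) (k - n)" "contr_summable (sdrop (k - n + 3) (sdrop n s)) C" using k by simp_all
    then show ?thesis by blast
  qed
  then show ?thesis unfolding good_def using AR_dir_sdrop good_AR[OF g] by blast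
qed

text \<open>A coordinate of the projection is the inner product with a vector \<open>y\<close>
  orthogonal to \<open>u 0\<close> of spread at most 1. The matrix is moved to the other side, where
  it contracts.\<close>

lemma block_mat_coord_bound:
  assumes s: "AR_dir s" and u: "eigseq s u"
  shows "\<bar>plane_proj (u 0) (block_mat s n x) $ k\<bar> \<le> contr_bound s n * (\<bar>x $ 1\<bar> + \<bar>x $ 2\<bar> + \<bar>x $ 3\<bar>)"
proof -
  define j :: 3 where "j = (if k = 1 then 1 else 2)"
  define c where "c = u 0 $ j / coord_sum (u 0)"
  define y :: "real^3" where "y = (\<chi> m. (if m = j then 1 else 0) - c)"
  have s0: "coord_sum (u 0) > 0" by (rule coord_sum_pos[OF eigseq_pos[OF u]])
  have k: "k = 1 \<or> k = 2" by (rule exhaust_2)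
  have perp: "y \<bullet> u 0 = 0"
  proof -
    have "y \<bullet> u 0 = u 0 $ j - c * coord_sum (u 0)"
      using k by (auto simp: y_def inner_vec_def sum_3 coord_sum_def j_def algebra_simps)
    then show ?thesis using s0 by (simp add: c_def)
  qed
  have sp: "spread y \<le> 1"
    by (rule spread_le[of 1 2 3]) (auto simp: y_def)
  have "plane_proj (u 0) (block_mat s n x) $ k = block_mat s n x \<bullet> y"
    using k by (auto simp: y_def inner_vec_def sum_3 coord_sum_def j_def c_def algebra_simps add_divide_distrib)
  also have "\<dots> = x \<bullet> block_mat_tr s n y" by (rule block_mat_inner)
  also have "\<bar>\<dots>\<bar> \<le> \<bar>x $ 1\<bar> * contr_bound s n + \<bar>x $ 2\<bar> * contr_bound s n + \<bar>x $ 3\<bar> * contr_bound s n"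
  proof -
    have m: "\<bar>block_mat_tr s n y $ i\<bar> \<le> contr_bound s n" for i
      using block_mat_tr_coord[OF s u perp, of n i] mult_left_mono[OF sp, of "contr_bound s n"] contr_bound_pos[of s n] by linarith
    have t: "\<bar>x $ i * block_mat_tr s n y $ i\<bar> \<le> \<bar>x $ i\<bar> * contr_bound s n" for i
      using mult_left_mono[OF m[of i], of "\<bar>x $ i\<bar>"] by (simp add: abs_mult)
    have "x \<bullet> block_mat_tr s n y = x $ 1 * block_mat_tr s n y $ 1 + x $ 2 * block_mat_tr s n y $ 2 + x $ 3 * block_mat_tr s n y $ 3"
      by (simp add: inner_vec_def sum_3)
    then show ?thesis using t[of 1] t[of 2] t[of 3] by linarith
  qed
  finally show ?thesis by (simp add: algebra_simps)
qed

text \<open>The word of \<open>a\<close> at level \<open>m + 1\<close> is its word at level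
  \<open>m\<close>, followed by at most the word of the letter \<open>?d\<close>. A prefix thus
  consists of at most one full word of each lower level, which costs one term of the sum.\<close>

lemma prefix_coord_bound:
  assumes s: "AR_dir s" and u: "eigseq s u" and p: "prefix (p @ [i]) (subst_block s m [a])"
  shows "\<bar>plane_proj (u 0) (abelian p) $ k\<bar> \<le> (\<Sum>j<m. contr_bound s j)"
  using p
proof (induction m arbitrary: a p)
  case 0
  then have "p = []" by (auto simp: prefix_Cons)
  then show ?case using linear_0[OF linear_plane_proj] by simp
next
  case (Suc m)
  let ?d = "dir_letter s m"
  have e: "subst_block s (Suc m) [a] = (if a = ?d then subst_block s m [a] else subst_block s m [a] @ subst_block s m [?d])"
    using subst_block_append[of s m "[a]" "[?d]"] by (simp add: subst_block_Suc[OF s] ar_Cons del: subst_block.simps)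
  have c: "0 \<le> contr_bound s m" using contr_bound_pos[of s m] by simp
  consider "prefix (p @ [i]) (subst_block s m [a])"
    | q where "p = subst_block s m [a] @ q" "prefix (q @ [i]) (subst_block s m [?d])"
  proof -
    have "prefix (p @ [i]) (subst_block s m [a] @ subst_block s m [?d])"
      using Suc.prems unfolding e by (auto split: if_splits intro: prefix_order.order_trans)
    then consider "prefix (p @ [i]) (subst_block s m [a])"
       | us where "p @ [i] = subst_block s m [a] @ us" "prefix us (subst_block s m [?d])" "us \<noteq> []"
      unfolding prefix_append by (metis append_Nil2 prefix_order.order_refl)
    then show thesis
    proof cases
      case 2
      then obtain q x where "us = q @ [x]" by (metis rev_exhaust)
      then show thesis using 2 that(2)[of q] by simp
    qed (rule that(1))
  qed
  then show ?case
  proof cases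
    case 1
    then show ?thesis using Suc.IH[OF 1] c by simp
  next
    case 2
    have "plane_proj (u 0) (abelian p) = plane_proj (u 0) (block_mat s m (axis a 1)) + plane_proj (u 0) (abelian q)"
      by (simp add: 2(1) abelian_block[OF s] abelian_single linear_add[OF linear_plane_proj])
    moreover have "\<bar>plane_proj (u 0) (block_mat s m (axis a 1)) $ k\<bar> \<le> contr_bound s m"
      using block_mat_coord_bound[OF s u, of m "axis a 1" k] exhaust_3[of a] by (auto simp: axis_def)
    ultimately show ?thesis using Suc.IH[OF 2(2)] by simp
  qed
qed

lemma pre_coord_bound:
  assumes s: "AR_dir s" and u: "eigseq s u" and b: "contr_summable s C" and p: "p \<in> pre s i"
  shows "\<bar>plane_proj (u 0) (abelian p) $ k\<bar> \<le> C"
proof -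
  obtain a m where "prefix (p @ [i]) (subst_block s m [a])" using p by (auto simp: pre_def)
  from prefix_coord_bound[OF s u this] have "\<bar>plane_proj (u 0) (abelian p) $ k\<bar> \<le> (\<Sum>j<m. contr_bound s j)" .
  also have "\<dots> \<le> suminf (contr_bound s)"
    using b contr_bound_pos by (intro sum_le_suminf) (auto simp: contr_summable_def less_imp_le)
  finally show ?thesis using b by (simp add: contr_summable_def)
qed

section \<open>Subtiles, covering and interior of the tiles\<close>

text \<open>The action of the level-\<open>n\<close> matrix from the plane of \<open>u n\<close> to
  that of \<open>u 0\<close>, in the charts; it maps tiles of level \<open>n\<close> to
  subtiles.\<close>

definition LL :: "subst stream \<Rightarrow> (nat \<Rightarrow> real^3) \<Rightarrow> nat \<Rightarrow> real^2 \<Rightarrow> real^2" where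
  "LL s u n y = plane_proj (u 0) (block_mat s n (plane_emb y))"

lemma linear_LL: "linear (LL s u n)"
proof -
  have "LL s u n = plane_proj (u 0) \<circ> (block_mat s n \<circ> plane_emb)" by (auto simp: LL_def)
  then show ?thesis using linear_compose[OF linear_compose[OF linear_plane_emb linear_block_mat] linear_plane_proj] by simp
qed

lemma finite_prefixes: "finite {q. prefix (q @ [i]) w}"
proof (rule finite_subset)
  show "{q. prefix (q @ [i]) w} \<subseteq> (\<lambda>n. take n w) ` {..length w}"
  proof clarify
    fix q assume "prefix (q @ [i]) w"
    then have "q = take (length q) w" "length q \<le> length w" by (auto elim!: prefixE)
    then show "q \<in> (\<lambda>n. take n w) ` {..length w}" by blast
  qed
qed simp

lemma closure_Union_finite: "finite I \<Longrightarrow> closure (\<Union>i\<in>I. A i) = (\<Union>i\<in>I. closure (A i))"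
  by (induction I rule: finite_induct) (simp_all add: closure_Un)

lemma integer_lattice_closed: "closed (integer_lattice :: (real^'n) set)"
proof -
  have "integer_lattice = (\<Inter>i. (\<lambda>x::real^'n. x $ i) -` \<int>)" by (auto simp: integer_lattice_def)
  moreover have "closed (\<Inter>i. (\<lambda>x::real^'n. x $ i) -` \<int>)"
    by (intro closed_INT ballI closed_vimage closed_Ints continuous_intros)
  ultimately show ?thesis by simp
qed

lemma integer_lattice_simps: "x \<in> integer_lattice \<Longrightarrow> y \<in> integer_lattice \<Longrightarrow> x + y \<in> integer_lattice"
   "x \<in> integer_lattice \<Longrightarrow> y \<in> integer_lattice \<Longrightarrow> x - y \<in> integer_lattice"
   "x \<in> integer_lattice \<Longrightarrow> - x \<in> integer_lattice" "0 \<in> integer_lattice"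
  by (simp_all add: integer_lattice_def)

lemma plane_emb_int: "z \<in> integer_lattice \<Longrightarrow> plane_emb z \<in> integer_lattice"
  by (simp add: integer_lattice_def forall_3)

lemma abelian_int: "abelian w \<in> integer_lattice"
  by (simp add: integer_lattice_def abelian_nth)

lemma countable_integer_lattice: "countable (integer_lattice :: (real^2) set)"
proof (rule countable_subset)
  show "integer_lattice \<subseteq> (\<lambda>(a, b). vector [of_int a, of_int b] :: real^2) ` (UNIV :: (int \<times> int) set)"
  proof
    fix x :: "real^2" assume "x \<in> integer_lattice"
    then have "x $ 1 \<in> \<int>" "x $ 2 \<in> \<int>" by (simp_all add: integer_lattice_def)
    then obtain a b where "x $ 1 = of_int a" "x $ 2 = of_int b" by (elim Ints_cases)
    then have "x = vector [of_int a, of_int b]" by (simp add: vec_eq_iff forall_2)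
    then show "x \<in> (\<lambda>(a, b). vector [of_int a, of_int b] :: real^2) ` (UNIV :: (int \<times> int) set)" by auto
  qed
qed simp

context
  fixes s :: "subst stream" and u :: "nat \<Rightarrow> real^3"
  assumes g: "good s" and u: "eigseq s u"
begin

lemma s: "AR_dir s"
  by (rule good_AR[OF g])

lemma coord_sum_u: "coord_sum (u n) > 0"
  by (rule coord_sum_pos[OF eigseq_pos[OF u]])

lemma LL_plane_proj: "LL s u n (plane_proj (u n) x) = plane_proj (u 0) (block_mat s n x)"
proof -
  have "x = plane_emb (plane_proj (u n) x) + (coord_sum x / coord_sum (u n)) *\<^sub>R u n" by (rule plane_proj_decomp) (use coord_sum_u[of n] in simp)
  then have "block_mat s n x = block_mat s n (plane_emb (plane_proj (u n) x)) + (coord_sum x / coord_sum (u n)) *\<^sub>R u 0"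
    using linear_add[OF linear_block_mat] linear_cmul[OF linear_block_mat] eigseq_block_mat[OF s u] by metis
  then have "plane_proj (u 0) (block_mat s n x) = plane_proj (u 0) (block_mat s n (plane_emb (plane_proj (u n) x))) + (coord_sum x / coord_sum (u n)) *\<^sub>R plane_proj (u 0) (u 0)"
    using linear_add[OF linear_plane_proj] linear_cmul[OF linear_plane_proj] by metis
  moreover have "plane_proj (u 0) (u 0) = 0" by (rule plane_proj_self) (use coord_sum_u[of 0] in simp)
  ultimately show ?thesis by (simp add: LL_def)
qed

lemma inj_LL: "inj (LL s u n)"
proof (subst linear_inj_iff_eq_0[OF linear_LL], intro allI impI)
  fix y assume "LL s u n y = 0"
  then have "plane_proj (u 0) (block_mat s n (plane_emb y)) = 0" by (simp add: LL_def)
  then have "block_mat s n (plane_emb y) = (coord_sum (block_mat s n (plane_emb y)) / coord_sum (u 0)) *\<^sub>R u 0"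
    using plane_proj_decomp[of "u 0" "block_mat s n (plane_emb y)"] coord_sum_u[of 0] linear_0[OF linear_plane_emb] by simp
  then obtain c where "block_mat s n (plane_emb y) = c *\<^sub>R u 0" by blast
  then have "block_mat s n (plane_emb y) = block_mat s n (c *\<^sub>R u n)" by (simp add: linear_cmul[OF linear_block_mat] eigseq_block_mat[OF s u])
  then have j: "plane_emb y = c *\<^sub>R u n" by (rule block_mat_inj[OF s])
  then have "coord_sum (plane_emb y) = c * coord_sum (u n)" by (simp only: coord_sum_simps)
  then have "c = 0" using coord_sum_u[of n] by simp
  then have "plane_emb y = 0" using j by simp
  then have "plane_proj (u 0) (plane_emb y) = 0" using linear_0[OF linear_plane_proj] by metis
  then show "y = 0" by simp
qed

lemma LL_Suc: "LL s u (Suc n) y = LL s u n (plane_proj (u n) (AR_mat (dir_letter s n) (plane_emb y)))"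
  unfolding LL_plane_proj by (simp add: LL_def block_mat_Suc[OF s])

text \<open>The matrix of a letter has determinant of absolute value 1 and takes
  \<open>u (Suc n)\<close> to \<open>u n\<close>, so the area factor on the plane compensates the
  change of the coordinate sum along the eigenvectors. The proof computes it for each
  letter.\<close>

lemma det_step: "det (matrix (\<lambda>y. plane_proj (u n) (AR_mat (dir_letter s n) (plane_emb y)))) = coord_sum (u (Suc n)) / coord_sum (u n)"
proof -
  have e: "u n = AR_mat (dir_letter s n) (u (Suc n))" by (rule eigseq_step[OF u])
  let ?v = "u (Suc n)"
  have p: "coord_sum (AR_mat (dir_letter s n) ?v) > 0" using coord_sum_u[of n] e by simp
  have q: "(1 - a / T) * (1 - b / T) - a / T * (b / T) = (T - a - b) / T" if "T > 0" for a b T :: real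
    using that by (simp add: field_simps)
  consider "dir_letter s n = 1" | "dir_letter s n = 2" | "dir_letter s n = 3" using exhaust_3 by blast
  then show ?thesis
  proof cases
    case 1
    then show ?thesis unfolding e by (simp add: det_2 matrix_def axis_def) (simp add: coord_sum_def minus_divide_left)
  next
    case 2
    then show ?thesis unfolding e by (simp add: det_2 matrix_def axis_def) (simp add: coord_sum_def minus_divide_left)
  next
    case 3
    have m: "coord_sum (AR_mat 3 ?v) = ?v $ 1 + ?v $ 2 + coord_sum ?v" by (simp add: coord_sum_def)
    define T where "T = coord_sum (AR_mat 3 ?v)"
    have T: "T > 0" using p 3 by (simp add: T_def)
    have "det (matrix (\<lambda>y. plane_proj (AR_mat 3 ?v) (AR_mat 3 (plane_emb y)))) = (1 - ?v $ 1 / T) * (1 - ?v $ 2 / T) - ?v $ 1 / T * (?v $ 2 / T)"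
      by (simp add: det_2 matrix_def axis_def T_def[symmetric]) (simp add: coord_sum_def)
    also have "\<dots> = coord_sum ?v / T" unfolding q[OF T] using m by (simp add: T_def[symmetric])
    finally show ?thesis unfolding e using 3 by (simp add: T_def)
  qed
qed

lemma det_LL: "det (matrix (LL s u n)) = coord_sum (u n) / coord_sum (u 0)"
proof (induction n)
  case 0
  have "LL s u 0 = (\<lambda>x. x)" by (auto simp: LL_def)
  then show ?case using coord_sum_u[of 0] by (simp add: matrix_id_mat_1[unfolded id_def])
next
  case (Suc n)
  let ?f = "\<lambda>y. plane_proj (u n) (AR_mat (dir_letter s n) (plane_emb y))"
  have lf: "linear ?f"
    using linear_compose[OF linear_compose[OF linear_plane_emb linear_AR_mat] linear_plane_proj] by (simp add: o_def)
  have "LL s u (Suc n) = LL s u n \<circ> ?f" by (auto simp: LL_Suc)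
  then have "det (matrix (LL s u (Suc n))) = det (matrix (LL s u n)) * det (matrix ?f)"
    by (simp only: matrix_compose[OF lf linear_LL] det_mul)
  also have "\<dots> = coord_sum (u n) / coord_sum (u 0) * (coord_sum (u (Suc n)) / coord_sum (u n))" by (simp only: Suc.IH det_step)
  finally show ?case using coord_sum_u[of n] by simp
qed

text \<open>The set equation of the tiles. The union is finite and \<open>LL\<close> is injective
  and linear, so \<open>pre_decomp\<close> and \<open>pre_comp\<close> pass to closures.\<close>

lemma tile_decomp:
  "tile s (u 0) i = (\<Union>(b, q)\<in>(SIGMA b:UNIV. {q. prefix (q @ [i]) (subst_block s n [b])}).
      (+) (plane_proj (u 0) (abelian q)) ` LL s u n ` tile (sdrop n s) (u n) b)"
proof -
  let ?I = "SIGMA b:UNIV. {q. prefix (q @ [i]) (subst_block s n [b])}"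
  let ?V = "\<lambda>b. (\<lambda>p. plane_proj (u n) (abelian p)) ` pre (sdrop n s) b"
  have eq: "plane_proj (u 0) (abelian (subst_block s n W @ q)) = plane_proj (u 0) (abelian q) + LL s u n (plane_proj (u n) (abelian W))" for W q
    by (simp add: abelian_block[OF s] LL_plane_proj linear_add[OF linear_plane_proj] add.commute)
  have "(\<lambda>p. plane_proj (u 0) (abelian p)) ` pre s i = (\<Union>(b, q)\<in>?I. (+) (plane_proj (u 0) (abelian q)) ` LL s u n ` ?V b)" (is "?A = ?B")
  proof
    show "?A \<subseteq> ?B"
    proof clarify
      fix p assume "p \<in> pre s i"
      then obtain W b q where "W \<in> pre (sdrop n s) b" "p = subst_block s n W @ q" "prefix (q @ [i]) (subst_block s n [b])"
        by (rule pre_decomp[OF s])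
      then show "plane_proj (u 0) (abelian p) \<in> ?B" by (intro UN_I[of "(b, q)"]) (auto simp: eq simp del: abelian_simps)
    qed
    show "?B \<subseteq> ?A"
    proof clarify
      fix b q W assume "prefix (q @ [i]) (subst_block s n [b])" "W \<in> pre (sdrop n s) b"
      then have "subst_block s n W @ q \<in> pre s i" by (rule pre_comp[rotated])
      then show "plane_proj (u 0) (abelian q) + LL s u n (plane_proj (u n) (abelian W)) \<in> ?A" unfolding eq[symmetric] by (rule imageI)
    qed
  qed
  then have "tile s (u 0) i = closure ?B" by (simp add: tile_def)
  also have "\<dots> = (\<Union>(b, q)\<in>?I. closure ((+) (plane_proj (u 0) (abelian q)) ` LL s u n ` ?V b))"
    unfolding case_prod_unfold by (rule closure_Union_finite) (intro finite_SigmaI finite_prefixes finite)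
  also have "\<dots> = (\<Union>(b, q)\<in>?I. (+) (plane_proj (u 0) (abelian q)) ` LL s u n ` tile (sdrop n s) (u n) b)"
    by (simp only: tile_def closure_translation closure_injective_linear_image[OF linear_LL inj_LL])
  finally show ?thesis .
qed

lemma tile_bound:
  assumes "contr_summable (sdrop n s) C" "y \<in> tile (sdrop n s) (u n) b"
  shows "\<bar>y $ k\<bar> \<le> C"
proof -
  have e: "eigseq (sdrop n s) (\<lambda>m. u (n + m))" by (rule eigseq_sdrop[OF u])
  have "closed {y :: real^2. \<bar>y $ k\<bar> \<le> C}" by (intro closed_Collect_le continuous_intros)
  moreover have "(\<lambda>p. plane_proj (u n) (abelian p)) ` pre (sdrop n s) b \<subseteq> {y. \<bar>y $ k\<bar> \<le> C}"
    using pre_coord_bound[OF AR_dir_sdrop[OF s] e assms(1)] by auto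
  ultimately have "tile (sdrop n s) (u n) b \<subseteq> {y. \<bar>y $ k\<bar> \<le> C}"
    unfolding tile_def by (rule closure_minimal[rotated])
  then show ?thesis using assms(2) by blast
qed

lemma good_level: obtains C where "\<And>m. \<exists>k\<ge>m. block_at s k \<and> contr_summable (sdrop (k + 3) s) C" "C \<ge> 0"
proof -
  obtain C where C: "\<And>m. \<exists>k\<ge>m. block_at s k \<and> contr_summable (sdrop (k + 3) s) C" using g unfolding good_def by blast
  obtain k where "contr_summable (sdrop (k + 3) s) C" using C by blast
  then have "0 \<le> C" unfolding contr_summable_def
    using suminf_nonneg[of "contr_bound (sdrop (k + 3) s)"] contr_bound_pos less_imp_le by (meson order.trans)
  then show thesis using that C by blast
qed

text \<open>Boundedness is available for a tail with summable contraction and is carried up to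
  \<open>s\<close> by the finite set equation.\<close>

lemma compact_tile: "compact (tile s (u 0) i)"
proof -
  obtain C where C: "\<And>m. \<exists>k\<ge>m. block_at s k \<and> contr_summable (sdrop (k + 3) s) C" using good_level by blast
  obtain k where "contr_summable (sdrop (k + 3) s) C" using C by blast
  define n where "n = k + 3"
  have b: "contr_summable (sdrop n s) C" unfolding n_def by fact
  have c: "compact (tile (sdrop n s) (u n) b)" for b
  proof (rule compact_eq_bounded_closed[THEN iffD2], rule conjI)
    show "closed (tile (sdrop n s) (u n) b)" by (simp add: tile_def)
    show "bounded (tile (sdrop n s) (u n) b)"
      unfolding bounded_iff
    proof (intro exI ballI)
      fix y assume "y \<in> tile (sdrop n s) (u n) b"
      then show "norm y \<le> C + C" using norm_2_le[of y] tile_bound[OF b, of y _ 1] tile_bound[OF b, of y _ 2] by fastforce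
    qed
  qed
  show ?thesis
    unfolding tile_decomp[where n=n] case_prod_unfold
    by (intro compact_UN finite_SigmaI finite_prefixes finite compact_translation
          compact_continuous_image[OF linear_continuous_on[OF linear_conv_bounded_linear[THEN iffD1, OF linear_LL]] c])
qed

text \<open>The target is pulled back to level \<open>n\<close> and made nonnegative by a multiple
  of \<open>u n\<close>, which the projection does not see since it becomes a multiple of
  \<open>u 0\<close>. The pull-back is then rounded down; \<open>contr_bound s n\<close> shrinks the
  rounding error.\<close>

lemma nonneg_dense:
  assumes "\<delta> > 0"
  shows "\<exists>z\<in>integer_lattice. (\<forall>i. z $ i \<ge> 0) \<and> dist (plane_proj (u 0) z) x < \<delta>"
proof -
  have "contr_bound s \<longlonglongrightarrow> 0" by (rule contr_bound_tendsto_0[OF good_blocks_recur[OF g]])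
  \<comment> \<open>The rounding error contributes at most 3 in each of two coordinates.\<close>
  then obtain n where n: "contr_bound s n < \<delta> / 6"
    using assms by (metis divide_pos_pos eventually_at_top_linorder order_refl order_tendstoD(2) zero_less_numeral)
  obtain v where v: "block_mat s n v = plane_emb x" using block_mat_surj[OF s] by blast
  define t where "t = (\<bar>v $ 1\<bar> + \<bar>v $ 2\<bar> + \<bar>v $ 3\<bar>) * (1 / u n $ 1 + 1 / u n $ 2 + 1 / u n $ 3)"
  have up: "u n $ i > 0" for i by (rule eigseq_pos[OF u])
  define w where "w = v + t *\<^sub>R u n"
  have w0: "w $ i \<ge> 0" for i
  proof -
    let ?S = "\<bar>v $ 1\<bar> + \<bar>v $ 2\<bar> + \<bar>v $ 3\<bar>" let ?R = "1 / u n $ 1 + 1 / u n $ 2 + 1 / u n $ 3"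
    have a: "\<bar>v $ i\<bar> \<le> ?S" using exhaust_3[of i] by (elim disjE) simp_all
    have "1 / u n $ i \<le> ?R" using exhaust_3[of i] up[of 1] up[of 2] up[of 3] by (elim disjE) simp_all
    then have "?S * (1 / u n $ i) \<le> ?S * ?R" by (rule mult_left_mono) simp
    then have "?S / u n $ i \<le> t" by (simp add: t_def)
    then have "?S \<le> t * u n $ i" using up[of i] by (simp add: pos_divide_le_eq)
    then show ?thesis using a by (simp add: w_def)
  qed
  define z :: "real^3" where "z = (\<chi> i. of_int \<lfloor>w $ i\<rfloor>)"
  have zi: "z \<in> integer_lattice" by (simp add: z_def integer_lattice_def)
  have z0: "z $ i \<ge> 0" for i using w0[of i] by (simp add: z_def)
  define f where "f = w - z"
  have f: "0 \<le> f $ i" "f $ i \<le> 1" for i using of_int_floor_le[of "w $ i"] real_of_int_floor_add_one_gt[of "w $ i"]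
    by (simp_all add: f_def z_def) linarith
  have "plane_proj (u 0) (block_mat s n w) = x"
  proof -
    have "block_mat s n w = plane_emb x + t *\<^sub>R u 0"
      by (simp add: w_def linear_add[OF linear_block_mat] linear_cmul[OF linear_block_mat] eigseq_block_mat[OF s u] v)
    then have "plane_proj (u 0) (block_mat s n w) = plane_proj (u 0) (plane_emb x) + t *\<^sub>R plane_proj (u 0) (u 0)"
      by (simp only: linear_add[OF linear_plane_proj] linear_cmul[OF linear_plane_proj])
    moreover have "plane_proj (u 0) (u 0) = 0" by (rule plane_proj_self) (use coord_sum_u[of 0] in simp)
    ultimately show ?thesis by simp
  qed
  moreover have "block_mat s n w = block_mat s n z + block_mat s n f"
    unfolding linear_add[OF linear_block_mat, symmetric] by (simp add: f_def)
  ultimately have "x - plane_proj (u 0) (block_mat s n z) = plane_proj (u 0) (block_mat s n f)"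
    using linear_add[OF linear_plane_proj] by (metis add_diff_cancel_left')
  moreover have k: "\<bar>plane_proj (u 0) (block_mat s n f) $ k\<bar> \<le> contr_bound s n * 3" for k
  proof -
    have "\<bar>f $ 1\<bar> + \<bar>f $ 2\<bar> + \<bar>f $ 3\<bar> \<le> 3" using f[of 1] f[of 2] f[of 3] by linarith
    then have "contr_bound s n * (\<bar>f $ 1\<bar> + \<bar>f $ 2\<bar> + \<bar>f $ 3\<bar>) \<le> contr_bound s n * 3"
      using contr_bound_pos[of s n] by (intro mult_left_mono) auto
    then show ?thesis using block_mat_coord_bound[OF s u, of n f k] by linarith
  qed
  have "norm (plane_proj (u 0) (block_mat s n f)) \<le> contr_bound s n * 6"
    using norm_2_le[of "plane_proj (u 0) (block_mat s n f)"] k[of 1] k[of 2] by linarith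
  ultimately have "dist (plane_proj (u 0) (block_mat s n z)) x < \<delta>" using n by (simp add: dist_norm norm_minus_commute)
  moreover have "block_mat s n z \<in> integer_lattice" "\<And>i. block_mat s n z $ i \<ge> 0"
    using block_mat_int[OF s zi] block_mat_nonneg[OF s z0] by auto
  ultimately show ?thesis by blast
qed

definition RR :: "(real^2) set" where "RR = (\<Union>i. tile s (u 0) i)"

lemma compact_RR: "compact RR"
  unfolding RR_def by (intro compact_UN compact_tile) simp

lemma pre_of_length: "\<exists>p i. p \<in> pre s i \<and> length p = n"
proof -
  obtain m where "\<And>a. Suc n \<le> height s m a" using height_unbounded[OF s good_blocks_recur[OF g], of "Suc n"] by blast
  then have "n < length (subst_block s m [1])" by (simp add: height_def Suc_le_eq)
  then have "prefix (take n (subst_block s m [1]) @ [subst_block s m [1] ! n]) (subst_block s m [1])"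
    by (metis take_Suc_conv_app_nth take_is_prefix)
  then have "take n (subst_block s m [1]) \<in> pre s (subst_block s m [1] ! n)" unfolding pre_def by blast
  moreover have "length (take n (subst_block s m [1])) = n" using \<open>n < _\<close> by simp
  ultimately show ?thesis by blast
qed

text \<open>A nonnegative integer vector of coordinate sum \<open>n\<close> and the letter counts of
  a prefix of length \<open>n\<close> differ by a lattice point of the plane. Hence the dense set of
  \<open>nonneg_dense\<close> lies in \<open>RR\<close> plus the lattice, which is closed as
  \<open>RR\<close> is compact.\<close>

lemma covering: "\<exists>z\<in>integer_lattice. x + z \<in> RR"
proof -
  let ?T = "\<Union>a\<in>RR. \<Union>b\<in>integer_lattice. {a + b}"
  have c: "closed ?T" by (rule compact_closed_sums[OF compact_RR integer_lattice_closed])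
  have "x \<in> closure ?T"
    unfolding closure_approachable
  proof (intro allI impI)
    fix e :: real assume "e > 0"
    then obtain z where z: "z \<in> integer_lattice" "\<And>i. z $ i \<ge> 0" "dist (plane_proj (u 0) z) x < e" using nonneg_dense by blast
    have "coord_sum z \<in> \<nat>"
    proof -
      have "coord_sum z \<in> \<int>" "coord_sum z \<ge> 0" using z(1) z(2)[of 1] z(2)[of 2] z(2)[of 3]
        by (auto simp: integer_lattice_def coord_sum_def)
      then show ?thesis by (metis Nats_altdef2 mem_Collect_eq)
    qed
    then obtain n where n: "coord_sum z = real n" by (auto elim: Nats_cases)
    obtain p i where p: "p \<in> pre s i" "length p = n" using pre_of_length by blast
    define v where "v = z - abelian p"
    define y where "y = plane_proj (u 0) v"
    have d0: "coord_sum v = 0" using n p by (simp add: v_def coord_sum_abelian)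
    have "v \<in> integer_lattice" unfolding v_def by (rule integer_lattice_simps(2)[OF z(1) abelian_int])
    then have y: "y \<in> integer_lattice" unfolding y_def by (simp add: integer_lattice_def forall_2 d0)
    have e1: "plane_proj (u 0) z = plane_proj (u 0) (abelian p) + y"
      unfolding y_def linear_add[OF linear_plane_proj, symmetric] by (simp add: v_def)
    have e2: "plane_proj (u 0) (abelian p) \<in> RR"
      unfolding RR_def tile_def by (rule UN_I[OF UNIV_I], rule subsetD[OF closure_subset], rule imageI, rule p(1))
    have "plane_proj (u 0) z \<in> ?T" unfolding e1 by (intro UN_I[OF e2] UN_I[OF y]) simp
    then show "\<exists>y\<in>?T. dist y x < e" using z(3) by blast
  qed
  then have "x \<in> ?T" unfolding closure_closed[OF c] .
  then obtain a b where "a \<in> RR" "b \<in> integer_lattice" "x = a + b" by (elim UN_E singletonE)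
  then have "x + (- b) \<in> RR" "- b \<in> integer_lattice" by (simp_all add: integer_lattice_simps)
  then show ?thesis by blast
qed

text \<open>Countably many translates of the tiles cover the plane; by Baire they cannot all be
  nowhere dense.\<close>

lemma tile_interior_ex: "\<exists>i. interior (tile s (u 0) i) \<noteq> {}"
proof (rule ccontr)
  assume "\<not> ?thesis"
  then have e: "interior (tile s (u 0) i) = {}" for i by blast
  let ?G = "(\<lambda>(z, i). - ((+) z ` tile s (u 0) i)) ` (integer_lattice \<times> UNIV)"
  have "UNIV \<subseteq> closure (\<Inter>?G)"
  proof (rule Baire)
    show "countable ?G" by (intro countable_image countable_SIGMA countable_integer_lattice) auto
    fix T assume "T \<in> ?G"
    then obtain z i where T: "T = - ((+) z ` tile s (u 0) i)" by auto
    have "closed ((+) z ` tile s (u 0) i)" by (intro closed_translation compact_imp_closed compact_tile)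
    moreover have "interior ((+) z ` tile s (u 0) i) = {}" by (simp add: interior_translation e)
    ultimately show "openin (top_of_set UNIV) T \<and> UNIV \<subseteq> closure T"
      unfolding T by (simp add: closure_complement open_Compl)
  qed simp
  moreover have "\<Inter>?G = {}"
  proof -
    have "\<exists>z\<in>integer_lattice. \<exists>i. x \<in> (+) z ` tile s (u 0) i" for x
    proof -
      obtain z i where "z \<in> integer_lattice" "x + z \<in> tile s (u 0) i" using covering[of x] unfolding RR_def by blast
      then have "- z \<in> integer_lattice" "x \<in> (+) (- z) ` tile s (u 0) i"
        by (auto simp: integer_lattice_simps intro!: image_eqI[where x="x + z"])
      then show ?thesis by blast
    qed
    note ex = this
    have "x \<notin> \<Inter>?G" for x
    proof -
      obtain z i where zi: "z \<in> integer_lattice" "x \<in> (+) z ` tile s (u 0) i"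
        using ex[of x] by (elim bexE exE)
      have "- ((+) z ` tile s (u 0) i) \<in> ?G" by (rule image_eqI[where x="(z, i)"]) (use zi(1) in simp_all)
      then show ?thesis using zi(2) by blast
    qed
    then show ?thesis by blast
  qed
  ultimately show False by simp
qed

end

lemma set_subst_block: "AR_dir s \<Longrightarrow> set w \<subseteq> set (subst_block s n w)"
proof (induction n arbitrary: w)
  case (Suc n)
  have "set w \<subseteq> set (ar (dir_letter s n) w)" by (induction w) (auto simp: ar_Cons)
  also have "\<dots> \<subseteq> set (subst_block s n (ar (dir_letter s n) w))" by (rule Suc.IH[OF Suc.prems])
  finally show ?case by (simp only: subst_block_Suc[OF Suc.prems])
qed simp

lemma all_letters:
  assumes s: "AR_dir s" and b: "block_at s k"
  shows "\<exists>q. prefix (q @ [i]) (subst_block s (k + 3) [a])"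
proof -
  let ?W = "ar 1 (ar 2 (ar 3 [a]))"
  have "subst_block s (k + 3) [a] = subst_block s k ?W"
    using subst_block_Suc[OF s, of "k + 2" "[a]"] subst_block_Suc[OF s, of "k + 1"] subst_block_Suc[OF s, of "k"] block_at_dir_letter[OF b]
    by (simp add: numeral_3_eq_3 del: subst_block.simps)
  moreover have "i \<in> set ?W" using exhaust_3[of i] exhaust_3[of a] by (elim disjE) (simp_all add: ar_Cons)
  ultimately have "i \<in> set (subst_block s (k + 3) [a])" using set_subst_block[OF s, of ?W k] by auto
  then obtain q r where "subst_block s (k + 3) [a] = q @ i # r" by (meson split_list)
  then have "prefix (q @ [i]) (subst_block s (k + 3) [a])" by simp
  then show ?thesis ..
qed

context
  fixes s :: "subst stream" and u :: "nat \<Rightarrow> real^3"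
  assumes g: "good s" and u: "eigseq s u"
begin

lemma piece_subset:
  assumes "prefix (q @ [i]) (subst_block s n [b])"
  shows "(+) (plane_proj (u 0) (abelian q)) ` LL s u n ` tile (sdrop n s) (u n) b \<subseteq> tile s (u 0) i"
  unfolding tile_decomp[OF g u, of i n] by (rule order.trans[OF _ UN_upper[of "(b, q)"]]) (use assms in auto)

lemma interior_piece:
  assumes "prefix (q @ [i]) (subst_block s n [b])"
  shows "(+) (plane_proj (u 0) (abelian q)) ` LL s u n ` interior (tile (sdrop n s) (u n) b) \<subseteq> interior (tile s (u 0) i)"
  using interior_mono[OF piece_subset[OF assms]]
  by (simp only: interior_translation interior_injective_linear_image[OF linear_LL inj_LL[OF g u]])

text \<open>Baire provides one tile with interior at level \<open>k + 3\<close>. Every letter occurs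
  in every word of that level, so each tile of level 0 contains an affine copy of it.\<close>

lemma tile_interior: "interior (tile s (u 0) i) \<noteq> {}"
proof -
  obtain C k where k: "block_at s k" using good_blocks_recur[OF g] unfolding blocks_recur_def by blast
  have "\<exists>b. interior (tile (sdrop (k + 3) s) (u (k + 3 + 0)) b) \<noteq> {}"
    by (rule tile_interior_ex[OF good_sdrop[OF g] eigseq_sdrop[OF u]])
  then obtain b where "interior (tile (sdrop (k + 3) s) (u (k + 3)) b) \<noteq> {}" by auto
  moreover obtain q where "prefix (q @ [i]) (subst_block s (k + 3) [b])" using all_letters[OF good_AR[OF g] k] by blast
  ultimately show ?thesis using interior_piece by blast
qed

end

context
  fixes s :: "subst stream" and u :: "nat \<Rightarrow> real^3"
  assumes g: "good s" and u: "eigseq s u"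
begin

lemma tile_interior_tail: "interior (tile (sdrop n s) (u n) b) \<noteq> {}"
  using tile_interior[OF good_sdrop[OF g] eigseq_sdrop[OF u], of n b] by simp

lemma LL_small:
  assumes "\<And>k. \<bar>y $ k\<bar> \<le> C"
  shows "norm (LL s u n y) \<le> contr_bound s n * (8 * C)"
proof -
  have "\<bar>plane_emb y $ 1\<bar> + \<bar>plane_emb y $ 2\<bar> + \<bar>plane_emb y $ 3\<bar> \<le> 4 * C" using assms[of 1] assms[of 2] by simp
  then have "contr_bound s n * (\<bar>plane_emb y $ 1\<bar> + \<bar>plane_emb y $ 2\<bar> + \<bar>plane_emb y $ 3\<bar>) \<le> contr_bound s n * (4 * C)"
    using contr_bound_pos[of s n] by (intro mult_left_mono) auto
  then have "\<bar>LL s u n y $ k\<bar> \<le> contr_bound s n * (4 * C)" for k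
    unfolding LL_def using block_mat_coord_bound[OF good_AR[OF g] u, of n "plane_emb y" k] by linarith
  from this[of 1] this[of 2] show ?thesis using norm_2_le[of "LL s u n y"] by linarith
qed

text \<open>Each point lies in arbitrarily small subtiles, and all of these have interior
  points.\<close>

lemma closure_interior_tile: "closure (interior (tile s (u 0) i)) = tile s (u 0) i"
proof
  have c: "closed (tile s (u 0) i)" by (simp add: tile_def)
  show "closure (interior (tile s (u 0) i)) \<subseteq> tile s (u 0) i"
    by (rule closure_minimal[OF interior_subset c])
  show "tile s (u 0) i \<subseteq> closure (interior (tile s (u 0) i))"
  proof
    fix x assume x: "x \<in> tile s (u 0) i"
    show "x \<in> closure (interior (tile s (u 0) i))"
      unfolding closure_approachable
    proof (intro allI impI)
      fix e :: real assume e: "e > 0"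
      obtain C where C: "\<And>m. \<exists>k\<ge>m. block_at s k \<and> contr_summable (sdrop (k + 3) s) C" "C \<ge> 0" using good_level[OF g u] by blast
      \<comment> \<open>Two points of a level-\<open>n\<close> subtile are at most twice
        \<open>contr_bound s n * (8 * C)\<close> apart; the summand 1 keeps the denominator
        positive.\<close>
      have "e / (16 * C + 1) > 0" using e C(2) by simp
      then obtain m where m: "\<And>n. n \<ge> m \<Longrightarrow> contr_bound s n < e / (16 * C + 1)"
        using order_tendstoD(2)[OF contr_bound_tendsto_0[OF good_blocks_recur[OF g]]] unfolding eventually_sequentially by blast
      obtain k where k: "k \<ge> m" "contr_summable (sdrop (k + 3) s) C" using C(1) by blast
      define n where "n = k + 3"
      have bn: "contr_summable (sdrop n s) C" using k by (simp add: n_def)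
      have "contr_bound s n < e / (16 * C + 1)" using m[of n] k by (simp add: n_def)
      then have small: "contr_bound s n * (16 * C) < e"
      proof -
        assume "contr_bound s n < e / (16 * C + 1)"
        then have "contr_bound s n * (16 * C + 1) < e" using C(2) by (simp add: pos_less_divide_eq)
        then show ?thesis using contr_bound_pos[of s n] by (simp add: algebra_simps)
      qed
      obtain b q \<xi> where q: "prefix (q @ [i]) (subst_block s n [b])" and \<xi>: "\<xi> \<in> tile (sdrop n s) (u n) b"
        and xe: "x = plane_proj (u 0) (abelian q) + LL s u n \<xi>"
        using x unfolding tile_decomp[OF g u, of i n] by auto
      obtain \<eta> where \<eta>: "\<eta> \<in> interior (tile (sdrop n s) (u n) b)" using tile_interior_tail by blast
      let ?y = "plane_proj (u 0) (abelian q) + LL s u n \<eta>"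
      have "?y \<in> interior (tile s (u 0) i)" using interior_piece[OF g u q] \<eta> by blast
      moreover have "dist ?y x < e"
      proof -
        have "\<eta> \<in> tile (sdrop n s) (u n) b" using \<eta> interior_subset by blast
        then have "norm (LL s u n \<eta>) \<le> contr_bound s n * (8 * C)" by (intro LL_small tile_bound[OF g u bn])
        moreover have "norm (LL s u n \<xi>) \<le> contr_bound s n * (8 * C)" by (intro LL_small tile_bound[OF g u bn \<xi>])
        moreover have "norm (LL s u n \<eta> - LL s u n \<xi>) \<le> norm (LL s u n \<eta>) + norm (LL s u n \<xi>)" by (rule norm_triangle_ineq4)
        ultimately have "norm (LL s u n \<eta> - LL s u n \<xi>) < e" using small by linarith
        then show ?thesis unfolding xe dist_norm by (simp only: add_diff_cancel_left)
      qed
      ultimately show "\<exists>y\<in>interior (tile s (u 0) i). dist y x < e" by blast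
    qed
  qed
qed

end

section \<open>Non-coincident positions and null overlaps\<close>

definition letter_word :: "(letter \<Rightarrow> nat) \<Rightarrow> letter list" where
  "letter_word c = replicate (c 1) 1 @ replicate (c 2) 2 @ replicate (c 3) 3"

lemma count_letter_word: "count_list (letter_word c) i = c i"
proof -
  have r: "count_list (replicate n a) j = (if a = j then n else 0)" for n and a j :: letter by (induction n) auto
  show ?thesis using exhaust_3[of i] by (elim disjE) (simp_all add: letter_word_def r)
qed

lemma mset_eq_count: "(\<And>i. count_list v i = count_list w i) \<Longrightarrow> mset v = mset w"
  by (rule multiset_eqI) (simp add: count_mset)

lemma length_eq_counts: "length w = count_list w 1 + count_list w 2 + count_list w (3::letter)"
  using coord_sum_abelian[of w] by (simp add: coord_sum_def abelian_nth flip: of_nat_add)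

text \<open>Two broken lines are compared at equal coordinate sum: that of the word of
  \<open>a\<close>, starting at the origin, and that of the word of \<open>b\<close>, starting at
  \<open>block_mat s n y\<close>. Collected are the positions in the first word where the vertices
  or the edges leaving them differ.\<close>

definition noncoinc :: "subst stream \<Rightarrow> nat \<Rightarrow> letter \<Rightarrow> letter \<Rightarrow> real^3 \<Rightarrow> nat set" where
  "noncoinc s n a b y = {H. \<exists>q q' i j. length q = H \<and> prefix (q @ [i]) (subst_block s n [a]) \<and>
      prefix (q' @ [j]) (subst_block s n [b]) \<and> real (length q) = coord_sum (block_mat s n y) + real (length q') \<and>
      \<not> (abelian q = block_mat s n y + abelian q' \<and> i = j)}"

text \<open>Both letters are completed to words \<open>U\<close> and \<open>V\<close> with the same
  letter counts, such that the parts in front of \<open>a\<close> and \<open>b\<close> differ by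
  \<open>y\<close>. A non-coincident position is then a mismatch of the images. Each letter occurs
  \<open>2 * Y + 1\<close> times in \<open>U\<close> and in \<open>V\<close>, whence the length in
  the bound.\<close>

lemma card_noncoinc:
  assumes s: "AR_dir s"
    and swap: "\<And>a b. card (mismatches (subst_block s n [a, b]) (subst_block s n [b, a])) \<le> m"
    and y: "y \<in> integer_lattice" "\<And>i. \<bar>y $ i\<bar> \<le> real Y"
  shows "finite (noncoinc s n a b y)" "card (noncoinc s n a b y) \<le> (3 * (2 * Y + 1))\<^sup>2 * m"
proof -
  have "\<exists>c. y $ i = of_int c" for i using y(1) by (auto simp: integer_lattice_def elim: Ints_cases)
  then obtain yi where yi: "\<And>i. y $ i = of_int (yi i)" by metis
  have yb: "\<bar>yi i\<bar> \<le> int Y" for i using y(2)[of i] unfolding yi by linarith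
  define A1 where "A1 = letter_word (\<lambda>i. Y)"
  define A2 where "A2 = letter_word (\<lambda>i. nat (int Y + yi i))"
  define D1 where "D1 = letter_word (\<lambda>i. Y + 1 - (if i = a then 1 else 0))"
  define D2 where "D2 = letter_word (\<lambda>i. nat (int Y + 1 - yi i - (if i = b then 1 else 0)))"
  define U where "U = A1 @ a # D1"
  define V where "V = A2 @ b # D2"
  have cU: "count_list U i = 2 * Y + 1" for i by (simp add: U_def A1_def D1_def count_letter_word)
  have cV: "count_list V i = 2 * Y + 1" for i
  proof -
    have "nat (int Y + yi i) + nat (int Y + 1 - yi i) = 2 * Y + 1" "nat (int Y + yi i) + Suc (nat (int Y - yi i)) = 2 * Y + 1"
      using yb[of i] by arith+
    then show ?thesis by (simp add: V_def A2_def D2_def count_letter_word)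
  qed
  have UV: "mset U = mset V" by (rule mset_eq_count) (simp add: cU cV)
  have lU: "length U = 3 * (2 * Y + 1)" by (simp add: length_eq_counts cU)
  have A12: "abelian A2 = abelian A1 + y"
  proof -
    have "real (nat (int Y + yi i)) = real Y + of_int (yi i)" for i
      using yb[of i] by (subst of_nat_nat) auto
    then show ?thesis by (simp add: vec_eq_iff abelian_nth A1_def A2_def count_letter_word yi)
  qed
  let ?f = "subst_block s n"
  have inj: "noncoinc s n a b y \<subseteq> (\<lambda>k. k - length (?f A1)) ` mismatches (?f U) (?f V)"
  proof
    fix H assume "H \<in> noncoinc s n a b y"
    then obtain q q' i j where H: "length q = H" and q: "prefix (q @ [i]) (?f [a])" and q': "prefix (q' @ [j]) (?f [b])"
       and h: "real (length q) = coord_sum (block_mat s n y) + real (length q')" and nc: "\<not> (abelian q = block_mat s n y + abelian q' \<and> i = j)"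
      unfolding noncoinc_def by blast
    obtain r where r: "?f [a] = q @ i # r" using q by (auto elim: prefixE)
    obtain r' where r': "?f [b] = q' @ j # r'" using q' by (auto elim: prefixE)
    have fU: "?f U = (?f A1 @ q) @ i # (r @ ?f D1)"
      using subst_block_append[of s n A1 "[a] @ D1"] subst_block_append[of s n "[a]" D1] r by (simp add: U_def del: subst_block_append)
    have fV: "?f V = (?f A2 @ q') @ j # (r' @ ?f D2)"
      using subst_block_append[of s n A2 "[b] @ D2"] subst_block_append[of s n "[b]" D2] r' by (simp add: V_def del: subst_block_append)
    have ab: "abelian (?f A2) = abelian (?f A1) + block_mat s n y"
      by (simp add: abelian_block[OF s] A12 linear_add[OF linear_block_mat])
    have l: "length (?f A2 @ q') = length (?f A1 @ q)"
    proof -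
      have "real (length (?f A2)) = real (length (?f A1)) + coord_sum (block_mat s n y)"
        unfolding coord_sum_abelian[symmetric] ab by simp
      then show ?thesis using h by simp
    qed
    define k where "k = length (?f A1 @ q)"
    have kV: "k = length (?f A2 @ q')" using l by (simp add: k_def)
    have "k \<in> mismatches (?f U) (?f V)"
    proof (rule ccontr)
      assume "k \<notin> mismatches (?f U) (?f V)"
      moreover have "k < length (?f U)" unfolding fU k_def by simp
      ultimately have m: "mset (take k (?f U)) = mset (take k (?f V))" and e: "?f U ! k = ?f V ! k"
        unfolding mismatches_def by blast+
      have tU: "take k (?f U) = ?f A1 @ q" "?f U ! k = i" unfolding fU k_def by (simp_all only: append_eq_conv_conj[THEN iffD1, OF refl] nth_append_length append_eq_conv_conj take_append) simp_all
      have tV: "take k (?f V) = ?f A2 @ q'" "?f V ! k = j" unfolding fV kV by (simp_all only: nth_append_length take_append) simp_all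
      have "mset (?f A1 @ q) = mset (?f A2 @ q')" using m unfolding tU tV .
      then have "count (mset (?f A1 @ q)) x = count (mset (?f A2 @ q')) x" for x by simp
      then have "abelian (?f A1 @ q) = abelian (?f A2 @ q')"
        unfolding vec_eq_iff abelian_nth count_mset by simp
      then have "abelian q = block_mat s n y + abelian q'" by (simp add: ab)
      then show False using nc e tU(2) tV(2) by simp
    qed
    moreover have "H = k - length (?f A1)" using H by (simp add: k_def)
    ultimately show "H \<in> (\<lambda>k. k - length (?f A1)) ` mismatches (?f U) (?f V)" by blast
  qed
  show "finite (noncoinc s n a b y)" by (rule finite_subset[OF inj]) simp
  have "card (noncoinc s n a b y) \<le> card ((\<lambda>k. k - length (?f A1)) ` mismatches (?f U) (?f V))"
    by (rule card_mono[OF _ inj]) simp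
  also have "\<dots> \<le> card (mismatches (?f U) (?f V))" by (rule card_image_le) simp
  also have "\<dots> \<le> (length U)\<^sup>2 * m" by (rule mismatches_permute[OF swap UV])
  finally show "card (noncoinc s n a b y) \<le> (3 * (2 * Y + 1))\<^sup>2 * m" unfolding lU .
qed

lemma finite_lattice_box: "finite {y :: real^3. y \<in> integer_lattice \<and> (\<forall>i. \<bar>y $ i\<bar> \<le> real Y)}"
proof (rule finite_subset)
  let ?I = "{- int Y..int Y}"
  show "{y :: real^3. y \<in> integer_lattice \<and> (\<forall>i. \<bar>y $ i\<bar> \<le> real Y)}
     \<subseteq> (\<lambda>(a, b, c). vector [of_int a, of_int b, of_int c]) ` (?I \<times> ?I \<times> ?I)"
  proof clarify
    fix y :: "real^3" assume y: "y \<in> integer_lattice" "\<forall>i. \<bar>y $ i\<bar> \<le> real Y"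
    have "\<exists>c. y $ i = of_int c" for i using y(1) by (auto simp: integer_lattice_def elim: Ints_cases)
    then obtain c where c: "\<And>i. y $ i = of_int (c i)" by metis
    have "c i \<in> ?I" for i using y(2)[rule_format, of i] unfolding c by (simp add: abs_le_iff)
    moreover have "y = vector [of_int (c 1), of_int (c 2), of_int (c 3)]" by (simp add: vec_eq_iff forall_3 c)
    ultimately show "y \<in> (\<lambda>(a, b, c). vector [of_int a, of_int b, of_int c]) ` (?I \<times> ?I \<times> ?I)"
      by (intro image_eqI[where x="(c 1, c 2, c 3)"]) auto
  qed
qed simp

lemma height_min:
  assumes "AR_dir s" "block_at s k"
  obtains a0 where "\<And>a. height s (k + 3) a0 \<le> height s (k + 3) a" "\<And>a. height s (k + 3) a \<le> 2 * height s (k + 3) a0"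
    "height s (k + 3) a0 > 0"
proof -
  obtain a0 where "\<And>a. height s (k + 3) a0 \<le> height s (k + 3) a"
    using ex_min_if_finite[of "range (height s (k + 3))"] by (auto simp: not_less) 
  then show thesis using that[of a0] height_block_at_ratio[OF assms] height_pos[OF assms(1), of "k + 3" a0] by auto
qed

context
  fixes s :: "subst stream" and u :: "nat \<Rightarrow> real^3"
  assumes g: "good s" and u: "eigseq s u"
begin

text \<open>Split \<open>y\<close> into a plane part, with coordinates at most \<open>2 * K\<close>,
  and a multiple \<open>c\<close> of \<open>u n\<close>. As all word lengths lie between
  \<open>h\<close> and \<open>2 * h\<close>, the bound on the coordinate sum of the image limits
  \<open>c\<close>, with \<open>2 + 8 * K\<close> left after division by \<open>h\<close>.\<close>

lemma lattice_bound:
  assumes h: "\<And>a. real (height s n a) \<ge> h" "\<And>a. real (height s n a) \<le> 2 * h" "h > 0"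
    and p: "\<And>k. \<bar>plane_proj (u n) y $ k\<bar> \<le> K" and y: "\<bar>coord_sum (block_mat s n y)\<bar> \<le> 2 * h"
  shows "\<bar>y $ i\<bar> \<le> 10 * K + 2"
proof -
  have sp: "coord_sum (u n) > 0" by (rule coord_sum_u[OF g u])
  define P where "P = plane_proj (u n) y"
  define c where "c = coord_sum y / coord_sum (u n)"
  have yd: "y = plane_emb P + c *\<^sub>R u n" unfolding P_def c_def by (rule plane_proj_decomp) (use sp in simp)
  have j: "\<bar>plane_emb P $ i\<bar> \<le> 2 * K" for i
    using exhaust_3[of i] p[of 1] p[of 2] by (elim disjE) (simp_all add: P_def[symmetric])
  have "\<bar>coord_sum (block_mat s n (plane_emb P))\<bar> \<le> 8 * K * h"
  proof -
    have t: "\<bar>real (height s n a) * x\<bar> \<le> 2 * h * \<bar>x\<bar>" for a x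
      using mult_right_mono[OF h(2)[of a], of "\<bar>x\<bar>"] by (simp add: abs_mult)
    have "\<bar>plane_emb P $ 1\<bar> + \<bar>plane_emb P $ 2\<bar> + \<bar>plane_emb P $ 3\<bar> \<le> 4 * K"
      using p[of 1] p[of 2] by (simp add: P_def[symmetric])
    then have "2 * h * (\<bar>plane_emb P $ 1\<bar> + \<bar>plane_emb P $ 2\<bar> + \<bar>plane_emb P $ 3\<bar>) \<le> 2 * h * (4 * K)"
      using h(3) by (intro mult_left_mono) auto
    moreover have "\<bar>coord_sum (block_mat s n (plane_emb P))\<bar> \<le> 2 * h * (\<bar>plane_emb P $ 1\<bar> + \<bar>plane_emb P $ 2\<bar> + \<bar>plane_emb P $ 3\<bar>)"
      unfolding coord_sum_block_mat[OF good_AR[OF g]] distrib_left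
      using t[of 1 "plane_emb P $ 1"] t[of 2 "plane_emb P $ 2"] t[of 3 "plane_emb P $ 3"] by linarith
    ultimately show ?thesis by (simp add: mult.commute mult.left_commute)
  qed
  moreover have "coord_sum (block_mat s n y) = coord_sum (block_mat s n (plane_emb P)) + c * coord_sum (block_mat s n (u n))"
    by (subst yd) (simp only: linear_add[OF linear_block_mat] linear_cmul[OF linear_block_mat] coord_sum_simps)
  ultimately have 1: "\<bar>c\<bar> * \<bar>coord_sum (block_mat s n (u n))\<bar> \<le> 2 * h + 8 * K * h"
    using y unfolding abs_mult[symmetric] by linarith
  have "h * u n $ a \<le> real (height s n a) * u n $ a" for a
    using h(1) eigseq_pos[OF u, of n a] by (intro mult_right_mono) auto
  from this[of 1] this[of 2] this[of 3] have "h * coord_sum (u n) \<le> coord_sum (block_mat s n (u n))"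
    unfolding coord_sum_block_mat[OF good_AR[OF g]] by (simp add: coord_sum_def distrib_left)
  then have "\<bar>c\<bar> * (h * coord_sum (u n)) \<le> \<bar>c\<bar> * \<bar>coord_sum (block_mat s n (u n))\<bar>" by (intro mult_left_mono) auto
  then have "h * (\<bar>c\<bar> * coord_sum (u n)) \<le> h * (2 + 8 * K)" using 1 by (simp add: algebra_simps)
  then have c: "\<bar>c\<bar> * coord_sum (u n) \<le> 2 + 8 * K" using h(3) by simp
  have "u n $ i \<le> coord_sum (u n)"
    using exhaust_3[of i] eigseq_pos[OF u, of n 1] eigseq_pos[OF u, of n 2] eigseq_pos[OF u, of n 3]
    by (elim disjE) (simp_all add: coord_sum_def)
  then have "\<bar>c\<bar> * u n $ i \<le> 2 + 8 * K" using c mult_left_mono[of "u n $ i" "coord_sum (u n)" "\<bar>c\<bar>"] by linarith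
  then have "\<bar>c * u n $ i\<bar> \<le> 2 + 8 * K" using eigseq_pos[OF u, of n i] by (simp add: abs_mult)
  moreover have "y $ i = plane_emb P $ i + c * u n $ i" by (subst yd) simp
  ultimately show ?thesis using j[of i] by linarith
qed

text \<open>A common point expresses the difference of the base points of two subtiles as the image
  of an integer vector \<open>y\<close>, whose projection is a difference of two points of
  level-\<open>n\<close> tiles, at most \<open>2 * C\<close> in each coordinate. If vertices and
  edges coincided, then also \<open>z = z'\<close> and \<open>i = j\<close>.\<close>

lemma overlap_noncoinc:
  assumes k: "block_at s k" and n: "n = k + 3" and bn: "contr_summable (sdrop n s) C"
    and z: "z \<in> integer_lattice" "z' \<in> integer_lattice" and ne: "(z, i) \<noteq> (z', j)"
    and q: "prefix (q @ [i]) (subst_block s n [a])" and q': "prefix (q' @ [j]) (subst_block s n [b])"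
    and \<xi>: "\<xi> \<in> tile (sdrop n s) (u n) a" and \<xi>': "\<xi>' \<in> tile (sdrop n s) (u n) b"
    and eq: "z + (plane_proj (u 0) (abelian q) + LL s u n \<xi>) = z' + (plane_proj (u 0) (abelian q') + LL s u n \<xi>')"
  obtains y where "y \<in> integer_lattice" "\<And>i. \<bar>y $ i\<bar> \<le> 20 * C + 2" "length q \<in> noncoinc s n a b y"
proof -
  have s: "AR_dir s" by (rule good_AR[OF g])
  let ?v = "plane_emb z - plane_emb z' + abelian q - abelian q'"
  have "?v \<in> integer_lattice" by (intro integer_lattice_simps plane_emb_int abelian_int z)
  then obtain y where y: "block_mat s n y = ?v" "y \<in> integer_lattice" using block_mat_surj[OF s, of n ?v] by blast
  have "plane_proj (u 0) ?v = z - z' + plane_proj (u 0) (abelian q) - plane_proj (u 0) (abelian q')"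
    by (simp only: linear_diff[OF linear_plane_proj] linear_add[OF linear_plane_proj] plane_proj_plane_emb)
  also have "\<dots> = LL s u n \<xi>' - LL s u n \<xi>" using eq by (simp add: algebra_simps)
  also have "\<dots> = LL s u n (\<xi>' - \<xi>)" by (rule linear_diff[OF linear_LL, symmetric])
  finally have "LL s u n (plane_proj (u n) y) = LL s u n (\<xi>' - \<xi>)" unfolding LL_plane_proj[OF g u] y(1) .
  then have py: "plane_proj (u n) y = \<xi>' - \<xi>" using inj_LL[OF g u] by (simp add: inj_eq)
  obtain a0 where a0: "\<And>a. height s n a0 \<le> height s n a" "\<And>a. height s n a \<le> 2 * height s n a0" "height s n a0 > 0"
    unfolding n using height_min[OF s k] by blast
  have smv: "coord_sum (block_mat s n y) = real (length q) - real (length q')" unfolding y(1) by (simp add: coord_sum_abelian)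
  have lq: "length q \<le> height s n a" "length q' \<le> height s n b"
    using prefix_length_le[OF q] prefix_length_le[OF q'] by (simp_all add: height_def)
  have "\<bar>y $ i\<bar> \<le> 10 * (2 * C) + 2" for i
  proof (rule lattice_bound[where n=n and h="real (height s n a0)"])
    show "real (height s n a) \<ge> real (height s n a0)" for a using a0(1) by simp
    show "real (height s n a) \<le> 2 * real (height s n a0)" for a using a0(2)[of a] by linarith
    show "real (height s n a0) > 0" using a0(3) by simp
    show "\<bar>plane_proj (u n) y $ k\<bar> \<le> 2 * C" for k
      unfolding py using tile_bound[OF g u bn \<xi>, of k] tile_bound[OF g u bn \<xi>', of k] by simp
    show "\<bar>coord_sum (block_mat s n y)\<bar> \<le> 2 * real (height s n a0)"
      unfolding smv using lq a0(2)[of a] a0(2)[of b] by (simp add: abs_le_iff)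
  qed
  moreover have "length q \<in> noncoinc s n a b y"
  proof -
    have "\<not> (abelian q = block_mat s n y + abelian q' \<and> i = j)"
    proof
      assume A: "abelian q = block_mat s n y + abelian q' \<and> i = j"
      then have "plane_emb z = plane_emb z'" unfolding y(1) by simp
      then have "plane_proj (u 0) (plane_emb z) = plane_proj (u 0) (plane_emb z')" by simp
      then show False using A ne by simp
    qed
    moreover have "real (length q) = coord_sum (block_mat s n y) + real (length q')" unfolding smv by simp
    ultimately show ?thesis unfolding noncoinc_def using q q' by blast
  qed
  ultimately show thesis using that[OF y(2)] by simp
qed

text \<open>At most \<open>A * m\<close> subtiles meet the overlap, with \<open>m\<close> at most
  \<open>4 * \<epsilon> * h\<close>, and each has area at most \<open>4 * C\<^sup>2 / h\<close>. The
  length \<open>h\<close> cancels, so \<open>\<epsilon>\<close> can be fixed before the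
  level.\<close>

lemma overlap_negligible:
  assumes z: "z \<in> integer_lattice" "z' \<in> integer_lattice" and ne: "(z, i) \<noteq> (z', j)"
  shows "negligible ((+) z ` tile s (u 0) i \<inter> (+) z' ` tile s (u 0) j)"
  unfolding negligible_outer_le
proof (intro allI impI)
  fix e :: real assume e: "e > 0"
  have s: "AR_dir s" by (rule good_AR[OF g])
  obtain C where C: "\<And>m. \<exists>k\<ge>m. block_at s k \<and> contr_summable (sdrop (k + 3) s) C" "C \<ge> 0" using good_level[OF g u] by blast
  define Y where "Y = nat \<lceil>20 * C + 2\<rceil>"
  define F where "F = {y :: real^3. y \<in> integer_lattice \<and> (\<forall>i. \<bar>y $ i\<bar> \<le> real Y)}"
  have F: "finite F" unfolding F_def by (rule finite_lattice_box)
  \<comment> \<open>The factor 9 counts the pairs of letters \<open>a\<close>, \<open>b\<close>; the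
    square comes from \<open>card_noncoinc\<close>.\<close>
  define A where "A = 9 * card F * (3 * (2 * Y + 1))\<^sup>2"
  define \<epsilon> where "\<epsilon> = e / (16 * real A * C\<^sup>2 + 1)"
  have \<epsilon>: "\<epsilon> > 0" using e by (simp add: \<epsilon>_def add_nonneg_pos)
  obtain n0 where n0: "\<And>n a b. n \<ge> n0 \<Longrightarrow> real (card (mismatches (subst_block s n [a, b]) (subst_block s n [b, a])))
     \<le> \<epsilon> * (real (height s n a) + real (height s n b))"
    using swap_decay[OF s good_blocks_recur[OF g] \<epsilon>] by blast
  obtain k where k: "k \<ge> n0" "block_at s k" "contr_summable (sdrop (k + 3) s) C" using C(1) by blast
  define n where "n = k + 3"
  have bn: "contr_summable (sdrop n s) C" unfolding n_def by (rule k(3))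
  obtain a0 where a0: "\<And>a. height s n a0 \<le> height s n a" "\<And>a. height s n a \<le> 2 * height s n a0" "height s n a0 > 0"
    unfolding n_def using height_min[OF s k(2)] by blast
  define h where "h = real (height s n a0)"
  have h: "h > 0" "\<And>a. h \<le> real (height s n a)" "\<And>a. real (height s n a) \<le> 2 * h"
    using a0(3) a0(1) of_nat_mono[OF a0(2)] by (auto simp: h_def)
  \<comment> \<open>Two words of this level together have length at most
    \<open>4 * h\<close>.\<close>
  define m where "m = nat \<lfloor>4 * \<epsilon> * h\<rfloor>"
  have mr: "real m \<le> 4 * \<epsilon> * h" using \<epsilon> h by (simp add: m_def)
  have swap: "card (mismatches (subst_block s n [a, b]) (subst_block s n [b, a])) \<le> m" for a b
  proof -
    have "real (card (mismatches (subst_block s n [a, b]) (subst_block s n [b, a]))) \<le> \<epsilon> * (real (height s n a) + real (height s n b))"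
      by (rule n0) (use k(1) in \<open>simp add: n_def\<close>)
    also have "\<dots> \<le> \<epsilon> * (4 * h)" using h(3)[of a] h(3)[of b] \<epsilon> by (intro mult_left_mono) auto
    finally show ?thesis unfolding m_def by (simp add: le_nat_floor mult.commute mult.left_commute)
  qed
  define NH where "NH a = (\<Union>b. \<Union>y\<in>F. noncoinc s n a b y)" for a
  define Bad where "Bad = (SIGMA a:UNIV. {q. prefix (q @ [i]) (subst_block s n [a]) \<and> length q \<in> NH a})"
  have fNH: "finite (NH a)" for a
    unfolding NH_def by (intro finite_UN_I F finite card_noncoinc(1)[OF s swap]) (auto simp: F_def)
  have cNH: "card (NH a) \<le> 3 * card F * ((3 * (2 * Y + 1))\<^sup>2 * m)" for a
  proof -
    have c1: "card (\<Union>y\<in>F. noncoinc s n a b y) \<le> card F * ((3 * (2 * Y + 1))\<^sup>2 * m)" for b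
    proof -
      have "card (\<Union>y\<in>F. noncoinc s n a b y) \<le> (\<Sum>y\<in>F. card (noncoinc s n a b y))" by (rule card_UN_le[OF F])
      also have "\<dots> \<le> (\<Sum>y\<in>F. (3 * (2 * Y + 1))\<^sup>2 * m)"
        by (intro sum_mono card_noncoinc(2)[OF s swap]) (auto simp: F_def)
      finally show ?thesis by simp
    qed
    have "card (NH a) \<le> (\<Sum>b\<in>(UNIV::letter set). card (\<Union>y\<in>F. noncoinc s n a b y))"
      unfolding NH_def by (rule card_UN_le) simp
    also have "\<dots> \<le> (\<Sum>b\<in>(UNIV::letter set). card F * ((3 * (2 * Y + 1))\<^sup>2 * m))" by (intro sum_mono c1)
    finally show ?thesis by simp
  qed
  have fB: "finite Bad" unfolding Bad_def
    by (intro finite_SigmaI finite) (rule finite_subset[OF _ finite_prefixes[of i]], auto)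
  have cB: "card Bad \<le> A * m"
  proof -
    have "card Bad = (\<Sum>a\<in>(UNIV::letter set). card {q. prefix (q @ [i]) (subst_block s n [a]) \<and> length q \<in> NH a})"
      unfolding Bad_def by (rule card_SigmaI) (auto intro: finite_subset[OF _ finite_prefixes[of i]])
    also have "\<dots> \<le> (\<Sum>a\<in>(UNIV::letter set). 3 * card F * ((3 * (2 * Y + 1))\<^sup>2 * m))"
    proof (rule sum_mono)
      fix a
      have "inj_on length {q. prefix (q @ [i]) (subst_block s n [a]) \<and> length q \<in> NH a}"
        by (rule inj_onI) (auto elim!: prefixE)
      then have "card {q. prefix (q @ [i]) (subst_block s n [a]) \<and> length q \<in> NH a} \<le> card (NH a)"
        by (rule card_inj_on_le) (auto intro: fNH)
      then show "card {q. prefix (q @ [i]) (subst_block s n [a]) \<and> length q \<in> NH a} \<le> 3 * card F * ((3 * (2 * Y + 1))\<^sup>2 * m)"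
        using cNH[of a] by (rule order.trans)
    qed
    also have "\<dots> = A * m" by (simp add: A_def)
    finally show ?thesis .
  qed
  define Q where "Q = cbox (vector [- C, - C]) (vector [C, C] :: real^2)"
  have mQ: "Q \<in> lmeasurable" "measure lebesgue Q = 4 * C\<^sup>2"
  proof -
    show "Q \<in> lmeasurable" unfolding Q_def by (rule lmeasurable_cbox)
    have "vector [- C, - C] \<in> Q" using C(2) by (simp add: Q_def mem_box_cart forall_2)
    then have "cbox (vector [- C, - C]) (vector [C, C] :: real^2) \<noteq> {}" unfolding Q_def by blast
    then show "measure lebesgue Q = 4 * C\<^sup>2"
      unfolding Q_def measure_completion[OF sets_lborel[THEN equalityD2, THEN subsetD, OF borel_closed[OF closed_cbox]], simplified]
      by (simp add: content_cbox_if_cart UNIV_2 power2_eq_square)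
  qed
  let ?P = "\<lambda>(a :: letter, q). (+) (z + plane_proj (u 0) (abelian q)) ` LL s u n ` Q"
  have mP: "?P p \<in> lmeasurable" "measure lebesgue (?P p) \<le> 4 * C\<^sup>2 / h" for p
  proof -
    obtain a q where p: "p = (a, q)" by (cases p)
    show "?P p \<in> lmeasurable" unfolding p prod.case
      by (intro measurable_translation measurable_linear_image linear_LL mQ)
    \<comment> \<open>The matrix maps \<open>u n\<close> to \<open>u 0\<close>, and its column sums,
      the word lengths, are at least \<open>h\<close>; so the area factor of \<open>LL\<close> is at
      most \<open>1 / h\<close>.\<close>
    have hs: "h * coord_sum (u n) \<le> coord_sum (u 0)"
    proof -
      have "h * u n $ a \<le> real (height s n a) * u n $ a" for a
        using h(2) eigseq_pos[OF u, of n a] by (intro mult_right_mono) auto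
      from this[of 1] this[of 2] this[of 3] have "h * coord_sum (u n) \<le> coord_sum (block_mat s n (u n))"
        unfolding coord_sum_block_mat[OF s] by (simp add: coord_sum_def distrib_left)
      then show ?thesis by (simp add: eigseq_block_mat[OF s u])
    qed
    have "measure lebesgue (?P p) = \<bar>det (matrix (LL s u n))\<bar> * (4 * C\<^sup>2)"
      unfolding p prod.case measure_translation by (simp add: measure_linear_image[OF linear_LL mQ(1)] mQ(2))
    also have "\<dots> = coord_sum (u n) / coord_sum (u 0) * (4 * C\<^sup>2)"
      using coord_sum_u[OF g u, of n] coord_sum_u[OF g u, of 0] by (simp add: det_LL[OF g u])
    also have "\<dots> \<le> 1 / h * (4 * C\<^sup>2)"
    proof (rule mult_right_mono)
      show "coord_sum (u n) / coord_sum (u 0) \<le> 1 / h"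
        using hs h(1) coord_sum_u[OF g u, of 0] by (simp add: field_simps)
    qed simp
    finally show "measure lebesgue (?P p) \<le> 4 * C\<^sup>2 / h" by simp
  qed
  let ?T = "\<Union>p\<in>Bad. ?P p"
  have "measure lebesgue ?T \<le> (\<Sum>p\<in>Bad. measure lebesgue (?P p))"
    by (rule measure_UNION_le[OF fB]) (use mP(1) in \<open>auto dest: fmeasurableD\<close>)
  also have "\<dots> \<le> (\<Sum>p\<in>Bad. 4 * C\<^sup>2 / h)" by (intro sum_mono mP(2))
  also have "\<dots> = real (card Bad) * (4 * C\<^sup>2 / h)" by simp
  also have "\<dots> \<le> (real A * (4 * \<epsilon> * h)) * (4 * C\<^sup>2 / h)"
  proof (rule mult_right_mono)
    have "real (card Bad) \<le> real A * real m" using of_nat_mono[OF cB, where 'a=real] by simp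
    also have "\<dots> \<le> real A * (4 * \<epsilon> * h)" using mr by (intro mult_left_mono) auto
    finally show "real (card Bad) \<le> real A * (4 * \<epsilon> * h)" .
  qed (use h in simp)
  also have "\<dots> = 16 * real A * C\<^sup>2 * \<epsilon>" using h(1) by simp
  also have "\<dots> \<le> (16 * real A * C\<^sup>2 + 1) * \<epsilon>" using \<epsilon> by (simp add: distrib_right)
  also have "\<dots> = e" unfolding \<epsilon>_def by (simp add: add_nonneg_eq_0_iff)
  finally have me: "measure lebesgue ?T \<le> e" .
  have sub: "(+) z ` tile s (u 0) i \<inter> (+) z' ` tile s (u 0) j \<subseteq> ?T"
  proof
    fix x assume x: "x \<in> (+) z ` tile s (u 0) i \<inter> (+) z' ` tile s (u 0) j"
    obtain a q \<xi> where q: "prefix (q @ [i]) (subst_block s n [a])" and \<xi>: "\<xi> \<in> tile (sdrop n s) (u n) a"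
        and xe: "x = z + (plane_proj (u 0) (abelian q) + LL s u n \<xi>)"
      using x unfolding tile_decomp[OF g u, of i n] by auto
    obtain b q' \<xi>' where q': "prefix (q' @ [j]) (subst_block s n [b])" and \<xi>': "\<xi>' \<in> tile (sdrop n s) (u n) b"
        and xe': "x = z' + (plane_proj (u 0) (abelian q') + LL s u n \<xi>')"
      using x unfolding tile_decomp[OF g u, of j n] by auto
    obtain y where y: "y \<in> integer_lattice" "\<And>i. \<bar>y $ i\<bar> \<le> 20 * C + 2" "length q \<in> noncoinc s n a b y"
      using overlap_noncoinc[OF k(2) n_def bn z ne q q' \<xi> \<xi>' trans[OF xe[symmetric] xe']] by blast
    have "\<bar>y $ i\<bar> \<le> real Y" for i
      using y(2)[of i] unfolding Y_def by linarith
    then have "y \<in> F" using y(1) by (simp add: F_def)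
    then have "length q \<in> NH a" using y(3) unfolding NH_def by blast
    then have B: "(a, q) \<in> Bad" using q by (simp add: Bad_def)
    have "\<xi> \<in> Q" using tile_bound[OF g u bn \<xi>, of 1] tile_bound[OF g u bn \<xi>, of 2]
      by (simp add: Q_def mem_box_cart forall_2 abs_le_iff) 
    then have "x \<in> ?P (a, q)" unfolding xe by (auto simp: add.assoc)
    then show "x \<in> ?T" using B by (rule UN_I[rotated])
  qed
  have "?T \<in> lmeasurable" by (rule fmeasurable.finite_UN[OF fB]) (rule mP(1))
  then show "\<exists>T. (+) z ` tile s (u 0) i \<inter> (+) z' ` tile s (u 0) j \<subseteq> T \<and> T \<in> lmeasurable \<and> measure lebesgue T \<le> e"
    using sub me by blast
qed

end

section \<open>Codings of orbits\<close>

text \<open>The vectors by which the tiles are exchanged. They agree modulo the lattice by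
  \<open>tau_diff\<close>, so the exchange induces one torus translation, by
  \<open>tau v 1\<close>.\<close>

definition tau :: "real^3 \<Rightarrow> letter \<Rightarrow> real^2" where
  "tau v i = plane_proj v (axis i 1)"

lemma coord_sum_axis [simp]: "coord_sum (axis i 1) = 1"
  using exhaust_3[of i] by (elim disjE) (simp_all add: coord_sum_def axis_def)

lemma tau_diff: "tau v i - tau v j \<in> integer_lattice"
proof -
  have "axis i 1 - axis j 1 \<in> (integer_lattice :: (real^3) set)" by (simp add: integer_lattice_def axis_def)
  then show ?thesis unfolding tau_def linear_diff[OF linear_plane_proj, symmetric]
    by (simp add: integer_lattice_def forall_2)
qed

lemma plane_proj_sum_tau: "plane_proj v (abelian w) = (\<Sum>k<length w. tau v (w ! k))"
proof (induction w rule: rev_induct)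
  case Nil
  show ?case using linear_0[OF linear_plane_proj] by simp
next
  case (snoc a w)
  then show ?case by (simp add: linear_add[OF linear_plane_proj] abelian_single tau_def nth_append)
qed

lemma pre_Suc:
  assumes s: "AR_dir s" and i: "blocks_recur s" and p: "p \<in> pre s i"
  obtains j where "p @ [i] \<in> pre s j"
proof -
  obtain a m where m: "prefix (p @ [i]) (subst_block s m [a])" using p by (auto simp: pre_def)
  obtain n where n: "\<And>a. length p + 2 \<le> height s n a" using height_unbounded[OF s i, of "length p + 2"] by blast
  have 1: "prefix (p @ [i]) (subst_block s (m + n) [a])"
    using m subst_block_mono_prefix[OF s] prefix_order.order_trans by blast
  have "length p + 2 \<le> length (subst_block s (m + n) [a])"
    using n[of a] height_mono[OF s, of n a m] by (simp add: height_def add.commute)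
  moreover obtain w where w: "subst_block s (m + n) [a] = (p @ [i]) @ w" using 1 by (elim prefixE)
  ultimately obtain j w' where "w = j # w'" by (cases w) auto
  then have "prefix ((p @ [i]) @ [j]) (subst_block s (m + n) [a])" unfolding w by simp
  then have "p @ [i] \<in> pre s j" unfolding pre_def by blast
  then show thesis by (rule that)
qed

lemma pre_ext_word:
  assumes s: "AR_dir s" and i: "blocks_recur s" and p: "p \<in> pre s i"
  shows "\<exists>v. length v = n \<and> (\<forall>m<n. p @ take m v \<in> pre s (v ! m)) \<and> (\<exists>a m. sublist v (subst_block s m [a]))"
proof -
  obtain a m where m: "prefix (p @ [i]) (subst_block s m [a])" using p by (auto simp: pre_def)
  obtain n' where n: "\<And>a. length p + n \<le> height s n' a" using height_unbounded[OF s i, of "length p + n"] by blast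
  have 1: "prefix (p @ [i]) (subst_block s (m + n') [a])"
    using m subst_block_mono_prefix[OF s] prefix_order.order_trans by blast
  have l: "length p + n \<le> length (subst_block s (m + n') [a])"
    using n[of a] height_mono[OF s, of n' a m] by (simp add: height_def add.commute)
  obtain w where w: "subst_block s (m + n') [a] = p @ w" using 1 by (auto elim: prefixE)
  define v where "v = take n w"
  have lv: "length v = n" using l w by (simp add: v_def)
  have "p @ take k v \<in> pre s (v ! k)" if "k < n" for k
  proof -
    have "k < length w" using that l w by simp
    then have "prefix ((p @ take k v) @ [v ! k]) (p @ w)"
      using that by (simp add: v_def min_def) (metis take_Suc_conv_app_nth take_is_prefix)
    then show ?thesis unfolding pre_def w[symmetric] by blast
  qed
  moreover have "sublist v (subst_block s (m + n') [a])"
    unfolding w v_def by (metis append_take_drop_id sublist_appendI append_assoc)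
  ultimately show ?thesis using lv by blast
qed

section \<open>Orbits of the exchange and their codings\<close>

definition periodic :: "(real^2) set \<Rightarrow> bool" where
  "periodic A \<longleftrightarrow> (\<forall>x z. x \<in> A \<longrightarrow> z \<in> integer_lattice \<longrightarrow> x + z \<in> A)"

lemma periodicD: "periodic A \<Longrightarrow> z \<in> integer_lattice \<Longrightarrow> x + z \<in> A \<longleftrightarrow> x \<in> A"
proof
  assume A: "periodic A" "z \<in> integer_lattice"
  show "x + z \<in> A" if "x \<in> A" using A that unfolding periodic_def by blast
  assume "x + z \<in> A"
  then have "(x + z) + - z \<in> A" using A integer_lattice_simps(3)[OF A(2)] unfolding periodic_def by blast
  then show "x \<in> A" by simp
qed

definition overlap_set :: "subst stream \<Rightarrow> real^3 \<Rightarrow> (real^2) set" where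
  "overlap_set s v = (\<Union>(z, i)\<in>integer_lattice \<times> UNIV. \<Union>(z', j)\<in>integer_lattice \<times> UNIV.
     if (z, i) = (z', j) then {} else (+) z ` tile s v i \<inter> (+) z' ` tile s v j)"

lemma overlap_set_iff: "x \<in> overlap_set s v \<longleftrightarrow> (\<exists>z z' i j. z \<in> integer_lattice \<and> z' \<in> integer_lattice \<and> (z, i) \<noteq> (z', j) \<and>
    x - z \<in> tile s v i \<and> x - z' \<in> tile s v j)"
proof -
  have "x \<in> (+) z ` A \<longleftrightarrow> x - z \<in> A" for z and A :: "(real^2) set"
    by (auto simp: image_iff intro!: bexI[of _ "x - z"])
  then show ?thesis unfolding overlap_set_def by (auto split: if_splits)
qed

lemma periodic_overlap_set: "periodic (overlap_set s v)"
  unfolding periodic_def overlap_set_iff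
proof (intro allI impI, elim exE conjE)
  fix x y z z' :: "real^2" and i j
  assume *: "y \<in> integer_lattice" "z \<in> integer_lattice" "z' \<in> integer_lattice" "(z, i) \<noteq> (z', j)"
    "x - z \<in> tile s v i" "x - z' \<in> tile s v j"
  show "\<exists>z z' i j. z \<in> integer_lattice \<and> z' \<in> integer_lattice \<and> (z, i) \<noteq> (z', j) \<and>
    x + y - z \<in> tile s v i \<and> x + y - z' \<in> tile s v j"
    by (rule exI[of _ "z + y"], rule exI[of _ "z' + y"], rule exI[of _ i], rule exI[of _ j])
      (use * in \<open>simp add: integer_lattice_simps\<close>)
qed

context
  fixes s :: "subst stream" and u :: "nat \<Rightarrow> real^3"
  assumes g: "good s" and u: "eigseq s u"
begin

private abbreviation (input) r :: "letter \<Rightarrow> (real^2) set" where "r \<equiv> tile s (u 0)"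
private abbreviation (input) \<tau> :: "letter \<Rightarrow> real^2" where "\<tau> \<equiv> tau (u 0)"
private abbreviation (input) tt :: "real^2" where "tt \<equiv> tau (u 0) 1"
private abbreviation (input) bad :: "(real^2) set" where "bad \<equiv> overlap_set s (u 0)"
private abbreviation (input) RRs :: "(real^2) set" where "RRs \<equiv> RR s u"

lemma RR_iff: "x \<in> RRs \<longleftrightarrow> (\<exists>i. x \<in> r i)"
  by (auto simp: RR_def[OF g u])

lemma closed_r: "closed (r i)"
  by (simp add: tile_def)

lemma bad_borel: "bad \<in> sets borel"
proof -
  have "(+) z ` r i \<inter> (+) z' ` r j \<in> sets borel" for z z' i j
    by (intro sets.Int borel_closed closed_translation closed_r)
  then show ?thesis unfolding overlap_set_def case_prod_unfold
    by (intro sets.countable_UN'' countable_SIGMA countable_integer_lattice) auto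
qed

lemma bad_negligible: "negligible bad"
proof -
  have *: "negligible (if (z, i) = (z', j) then {} else (+) z ` r i \<inter> (+) z' ` r j)"
    if "z \<in> integer_lattice" "z' \<in> integer_lattice" for z z' i j
    using overlap_negligible[OF g u that] by auto
  have cI: "countable ((integer_lattice :: (real^2) set) \<times> (UNIV :: letter set))"
    by (intro countable_SIGMA countable_integer_lattice) auto
  have UN: "negligible (\<Union>p\<in>integer_lattice \<times> (UNIV :: letter set). A p)"
    if "\<And>p. p \<in> integer_lattice \<times> UNIV \<Longrightarrow> negligible (A p)" for A :: "(real^2) \<times> letter \<Rightarrow> (real^2) set"
    by (rule negligible_countable_Union) (use that cI in auto)
  show ?thesis unfolding overlap_set_def
  proof (intro UN, clarify, intro UN, clarify)
    fix z z' i j assume "z \<in> (integer_lattice :: (real^2) set)" "z' \<in> (integer_lattice :: (real^2) set)"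
    then show "negligible (if (z, i) = (z', j) then {} else (+) z ` r i \<inter> (+) z' ` r j)" by (rule *)
  qed
qed

lemma bad_null: "emeasure lborel bad = 0"
  using bad_negligible bad_borel negligible_iff_null_sets[of bad] by (simp add: null_sets_completion_iff null_sets_def)

lemma AE_not_bad: "AE x in lborel. x + c \<notin> bad"
proof -
  have "AE x in lborel. x \<notin> bad" by (rule AE_not_in) (simp add: null_sets_def bad_null bad_borel)
  then have "AE x in distr lborel borel ((+) c). x \<notin> bad" by (simp only: lborel_distr_plus)
  then have "AE x in lborel. c + x \<notin> bad" by (rule AE_distrD[rotated]) simp
  then show ?thesis by (simp add: add.commute)
qed

lemma bad_periodic: "z \<in> integer_lattice \<Longrightarrow> x + z \<in> bad \<longleftrightarrow> x \<in> bad"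
  by (rule periodicD[OF periodic_overlap_set])

lemma not_bad_unique:
  assumes "x \<notin> bad" "z \<in> integer_lattice" "z' \<in> integer_lattice" "x + z \<in> r i" "x + z' \<in> r j"
  shows "z = z' \<and> i = j"
proof (rule ccontr)
  assume n: "\<not> ?thesis"
  have "x \<in> bad" unfolding overlap_set_iff
    by (rule exI[of _ "- z"], rule exI[of _ "- z'"], rule exI[of _ i], rule exI[of _ j])
       (use assms n in \<open>auto simp: integer_lattice_simps\<close>)
  then show False using assms(1) by blast
qed

lemma not_bad_unique_letter: "x \<notin> bad \<Longrightarrow> x \<in> r i \<Longrightarrow> x \<in> r j \<Longrightarrow> i = j"
  using not_bad_unique[of x 0 0 i j] by (simp add: integer_lattice_simps)

lemma not_bad_unique_shift: "x \<notin> bad \<Longrightarrow> z \<in> integer_lattice \<Longrightarrow> x \<in> RRs \<Longrightarrow> x + z \<in> RRs \<Longrightarrow> z = 0"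
  using not_bad_unique[of x 0 z] by (auto simp: RR_iff integer_lattice_simps)

text \<open>For projected prefixes this is extension by the next letter, and the condition is
  closed.\<close>

lemma r_tau: assumes "x \<in> r i" shows "x + \<tau> i \<in> RRs"
proof -
  have sub: "(\<lambda>p. plane_proj (u 0) (abelian p)) ` pre s i \<subseteq> {x. x + \<tau> i \<in> RRs}"
  proof clarify
    fix p assume "p \<in> pre s i"
    then obtain j where j: "p @ [i] \<in> pre s j" using pre_Suc[OF good_AR[OF g] good_blocks_recur[OF g]] by blast
    have "plane_proj (u 0) (abelian p) + \<tau> i = plane_proj (u 0) (abelian (p @ [i]))"
      by (simp add: linear_add[OF linear_plane_proj] abelian_single tau_def)
    also have "\<dots> \<in> r j" unfolding tile_def by (rule subsetD[OF closure_subset], rule imageI, rule j)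
    finally show "plane_proj (u 0) (abelian p) + \<tau> i \<in> RRs" unfolding RR_iff by blast
  qed
  have "closed {x. x + \<tau> i \<in> RRs}"
    using closed_vimage[of RRs "\<lambda>x. x + \<tau> i"] compact_imp_closed[OF compact_RR[OF g u]]
    by (simp add: vimage_def continuous_on_add)
  then have "r i \<subseteq> {x. x + \<tau> i \<in> RRs}" unfolding tile_def by (rule closure_minimal[OF sub])
  then show ?thesis using assms by blast
qed

text \<open>Truncating a coding makes it a closed condition on the point that depends on finitely
  many letters; this serves compactness and measurability alike.\<close>

definition codes_upto :: "nat \<Rightarrow> real^2 \<Rightarrow> (nat \<Rightarrow> letter) \<Rightarrow> bool" where
  "codes_upto n x w \<longleftrightarrow> (\<forall>m<n. x + (\<Sum>k<m. tau (u 0) (w k)) \<in> tile s (u 0) (w m))"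

lemma is_coding_codes_upto: "is_coding r \<tau> x w \<longleftrightarrow> (\<forall>n. codes_upto n x ((!!) w))"
  unfolding is_coding_def codes_upto_def by blast

lemma closed_codes_upto: "closed {x. codes_upto n x w}"
proof -
  have e: "{x. codes_upto n x w} = (\<Inter>m\<in>{..<n}. (\<lambda>x. x + (\<Sum>k<m. \<tau> (w k))) -` r (w m))" by (auto simp: codes_upto_def)
  show ?thesis unfolding e by (intro closed_INT ballI closed_vimage closed_r continuous_intros)
qed

lemma codes_upto_cong: "(\<And>m. m < n \<Longrightarrow> w m = w' m) \<Longrightarrow> codes_upto n x w \<longleftrightarrow> codes_upto n x w'"
  unfolding codes_upto_def by (intro all_cong arg_cong2[where f="(\<in>)"] arg_cong2[where f=plus] refl sum.cong arg_cong[where f=r]) auto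

lemma codes_upto_mono: "m \<le> n \<Longrightarrow> codes_upto n x w \<Longrightarrow> codes_upto m x w"
  by (auto simp: codes_upto_def)

lemma pre_codes_upto:
  assumes "\<forall>m<n. p @ take m v \<in> pre s (v ! m)" "length v = n"
  shows "codes_upto n (plane_proj (u 0) (abelian p)) ((!) v)"
  unfolding codes_upto_def
proof (intro allI impI)
  fix m assume m: "m < n"
  have "plane_proj (u 0) (abelian p) + (\<Sum>k<m. \<tau> (v ! k)) = plane_proj (u 0) (abelian (p @ take m v))"
    using m assms(2) by (simp add: linear_add[OF linear_plane_proj] plane_proj_sum_tau)
  also have "\<dots> \<in> r (v ! m)" unfolding tile_def
    by (rule subsetD[OF closure_subset], rule imageI) (use assms m in blast)
  finally show "plane_proj (u 0) (abelian p) + (\<Sum>k<m. \<tau> (v ! k)) \<in> r (v ! m)" .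
qed

lemma codes_upto_RR: "0 < n \<Longrightarrow> codes_upto n x w \<Longrightarrow> x \<in> RRs"
  unfolding RR_iff codes_upto_def by fastforce

private abbreviation (input) X :: "letter stream set" where "X \<equiv> sadic_shift s"

text \<open>An initial part of \<open>w\<close> occurs in some \<open>subst_block s m [i]\<close>
  behind a prefix \<open>A\<close>; the projection of \<open>A\<close> is coded by it.\<close>

lemma X_approx:
  assumes w: "w \<in> X"
  shows "\<exists>x. codes_upto n x ((!!) w)"
proof -
  obtain i m where "sublist (stake n (sdrop 0 w)) (subst_block s m [i])" using w unfolding sadic_shift_def by blast
  then obtain A B where AB: "subst_block s m [i] = A @ stake n w @ B" unfolding sublist_def by auto
  have "\<forall>k<n. A @ take k (stake n w) \<in> pre s (stake n w ! k)"
  proof (intro allI impI)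
    fix k assume k: "k < n"
    have "stake n w = take k (stake n w) @ stake n w ! k # drop (Suc k) (stake n w)"
      using k by (intro id_take_nth_drop) simp
    then have "subst_block s m [i] = ((A @ take k (stake n w)) @ [stake n w ! k]) @ (drop (Suc k) (stake n w) @ B)"
      unfolding AB by simp
    then have "prefix ((A @ take k (stake n w)) @ [stake n w ! k]) (subst_block s m [i])" by (metis prefixI)
    then show "A @ take k (stake n w) \<in> pre s (stake n w ! k)" unfolding pre_def by blast
  qed
  then have "codes_upto n (plane_proj (u 0) (abelian A)) ((!) (stake n w))" by (rule pre_codes_upto) simp
  then have "codes_upto n (plane_proj (u 0) (abelian A)) ((!!) w)" by (rule codes_upto_cong[THEN iffD1, rotated]) simp
  then show ?thesis by blast
qed

text \<open>Nested compact sets. The closed set \<open>K\<close> is a parameter because the lemma is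
  used with the whole plane for existence of a coded point and with an arbitrary closed set for
  measurability of \<open>point_of\<close>.\<close>

lemma codes_upto_compact:
  assumes K: "closed K" and ex: "\<And>n. \<exists>x\<in>K. codes_upto n x w"
  shows "\<exists>x\<in>K. \<forall>n. codes_upto n x w"
proof -
  let ?F = "\<lambda>n. {x. codes_upto (Suc n) x w} \<inter> K"
  have "(\<Inter>n. ?F n) \<noteq> {}"
  proof (rule compact_nest)
    fix n
    have sub: "?F n \<subseteq> RRs" using codes_upto_RR[of "Suc n"] by blast
    have "?F n = RRs \<inter> ?F n" using sub by blast
    then show "compact (?F n)"
      using compact_Int_closed[OF compact_RR[OF g u] closed_Int[OF closed_codes_upto K], of "Suc n" w] by simp
    show "?F n \<noteq> {}" using ex by blast
    fix m assume "m \<le> n"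
    then show "?F n \<subseteq> ?F m" using codes_upto_mono[of "Suc m" "Suc n"] by auto
  qed
  then obtain x where x: "x \<in> K" "\<And>n. codes_upto (Suc n) x w" by blast
  have "codes_upto n x w" for n by (rule codes_upto_mono[OF _ x(2)[of n]]) simp
  then show ?thesis using x by blast
qed

lemma X_coded: assumes "w \<in> X" obtains x where "x \<in> RRs" "is_coding r \<tau> x w"
proof -
  have "\<exists>x\<in>UNIV. \<forall>n. codes_upto n x ((!!) w)"
    by (rule codes_upto_compact) (use X_approx[OF assms] in auto)
  then obtain x where "\<And>n. codes_upto n x ((!!) w)" by blast
  then show thesis using that[of x] codes_upto_RR[of 1 x "(!!) w"] unfolding is_coding_codes_upto by simp
qed

lemma tau_sum: "(\<Sum>k<n. \<tau> (w k)) - real n *\<^sub>R tt \<in> integer_lattice"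
proof (induction n)
  case (Suc n)
  have e: "(\<Sum>k<Suc n. \<tau> (w k)) - real (Suc n) *\<^sub>R tt = ((\<Sum>k<n. \<tau> (w k)) - real n *\<^sub>R tt) + (\<tau> (w n) - tt)"
    by (simp add: algebra_simps)
  show ?case unfolding e by (rule integer_lattice_simps(1)[OF Suc.IH tau_diff])
qed (simp add: integer_lattice_simps)

text \<open>Minimality of the torus translation: modulo the lattice, a projected integer vector
  depends only on its coordinate sum \<open>n\<close> and equals \<open>n\<close> times the
  projection of the first unit vector.\<close>

lemma translates_dense:
  assumes "\<delta> > 0"
  shows "\<exists>n. \<exists>z\<in>integer_lattice. dist (real n *\<^sub>R tt + z) x < \<delta>"
proof -
  obtain y where y: "y \<in> integer_lattice" "\<forall>i. y $ i \<ge> 0" "dist (plane_proj (u 0) y) x < \<delta>"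
    using nonneg_dense[OF g u assms] by blast
  define n where "n = nat \<lfloor>coord_sum y\<rfloor>"
  have sn: "coord_sum y = real n"
  proof -
    have "coord_sum y \<in> \<int>" "coord_sum y \<ge> 0" using y(1) y(2)[rule_format, of 1] y(2)[rule_format, of 2] y(2)[rule_format, of 3]
      by (auto simp: integer_lattice_def coord_sum_def)
    then show ?thesis unfolding n_def by (auto elim: Ints_cases)
  qed
  define v where "v = y - real n *\<^sub>R axis 1 1"
  have "coord_sum v = 0" by (simp add: v_def sn)
  moreover have "v \<in> integer_lattice" using y(1) by (simp add: v_def integer_lattice_def axis_def)
  ultimately have "plane_proj (u 0) v \<in> integer_lattice" by (simp add: integer_lattice_def forall_2)
  moreover have "plane_proj (u 0) y = real n *\<^sub>R tt + plane_proj (u 0) v"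
    by (simp add: v_def tau_def linear_diff[OF linear_plane_proj] linear_cmul[OF linear_plane_proj])
  ultimately show ?thesis using y(3) by metis
qed

lemma bad_no_interior: "open V \<Longrightarrow> V \<subseteq> bad \<Longrightarrow> V = {}"
  using bad_negligible negligible_subset open_not_negligible by blast

text \<open>The orbit closure plus the lattice is closed and dense, hence everything. An interior
  point of a tile missed by the orbit closure would have a second representative in
  \<open>RR\<close>; such points form an open set inside a null set.\<close>

lemma orbit_dense:
  assumes c: "is_coding r \<tau> x w"
  shows "RRs \<subseteq> closure (range (\<lambda>n. x + (\<Sum>k<n. \<tau> (w !! k))))"
proof -
  let ?O = "range (\<lambda>n. x + (\<Sum>k<n. \<tau> (w !! k)))"
  have sub: "?O \<subseteq> RRs" using c by (fastforce simp: is_coding_def RR_iff)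
  have cR: "closed RRs" by (rule compact_imp_closed[OF compact_RR[OF g u]])
  have cO: "closure ?O \<subseteq> RRs" by (rule closure_minimal[OF sub cR])
  have "compact (RRs \<inter> closure ?O)" by (rule compact_Int_closed[OF compact_RR[OF g u] closed_closure])
  then have kO: "compact (closure ?O)" using cO by (simp add: Int_absorb1)
  let ?T = "\<Union>a\<in>closure ?O. \<Union>b\<in>integer_lattice. {a + b}"
  have cT: "closed ?T" by (rule compact_closed_sums[OF kO integer_lattice_closed])
  have all: "y \<in> ?T" for y
  proof -
    have "y \<in> closure ?T" unfolding closure_approachable
    proof (intro allI impI)
      fix e :: real assume "e > 0"
      then obtain n z where z: "z \<in> integer_lattice" "dist (real n *\<^sub>R tt + z) (y - x) < e" using translates_dense by blast
      define b where "b = z - ((\<Sum>k<n. \<tau> (w !! k)) - real n *\<^sub>R tt)"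
      have b: "b \<in> integer_lattice" unfolding b_def by (rule integer_lattice_simps(2)[OF z(1) tau_sum])
      have a: "x + (\<Sum>k<n. \<tau> (w !! k)) \<in> closure ?O" by (rule subsetD[OF closure_subset rangeI])
      have "(x + (\<Sum>k<n. \<tau> (w !! k))) + b \<in> ?T" by (intro UN_I[OF a] UN_I[OF b]) simp
      moreover have "dist ((x + (\<Sum>k<n. \<tau> (w !! k))) + b) y < e"
        using z(2) by (simp add: b_def dist_norm algebra_simps)
      ultimately show "\<exists>y'\<in>?T. dist y' y < e" by blast
    qed
    then show ?thesis unfolding closure_closed[OF cT] .
  qed
  have int: "interior (r i) \<subseteq> closure ?O" for i
  proof -
    let ?V = "interior (r i) - closure ?O"
    have "?V \<subseteq> bad"
    proof
      fix y assume y: "y \<in> ?V"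
      obtain a b where ab: "a \<in> closure ?O" "b \<in> integer_lattice" "y = a + b" using all[of y] by (elim UN_E singletonE)
      have nb: "b \<noteq> 0" using y ab by auto
      have "a \<in> RRs" using ab(1) cO by blast
      then have "y + (- b) \<in> RRs" using ab(3) by simp
      moreover have "y \<in> RRs" using y interior_subset RR_iff by blast
      ultimately show "y \<in> bad" using not_bad_unique_shift[of y "- b"] ab(2) nb integer_lattice_simps(3) by fastforce
    qed
    moreover have "open ?V" by (intro open_Diff) auto
    ultimately have "?V = {}" by (rule bad_no_interior[rotated])
    then show ?thesis by blast
  qed
  have "r i \<subseteq> closure ?O" for i
  proof -
    have "closure (interior (r i)) \<subseteq> closure ?O" by (rule closure_minimal[OF int closed_closure])
    then show ?thesis by (simp only: closure_interior_tile[OF g u])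
  qed
  then show ?thesis unfolding RR_def[OF g u] by blast
qed

text \<open>Two points with the same coding keep their difference \<open>d\<close> along the orbit.
  By density of the orbit, translation by \<open>d\<close> maps the bounded set \<open>RR\<close>
  into itself, which forces \<open>d = 0\<close>.\<close>

lemma coding_unique:
  assumes c: "is_coding r \<tau> x w" "is_coding r \<tau> y w"
  shows "x = y"
proof (rule ccontr)
  assume n: "x \<noteq> y"
  define d where "d = y - x"
  have d: "norm d > 0" using n by (simp add: d_def)
  have cR: "closed RRs" by (rule compact_imp_closed[OF compact_RR[OF g u]])
  have sh: "a + d \<in> RRs" if "a \<in> RRs" for a
  proof -
    have "range (\<lambda>n. x + (\<Sum>k<n. \<tau> (w !! k))) \<subseteq> {a. a + d \<in> RRs}"
    proof clarify
      fix n
      have "y + (\<Sum>k<n. \<tau> (w !! k)) \<in> RRs" using c(2) unfolding is_coding_def RR_iff by blast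
      then show "x + (\<Sum>k<n. \<tau> (w !! k)) + d \<in> RRs" by (simp add: d_def algebra_simps)
    qed
    moreover have "closed {a. a + d \<in> RRs}"
      using closed_vimage[of RRs "\<lambda>a. a + d"] cR by (simp add: vimage_def continuous_on_add)
    ultimately have "closure (range (\<lambda>n. x + (\<Sum>k<n. \<tau> (w !! k)))) \<subseteq> {a. a + d \<in> RRs}" by (rule closure_minimal)
    then show ?thesis using orbit_dense[OF c(1)] that by blast
  qed
  have x: "x \<in> RRs" using c(1) is_coding_codes_upto codes_upto_RR[of 1 x "(!!) w"] by simp
  have "x + real n *\<^sub>R d \<in> RRs" for n
  proof (induction n)
    case (Suc n)
    then show ?case using sh[of "x + real n *\<^sub>R d"] by (simp add: algebra_simps)
  qed (use x in simp)
  then obtain B where B: "\<And>n. norm (x + real n *\<^sub>R d) \<le> B"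
    using compact_imp_bounded[OF compact_RR[OF g u]] unfolding bounded_iff by blast
  obtain n where nn: "B + norm x < real n * norm d" using ex_less_of_nat_mult[OF d] by blast
  have "norm (real n *\<^sub>R d) \<le> norm (x + real n *\<^sub>R d) + norm x"
    using norm_triangle_ineq4[of "x + real n *\<^sub>R d" x] by simp
  then show False using B[of n] nn by simp
qed

text \<open>The orbit moves by a vector depending on the letter, but testing multiples of one vector
  is enough, as the overlap set is periodic under the lattice.\<close>

definition good_pts :: "(real^2) set" where
  "good_pts = {x \<in> RR s u. \<forall>n. x + real n *\<^sub>R tau (u 0) 1 \<notin> overlap_set s (u 0)}"

private abbreviation (input) R0 :: "(real^2) set" where "R0 \<equiv> good_pts"

lemma R0_iff: "x \<in> R0 \<longleftrightarrow> x \<in> RRs \<and> (\<forall>n. x + real n *\<^sub>R tt \<notin> bad)"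
  by (simp add: good_pts_def)

lemma R0_not_bad: "x \<in> R0 \<Longrightarrow> x \<notin> bad"
  using R0_iff[of x] by (metis add_0_right of_nat_0 scaleR_zero_left)

lemma R0_step: "x \<in> R0 \<Longrightarrow> x \<in> r i \<Longrightarrow> x + \<tau> i \<in> R0"
proof -
  assume x: "x \<in> R0" "x \<in> r i"
  have "x + \<tau> i + real n *\<^sub>R tt \<notin> bad" for n
  proof -
    have e: "x + \<tau> i + real n *\<^sub>R tt = (x + real (Suc n) *\<^sub>R tt) + (\<tau> i - tt)" by (simp add: algebra_simps)
    have "x + real (Suc n) *\<^sub>R tt \<notin> bad" using x(1) unfolding R0_iff by blast
    then show ?thesis unfolding e bad_periodic[OF tau_diff] .
  qed
  then show ?thesis unfolding R0_iff using r_tau[OF x(2)] by blast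
qed

definition coding_of :: "real^2 \<Rightarrow> letter stream" where
  "coding_of x = (SOME w. \<forall>n. codes_upto n x ((!!) w))"

lemma R0_orbit:
  assumes "x \<in> R0" "codes_upto n x w"
  shows "x + (\<Sum>k<n. \<tau> (w k)) \<in> R0"
  using assms(2)
proof (induction n)
  case (Suc n)
  have "x + (\<Sum>k<n. \<tau> (w k)) \<in> R0" by (rule Suc.IH[OF codes_upto_mono[OF _ Suc.prems]]) simp
  moreover have "x + (\<Sum>k<n. \<tau> (w k)) \<in> r (w n)" using Suc.prems by (simp add: codes_upto_def)
  ultimately have "x + (\<Sum>k<n. \<tau> (w k)) + \<tau> (w n) \<in> R0" by (rule R0_step)
  then show ?case by (simp add: add.assoc)
qed (use assms(1) in simp)

lemma R0_codes_upto_unique: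
  assumes x: "x \<in> R0" and c: "codes_upto n x w" "codes_upto n x w'" and m: "m < n"
  shows "w m = w' m"
  using m
proof (induction m rule: less_induct)
  case (less m)
  have e: "(\<Sum>k<m. \<tau> (w k)) = (\<Sum>k<m. \<tau> (w' k))" using less by (intro sum.cong) auto
  have "x + (\<Sum>k<m. \<tau> (w k)) \<in> R0" by (rule R0_orbit[OF x codes_upto_mono[OF _ c(1)]]) (use less.prems in simp)
  from R0_not_bad[OF this] show ?case
    by (rule not_bad_unique_letter) (use c less.prems e in \<open>auto simp: codes_upto_def\<close>)
qed

text \<open>Finitely many closed sets, one for each factor of length \<open>n\<close>, cover the
  projected prefixes of a tile and therefore the tile. That the word is a factor is recorded in
  order to reach a word of the shift in the limit.\<close>

lemma R0_codes_upto_ex: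
  assumes x: "x \<in> R0"
  shows "\<exists>v. length v = n \<and> codes_upto n x ((!) v) \<and> (\<exists>a m. sublist v (subst_block s m [a]))"
proof -
  obtain i where i: "x \<in> r i" using x unfolding R0_iff RR_iff by blast
  let ?V = "{v :: letter list. length v = n \<and> (\<exists>a m. sublist v (subst_block s m [a]))}"
  have fin: "finite ?V" by (rule finite_subset[OF _ finite_lists_length_eq[of UNIV n]]) auto
  have "(\<lambda>p. plane_proj (u 0) (abelian p)) ` pre s i \<subseteq> (\<Union>v\<in>?V. {x. codes_upto n x ((!) v)})"
  proof clarify
    fix p assume "p \<in> pre s i"
    then obtain v where v: "length v = n" "\<forall>m<n. p @ take m v \<in> pre s (v ! m)" "\<exists>a m. sublist v (subst_block s m [a])"
      using pre_ext_word[OF good_AR[OF g] good_blocks_recur[OF g], of p i n] by blast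
    then have "codes_upto n (plane_proj (u 0) (abelian p)) ((!) v)" by (intro pre_codes_upto)
    then show "plane_proj (u 0) (abelian p) \<in> (\<Union>v\<in>?V. {x. codes_upto n x ((!) v)})" using v by blast
  qed
  then have "r i \<subseteq> (\<Union>v\<in>?V. {x. codes_upto n x ((!) v)})"
    unfolding tile_def by (rule closure_minimal) (intro closed_UN fin ballI closed_codes_upto)
  then show ?thesis using i by blast
qed

text \<open>At good points finite codings are unique, so those of different lengths extend each
  other and fit together to one infinite word.\<close>

lemma coding_of_ex:
  assumes x: "x \<in> R0"
  shows "\<exists>w\<in>X. \<forall>n. codes_upto n x ((!!) w)"
proof -
  obtain v where v: "\<And>n. length (v n) = n" "\<And>n. codes_upto n x ((!) (v n))" "\<And>n. \<exists>a m. sublist (v n) (subst_block s m [a])"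
    using R0_codes_upto_ex[OF x] by metis
  define w where "w = smap (\<lambda>n. v (Suc n) ! n) nats"
  have wn: "w !! m = v n ! m" if "m < n" for m n
  proof -
    have "codes_upto (Suc m) x ((!) (v n))" by (rule codes_upto_mono[OF _ v(2)]) (use that in simp)
    from R0_codes_upto_unique[OF x v(2)[of "Suc m"] this, of m] show ?thesis by (simp add: w_def)
  qed
  have st: "stake n w = v n" for n
    by (rule nth_equalityI) (simp_all add: v(1) wn)
  have "codes_upto n x ((!!) w)" for n by (rule codes_upto_cong[THEN iffD1, OF _ v(2)[of n]]) (simp add: wn)
  moreover have "w \<in> X" unfolding sadic_shift_def
  proof (clarify, rule ccontr)
    fix k l assume n: "\<not> (\<exists>i n. sublist (stake l (sdrop k w)) (subst_block s n [i]))"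
    have e: "v (k + l) = stake k w @ stake l (sdrop k w)" unfolding st[symmetric] by (rule stake_add[symmetric])
    have "sublist (stake l (sdrop k w)) (v (k + l))" unfolding e by (rule sublist_append_leftI)
    then show False using v(3)[of "k + l"] sublist_trans n by blast
  qed
  ultimately show ?thesis by blast
qed

lemma coding_of_codes_upto: "x \<in> R0 \<Longrightarrow> codes_upto n x ((!!) (coding_of x))"
  unfolding coding_of_def using someI_ex[of "\<lambda>w. \<forall>n. codes_upto n x ((!!) w)"] coding_of_ex[of x] by blast

lemma coding_of_unique: "x \<in> R0 \<Longrightarrow> \<forall>n. codes_upto n x ((!!) w) \<Longrightarrow> w = coding_of x"
proof (rule snth_ext)
  fix k assume x: "x \<in> R0" and c: "\<forall>n. codes_upto n x ((!!) w)"
  show "w !! k = coding_of x !! k" by (rule R0_codes_upto_unique[OF x c[rule_format, of "Suc k"] coding_of_codes_upto[OF x, of "Suc k"]]) simp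
qed

lemma coding_of_X: "x \<in> R0 \<Longrightarrow> coding_of x \<in> X"
  using coding_of_ex[of x] coding_of_unique[of x] by metis

end

section \<open>Fundamental domains and periodic sets\<close>

lemma vimage_shift_borel: "S \<in> sets borel \<Longrightarrow> {x :: real^2. x + c \<in> S} \<in> sets borel"
proof -
  assume "S \<in> sets borel"
  then have "(\<lambda>x :: real^2. x + c) -` S \<inter> space borel \<in> sets borel" by (intro measurable_sets[of _ _ borel]) auto
  then show ?thesis by (simp add: vimage_def)
qed

lemma emeasure_shift: "S \<in> sets borel \<Longrightarrow> emeasure lborel {x :: real^2. x + c \<in> S} = emeasure lborel S"
proof -
  assume S: "S \<in> sets borel"
  have "emeasure lborel S = emeasure (distr lborel borel ((+) c)) S" by (simp only: lborel_distr_plus)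
  also have "\<dots> = emeasure lborel ((+) c -` S \<inter> space lborel)" by (rule emeasure_distr) (use S in auto)
  also have "(+) c -` S \<inter> space lborel = {x. x + c \<in> S}" by (auto simp: add.commute)
  finally show ?thesis by simp
qed

definition fund_dom :: "(real^2) set \<Rightarrow> bool" where
  "fund_dom G \<longleftrightarrow> G \<in> sets borel \<and> (AE x in lborel. \<exists>!l. l \<in> integer_lattice \<and> x + l \<in> G)"

lemma fund_dom_null:
  assumes "fund_dom G"
  obtains N where "N \<in> null_sets lborel" "\<And>x. x \<notin> N \<Longrightarrow> \<exists>!l. l \<in> integer_lattice \<and> x + l \<in> G"
proof -
  obtain N where "{x \<in> space lborel. \<not> (\<exists>!l. l \<in> integer_lattice \<and> x + l \<in> G)} \<subseteq> N" "N \<in> null_sets lborel"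
    using assms unfolding fund_dom_def eventually_ae_filter by blast
  then show thesis by (intro that[of N]) auto
qed

text \<open>\<open>G \<inter> A\<close> is cut into the parts \<open>K z\<close> that a lattice
  vector \<open>z\<close> carries into \<open>G'\<close>. Up to a null set \<open>K z\<close> is
  shifted into \<open>H z\<close>, still inside \<open>A\<close> by periodicity, and the sets
  \<open>H z\<close> are disjoint. Removing the exceptional null sets makes the families exactly
  disjoint.\<close>

lemma fund_dom_le:
  assumes G: "fund_dom G" and G': "fund_dom G'" and A: "A \<in> sets borel" "periodic A"
  shows "emeasure lborel (G \<inter> A) \<le> emeasure lborel (G' \<inter> A)"
proof -
  obtain N where N: "N \<in> null_sets lborel" "\<And>x. x \<notin> N \<Longrightarrow> \<exists>!l. l \<in> integer_lattice \<and> x + l \<in> G"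
    using fund_dom_null[OF G] by blast
  obtain N' where N': "N' \<in> null_sets lborel" "\<And>x. x \<notin> N' \<Longrightarrow> \<exists>!l. l \<in> integer_lattice \<and> x + l \<in> G'"
    using fund_dom_null[OF G'] by blast
  have b: "G \<in> sets borel" "G' \<in> sets borel" using G G' by (auto simp: fund_dom_def)
  have nb: "N \<in> sets borel" "N' \<in> sets borel" using N(1) N'(1) by (auto simp: null_sets_def)
  define K where "K z = (G \<inter> A \<inter> {x. x + z \<in> G'}) - N'" for z
  define H where "H z = (G' \<inter> A \<inter> {x. x + (- z) \<in> G}) - N" for z
  have Kb: "K z \<in> sets lborel" and Hb: "H z \<in> sets lborel" for z
    unfolding K_def H_def sets_lborel using b nb A vimage_shift_borel by auto
  have ni: "N' \<inter> G \<inter> A \<in> null_sets lborel" using N'(1) b A by (intro null_set_Int2) (auto simp: Int_assoc)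
  have "emeasure lborel (G \<inter> A) = emeasure lborel ((G \<inter> A) - (N' \<inter> G \<inter> A))"
    using ni b A by (intro emeasure_Diff_null_set[symmetric]) auto
  also have "(G \<inter> A) - (N' \<inter> G \<inter> A) = (\<Union>z\<in>integer_lattice. K z)"
  proof
    show "(G \<inter> A) - (N' \<inter> G \<inter> A) \<subseteq> (\<Union>z\<in>integer_lattice. K z)"
    proof
      fix x assume x: "x \<in> (G \<inter> A) - (N' \<inter> G \<inter> A)"
      then obtain l where "l \<in> integer_lattice" "x + l \<in> G'" using N'(2)[of x] by blast
      then show "x \<in> (\<Union>z\<in>integer_lattice. K z)" using x unfolding K_def by blast
    qed
  qed (auto simp: K_def)
  also have "emeasure lborel (\<Union>z\<in>integer_lattice. K z) = (\<integral>\<^sup>+z. emeasure lborel (K z) \<partial>count_space integer_lattice)"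
    by (rule emeasure_UN_countable[OF Kb countable_integer_lattice])
      (use N'(2) in \<open>fastforce simp: disjoint_family_on_def K_def\<close>)
  also have "\<dots> \<le> (\<integral>\<^sup>+z. emeasure lborel (H z) \<partial>count_space integer_lattice)"
  proof (rule nn_integral_mono)
    fix z :: "real^2" assume "z \<in> space (count_space integer_lattice)"
    then have z: "z \<in> integer_lattice" by simp
    let ?H = "G' \<inter> A \<inter> {x. x + (- z) \<in> G}"
    have Hb': "?H \<in> sets borel" using b A vimage_shift_borel by auto
    have "emeasure lborel (K z) \<le> emeasure lborel {x. x + z \<in> ?H}"
    proof (rule emeasure_mono)
      show "K z \<subseteq> {x. x + z \<in> ?H}" using periodicD[OF A(2) z] by (auto simp: K_def)
      show "{x. x + z \<in> ?H} \<in> sets lborel" unfolding sets_lborel by (rule vimage_shift_borel[OF Hb'])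
    qed
    also have "\<dots> = emeasure lborel ?H" by (rule emeasure_shift[OF Hb'])
    also have "\<dots> = emeasure lborel (?H - N)" using N(1) Hb' by (intro emeasure_Diff_null_set[symmetric]) auto
    finally show "emeasure lborel (K z) \<le> emeasure lborel (H z)" by (simp add: H_def)
  qed
  also have "\<dots> = emeasure lborel (\<Union>z\<in>integer_lattice. H z)"
  proof (rule emeasure_UN_countable[OF Hb countable_integer_lattice, symmetric])
    show "disjoint_family_on H integer_lattice"
      unfolding disjoint_family_on_def
    proof (intro ballI impI)
      fix m n :: "real^2" assume mn: "m \<in> integer_lattice" "n \<in> integer_lattice" "m \<noteq> n"
      show "H m \<inter> H n = {}"
      proof (rule ccontr)
        assume "H m \<inter> H n \<noteq> {}"
        then obtain x where "x \<notin> N" "x + (- m) \<in> G" "x + (- n) \<in> G" unfolding H_def by blast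
        then have "- m = - n" using N(2)[of x] integer_lattice_simps(3) mn by blast
        then show False using mn by simp
      qed
    qed
  qed
  also have "\<dots> \<le> emeasure lborel (G' \<inter> A)"
    by (rule emeasure_mono) (use b A in \<open>auto simp: H_def\<close>)
  finally show ?thesis .
qed

lemma fund_dom_eq: "fund_dom G \<Longrightarrow> fund_dom G' \<Longrightarrow> A \<in> sets borel \<Longrightarrow> periodic A \<Longrightarrow>
    emeasure lborel (G \<inter> A) = emeasure lborel (G' \<inter> A)"
  by (intro antisym fund_dom_le)

lemma fund_dom_shift: assumes "fund_dom G" shows "fund_dom {x. x + c \<in> G}"
proof -
  have b: "G \<in> sets borel" and a: "AE x in lborel. \<exists>!l. l \<in> integer_lattice \<and> x + l \<in> G"
    using assms by (auto simp: fund_dom_def)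
  have "AE x in distr lborel borel ((+) c). \<exists>!l. l \<in> integer_lattice \<and> x + l \<in> G"
    by (simp only: lborel_distr_plus a)
  then have "AE x in lborel. \<exists>!l. l \<in> integer_lattice \<and> (c + x) + l \<in> G" by (rule AE_distrD[rotated]) simp
  then show ?thesis unfolding fund_dom_def using vimage_shift_borel[OF b, of c] by (simp add: ac_simps)
qed

definition unit_square :: "(real^2) set" where "unit_square = {x. \<forall>i. 0 \<le> x $ i \<and> x $ i < 1}"

lemma unit_square_borel: "unit_square \<in> sets borel"
proof -
  have e: "unit_square = {x. 0 \<le> x $ 1} \<inter> {x. x $ 1 < 1} \<inter> {x. 0 \<le> x $ 2} \<inter> {x. x $ 2 < 1}" by (auto simp: unit_square_def forall_2)
  have m: "{x :: real^2. 0 \<le> x $ i} \<in> sets borel" "{x :: real^2. x $ i < 1} \<in> sets borel" for i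
    by (intro borel_closed borel_open closed_Collect_le open_Collect_less continuous_intros)+
  show ?thesis unfolding e by (intro sets.Int m)
qed

lemma unit_square_unique: "\<exists>!l. l \<in> integer_lattice \<and> x + l \<in> unit_square"
proof (rule ex1I)
  show "(\<chi> i. - of_int \<lfloor>x $ i\<rfloor>) \<in> integer_lattice \<and> x + (\<chi> i. - of_int \<lfloor>x $ i\<rfloor>) \<in> unit_square"
    by (auto simp: integer_lattice_def unit_square_def) linarith
  fix l assume l: "l \<in> integer_lattice \<and> x + l \<in> unit_square"
  show "l = (\<chi> i. - of_int \<lfloor>x $ i\<rfloor>)"
    unfolding vec_eq_iff
  proof
    fix i
    have "l $ i \<in> \<int>" using l by (simp add: integer_lattice_def)
    then obtain k where k: "l $ i = of_int k" by (elim Ints_cases)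
    have "0 \<le> x $ i + l $ i" "x $ i + l $ i < 1" using l by (auto simp: unit_square_def)
    then have "\<lfloor>x $ i\<rfloor> = - k" unfolding k by (intro floor_unique) auto
    then show "l $ i = (\<chi> i. - of_int \<lfloor>x $ i\<rfloor>) $ i" by (simp add: k)
  qed
qed

lemma fund_dom_unit_square: "fund_dom unit_square"
  unfolding fund_dom_def using unit_square_borel unit_square_unique by simp

lemma emeasure_unit_square: "emeasure lborel unit_square = 1"
proof (rule antisym)
  have B: "(1 :: real^2) \<bullet> b = 1" "(0::real^2) \<bullet> b = 0" if "b \<in> Basis" for b :: "real^2"
    using that by (auto simp: Basis_vec_def inner_axis)
  have "emeasure lborel unit_square \<le> emeasure lborel (cbox 0 (1 :: real^2))"
    by (rule emeasure_mono) (auto simp: unit_square_def mem_box_cart less_imp_le)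
  also have "\<dots> = 1" by (subst emeasure_lborel_cbox) (simp_all add: B inner_diff_left)
  finally show "emeasure lborel unit_square \<le> 1" .
  have "1 = emeasure lborel (box 0 (1 :: real^2))" by (subst emeasure_lborel_box) (simp_all add: B inner_diff_left)
  also have "\<dots> \<le> emeasure lborel unit_square"
    by (rule emeasure_mono) (use unit_square_borel in \<open>auto simp: unit_square_def mem_box_cart less_imp_le\<close>)
  finally show "1 \<le> emeasure lborel unit_square" .
qed

definition saturation :: "(real^2) set \<Rightarrow> (real^2) set" where
  "saturation F = {x. \<exists>z\<in>integer_lattice. x + z \<in> F}"

lemma saturation_borel: "F \<in> sets borel \<Longrightarrow> saturation F \<in> sets borel"
proof -
  assume "F \<in> sets borel"
  then have "(\<Union>z\<in>integer_lattice. {x. x + z \<in> F}) \<in> sets borel"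
    by (intro sets.countable_UN'' countable_integer_lattice vimage_shift_borel)
  moreover have "saturation F = (\<Union>z\<in>integer_lattice. {x. x + z \<in> F})" by (auto simp: saturation_def)
  ultimately show ?thesis by simp
qed

lemma saturation_periodic: "periodic (saturation F)"
  unfolding periodic_def saturation_def
proof clarify
  fix x z y :: "real^2" assume "z \<in> integer_lattice" "y \<in> integer_lattice" "x + y \<in> F"
  then show "\<exists>za\<in>integer_lattice. x + z + za \<in> F"
    by (intro bexI[of _ "y - z"]) (simp_all add: integer_lattice_simps)
qed

lemma saturation_superset: "F \<subseteq> saturation F"
proof
  fix x assume "x \<in> F"
  then show "x \<in> saturation F" unfolding saturation_def by (intro CollectI bexI[of _ 0] integer_lattice_simps) simp
qed

lemma saturation_closed: "compact F \<Longrightarrow> closed (saturation F)"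
proof -
  assume F: "compact F"
  have "saturation F = (\<Union>a\<in>F. \<Union>b\<in>integer_lattice. {a + b})"
  proof
    show "saturation F \<subseteq> (\<Union>a\<in>F. \<Union>b\<in>integer_lattice. {a + b})"
    proof
      fix x assume "x \<in> saturation F"
      then obtain z where z: "z \<in> integer_lattice" "x + z \<in> F" unfolding saturation_def by blast
      show "x \<in> (\<Union>a\<in>F. \<Union>b\<in>integer_lattice. {a + b})"
        by (intro UN_I[OF z(2)] UN_I[OF integer_lattice_simps(3)[OF z(1)]]) simp
    qed
    show "(\<Union>a\<in>F. \<Union>b\<in>integer_lattice. {a + b}) \<subseteq> saturation F"
    proof clarsimp
      fix a b :: "real^2" assume "a \<in> F" "b \<in> integer_lattice"
      then show "a + b \<in> saturation F" unfolding saturation_def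
        by (intro CollectI bexI[of _ "- b"]) (simp_all add: integer_lattice_simps)
    qed
  qed
  then show ?thesis using compact_closed_sums[OF F integer_lattice_closed] by simp
qed

section \<open>Measurable passage between words and points\<close>

abbreviation WS :: "letter stream measure" where "WS \<equiv> stream_space (count_space UNIV)"

lemma space_WS [simp]: "space WS = UNIV"
  by (simp add: space_stream_space)

context
  fixes s :: "subst stream" and u :: "nat \<Rightarrow> real^3"
  assumes g: "good s" and u: "eigseq s u"
begin

private abbreviation (input) "r' \<equiv> tile s (u 0)"
private abbreviation (input) "\<tau>' \<equiv> tau (u 0)"
private abbreviation (input) "t' \<equiv> tau (u 0) 1"
private abbreviation (input) "bad' \<equiv> overlap_set s (u 0)"
private abbreviation (input) "RR' \<equiv> RR s u"
private abbreviation (input) "R0' \<equiv> good_pts s u"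
private abbreviation (input) "X' \<equiv> sadic_shift s"
private abbreviation (input) "MX \<equiv> restrict_space WS (sadic_shift s)"

lemma RR_borel: "RR' \<in> sets borel"
  by (intro borel_closed compact_imp_closed compact_RR[OF g u])

lemma fund_dom_RR: "fund_dom RR'"
  unfolding fund_dom_def
proof (intro conjI RR_borel)
  show "AE x in lborel. \<exists>!l. l \<in> integer_lattice \<and> x + l \<in> RR'"
    using AE_not_bad[OF g u, of 0]
  proof (rule AE_mp, intro AE_I2 impI)
    fix x assume "x + 0 \<notin> bad'"
    then have x: "x \<notin> bad'" by simp
    show "\<exists>!l. l \<in> integer_lattice \<and> x + l \<in> RR'"
    proof (rule ex_ex1I)
      show "\<exists>l. l \<in> integer_lattice \<and> x + l \<in> RR'" using covering[OF g u, of x] by blast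
      show "l = l'" if "l \<in> integer_lattice \<and> x + l \<in> RR'" "l' \<in> integer_lattice \<and> x + l' \<in> RR'" for l l'
        using that not_bad_unique[OF g u x] unfolding RR_iff[OF g u] by blast
    qed
  qed
qed

lemma R0_borel: "R0' \<in> sets borel"
proof -
  have "R0' = RR' \<inter> (\<Inter>n. - {x. x + real n *\<^sub>R t' \<in> bad'})" by (auto simp: R0_iff[OF g u])
  moreover have "{x. x + real n *\<^sub>R t' \<in> bad'} \<in> sets borel" for n
    by (rule vimage_shift_borel[OF bad_borel[OF g u]])
  ultimately show ?thesis using RR_borel by (auto intro!: sets.Int sets.countable_INT)
qed

lemma R0_sub_RR: "R0' \<subseteq> RR'"
  by (auto simp: R0_iff[OF g u])

lemma AE_R0: "AE x in lborel. x \<in> RR' \<longrightarrow> x \<in> R0'"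
proof -
  have "AE x in lborel. \<forall>n. x + real n *\<^sub>R t' \<notin> bad'"
    unfolding AE_all_countable using AE_not_bad[OF g u] by blast
  then show ?thesis by (rule AE_mp) (auto simp: R0_iff[OF g u])
qed

lemma emeasure_R0_Int: "B \<in> sets borel \<Longrightarrow> emeasure lborel (R0' \<inter> B) = emeasure lborel (RR' \<inter> B)"
  by (rule emeasure_eq_AE, use AE_R0 in \<open>rule AE_mp\<close>) (use R0_sub_RR R0_borel RR_borel in auto)

lemma emeasure_RR: "emeasure lborel RR' = 1"
  using fund_dom_eq[OF fund_dom_RR fund_dom_unit_square, of UNIV] emeasure_unit_square by (simp add: periodic_def)

lemma emeasure_R0: "emeasure lborel R0' = 1"
  using emeasure_R0_Int[of UNIV] emeasure_RR by simp

definition point_of :: "letter stream \<Rightarrow> real^2" where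
  "point_of w = (THE x. \<forall>n. codes_upto s u n x ((!!) w))"

lemma point_of_coded: "w \<in> X' \<Longrightarrow> \<forall>n. codes_upto s u n (point_of w) ((!!) w)"
proof -
  assume "w \<in> X'"
  then obtain x where x: "is_coding r' \<tau>' x w" by (rule X_coded[OF g u])
  have "\<exists>!x. \<forall>n. codes_upto s u n x ((!!) w)"
    by (rule ex1I[of _ x]) (use x coding_unique[OF g u] in \<open>auto simp: is_coding_codes_upto[OF g u]\<close>)
  then show ?thesis unfolding point_of_def by (rule theI')
qed

lemma point_of_eq: "w \<in> X' \<Longrightarrow> \<forall>n. codes_upto s u n x ((!!) w) \<Longrightarrow> point_of w = x"
  using coding_unique[OF g u, of "point_of w" w x] point_of_coded[of w] by (simp add: is_coding_codes_upto[OF g u])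

lemma point_of_RR: "w \<in> X' \<Longrightarrow> point_of w \<in> RR'"
  by (rule codes_upto_RR[OF g u, of 1 _ "(!!) w"]) (use point_of_coded in simp_all)

lemma stl_X: "w \<in> X' \<Longrightarrow> stl w \<in> X'"
  unfolding sadic_shift_def
proof clarify
  fix k l assume "\<forall>k l. \<exists>i n. sublist (stake l (sdrop k w)) (subst_block s n [i])"
  from this[rule_format, of l "Suc k"] show "\<exists>i n. sublist (stake l (sdrop k (stl w))) (subst_block s n [i])" by simp
qed

lemma codes_upto_stl: "codes_upto s u (Suc n) x ((!!) w) \<Longrightarrow> codes_upto s u n (x + \<tau>' (shd w)) ((!!) (stl w))"
  unfolding codes_upto_def[OF g u]
proof (intro allI impI)
  fix m assume c: "\<forall>m<Suc n. x + (\<Sum>k<m. \<tau>' (w !! k)) \<in> r' (w !! m)" and m: "m < n"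
  have "x + (\<Sum>k<Suc m. \<tau>' (w !! k)) \<in> r' (w !! Suc m)" using c m by blast
  then show "x + \<tau>' (shd w) + (\<Sum>k<m. \<tau>' (stl w !! k)) \<in> r' (stl w !! m)"
    unfolding sum.lessThan_Suc_shift by (simp add: add.assoc)
qed

lemma point_of_stl: "w \<in> X' \<Longrightarrow> point_of (stl w) = point_of w + \<tau>' (shd w)"
  by (rule point_of_eq[OF stl_X]) (use point_of_coded codes_upto_stl in blast)+

lemma point_of_coding_of: "x \<in> R0' \<Longrightarrow> point_of (coding_of s u x) = x"
  by (rule point_of_eq[OF coding_of_X[OF g u]]) (use coding_of_codes_upto[OF g u] in blast)+

lemma coding_of_point_of: "w \<in> X' \<Longrightarrow> point_of w \<in> R0' \<Longrightarrow> coding_of s u (point_of w) = w"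
  using coding_of_unique[OF g u, of "point_of w" w] point_of_coded by simp

lemma coding_of_stl:
  assumes "x \<in> R0'"
  shows "x + \<tau>' (shd (coding_of s u x)) \<in> R0'" "coding_of s u (x + \<tau>' (shd (coding_of s u x))) = stl (coding_of s u x)"
proof -
  have c: "\<forall>n. codes_upto s u n x ((!!) (coding_of s u x))" using coding_of_codes_upto[OF g u assms] by blast
  have "x \<in> r' (shd (coding_of s u x))" using c[rule_format, of 1] by (simp add: codes_upto_def[OF g u])
  then show 1: "x + \<tau>' (shd (coding_of s u x)) \<in> R0'" by (rule R0_step[OF g u assms])
  show "coding_of s u (x + \<tau>' (shd (coding_of s u x))) = stl (coding_of s u x)"
    using coding_of_unique[OF g u 1, of "stl (coding_of s u x)"] codes_upto_stl c by simp
qed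

lemma measurable_stake_pred: "{w \<in> space WS. P (stake n w)} \<in> sets WS"
proof -
  have "stake n -` {v. P v} \<inter> space WS \<in> sets WS" by (rule measurable_sets[OF measurable_stake]) simp
  moreover have "stake n -` {v. P v} \<inter> space WS = {w \<in> space WS. P (stake n w)}" by auto
  ultimately show ?thesis by simp
qed

text \<open>By compactness the coded point lies in \<open>F\<close> iff for every \<open>n\<close>
  some point of \<open>F\<close> has the first \<open>n\<close> letters as coding, and each of these
  conditions is measurable.\<close>

lemma point_of_vimage_closed:
  assumes F: "closed F"
  shows "{w \<in> X'. point_of w \<in> F} \<in> sets MX"
proof -
  have "{w \<in> X'. point_of w \<in> F} = X' \<inter> (\<Inter>n. {w \<in> space WS. \<exists>x\<in>F. codes_upto s u n x ((!) (stake n w))})"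
  proof
    show "{w \<in> X'. point_of w \<in> F} \<subseteq> X' \<inter> (\<Inter>n. {w \<in> space WS. \<exists>x\<in>F. codes_upto s u n x ((!) (stake n w))})"
    proof (clarsimp, rule bexI)
      fix w n assume w: "w \<in> X'" "point_of w \<in> F"
      show "codes_upto s u n (point_of w) ((!) (stake n w))"
        by (rule codes_upto_cong[OF g u, THEN iffD1, OF _ point_of_coded[OF w(1), rule_format, of n]]) simp
    qed
    show "X' \<inter> (\<Inter>n. {w \<in> space WS. \<exists>x\<in>F. codes_upto s u n x ((!) (stake n w))}) \<subseteq> {w \<in> X'. point_of w \<in> F}"
    proof
      fix w assume w: "w \<in> X' \<inter> (\<Inter>n. {w \<in> space WS. \<exists>x\<in>F. codes_upto s u n x ((!) (stake n w))})"
      have "\<exists>x\<in>F. codes_upto s u n x ((!!) w)" for n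
      proof -
        obtain x where x: "x \<in> F" "codes_upto s u n x ((!) (stake n w))" using w by blast
        have "codes_upto s u n x ((!!) w)" by (rule codes_upto_cong[OF g u, THEN iffD1, OF _ x(2)]) simp
        then show ?thesis using x(1) by blast
      qed
      then obtain x where "x \<in> F" "\<forall>n. codes_upto s u n x ((!!) w)" using codes_upto_compact[OF g u F] by blast
      then show "w \<in> {w \<in> X'. point_of w \<in> F}" using point_of_eq w by auto
    qed
  qed
  moreover have "(\<Inter>n. {w \<in> space WS. \<exists>x\<in>F. codes_upto s u n x ((!) (stake n w))}) \<in> sets WS"
    by (intro sets.countable_INT'' measurable_stake_pred) (use sets.top[of WS] in auto)
  ultimately show ?thesis unfolding sets_restrict_space by auto
qed

lemma space_MX: "space MX = X'"
  by (simp add: space_restrict_space)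

lemma point_of_measurable: "point_of \<in> measurable MX borel"
proof (rule borel_measurableI)
  fix S :: "(real^2) set" assume "open S"
  then have "{w \<in> X'. point_of w \<in> - S} \<in> sets MX" by (intro point_of_vimage_closed) (simp add: closed_Compl)
  then have "space MX - {w \<in> X'. point_of w \<in> - S} \<in> sets MX" by blast
  moreover have "space MX - {w \<in> X'. point_of w \<in> - S} = point_of -` S \<inter> space MX" by (auto simp: space_MX)
  ultimately show "point_of -` S \<inter> space MX \<in> sets MX" by simp
qed

lemma codes_upto_borel: "{x. codes_upto s u n x w} \<in> sets borel"
  by (rule borel_closed[OF closed_codes_upto[OF g u]])

text \<open>By uniqueness at good points, letter \<open>n\<close> is \<open>a\<close> exactly on a
  finite union of closed sets, one for each word of length \<open>n + 1\<close> ending in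
  \<open>a\<close>.\<close>

lemma coding_of_measurable: "coding_of s u \<in> measurable (restrict_space borel R0') MX"
proof (rule measurable_restrict_space2)
  show "coding_of s u \<in> space (restrict_space borel R0') \<rightarrow> X'"
    using coding_of_X[OF g u] by (auto simp: space_restrict_space)
  show "coding_of s u \<in> measurable (restrict_space borel R0') WS"
  proof (rule measurable_stream_space2)
    fix n
    show "(\<lambda>x. coding_of s u x !! n) \<in> measurable (restrict_space borel R0') (count_space UNIV)"
    proof (rule measurable_count_space_eq2[THEN iffD2], simp, intro conjI ballI Pi_I UNIV_I)
      fix a :: letter
      let ?V = "{v :: letter list. length v = Suc n \<and> v ! n = a}"
      have "(\<lambda>x. coding_of s u x !! n) -` {a} \<inter> space (restrict_space borel R0') = R0' \<inter> (\<Union>v\<in>?V. {x. codes_upto s u (Suc n) x ((!) v)})"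
      proof
        show "(\<lambda>x. coding_of s u x !! n) -` {a} \<inter> space (restrict_space borel R0') \<subseteq> R0' \<inter> (\<Union>v\<in>?V. {x. codes_upto s u (Suc n) x ((!) v)})"
        proof
          fix x assume "x \<in> (\<lambda>x. coding_of s u x !! n) -` {a} \<inter> space (restrict_space borel R0')"
          then have x: "x \<in> R0'" "coding_of s u x !! n = a" by (auto simp: space_restrict_space)
          have c: "codes_upto s u (Suc n) x ((!) (stake (Suc n) (coding_of s u x)))"
            by (rule codes_upto_cong[OF g u, THEN iffD1, OF _ coding_of_codes_upto[OF g u x(1)]]) (simp del: stake.simps)
          have v: "stake (Suc n) (coding_of s u x) \<in> ?V" using x(2) by (simp del: stake.simps)
          show "x \<in> R0' \<inter> (\<Union>v\<in>?V. {x. codes_upto s u (Suc n) x ((!) v)})"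
            by (rule IntI[OF x(1)], rule UN_I[OF v]) (use c in blast)
        qed
        show "R0' \<inter> (\<Union>v\<in>?V. {x. codes_upto s u (Suc n) x ((!) v)}) \<subseteq> (\<lambda>x. coding_of s u x !! n) -` {a} \<inter> space (restrict_space borel R0')"
        proof
          fix x assume "x \<in> R0' \<inter> (\<Union>v\<in>?V. {x. codes_upto s u (Suc n) x ((!) v)})"
          then obtain v where x: "x \<in> R0'" and v: "v ! n = a" "codes_upto s u (Suc n) x ((!) v)" by blast
          have "v ! n = coding_of s u x !! n" by (rule R0_codes_upto_unique[OF g u x v(2) coding_of_codes_upto[OF g u x]]) simp
          then show "x \<in> (\<lambda>x. coding_of s u x !! n) -` {a} \<inter> space (restrict_space borel R0')"
            using x v by (simp add: space_restrict_space)
        qed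
      qed
      also have "\<dots> \<in> sets (restrict_space borel R0')"
      proof -
        have "finite ?V" by (rule finite_subset[OF _ finite_lists_length_eq[of UNIV "Suc n"]]) auto
        then have "(\<Union>v\<in>?V. {x. codes_upto s u (Suc n) x ((!) v)}) \<in> sets borel" by (intro sets.finite_UN codes_upto_borel)
        then show ?thesis unfolding sets_restrict_space by blast
      qed
      finally show "(\<lambda>x. coding_of s u x !! n) -` {a} \<inter> space (restrict_space borel R0') \<in> sets (restrict_space borel R0')" .
    qed
  qed
qed

end

section \<open>Uniqueness of the invariant measure\<close>

definition fatten :: "real \<Rightarrow> (real^2) set \<Rightarrow> (real^2) set" where
  "fatten \<delta> A = (\<Union>a\<in>A. \<Union>b\<in>cball 0 \<delta>. {a + b})"

lemma fatten_iff: "x \<in> fatten \<delta> A \<longleftrightarrow> (\<exists>a\<in>A. dist a x \<le> \<delta>)"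
proof
  assume "\<exists>a\<in>A. dist a x \<le> \<delta>"
  then obtain a where "a \<in> A" "dist a x \<le> \<delta>" by blast
  then show "x \<in> fatten \<delta> A"
    unfolding fatten_def by (intro UN_I[of a] UN_I[of "x - a"]) (simp_all add: dist_norm norm_minus_commute)
next
  assume "x \<in> fatten \<delta> A"
  then obtain a b where "a \<in> A" "b \<in> cball 0 \<delta>" "x = a + b" unfolding fatten_def by blast
  then show "\<exists>a\<in>A. dist a x \<le> \<delta>" by (intro bexI[of _ a]) (simp_all add: dist_norm)
qed

lemma fatten_closed: "closed A \<Longrightarrow> closed (fatten \<delta> A)"
  unfolding fatten_def by (rule closed_compact_sums) simp_all

lemma fatten_periodic: "periodic A \<Longrightarrow> periodic (fatten \<delta> A)"
  unfolding periodic_def fatten_iff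
proof (intro allI impI)
  fix x z :: "real^2" assume A: "\<forall>x z. x \<in> A \<longrightarrow> z \<in> integer_lattice \<longrightarrow> x + z \<in> A" "\<exists>a\<in>A. dist a x \<le> \<delta>" "z \<in> integer_lattice"
  then obtain a where "a \<in> A" "dist a x \<le> \<delta>" by blast
  then show "\<exists>a\<in>A. dist a (x + z) \<le> \<delta>" using A(1,3) by (intro bexI[of _ "a + z"]) simp_all
qed

lemma fatten_Inter: "closed A \<Longrightarrow> (\<Inter>n. fatten (1 / real (Suc n)) A) = A"
proof
  assume A: "closed A"
  show "(\<Inter>n. fatten (1 / real (Suc n)) A) \<subseteq> A"
  proof
    fix x assume x: "x \<in> (\<Inter>n. fatten (1 / real (Suc n)) A)"
    have "x \<in> closure A" unfolding closure_approachable
    proof (intro allI impI)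
      fix e :: real assume "e > 0"
      then obtain n where n: "1 / real (Suc n) < e" using nat_approx_posE by blast
      have "x \<in> fatten (1 / real (Suc n)) A" using x by (rule INT_D) (rule UNIV_I)
      then obtain a where "a \<in> A" "dist a x \<le> 1 / real (Suc n)" unfolding fatten_iff by blast
      then show "\<exists>y\<in>A. dist y x < e" using n by (intro bexI[of _ a]) linarith+
    qed
    then show "x \<in> A" unfolding closure_closed[OF A] .
  qed
  show "A \<subseteq> (\<Inter>n. fatten (1 / real (Suc n)) A)"
  proof
    fix x assume x: "x \<in> A"
    show "x \<in> (\<Inter>n. fatten (1 / real (Suc n)) A)"
      unfolding INT_iff fatten_iff by (intro ballI bexI[OF _ x]) simp
  qed
qed

lemma fatten_mono: "\<delta> \<le> \<delta>' \<Longrightarrow> fatten \<delta> A \<subseteq> fatten \<delta>' A"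
proof
  fix x assume d: "\<delta> \<le> \<delta>'" and "x \<in> fatten \<delta> A"
  then obtain a where "a \<in> A" "dist a x \<le> \<delta>" unfolding fatten_iff by blast
  then show "x \<in> fatten \<delta>' A" unfolding fatten_iff using d by (intro bexI[of _ a]) auto
qed

lemma periodic_shift: "periodic A \<Longrightarrow> periodic {x. x + c \<in> A}"
  unfolding periodic_def
proof (intro allI impI, unfold mem_Collect_eq)
  fix x z :: "real^2" assume A: "\<forall>x z. x \<in> A \<longrightarrow> z \<in> integer_lattice \<longrightarrow> x + z \<in> A" "x + c \<in> A" "z \<in> integer_lattice"
  then have "(x + c) + z \<in> A" by blast
  then show "x + z + c \<in> A" by (simp add: ac_simps)
qed

context
  fixes s :: "subst stream" and u :: "nat \<Rightarrow> real^3" and \<mu> :: "letter stream measure"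
  assumes g: "good s" and u: "eigseq s u" and mu: "shift_invariant_measure (sadic_shift s) \<mu>"
begin

private abbreviation (input) "\<tau>\<^sub>1 \<equiv> tau (u 0)"
private abbreviation (input) "t\<^sub>1 \<equiv> tau (u 0) 1"
private abbreviation (input) "RR\<^sub>1 \<equiv> RR s u"
private abbreviation (input) "R0\<^sub>1 \<equiv> good_pts s u"
private abbreviation (input) "X\<^sub>1 \<equiv> sadic_shift s"
private abbreviation (input) "MX\<^sub>1 \<equiv> restrict_space WS (sadic_shift s)"
private abbreviation (input) "point_of\<^sub>1 \<equiv> point_of s u"

lemma sets_mu: "sets \<mu> = sets MX\<^sub>1" and prob_mu: "prob_space \<mu>" and stl_mu: "stl \<in> measurable \<mu> \<mu>"
  and distr_mu: "distr \<mu> \<mu> stl = \<mu>"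
  using mu by (auto simp: shift_invariant_measure_def)

lemma space_mu: "space \<mu> = X\<^sub>1"
  using sets_eq_imp_space_eq[OF sets_mu] space_MX[OF g u] by simp

lemma point_of_mu: "point_of\<^sub>1 \<in> borel_measurable \<mu>"
  using point_of_measurable[OF g u] measurable_cong_sets[OF sets_mu refl] by blast

text \<open>The shift moves the coded point by \<open>\<tau>\<^sub>1\<close> of the first letter,
  and a periodic set cannot tell this vector from \<open>t\<^sub>1\<close>.\<close>

lemma mu_inv:
  assumes A: "A \<in> sets borel" "periodic A"
  shows "emeasure \<mu> (point_of\<^sub>1 -` A \<inter> space \<mu>) = emeasure \<mu> (point_of\<^sub>1 -` {x. x + t\<^sub>1 \<in> A} \<inter> space \<mu>)"
proof -
  let ?S = "point_of\<^sub>1 -` A \<inter> space \<mu>"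
  have "?S \<in> sets \<mu>" by (rule measurable_sets[OF point_of_mu A(1)])
  then have "emeasure (distr \<mu> \<mu> stl) ?S = emeasure \<mu> (stl -` ?S \<inter> space \<mu>)" by (rule emeasure_distr[OF stl_mu])
  also have "stl -` ?S \<inter> space \<mu> = point_of\<^sub>1 -` {x. x + t\<^sub>1 \<in> A} \<inter> space \<mu>"
  proof -
    have "point_of\<^sub>1 (stl w) \<in> A \<longleftrightarrow> point_of\<^sub>1 w + t\<^sub>1 \<in> A" if "w \<in> X\<^sub>1" for w
    proof -
      have "point_of\<^sub>1 (stl w) = (point_of\<^sub>1 w + t\<^sub>1) + (\<tau>\<^sub>1 (shd w) - t\<^sub>1)" using point_of_stl[OF g u that] by simp
      then show ?thesis using periodicD[OF A(2) tau_diff] by metis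
    qed
    then show ?thesis using stl_X[OF g u] by (auto simp: space_mu)
  qed
  finally show ?thesis by (simp add: distr_mu)
qed

lemma mu_inv_n:
  assumes A: "A \<in> sets borel" "periodic A"
  shows "emeasure \<mu> (point_of\<^sub>1 -` A \<inter> space \<mu>) = emeasure \<mu> (point_of\<^sub>1 -` {x. x + real n *\<^sub>R t\<^sub>1 \<in> A} \<inter> space \<mu>)"
proof (induction n)
  case (Suc n)
  let ?B = "{x. x + real n *\<^sub>R t\<^sub>1 \<in> A}"
  have "emeasure \<mu> (point_of\<^sub>1 -` ?B \<inter> space \<mu>) = emeasure \<mu> (point_of\<^sub>1 -` {x. x + t\<^sub>1 \<in> ?B} \<inter> space \<mu>)"
    by (rule mu_inv[OF vimage_shift_borel[OF A(1)] periodic_shift[OF A(2)]])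
  also have "{x. x + t\<^sub>1 \<in> ?B} = {x. x + real (Suc n) *\<^sub>R t\<^sub>1 \<in> A}" by (simp add: algebra_simps)
  finally show ?case using Suc.IH by simp
qed simp

text \<open>Invariance under all \<open>n * t\<^sub>1\<close> and their density modulo the lattice
  bound the measure of \<open>A\<close> by that of every translate of its neighbourhood. Averaging
  the translates over the unit square replaces the measure by Lebesgue measure, and then the
  neighbourhoods shrink to \<open>A\<close>.\<close>

lemma mu_saturation_le:
  assumes A: "closed A" "periodic A"
  shows "emeasure \<mu> (point_of\<^sub>1 -` A \<inter> space \<mu>) \<le> emeasure lborel (RR\<^sub>1 \<inter> A)"
proof -
  interpret prob_space \<mu> by (rule prob_mu)
  interpret P: pair_sigma_finite \<mu> "lborel :: (real^2) measure" by unfold_locales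
  have [measurable]: "A \<in> sets borel" "unit_square \<in> sets borel" "RR\<^sub>1 \<in> sets borel"
    using A unit_square_borel RR_borel[OF g u] by auto
  note point_of_mu[measurable]
  have le: "emeasure \<mu> (point_of\<^sub>1 -` A \<inter> space \<mu>) \<le> emeasure lborel (RR\<^sub>1 \<inter> fatten \<delta> A)" if d: "\<delta> > 0" for \<delta>
  proof -
    let ?A = "fatten \<delta> A" let ?e = "emeasure \<mu> (point_of\<^sub>1 -` A \<inter> space \<mu>)"
    have [measurable]: "?A \<in> sets borel" using fatten_closed[OF A(1)] by auto
    have pA: "periodic ?A" by (rule fatten_periodic[OF A(2)])
    have 1: "?e \<le> (\<integral>\<^sup>+w. indicator ?A (point_of\<^sub>1 w + c) \<partial>\<mu>)" for c
    proof -
      obtain n z where z: "z \<in> integer_lattice" "dist (real n *\<^sub>R t\<^sub>1 + z) c < \<delta>" using translates_dense[OF g u d] by blast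
      have "?e = emeasure \<mu> (point_of\<^sub>1 -` {x. x + real n *\<^sub>R t\<^sub>1 \<in> A} \<inter> space \<mu>)"
        by (rule mu_inv_n[OF _ A(2)]) simp
      also have "\<dots> \<le> emeasure \<mu> (point_of\<^sub>1 -` {x. x + c \<in> ?A} \<inter> space \<mu>)"
      proof (rule emeasure_mono)
        show "point_of\<^sub>1 -` {x. x + c \<in> ?A} \<inter> space \<mu> \<in> sets \<mu>"
          by (rule measurable_sets[OF point_of_mu vimage_shift_borel]) simp
        have "x + c \<in> ?A" if "x + real n *\<^sub>R t\<^sub>1 \<in> A" for x
        proof -
          have a: "x + real n *\<^sub>R t\<^sub>1 + z \<in> A" using that periodicD[OF A(2) z(1)] by blast
          have "dist (x + real n *\<^sub>R t\<^sub>1 + z) (x + c) = dist (real n *\<^sub>R t\<^sub>1 + z) c"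
            unfolding dist_norm by (rule arg_cong[where f=norm]) (simp add: algebra_simps)
          then show ?thesis unfolding fatten_iff using z(2) by (intro bexI[OF _ a]) simp
        qed
        then show "point_of\<^sub>1 -` {x. x + real n *\<^sub>R t\<^sub>1 \<in> A} \<inter> space \<mu> \<subseteq> point_of\<^sub>1 -` {x. x + c \<in> ?A} \<inter> space \<mu>" by blast
      qed
      also have "\<dots> = (\<integral>\<^sup>+w. indicator (point_of\<^sub>1 -` {x. x + c \<in> ?A} \<inter> space \<mu>) w \<partial>\<mu>)"
        by (rule nn_integral_indicator[symmetric], rule measurable_sets[OF point_of_mu vimage_shift_borel]) simp
      also have "\<dots> = (\<integral>\<^sup>+w. indicator ?A (point_of\<^sub>1 w + c) \<partial>\<mu>)"
        by (intro nn_integral_cong) (auto simp: indicator_def)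
      finally show ?thesis .
    qed
    \<comment> \<open>The value does not depend on \<open>y\<close>: the unit square and the shifted
      \<open>RR\<^sub>1\<close> are both fundamental domains.\<close>
    have inner: "(\<integral>\<^sup>+c. indicator unit_square c * indicator ?A (y + c) \<partial>lborel) = emeasure lborel (RR\<^sub>1 \<inter> ?A)" for y
    proof -
      have m: "{c. c + y \<in> ?A} \<in> sets borel" by (rule vimage_shift_borel) simp
      have "(\<integral>\<^sup>+c. indicator unit_square c * indicator ?A (y + c) \<partial>lborel) = (\<integral>\<^sup>+c. indicator (unit_square \<inter> {c. c + y \<in> ?A}) c \<partial>lborel)"
        by (intro nn_integral_cong) (auto simp: indicator_def add.commute)
      also have "\<dots> = emeasure lborel (unit_square \<inter> {c. c + y \<in> ?A})" by (rule nn_integral_indicator) (use m in auto)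
      also have "\<dots> = emeasure lborel ({c. c + y \<in> RR\<^sub>1} \<inter> {c. c + y \<in> ?A})"
        by (rule fund_dom_eq[OF fund_dom_unit_square fund_dom_shift[OF fund_dom_RR[OF g u]] m periodic_shift[OF pA]])
      also have "\<dots> = emeasure lborel {c. c + y \<in> RR\<^sub>1 \<inter> ?A}" by (rule arg_cong[where f="emeasure lborel"]) auto
      also have "\<dots> = emeasure lborel (RR\<^sub>1 \<inter> ?A)" by (rule emeasure_shift) simp
      finally show ?thesis .
    qed
    have "?e = (\<integral>\<^sup>+c. indicator unit_square c * ?e \<partial>lborel)"
      by (simp add: nn_integral_multc emeasure_unit_square)
    also have "\<dots> \<le> (\<integral>\<^sup>+c. (\<integral>\<^sup>+w. indicator unit_square c * indicator ?A (point_of\<^sub>1 w + c) \<partial>\<mu>) \<partial>lborel)"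
    proof (rule nn_integral_mono)
      fix c :: "real^2"
      have "(\<integral>\<^sup>+w. indicator unit_square c * indicator ?A (point_of\<^sub>1 w + c) \<partial>\<mu>) = indicator unit_square c * (\<integral>\<^sup>+w. indicator ?A (point_of\<^sub>1 w + c) \<partial>\<mu>)"
        by (rule nn_integral_cmult) measurable
      then show "indicator unit_square c * ?e \<le> (\<integral>\<^sup>+w. indicator unit_square c * indicator ?A (point_of\<^sub>1 w + c) \<partial>\<mu>)"
        using 1[of c] by (simp add: mult_left_mono)
    qed
    also have "\<dots> = (\<integral>\<^sup>+w. (\<integral>\<^sup>+c. indicator unit_square c * indicator ?A (point_of\<^sub>1 w + c) \<partial>lborel) \<partial>\<mu>)"
      by (rule P.Fubini[of "\<lambda>(w, c). indicator unit_square c * indicator ?A (point_of\<^sub>1 w + c)", unfolded prod.case]) measurable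
    also have "\<dots> = emeasure lborel (RR\<^sub>1 \<inter> ?A)" unfolding inner by (simp add: emeasure_space_1)
    finally show ?thesis .
  qed
  let ?F = "\<lambda>n. RR\<^sub>1 \<inter> fatten (1 / real (Suc n)) A"
  have "(INF n. emeasure lborel (?F n)) = emeasure lborel (\<Inter>n. ?F n)"
  proof (rule INF_emeasure_decseq')
    show "?F n \<in> sets lborel" for n
      using RR_borel[OF g u] fatten_closed[OF A(1)] by (auto intro!: sets.Int borel_closed)
    show "decseq ?F"
      by (intro antimonoI Int_mono order_refl fatten_mono) (simp add: frac_le)
    have "emeasure lborel (?F 0) \<le> emeasure lborel RR\<^sub>1" by (rule emeasure_mono) auto
    then show "\<exists>i. emeasure lborel (?F i) \<noteq> \<infinity>" using emeasure_RR[OF g u] by (intro exI[of _ 0]) (auto simp: top_unique)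
  qed
  also have "(\<Inter>n. ?F n) = RR\<^sub>1 \<inter> A" using fatten_Inter[OF A(1)] by auto
  finally have e: "(INF n. emeasure lborel (?F n)) = emeasure lborel (RR\<^sub>1 \<inter> A)" .
  show ?thesis unfolding e[symmetric] by (rule INF_greatest) (rule le, simp)
qed

text \<open>Within \<open>RR\<^sub>1\<close>, saturating a compact subset under the lattice adds
  only points of the null overlap set.\<close>

lemma mu_compact_le:
  assumes F: "compact F"
  shows "emeasure \<mu> (point_of\<^sub>1 -` F \<inter> space \<mu>) \<le> emeasure lborel (RR\<^sub>1 \<inter> F)"
proof -
  let ?K = "RR\<^sub>1 \<inter> F"
  have K: "compact ?K" using compact_Int_closed[OF compact_RR[OF g u] compact_imp_closed[OF F]] .
  have "emeasure \<mu> (point_of\<^sub>1 -` F \<inter> space \<mu>) \<le> emeasure \<mu> (point_of\<^sub>1 -` saturation ?K \<inter> space \<mu>)"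
  proof (rule emeasure_mono)
    show "point_of\<^sub>1 -` F \<inter> space \<mu> \<subseteq> point_of\<^sub>1 -` saturation ?K \<inter> space \<mu>"
      using point_of_RR[OF g u] subsetD[OF saturation_superset[of ?K]] by (auto simp: space_mu)
    show "point_of\<^sub>1 -` saturation ?K \<inter> space \<mu> \<in> sets \<mu>"
      by (rule measurable_sets[OF point_of_mu]) (use saturation_closed[OF K] in auto)
  qed
  also have "\<dots> \<le> emeasure lborel (RR\<^sub>1 \<inter> saturation ?K)"
    by (rule mu_saturation_le[OF saturation_closed[OF K] saturation_periodic])
  also have "\<dots> \<le> emeasure lborel (?K \<union> overlap_set s (u 0))"
  proof (rule emeasure_mono)
    show "RR\<^sub>1 \<inter> saturation ?K \<subseteq> ?K \<union> overlap_set s (u 0)"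
    proof
      fix x assume x: "x \<in> RR\<^sub>1 \<inter> saturation ?K"
      then obtain z where z: "z \<in> integer_lattice" "x + z \<in> ?K" unfolding saturation_def by blast
      show "x \<in> ?K \<union> overlap_set s (u 0)"
      proof (cases "x \<in> overlap_set s (u 0)")
        case False
        then have "z = 0" using not_bad_unique_shift[OF g u False z(1)] x z(2) by blast
        then show ?thesis using z(2) by simp
      qed simp
    qed
    show "?K \<union> overlap_set s (u 0) \<in> sets lborel"
      using compact_imp_closed[OF K] bad_borel[OF g u] by auto
  qed
  also have "\<dots> \<le> emeasure lborel ?K + emeasure lborel (overlap_set s (u 0))"
    by (rule emeasure_subadditive) (use compact_imp_closed[OF K] bad_borel[OF g u] in auto)
  also have "\<dots> = emeasure lborel ?K" by (simp add: bad_null[OF g u])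
  finally show ?thesis .
qed

lemma mu_borel_le:
  assumes B: "B \<in> sets borel"
  shows "emeasure \<mu> (point_of\<^sub>1 -` B \<inter> space \<mu>) \<le> emeasure lborel (RR\<^sub>1 \<inter> B)"
proof -
  interpret prob_space \<mu> by (rule prob_mu)
  let ?M = "distr \<mu> borel point_of\<^sub>1"
  interpret D: prob_space ?M by (rule prob_space_distr[OF point_of_mu])
  have d: "emeasure ?M S = emeasure \<mu> (point_of\<^sub>1 -` S \<inter> space \<mu>)" if "S \<in> sets borel" for S
    by (rule emeasure_distr[OF point_of_mu that])
  have "emeasure ?M B = (SUP K \<in> {K. K \<subseteq> B \<and> compact K}. emeasure ?M K)"
    by (rule inner_regular) (use B in auto)
  also have "\<dots> \<le> emeasure lborel (RR\<^sub>1 \<inter> B)"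
  proof (rule SUP_least)
    fix K assume K: "K \<in> {K. K \<subseteq> B \<and> compact K}"
    have "emeasure ?M K = emeasure \<mu> (point_of\<^sub>1 -` K \<inter> space \<mu>)"
      by (rule d, rule borel_compact) (use K in blast)
    also have "\<dots> \<le> emeasure lborel (RR\<^sub>1 \<inter> K)" by (rule mu_compact_le) (use K in blast)
    also have "\<dots> \<le> emeasure lborel (RR\<^sub>1 \<inter> B)"
      by (rule emeasure_mono) (use K B RR_borel[OF g u] in auto)
    finally show "emeasure ?M K \<le> emeasure lborel (RR\<^sub>1 \<inter> B)" .
  qed
  finally show ?thesis using d[OF B] by simp
qed

text \<open>The upper bound holds for the part inside \<open>B\<close>, the part outside
  \<open>B\<close>, and the complement of the good points. The two measures have total mass 1, so no
  inequality can be strict.\<close>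

lemma mu_R0:
  assumes B: "B \<in> sets borel"
  shows "emeasure \<mu> (point_of\<^sub>1 -` (R0\<^sub>1 \<inter> B) \<inter> space \<mu>) = emeasure lborel (R0\<^sub>1 \<inter> B)"
proof -
  interpret prob_space \<mu> by (rule prob_mu)
  have R0b: "R0\<^sub>1 \<in> sets borel" by (rule R0_borel[OF g u])
  define f where "f S = emeasure \<mu> (point_of\<^sub>1 -` S \<inter> space \<mu>)" for S
  have le: "f S \<le> emeasure lborel (R0\<^sub>1 \<inter> S)" if "S \<in> sets borel" for S
    unfolding f_def emeasure_R0_Int[OF g u that] by (rule mu_borel_le[OF that])
  have m: "point_of\<^sub>1 -` S \<inter> space \<mu> \<in> sets \<mu>" if "S \<in> sets borel" for S
    by (rule measurable_sets[OF point_of_mu that])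
  let ?B1 = "R0\<^sub>1 \<inter> B" let ?B2 = "R0\<^sub>1 - B" let ?B3 = "- R0\<^sub>1"
  have b: "?B1 \<in> sets borel" "?B2 \<in> sets borel" "?B3 \<in> sets borel" using B R0b by auto
  have "1 = f UNIV" by (simp add: f_def emeasure_space_1)
  also have "\<dots> = f ?B1 + f ?B2 + f ?B3"
  proof -
    have "f UNIV = emeasure \<mu> ((point_of\<^sub>1 -` ?B1 \<inter> space \<mu>) \<union> (point_of\<^sub>1 -` ?B2 \<inter> space \<mu>) \<union> (point_of\<^sub>1 -` ?B3 \<inter> space \<mu>))"
      unfolding f_def by (rule arg_cong[where f="emeasure \<mu>"]) auto
    also have "\<dots> = emeasure \<mu> ((point_of\<^sub>1 -` ?B1 \<inter> space \<mu>) \<union> (point_of\<^sub>1 -` ?B2 \<inter> space \<mu>)) + f ?B3"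
      unfolding f_def by (rule plus_emeasure[symmetric], intro sets.Un m b, intro m b, blast)
    also have "emeasure \<mu> ((point_of\<^sub>1 -` ?B1 \<inter> space \<mu>) \<union> (point_of\<^sub>1 -` ?B2 \<inter> space \<mu>)) = f ?B1 + f ?B2"
      unfolding f_def by (rule plus_emeasure[symmetric], intro m b, intro m b, blast)
    finally show ?thesis .
  qed
  also have "f ?B3 = 0" using le[OF b(3)] by simp
  finally have 1: "1 = f ?B1 + f ?B2" by simp
  have 2: "1 = emeasure lborel ?B1 + emeasure lborel ?B2"
    using plus_emeasure[of ?B1 lborel ?B2] b emeasure_R0[OF g u] by (simp add: Int_Diff_Un Diff_Int_distrib2 Int_Diff_disjoint)
  have l1: "f ?B1 \<le> emeasure lborel ?B1" "f ?B2 \<le> emeasure lborel ?B2"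
    using le[OF b(1)] le[OF b(2)] by (simp_all add: Int_absorb1 Int_left_absorb Diff_subset)
  have "emeasure lborel ?B1 \<le> f ?B1"
  proof (rule ccontr)
    assume "\<not> ?thesis"
    then have "f ?B1 < emeasure lborel ?B1" by simp
    moreover have "f ?B2 \<noteq> \<infinity>" unfolding f_def by simp
    ultimately have "f ?B1 + f ?B2 < emeasure lborel ?B1 + f ?B2" by (metis add.commute ennreal_add_left_cancel_less infinity_ennreal_def)
    also have "\<dots> \<le> emeasure lborel ?B1 + emeasure lborel ?B2" by (intro add_left_mono l1(2))
    finally show False using 1 2 by simp
  qed
  then show ?thesis using l1(1) unfolding f_def by simp
qed

text \<open>The right-hand side does not involve \<open>\<mu>\<close>, so this determines the
  invariant measure.\<close>

lemma mu_eq: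
  assumes S: "S \<in> sets MX\<^sub>1"
  shows "emeasure \<mu> S = emeasure lborel (R0\<^sub>1 \<inter> coding_of s u -` S)"
proof -
  interpret prob_space \<mu> by (rule prob_mu)
  let ?B = "coding_of s u -` S \<inter> space (restrict_space borel R0\<^sub>1)"
  have "?B \<in> sets (restrict_space borel R0\<^sub>1)" by (rule measurable_sets[OF coding_of_measurable[OF g u] S])
  then have b: "?B \<in> sets borel" using R0_borel[OF g u] by (auto simp: sets_restrict_space_iff)
  have Be: "?B = R0\<^sub>1 \<inter> coding_of s u -` S" by (auto simp: space_restrict_space)
  have full: "emeasure \<mu> (point_of\<^sub>1 -` R0\<^sub>1 \<inter> space \<mu>) = 1"
    using mu_R0[of UNIV] emeasure_R0[OF g u] by simp
  have R0m: "point_of\<^sub>1 -` R0\<^sub>1 \<inter> space \<mu> \<in> sets \<mu>" by (rule measurable_sets[OF point_of_mu R0_borel[OF g u]])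
  have Sm: "S \<in> sets \<mu>" using S by (simp add: sets_mu)
  have n: "AE w in \<mu>. w \<in> point_of\<^sub>1 -` R0\<^sub>1 \<inter> space \<mu>"
    by (rule AE_in_set_eq_1[THEN iffD2, OF R0m]) (simp add: measure_def full)
  have "emeasure \<mu> S = emeasure \<mu> (S \<inter> (point_of\<^sub>1 -` R0\<^sub>1 \<inter> space \<mu>))"
    by (rule emeasure_eq_AE, use n in \<open>rule AE_mp\<close>) (use Sm R0m in auto)
  also have "S \<inter> (point_of\<^sub>1 -` R0\<^sub>1 \<inter> space \<mu>) = point_of\<^sub>1 -` (R0\<^sub>1 \<inter> ?B) \<inter> space \<mu>"
    unfolding Be using coding_of_point_of[OF g u] sets.sets_into_space[OF Sm] by (auto simp: space_mu)
  also have "emeasure \<mu> \<dots> = emeasure lborel (R0\<^sub>1 \<inter> ?B)" by (rule mu_R0[OF b])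
  also have "R0\<^sub>1 \<inter> ?B = R0\<^sub>1 \<inter> coding_of s u -` S" unfolding Be by blast
  finally show ?thesis .
qed

end

section \<open>Torus translation and natural coding\<close>

lemma torus_proj_eq_iff: "torus_proj x = torus_proj y \<longleftrightarrow> (\<exists>z\<in>integer_lattice. x + z = y)"
proof
  assume "torus_proj x = torus_proj y"
  moreover have "y + 0 \<in> torus_proj y" unfolding torus_proj_def by (rule imageI) (rule integer_lattice_simps)
  ultimately have "y \<in> torus_proj x" by simp
  then show "\<exists>z\<in>integer_lattice. x + z = y" unfolding torus_proj_def by auto
next
  assume "\<exists>z\<in>integer_lattice. x + z = y"
  then obtain z where z: "z \<in> integer_lattice" "y = x + z" by auto
  have "x + v \<in> (+) y ` integer_lattice" if "v \<in> integer_lattice" for v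
    by (rule image_eqI[of _ _ "v - z"]) (use z that in \<open>simp_all add: integer_lattice_simps\<close>)
  moreover have "y + v \<in> (+) x ` integer_lattice" if "v \<in> integer_lattice" for v
    by (rule image_eqI[of _ _ "z + v"]) (use z that in \<open>simp_all add: integer_lattice_simps add.assoc\<close>)
  ultimately show "torus_proj x = torus_proj y" unfolding torus_proj_def by blast
qed

lemma torus_proj_vimage_image: "torus_proj -` (torus_proj ` B) = saturation B"
proof -
  have "x \<in> torus_proj -` (torus_proj ` B) \<longleftrightarrow> (\<exists>b\<in>B. \<exists>z\<in>integer_lattice. x + z = b)" for x
    unfolding vimage_eq image_iff torus_proj_eq_iff ..
  then show ?thesis unfolding saturation_def by blast
qed

lemma torus_translation_proj: "torus_translation t (torus_proj x) = torus_proj (x + t)"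
proof -
  have "(+) t ` (+) x ` integer_lattice = (+) (x + t) ` integer_lattice"
    by (simp add: image_image add.assoc add.left_commute add.commute)
  then show ?thesis by (simp add: torus_translation_def torus_proj_def)
qed

lemma space_torus_algebra: "space torus_algebra = range torus_proj"
  by (simp add: torus_algebra_def space_measure_of_conv)

lemma torus_proj_measurable: "torus_proj \<in> measurable borel torus_algebra"
  unfolding torus_algebra_def by (rule measurable_measure_of) auto

lemma torus_algebraI: "A \<subseteq> range torus_proj \<Longrightarrow> torus_proj -` A \<in> sets borel \<Longrightarrow> A \<in> sets torus_algebra"
  unfolding torus_algebra_def by (subst sets_measure_of) auto

lemma torus_algebraD: "A \<in> sets torus_algebra \<Longrightarrow> torus_proj -` A \<in> sets borel"
  using measurable_sets[OF torus_proj_measurable, of A] by simp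

lemma torus_image: "B \<in> sets borel \<Longrightarrow> torus_proj ` B \<in> sets torus_algebra"
  by (rule torus_algebraI) (auto simp: torus_proj_vimage_image saturation_borel)

lemma sets_torus: "sets torus = sets torus_algebra"
  by (simp add: torus_def)

lemma space_torus: "space torus = range torus_proj"
  by (simp add: torus_def space_torus_algebra)

lemma periodic_proj: "periodic (torus_proj -` A)"
  unfolding periodic_def
proof clarsimp
  fix x z :: "real^2" assume "torus_proj x \<in> A" "z \<in> integer_lattice"
  moreover from this(2) have "torus_proj x = torus_proj (x + z)" unfolding torus_proj_eq_iff by blast
  ultimately show "torus_proj (x + z) \<in> A" by simp
qed

lemma emeasure_torus:
  assumes "C \<in> sets torus_algebra"
  shows "emeasure torus C = emeasure lborel (unit_square \<inter> torus_proj -` C)"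
proof -
  have u: "{x :: real^2. \<forall>i. 0 \<le> x $ i \<and> x $ i < 1} = unit_square" by (simp add: unit_square_def)
  have m: "torus_proj \<in> measurable (restrict_space lborel unit_square) torus_algebra"
    by (rule measurable_restrict_space1) (use torus_proj_measurable in simp)
  have "emeasure torus C = emeasure (restrict_space lborel unit_square) (torus_proj -` C \<inter> space (restrict_space lborel unit_square))"
    unfolding torus_def u by (rule emeasure_distr[OF m assms])
  also have "\<dots> = emeasure lborel (torus_proj -` C \<inter> space (restrict_space lborel unit_square))"
    by (rule emeasure_restrict_space) (auto simp: space_restrict_space unit_square_borel)
  also have "torus_proj -` C \<inter> space (restrict_space lborel unit_square) = unit_square \<inter> torus_proj -` C"
    by (auto simp: space_restrict_space)
  finally show ?thesis .
qed

context
  fixes s :: "subst stream" and u :: "nat \<Rightarrow> real^3"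
  assumes g: "good s" and u: "eigseq s u"
begin

private abbreviation (input) "r\<^sub>2 \<equiv> tile s (u 0)"
private abbreviation (input) "\<tau>\<^sub>2 \<equiv> tau (u 0)"
private abbreviation (input) "t\<^sub>2 \<equiv> tau (u 0) 1"
private abbreviation (input) "bad\<^sub>2 \<equiv> overlap_set s (u 0)"
private abbreviation (input) "RR\<^sub>2 \<equiv> RR s u"
private abbreviation (input) "R0\<^sub>2 \<equiv> good_pts s u"
private abbreviation (input) "X\<^sub>2 \<equiv> sadic_shift s"
private abbreviation (input) "MX\<^sub>2 \<equiv> restrict_space WS (sadic_shift s)"
private abbreviation (input) "point_of\<^sub>2 \<equiv> point_of s u"
private abbreviation (input) "coding_of\<^sub>2 \<equiv> coding_of s u"

lemma R0_unique_shift: "x \<in> R0\<^sub>2 \<Longrightarrow> x + z \<in> R0\<^sub>2 \<Longrightarrow> z \<in> integer_lattice \<Longrightarrow> z = 0"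
  using not_bad_unique_shift[OF g u R0_not_bad[OF g u]] R0_sub_RR[OF g u] by blast

lemma R0_Int_saturation: "B \<subseteq> R0\<^sub>2 \<Longrightarrow> R0\<^sub>2 \<inter> saturation B = B"
proof
  assume B: "B \<subseteq> R0\<^sub>2"
  show "R0\<^sub>2 \<inter> saturation B \<subseteq> B"
  proof
    fix x assume x: "x \<in> R0\<^sub>2 \<inter> saturation B"
    then obtain z where "z \<in> integer_lattice" "x + z \<in> B" unfolding saturation_def by blast
    moreover from this B x have "z = 0" using R0_unique_shift[of x z] by blast
    ultimately show "x \<in> B" by simp
  qed
  show "B \<subseteq> R0\<^sub>2 \<inter> saturation B" using B saturation_superset by blast
qed

lemma coding_of_vimage_borel: "S \<in> sets MX\<^sub>2 \<Longrightarrow> R0\<^sub>2 \<inter> coding_of\<^sub>2 -` S \<in> sets borel"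
proof -
  assume S: "S \<in> sets MX\<^sub>2"
  have "coding_of\<^sub>2 -` S \<inter> space (restrict_space borel R0\<^sub>2) \<in> sets (restrict_space borel R0\<^sub>2)"
    by (rule measurable_sets[OF coding_of_measurable[OF g u] S])
  moreover have "coding_of\<^sub>2 -` S \<inter> space (restrict_space borel R0\<^sub>2) = R0\<^sub>2 \<inter> coding_of\<^sub>2 -` S" by (auto simp: space_restrict_space)
  ultimately show ?thesis using R0_borel[OF g u] by (simp add: sets_restrict_space_iff)
qed

lemma stl_MX: "stl \<in> measurable MX\<^sub>2 MX\<^sub>2"
  by (rule measurable_restrict_space3) (use stl_X[OF g u] in auto)

text \<open>Lebesgue measure on the good points, carried to their codings; it supplies
  existence.\<close>

definition mu0 :: "letter stream measure" where
  "mu0 = distr (restrict_space lborel (good_pts s u)) (restrict_space WS (sadic_shift s)) (coding_of s u)"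

lemma coding_of_meas': "coding_of\<^sub>2 \<in> measurable (restrict_space lborel R0\<^sub>2) MX\<^sub>2"
proof -
  have "sets (restrict_space lborel R0\<^sub>2) = sets (restrict_space (borel :: (real^2) measure) R0\<^sub>2)"
    by (rule sets_restrict_space_cong) simp
  then show ?thesis using coding_of_measurable[OF g u] measurable_cong_sets by blast
qed

lemma emeasure_mu0: "S \<in> sets MX\<^sub>2 \<Longrightarrow> emeasure mu0 S = emeasure lborel (R0\<^sub>2 \<inter> coding_of\<^sub>2 -` S)"
proof -
  assume S: "S \<in> sets MX\<^sub>2"
  have "emeasure mu0 S = emeasure (restrict_space lborel R0\<^sub>2) (coding_of\<^sub>2 -` S \<inter> space (restrict_space lborel R0\<^sub>2))"
    unfolding mu0_def by (rule emeasure_distr[OF coding_of_meas' S])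
  also have "\<dots> = emeasure lborel (coding_of\<^sub>2 -` S \<inter> space (restrict_space lborel R0\<^sub>2))"
    by (rule emeasure_restrict_space) (use R0_borel[OF g u] in \<open>auto simp: space_restrict_space\<close>)
  also have "coding_of\<^sub>2 -` S \<inter> space (restrict_space lborel R0\<^sub>2) = R0\<^sub>2 \<inter> coding_of\<^sub>2 -` S" by (auto simp: space_restrict_space)
  finally show ?thesis .
qed

text \<open>Saturation turns a set of good points into a periodic one, for which the
  letter-dependent step is translation by \<open>t\<^sub>2\<close>. What remains is to compare the
  fundamental domain \<open>RR\<^sub>2\<close> with its translate.\<close>

lemma mu0_invariant: "shift_invariant_measure X\<^sub>2 mu0"
  unfolding shift_invariant_measure_def
proof (intro conjI)
  have sp: "space mu0 = X\<^sub>2" by (simp add: mu0_def space_restrict_space)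
  show sets: "sets mu0 = sets MX\<^sub>2" by (simp add: mu0_def)
  show "prob_space mu0"
  proof
    have "X\<^sub>2 \<in> sets MX\<^sub>2" using sets.top[of MX\<^sub>2] space_MX[OF g u] by simp
    then have "emeasure mu0 (space mu0) = emeasure lborel (R0\<^sub>2 \<inter> coding_of\<^sub>2 -` X\<^sub>2)" unfolding sp by (rule emeasure_mu0)
    also have "R0\<^sub>2 \<inter> coding_of\<^sub>2 -` X\<^sub>2 = R0\<^sub>2" using coding_of_X[OF g u] by blast
    finally show "emeasure mu0 (space mu0) = 1" using emeasure_R0[OF g u] by simp
  qed
  show st: "stl \<in> measurable mu0 mu0" using stl_MX measurable_cong_sets[OF sets sets] by blast
  show "distr mu0 mu0 stl = mu0"
  proof (rule measure_eqI)
    fix S assume "S \<in> sets (distr mu0 mu0 stl)"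
    then have S: "S \<in> sets MX\<^sub>2" by (simp add: sets)
    let ?B = "R0\<^sub>2 \<inter> coding_of\<^sub>2 -` S"
    have B: "?B \<in> sets borel" "?B \<subseteq> R0\<^sub>2" by (rule coding_of_vimage_borel[OF S]) auto
    have A: "{x. x + t\<^sub>2 \<in> saturation ?B} \<in> sets borel" "periodic {x. x + t\<^sub>2 \<in> saturation ?B}"
      by (rule vimage_shift_borel[OF saturation_borel[OF B(1)]], rule periodic_shift[OF saturation_periodic])
    have "stl -` S \<inter> space mu0 \<in> sets MX\<^sub>2" using measurable_sets[OF st, of S] S by (simp add: sets)
    have "emeasure (distr mu0 mu0 stl) S = emeasure mu0 (stl -` S \<inter> space mu0)"
      by (rule emeasure_distr[OF st]) (use S sets in simp)
    also have "\<dots> = emeasure lborel (R0\<^sub>2 \<inter> coding_of\<^sub>2 -` (stl -` S \<inter> space mu0))" by (rule emeasure_mu0) fact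
    also have "R0\<^sub>2 \<inter> coding_of\<^sub>2 -` (stl -` S \<inter> space mu0) = R0\<^sub>2 \<inter> {x. x + t\<^sub>2 \<in> saturation ?B}"
    proof -
      have "coding_of\<^sub>2 x \<in> stl -` S \<inter> space mu0 \<longleftrightarrow> x + t\<^sub>2 \<in> saturation ?B" if x: "x \<in> R0\<^sub>2" for x
      proof -
        let ?y = "x + \<tau>\<^sub>2 (shd (coding_of\<^sub>2 x))"
        have y: "?y \<in> R0\<^sub>2" "coding_of\<^sub>2 ?y = stl (coding_of\<^sub>2 x)" using coding_of_stl[OF g u x] by auto
        have "?y = (x + t\<^sub>2) + (\<tau>\<^sub>2 (shd (coding_of\<^sub>2 x)) - t\<^sub>2)" by simp
        then have "x + t\<^sub>2 \<in> saturation ?B \<longleftrightarrow> ?y \<in> saturation ?B" using periodicD[OF saturation_periodic tau_diff] by metis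
        also have "\<dots> \<longleftrightarrow> ?y \<in> ?B" using R0_Int_saturation[OF B(2)] y(1) by blast
        also have "\<dots> \<longleftrightarrow> stl (coding_of\<^sub>2 x) \<in> S" using y by simp
        also have "\<dots> \<longleftrightarrow> coding_of\<^sub>2 x \<in> stl -` S \<inter> space mu0" using coding_of_X[OF g u x] sp by simp
        finally show ?thesis by simp
      qed
      then show ?thesis by blast
    qed
    also have "emeasure lborel (R0\<^sub>2 \<inter> {x. x + t\<^sub>2 \<in> saturation ?B}) = emeasure lborel (RR\<^sub>2 \<inter> {x. x + t\<^sub>2 \<in> saturation ?B})"
      by (rule emeasure_R0_Int[OF g u A(1)])
    also have "\<dots> = emeasure lborel ({x. x + t\<^sub>2 \<in> RR\<^sub>2} \<inter> {x. x + t\<^sub>2 \<in> saturation ?B})"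
      by (rule fund_dom_eq[OF fund_dom_RR[OF g u] fund_dom_shift[OF fund_dom_RR[OF g u]] A])
    also have "{x. x + t\<^sub>2 \<in> RR\<^sub>2} \<inter> {x. x + t\<^sub>2 \<in> saturation ?B} = {x. x + t\<^sub>2 \<in> RR\<^sub>2 \<inter> saturation ?B}" by auto
    also have "emeasure lborel \<dots> = emeasure lborel (RR\<^sub>2 \<inter> saturation ?B)"
      by (rule emeasure_shift) (intro sets.Int RR_borel[OF g u] saturation_borel B)
    also have "\<dots> = emeasure lborel (R0\<^sub>2 \<inter> saturation ?B)" by (rule emeasure_R0_Int[OF g u saturation_borel[OF B(1)], symmetric])
    also have "\<dots> = emeasure mu0 S" unfolding R0_Int_saturation[OF B(2)] emeasure_mu0[OF S] ..
    finally show "emeasure (distr mu0 mu0 stl) S = emeasure mu0 S" .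
  qed simp
qed

lemma unique_invariant: "\<exists>!\<mu>. shift_invariant_measure X\<^sub>2 \<mu>"
proof (rule ex1I[of _ mu0])
  show "shift_invariant_measure X\<^sub>2 mu0" by (rule mu0_invariant)
  fix \<mu> assume m: "shift_invariant_measure X\<^sub>2 \<mu>"
  show "\<mu> = mu0"
  proof (rule measure_eqI)
    show "sets \<mu> = sets mu0" using sets_mu[OF g u m] by (simp add: mu0_def)
    fix S assume "S \<in> sets \<mu>"
    then have "S \<in> sets MX\<^sub>2" using sets_mu[OF g u m] by simp
    then show "emeasure \<mu> S = emeasure mu0 S" using mu_eq[OF g u m] emeasure_mu0 by simp
  qed
qed

text \<open>On the words whose point is good, the coded point determines the word; on the good
  points, \<open>torus_proj\<close> is injective. Both restrictions remove null sets, and both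
  remaining sets are mapped into themselves by the dynamics.\<close>

lemma conjugate:
  assumes m: "shift_invariant_measure X\<^sub>2 \<mu>"
  shows "measurably_conjugate \<mu> stl torus (torus_translation t\<^sub>2)"
proof -
  have smu: "sets \<mu> = sets MX\<^sub>2" and spmu: "space \<mu> = X\<^sub>2" by (rule sets_mu[OF g u m], rule space_mu[OF g u m])
  have xmm: "point_of\<^sub>2 \<in> borel_measurable \<mu>" by (rule point_of_mu[OF g u m])
  have R0b: "R0\<^sub>2 \<in> sets borel" by (rule R0_borel[OF g u])
  define M0 where "M0 = point_of\<^sub>2 -` R0\<^sub>2 \<inter> space \<mu>"
  define N0 where "N0 = torus_proj ` R0\<^sub>2"
  define \<phi> where "\<phi> = (\<lambda>w. torus_proj (point_of\<^sub>2 w))"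
  have M0: "M0 \<in> sets \<mu>" unfolding M0_def by (rule measurable_sets[OF xmm R0b])
  have N0: "N0 \<in> sets torus" unfolding N0_def sets_torus by (rule torus_image[OF R0b])
  have M0X: "w \<in> M0 \<longleftrightarrow> w \<in> X\<^sub>2 \<and> point_of\<^sub>2 w \<in> R0\<^sub>2" for w by (auto simp: M0_def spmu)
  have kM0: "coding_of\<^sub>2 x \<in> M0" if "x \<in> R0\<^sub>2" for x using that coding_of_X[OF g u that] point_of_coding_of[OF g u that] by (simp add: M0X)
  have M0null: "emeasure \<mu> (space \<mu> - M0) = 0"
  proof -
    have "space \<mu> - M0 \<in> sets MX\<^sub>2" using M0 smu by (metis sets.compl_sets)
    then have "emeasure \<mu> (space \<mu> - M0) = emeasure lborel (R0\<^sub>2 \<inter> coding_of\<^sub>2 -` (space \<mu> - M0))" by (rule mu_eq[OF g u m])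
    also have "R0\<^sub>2 \<inter> coding_of\<^sub>2 -` (space \<mu> - M0) = {}" using kM0 by blast
    finally show ?thesis by simp
  qed
  have stlM0: "stl ` M0 \<subseteq> M0"
  proof clarify
    fix w assume w: "w \<in> M0"
    then have k: "coding_of\<^sub>2 (point_of\<^sub>2 w) = w" using coding_of_point_of[OF g u] by (simp add: M0X)
    have "point_of\<^sub>2 w \<in> R0\<^sub>2" using w by (simp add: M0X)
    from coding_of_stl(1)[OF g u this] have "point_of\<^sub>2 w + \<tau>\<^sub>2 (shd w) \<in> R0\<^sub>2" by (simp add: k)
    then show "stl w \<in> M0" using w stl_X[OF g u] point_of_stl[OF g u] by (simp add: M0X)
  qed
  have N0null: "emeasure torus (space torus - N0) = 0"
  proof -
    have C: "space torus - N0 \<in> sets torus_algebra" using N0 unfolding sets_torus[symmetric] by blast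
    have "emeasure torus (space torus - N0) = emeasure lborel (unit_square \<inter> torus_proj -` (space torus - N0))"
      by (rule emeasure_torus[OF C])
    also have "\<dots> = emeasure lborel (RR\<^sub>2 \<inter> torus_proj -` (space torus - N0))"
      by (rule fund_dom_eq[OF fund_dom_unit_square fund_dom_RR[OF g u] torus_algebraD[OF C] periodic_proj])
    also have "\<dots> = emeasure lborel (R0\<^sub>2 \<inter> torus_proj -` (space torus - N0))"
      by (rule emeasure_R0_Int[OF g u torus_algebraD[OF C], symmetric])
    also have "R0\<^sub>2 \<inter> torus_proj -` (space torus - N0) = {}" by (auto simp: N0_def)
    finally show ?thesis by simp
  qed
  have tau_proj: "torus_proj (x + \<tau>\<^sub>2 i) = torus_translation t\<^sub>2 (torus_proj x)" for x i
  proof -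
    have "(x + t\<^sub>2) + (\<tau>\<^sub>2 i - t\<^sub>2) = x + \<tau>\<^sub>2 i" by simp
    then have "torus_proj (x + t\<^sub>2) = torus_proj (x + \<tau>\<^sub>2 i)" unfolding torus_proj_eq_iff using tau_diff by blast
    then show ?thesis by (simp add: torus_translation_proj)
  qed
  have equi: "\<phi> (stl w) = torus_translation t\<^sub>2 (\<phi> w)" if "w \<in> M0" for w
    using that point_of_stl[OF g u] tau_proj by (simp add: M0X \<phi>_def)
  have N0inv: "torus_translation t\<^sub>2 ` N0 \<subseteq> N0"
  proof clarify
    fix C assume "C \<in> N0"
    then obtain x where x: "x \<in> R0\<^sub>2" "C = torus_proj x" by (auto simp: N0_def)
    have "torus_translation t\<^sub>2 C = torus_proj (x + \<tau>\<^sub>2 (shd (coding_of\<^sub>2 x)))" using tau_proj x(2) by simp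
    then show "torus_translation t\<^sub>2 C \<in> N0" using coding_of_stl(1)[OF g u x(1)] by (simp add: N0_def)
  qed
  have projinj: "x = y" if xy: "x \<in> R0\<^sub>2" "y \<in> R0\<^sub>2" and e: "torus_proj x = torus_proj y" for x y
  proof -
    obtain z where "z \<in> integer_lattice" "x + z = y" using e unfolding torus_proj_eq_iff by blast
    then show ?thesis using R0_unique_shift[of x z] xy by auto
  qed
  have phik: "\<phi> (coding_of\<^sub>2 x) = torus_proj x" if "x \<in> R0\<^sub>2" for x using point_of_coding_of[OF g u that] by (simp add: \<phi>_def)
  have inj: "inj_on \<phi> M0"
  proof (rule inj_onI)
    fix v w assume vw: "v \<in> M0" "w \<in> M0" "\<phi> v = \<phi> w"
    have v: "v \<in> X\<^sub>2" "point_of\<^sub>2 v \<in> R0\<^sub>2" and w: "w \<in> X\<^sub>2" "point_of\<^sub>2 w \<in> R0\<^sub>2" using vw(1,2) by (simp_all add: M0X)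
    have "point_of\<^sub>2 v = point_of\<^sub>2 w" by (rule projinj[OF v(2) w(2)]) (use vw(3) in \<open>simp only: \<phi>_def\<close>)
    then show "v = w" using coding_of_point_of[OF g u v] coding_of_point_of[OF g u w] by argo
  qed
  have img: "\<phi> ` M0 = N0"
  proof
    show "\<phi> ` M0 \<subseteq> N0" by (auto simp: \<phi>_def N0_def M0X)
    show "N0 \<subseteq> \<phi> ` M0"
    proof
      fix C assume "C \<in> N0"
      then obtain x where x: "x \<in> R0\<^sub>2" "C = torus_proj x" by (auto simp: N0_def)
      show "C \<in> \<phi> ` M0" by (rule image_eqI[of _ _ "coding_of\<^sub>2 x"]) (use x phik kM0 in auto)
    qed
  qed
  have bij: "bij_betw \<phi> M0 N0" using inj img by (simp add: bij_betw_def)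
  have phim: "\<phi> \<in> measurable \<mu> torus"
    unfolding \<phi>_def measurable_cong_sets[OF refl sets_torus] by (rule measurable_compose[OF xmm torus_proj_measurable])
  have m1: "\<phi> \<in> measurable (restrict_space \<mu> M0) (restrict_space torus N0)"
    by (rule measurable_restrict_space3[OF phim]) (use img in auto)
  have inv: "the_inv_into M0 \<phi> (torus_proj x) = coding_of\<^sub>2 x" if "x \<in> R0\<^sub>2" for x
    using the_inv_into_f_eq[OF inj phik[OF that] kM0[OF that]] .
  have m2: "the_inv_into M0 \<phi> \<in> measurable (restrict_space torus N0) (restrict_space \<mu> M0)"
  proof (rule measurableI)
    fix C assume "C \<in> space (restrict_space torus N0)"
    then obtain x where x: "x \<in> R0\<^sub>2" "C = torus_proj x" by (auto simp: space_restrict_space N0_def)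
    then show "the_inv_into M0 \<phi> C \<in> space (restrict_space \<mu> M0)"
      using inv[OF x(1)] kM0[OF x(1)] sets.sets_into_space[OF M0] by (auto simp: space_restrict_space)
  next
    fix S assume "S \<in> sets (restrict_space \<mu> M0)"
    then obtain S' where S': "S' \<in> sets MX\<^sub>2" "S = M0 \<inter> S'" by (auto simp: sets_restrict_space smu)
    have B: "R0\<^sub>2 \<inter> coding_of\<^sub>2 -` S' \<in> sets borel" by (rule coding_of_vimage_borel[OF S'(1)])
    have "the_inv_into M0 \<phi> -` S \<inter> space (restrict_space torus N0) = torus_proj ` (R0\<^sub>2 \<inter> coding_of\<^sub>2 -` S')"
    proof
      show "the_inv_into M0 \<phi> -` S \<inter> space (restrict_space torus N0) \<subseteq> torus_proj ` (R0\<^sub>2 \<inter> coding_of\<^sub>2 -` S')"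
        using inv by (auto simp: space_restrict_space N0_def S'(2))
      show "torus_proj ` (R0\<^sub>2 \<inter> coding_of\<^sub>2 -` S') \<subseteq> the_inv_into M0 \<phi> -` S \<inter> space (restrict_space torus N0)"
        using inv kM0 by (auto simp: space_restrict_space N0_def S'(2) space_torus)
    qed
    also have "\<dots> \<in> sets (restrict_space torus N0)"
      unfolding sets_restrict_space
      by (rule image_eqI[of _ _ "torus_proj ` (R0\<^sub>2 \<inter> coding_of\<^sub>2 -` S')"]) (use torus_image[OF B] in \<open>auto simp: N0_def sets_torus\<close>)
    finally show "the_inv_into M0 \<phi> -` S \<inter> space (restrict_space torus N0) \<in> sets (restrict_space torus N0)" .
  qed
  have d: "distr (restrict_space \<mu> M0) (restrict_space torus N0) \<phi> = restrict_space torus N0"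
  proof (rule measure_eqI)
    fix C assume "C \<in> sets (distr (restrict_space \<mu> M0) (restrict_space torus N0) \<phi>)"
    then have C: "C \<in> sets (restrict_space torus N0)" by simp
    then have Ct: "C \<in> sets torus" "C \<subseteq> N0" using N0 by (auto simp: sets_restrict_space_iff sets_restrict_space)
    have P: "torus_proj -` C \<in> sets borel" using torus_algebraD Ct(1) sets_torus by simp
    have sub: "\<phi> -` C \<inter> space (restrict_space \<mu> M0) = \<phi> -` C \<inter> M0"
      using sets.sets_into_space[OF M0] by (auto simp: space_restrict_space)
    have pm: "\<phi> -` C \<inter> M0 \<in> sets MX\<^sub>2"
    proof -
      have "\<phi> -` C \<inter> M0 = (\<phi> -` C \<inter> space \<mu>) \<inter> M0" using sets.sets_into_space[OF M0] by blast
      then show ?thesis using measurable_sets[OF phim Ct(1)] M0 smu by (metis sets.Int)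
    qed
    have "emeasure (distr (restrict_space \<mu> M0) (restrict_space torus N0) \<phi>) C = emeasure (restrict_space \<mu> M0) (\<phi> -` C \<inter> M0)"
      unfolding emeasure_distr[OF m1 C] sub ..
    also have "\<dots> = emeasure \<mu> (\<phi> -` C \<inter> M0)" by (rule emeasure_restrict_space) (use M0 in auto)
    also have "\<dots> = emeasure lborel (R0\<^sub>2 \<inter> coding_of\<^sub>2 -` (\<phi> -` C \<inter> M0))" by (rule mu_eq[OF g u m pm])
    also have "R0\<^sub>2 \<inter> coding_of\<^sub>2 -` (\<phi> -` C \<inter> M0) = R0\<^sub>2 \<inter> torus_proj -` C" using phik kM0 by auto
    also have "emeasure lborel \<dots> = emeasure lborel (RR\<^sub>2 \<inter> torus_proj -` C)" by (rule emeasure_R0_Int[OF g u P])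
    also have "\<dots> = emeasure lborel (unit_square \<inter> torus_proj -` C)" by (rule fund_dom_eq[OF fund_dom_RR[OF g u] fund_dom_unit_square P periodic_proj])
    also have "\<dots> = emeasure torus C" by (rule emeasure_torus[symmetric]) (use Ct sets_torus in simp)
    also have "\<dots> = emeasure (restrict_space torus N0) C" by (rule emeasure_restrict_space[symmetric]) (use N0 Ct in auto)
    finally show "emeasure (distr (restrict_space \<mu> M0) (restrict_space torus N0) \<phi>) C = emeasure (restrict_space torus N0) C" .
  qed simp
  show ?thesis unfolding measurably_conjugate_def
    by (rule exI[of _ M0], rule exI[of _ N0], rule exI[of _ \<phi>])
      (use M0 M0null stlM0 N0 N0null N0inv bij m1 m2 d equi in blast)
qed

lemma full_rank_integer_lattice: "full_rank_lattice (integer_lattice :: (real^2) set)"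
  unfolding full_rank_lattice_def
proof (intro exI[of _ Basis] conjI)
  show "independent (Basis :: (real^2) set)" by (rule independent_Basis)
  show "span (Basis :: (real^2) set) = UNIV" by (rule span_Basis)
  have s: "(\<Sum>b\<in>Basis. real_of_int (c b) *\<^sub>R b) $ i = real_of_int (c (axis i 1))" for c and i :: 2
  proof -
    have "(\<Sum>b\<in>Basis. real_of_int (c b) *\<^sub>R b) $ i = (\<Sum>b\<in>Basis. real_of_int (c b) *\<^sub>R b) \<bullet> axis i 1"
      by (simp add: inner_axis)
    also have "\<dots> = real_of_int (c (axis i 1))"
      by (subst inner_sum_left_Basis) (auto simp: axis_in_Basis_iff)
    finally show ?thesis .
  qed
  show "integer_lattice = {\<Sum>b\<in>(Basis :: (real^2) set). real_of_int (c b) *\<^sub>R b |c. True}"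
  proof
    show "integer_lattice \<subseteq> {\<Sum>b\<in>(Basis :: (real^2) set). real_of_int (c b) *\<^sub>R b |c. True}"
    proof
      fix x :: "real^2" assume "x \<in> integer_lattice"
      then have x: "of_int \<lfloor>x $ i\<rfloor> = x $ i" for i by (auto simp: integer_lattice_def elim: Ints_cases)
      have "x = (\<Sum>b\<in>Basis. real_of_int \<lfloor>x \<bullet> b\<rfloor> *\<^sub>R b)"
        unfolding vec_eq_iff s by (simp add: inner_axis x)
      then show "x \<in> {\<Sum>b\<in>Basis. real_of_int (c b) *\<^sub>R b |c. True}"
        by (intro CollectI exI[of _ "\<lambda>b. \<lfloor>x \<bullet> b\<rfloor>"]) simp
    qed
    show "{\<Sum>b\<in>(Basis :: (real^2) set). real_of_int (c b) *\<^sub>R b |c. True} \<subseteq> integer_lattice"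
      unfolding integer_lattice_def using s by force
  qed
qed

lemma coding_partition: "natural_partition integer_lattice t\<^sub>2 RR\<^sub>2 r\<^sub>2 \<tau>\<^sub>2"
  unfolding natural_partition_def
proof (intro conjI allI)
  show "full_rank_lattice (integer_lattice :: (real^2) set)" by (rule full_rank_integer_lattice)
  show "fundamental_domain integer_lattice RR\<^sub>2"
    using fund_dom_RR[OF g u] by (simp add: fund_dom_def fundamental_domain_def)
  show "compact (r\<^sub>2 i)" for i by (rule compact_tile[OF g u])
  show "closure (interior (r\<^sub>2 i)) = r\<^sub>2 i" for i by (rule closure_interior_tile[OF g u])
  show "RR\<^sub>2 = (\<Union>i. r\<^sub>2 i)" by (rule RR_def[OF g u])
  show "AE x in lborel. x \<in> RR\<^sub>2 \<longrightarrow> (\<exists>!i. x \<in> r\<^sub>2 i)"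
    using AE_not_bad[OF g u, of 0]
  proof (rule AE_mp, intro AE_I2 impI)
    fix x assume "x + 0 \<notin> bad\<^sub>2" "x \<in> RR\<^sub>2"
    then show "\<exists>!i. x \<in> r\<^sub>2 i" using not_bad_unique_letter[OF g u, of x] RR_iff[OF g u, of x] by auto
  qed
  show "AE x in lborel. x \<in> r\<^sub>2 i \<longrightarrow> induced_translation integer_lattice RR\<^sub>2 t\<^sub>2 x = x + \<tau>\<^sub>2 i" for i
    \<comment> \<open>Keeping \<open>x + t\<^sub>2\<close> off the overlap set makes its
      representative in \<open>RR\<^sub>2\<close> unique, so the definite description is resolved by
      \<open>r_tau\<close>.\<close>
    using AE_not_bad[OF g u, of t\<^sub>2]
  proof (rule AE_mp, intro AE_I2 impI)
    fix x assume nb: "x + t\<^sub>2 \<notin> bad\<^sub>2" and x: "x \<in> r\<^sub>2 i"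
    have in1: "x + \<tau>\<^sub>2 i \<in> RR\<^sub>2" by (rule r_tau[OF g u x])
    have d1: "(x + \<tau>\<^sub>2 i) - (x + t\<^sub>2) \<in> integer_lattice" using tau_diff[of "u 0" i 1] by simp
    show "induced_translation integer_lattice RR\<^sub>2 t\<^sub>2 x = x + \<tau>\<^sub>2 i"
      unfolding induced_translation_def
    proof (rule the_equality)
      show "x + \<tau>\<^sub>2 i \<in> RR\<^sub>2 \<and> x + \<tau>\<^sub>2 i - (x + t\<^sub>2) \<in> integer_lattice" using in1 d1 by blast
      fix y assume y: "y \<in> RR\<^sub>2 \<and> y - (x + t\<^sub>2) \<in> integer_lattice"
      obtain a b where "(x + t\<^sub>2) + (y - (x + t\<^sub>2)) \<in> r\<^sub>2 a" "(x + t\<^sub>2) + ((x + \<tau>\<^sub>2 i) - (x + t\<^sub>2)) \<in> r\<^sub>2 b"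
        using y in1 RR_iff[OF g u] by auto
      then have "y - (x + t\<^sub>2) = (x + \<tau>\<^sub>2 i) - (x + t\<^sub>2)" using not_bad_unique[OF g u nb] y d1 by blast
      then show "y = x + \<tau>\<^sub>2 i" by (metis diff_add_cancel)
    qed
  qed
qed

lemma natural_codings_sadic: "natural_codings integer_lattice t\<^sub>2 X\<^sub>2"
  unfolding natural_codings_def
proof (rule exI[of _ RR\<^sub>2], rule exI[of _ r\<^sub>2], rule exI[of _ \<tau>\<^sub>2], intro conjI coding_partition ballI)
  fix w assume "w \<in> X\<^sub>2"
  then show "\<exists>x\<in>RR\<^sub>2. is_coding r\<^sub>2 \<tau>\<^sub>2 x w" using X_coded[OF g u] by blast
qed

end

section \<open>Tiling of the plane\<close>

lemma coord_sum_ones: "x \<bullet> ones = coord_sum x"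
  by (simp add: inner_vec_def ones_def coord_sum_def sum_3)

lemma proj_ones_plane_proj: assumes "coord_sum v \<noteq> 0" shows "proj_ones v x = plane_emb (plane_proj v x)"
  using plane_proj_decomp[OF assms, of x] by (simp add: proj_ones_def coord_sum_ones algebra_simps)

lemma inj_plane_emb: "inj plane_emb"
  by (rule inj_on_inverseI[of _ "\<lambda>x. plane_proj ones x"]) simp

lemma plane_emb_add: "plane_emb (x + y) = plane_emb x + plane_emb y"
  using linear_plane_emb by (rule linear_add)

lemma ones_perp_plane_emb: "ones_perp = range plane_emb"
proof
  show "range plane_emb \<subseteq> ones_perp" by (auto simp: ones_perp_def coord_sum_ones coord_sum_def)
  show "ones_perp \<subseteq> range plane_emb"
  proof
    fix x assume "x \<in> ones_perp"
    then have "x = plane_emb (vector [x $ 1, x $ 2])" by (simp add: ones_perp_def coord_sum_ones coord_sum_def vec_eq_iff forall_3)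
    then show "x \<in> range plane_emb" by blast
  qed
qed

lemma integer_lattice_plane_emb: "integer_lattice \<inter> ones_perp = plane_emb ` integer_lattice"
proof
  show "plane_emb ` integer_lattice \<subseteq> integer_lattice \<inter> ones_perp"
    by (auto simp: ones_perp_plane_emb integer_lattice_def forall_3)
  show "integer_lattice \<inter> ones_perp \<subseteq> plane_emb ` integer_lattice"
  proof
    fix x assume x: "x \<in> integer_lattice \<inter> ones_perp"
    then obtain y where y: "x = plane_emb y" by (auto simp: ones_perp_plane_emb)
    have "x $ 1 \<in> \<int>" "x $ 2 \<in> \<int>" using x by (simp_all add: integer_lattice_def)
    then have "y \<in> integer_lattice" by (simp add: y integer_lattice_def forall_2)
    then show "x \<in> plane_emb ` integer_lattice" using y by blast
  qed
qed

lemma closure_plane_emb_image: "closure (plane_emb ` A) = plane_emb ` closure A"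
  using closure_injective_linear_image[OF linear_plane_emb inj_plane_emb, of A] by simp

lemma continuous_on_plane_emb: "continuous_on A plane_emb"
  by (rule linear_continuous_on) (simp add: linear_plane_emb linear_linear)

lemma continuous_on_plane_proj: "continuous_on A (plane_proj v)"
  by (rule linear_continuous_on) (simp add: linear_plane_proj linear_linear)

lemma plane_emb_image_regular:
  assumes "closure (interior A) = A"
  shows "closure (top_of_set ones_perp interior_of (plane_emb ` A)) = plane_emb ` A"
proof
  have o: "openin (top_of_set ones_perp) (plane_emb ` interior A)"
  proof -
    have "plane_emb ` interior A = ones_perp \<inter> plane_proj ones -` interior A"
    proof (unfold ones_perp_plane_emb, intro equalityI subsetI)
      fix x assume "x \<in> range plane_emb \<inter> plane_proj ones -` interior A"
      then obtain y where y: "x = plane_emb y" "plane_proj ones (plane_emb y) \<in> interior A" by blast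
      then show "x \<in> plane_emb ` interior A" using plane_proj_plane_emb[of ones y] by auto
    qed auto
    moreover have "open (plane_proj ones -` interior A)"
      by (rule open_vimage) (simp_all add: continuous_on_plane_proj)
    ultimately show ?thesis by (metis openin_open)
  qed
  have "plane_emb ` interior A \<subseteq> top_of_set ones_perp interior_of (plane_emb ` A)"
    by (rule interior_of_maximal[OF _ o]) (use interior_subset in blast)
  then have "closure (plane_emb ` interior A) \<subseteq> closure (top_of_set ones_perp interior_of (plane_emb ` A))" by (rule closure_mono)
  then show "plane_emb ` A \<subseteq> closure (top_of_set ones_perp interior_of (plane_emb ` A))" by (simp add: closure_plane_emb_image assms)
  have "closed A" by (metis assms closed_closure)
  then have "closed (plane_emb ` A)" using closure_plane_emb_image[of A] by (metis closure_closed closed_closure)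
  then show "closure (top_of_set ones_perp interior_of (plane_emb ` A)) \<subseteq> plane_emb ` A"
    by (intro closure_minimal interior_of_subset)
qed

context
  fixes s :: "subst stream" and u :: "nat \<Rightarrow> real^3"
  assumes g: "good s" and u: "eigseq s u"
begin

private abbreviation (input) "r\<^sub>3 \<equiv> tile s (u 0)"
private abbreviation (input) "bad\<^sub>3 \<equiv> overlap_set s (u 0)"

lemma rauzy_fractal_plane_emb: "rauzy_fractal s (u 0) i = plane_emb ` r\<^sub>3 i"
proof -
  have coord_sum: "coord_sum (u 0) \<noteq> 0" using coord_sum_pos[OF eigseq_pos[OF u, of 0]] by simp
  have "{proj_ones (u 0) (abelian p) | p. \<exists>w. limit_word s w \<and> stake (Suc (length p)) w = p @ [i]} =
      plane_emb ` (\<lambda>p. plane_proj (u 0) (abelian p)) ` pre s i"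
    unfolding pre_limit_word[OF good_AR[OF g] good_blocks_recur[OF g], symmetric] proj_ones_plane_proj[OF coord_sum] by blast
  then show ?thesis by (simp add: rauzy_fractal_def tile_def closure_plane_emb_image)
qed

lemma translated_fractal:
  "(+) (plane_emb z) ` rauzy_fractal s (u 0) i = plane_emb ` ((+) z ` r\<^sub>3 i)"
  by (simp add: rauzy_fractal_plane_emb image_image plane_emb_add)

lemma rauzy_collection_plane_emb:
  "rauzy_collection s (u 0) = {plane_emb ` ((+) z ` r\<^sub>3 i) | z i. z \<in> integer_lattice}"
  unfolding rauzy_collection_def integer_lattice_plane_emb
proof (intro equalityI subsetI)
  fix C assume "C \<in> {(+) x ` rauzy_fractal s (u 0) i |x i. x \<in> plane_emb ` integer_lattice}"
  then obtain z i where "z \<in> integer_lattice" "C = (+) (plane_emb z) ` rauzy_fractal s (u 0) i" by auto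
  then show "C \<in> {plane_emb ` ((+) z ` r\<^sub>3 i) | z i. z \<in> integer_lattice}" unfolding translated_fractal by blast
next
  fix C assume "C \<in> {plane_emb ` ((+) z ` r\<^sub>3 i) | z i. z \<in> integer_lattice}"
  then obtain z i where "z \<in> integer_lattice" "C = (+) (plane_emb z) ` rauzy_fractal s (u 0) i"
    unfolding translated_fractal by blast
  then show "C \<in> {(+) x ` rauzy_fractal s (u 0) i |x i. x \<in> plane_emb ` integer_lattice}" by auto
qed

theorem tiling: "tiling_ones_perp (rauzy_collection s (u 0))"
  unfolding tiling_ones_perp_def
proof (intro conjI ballI)
  fix C assume "C \<in> rauzy_collection s (u 0)"
  then obtain z i where z: "C = plane_emb ` ((+) z ` r\<^sub>3 i)" unfolding rauzy_collection_plane_emb by blast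
  show "C \<subseteq> ones_perp" by (auto simp: z ones_perp_plane_emb)
  show "compact C" unfolding z
    by (intro compact_continuous_image continuous_on_plane_emb compact_translation compact_tile[OF g u])
  show "closure (top_of_set ones_perp interior_of C) = C" unfolding z
  proof (rule plane_emb_image_regular)
    show "closure (interior ((+) z ` r\<^sub>3 i)) = (+) z ` r\<^sub>3 i"
      by (simp add: interior_translation closure_translation closure_interior_tile[OF g u])
  qed
next
  let ?P = "\<lambda>x. \<exists>!C. C \<in> rauzy_collection s (u 0) \<and> x \<in> C"
  have P: "?P (plane_emb y)" if y: "y \<notin> bad\<^sub>3" for y
  proof -
    obtain z i where z: "z \<in> integer_lattice" "y + z \<in> r\<^sub>3 i"
      using covering[OF g u, of y] unfolding RR_iff[OF g u] by blast
    have mem: "plane_emb y \<in> plane_emb ` ((+) z' ` r\<^sub>3 j) \<longleftrightarrow> y + (- z') \<in> r\<^sub>3 j" for z' j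
    proof -
      have "plane_emb y \<in> plane_emb ` ((+) z' ` r\<^sub>3 j) \<longleftrightarrow> y \<in> (+) z' ` r\<^sub>3 j" by (rule inj_image_mem_iff[OF inj_plane_emb])
      also have "\<dots> \<longleftrightarrow> y + (- z') \<in> r\<^sub>3 j" by (auto simp: image_iff intro!: bexI[of _ "y - z'"])
      finally show ?thesis .
    qed
    have mz: "- w \<in> integer_lattice" if "w \<in> integer_lattice" for w :: "real^2" using that by (simp add: integer_lattice_simps)
    show ?thesis
    proof (rule ex1I[of _ "plane_emb ` ((+) (- z) ` r\<^sub>3 i)"], intro conjI)
      show "plane_emb ` ((+) (- z) ` r\<^sub>3 i) \<in> rauzy_collection s (u 0)"
        unfolding rauzy_collection_plane_emb using mz[OF z(1)] by blast
      show "plane_emb y \<in> plane_emb ` ((+) (- z) ` r\<^sub>3 i)" using z(2) mem[of "- z" i] by simp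
    next
      fix C assume C: "C \<in> rauzy_collection s (u 0) \<and> plane_emb y \<in> C"
      then obtain z' j where z': "z' \<in> integer_lattice" "C = plane_emb ` ((+) z' ` r\<^sub>3 j)" unfolding rauzy_collection_plane_emb by blast
      then have "y + (- z') \<in> r\<^sub>3 j" using C mem by blast
      from not_bad_unique[OF g u y mz[OF z'(1)] z(1) this z(2)] have "z' = - z" "j = i" by auto
      then show "C = plane_emb ` ((+) (- z) ` r\<^sub>3 i)" using z'(2) by simp
    qed
  qed
  have m: "plane_emb \<in> borel_measurable borel" by (rule borel_measurable_continuous_onI[OF continuous_on_plane_emb])
  \<comment> \<open>The exceptional set is written as a preimage under the projection, so that it is
    Borel in space; points off the plane are excluded as well, since the measure lives on the
    plane.\<close>
  have "AE x in ones_perp_measure. x \<notin> {x. plane_proj ones x \<in> bad\<^sub>3} \<union> - ones_perp"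
    unfolding ones_perp_measure_def plane_emb_def[abs_def, symmetric]
  proof (subst AE_distr_iff)
    show "plane_emb \<in> measurable lborel borel" using m by simp
    have cl: "closed ones_perp" unfolding ones_perp_def by (rule closed_Collect_eq) (auto intro!: continuous_intros)
    have pm: "plane_proj ones \<in> borel_measurable borel"
      by (rule borel_measurable_continuous_onI[OF continuous_on_plane_proj])
    have "{x. plane_proj ones x \<in> bad\<^sub>3} \<in> sets (borel :: (real^3) measure)"
      using measurable_sets[OF pm bad_borel[OF g u]] by (simp add: vimage_def)
    then have "- ({x. plane_proj ones x \<in> bad\<^sub>3} \<union> - ones_perp) \<in> sets (borel :: (real^3) measure)"
      using borel_closed[OF cl] by (intro borel_comp sets.Un) simp_all
    then show "{x \<in> space borel. x \<notin> {x. plane_proj ones x \<in> bad\<^sub>3} \<union> - ones_perp} \<in> sets (borel :: (real^3) measure)"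
      by (simp add: Compl_eq)
    show "AE x in lborel. plane_emb x \<notin> {x. plane_proj ones x \<in> bad\<^sub>3} \<union> - ones_perp"
      using AE_not_bad[OF g u, of 0] by (rule AE_mp, intro AE_I2) (auto simp: ones_perp_plane_emb)
  qed
  then show "AE x in ones_perp_measure. ?P x"
  proof (rule AE_mp, intro AE_I2 impI)
    fix x :: "real^3" assume x: "x \<notin> {x. plane_proj ones x \<in> bad\<^sub>3} \<union> - ones_perp"
    then obtain y where y: "x = plane_emb y" by (auto simp: ones_perp_plane_emb)
    have "y \<notin> bad\<^sub>3" using x y by simp
    then show "?P x" unfolding y by (rule P)
  qed
qed

end

section \<open>Generalized right eigenvectors\<close>

abbreviation (input) orthant :: "(real^3) set" where
  "orthant \<equiv> {x. \<forall>i. x $ i \<ge> 0}"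

lemma coord_sum_block_mat_ge: "AR_dir s \<Longrightarrow> x \<in> orthant \<Longrightarrow> coord_sum x \<le> coord_sum (block_mat s n x)"
proof (induction n arbitrary: x)
  case (Suc n)
  have p: "x $ i \<ge> 0" for i using Suc.prems(2) by simp
  have "coord_sum x \<le> coord_sum (AR_mat (dir_letter s n) x)"
    using exhaust_3[of "dir_letter s n"] p[of 1] p[of 2] p[of 3] by (elim disjE) (simp_all add: coord_sum_def)
  also have "\<dots> \<le> coord_sum (block_mat s n (AR_mat (dir_letter s n) x))"
    by (rule Suc.IH[OF Suc.prems(1)]) (use p[of 1] p[of 2] p[of 3] p in auto)
  finally show ?case by (simp only: block_mat_Suc[OF Suc.prems(1)])
qed simp

text \<open>A vector \<open>z\<close> in all cones satisfies, for every \<open>y\<close> orthogonal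
  to \<open>u 0\<close>, a bound on \<open>\<bar>z \<bullet> y\<bar>\<close> by a multiple of
  \<open>contr_bound s n\<close>, because its nonnegative preimages have coordinate sum at most that
  of \<open>z\<close>. So \<open>z\<close> is a multiple of \<open>u 0\<close>.\<close>

lemma eigseq_cone:
  assumes s: "AR_dir s" and i: "blocks_recur s" and u: "eigseq s u"
  shows "(\<Inter>n. block_mat s n ` orthant) = {c *\<^sub>R u 0 | c. c \<ge> 0}"
proof (intro equalityI subsetI)
  fix v assume "v \<in> {c *\<^sub>R u 0 | c. c \<ge> 0}"
  then obtain c where c: "v = c *\<^sub>R u 0" "c \<ge> 0" by blast
  show "v \<in> (\<Inter>n. block_mat s n ` orthant)"
  proof (intro INT_I image_eqI)
    fix n
    show "v = block_mat s n (c *\<^sub>R u n)" by (simp only: c eigseq_block_mat[OF s u] linear_scale[OF linear_block_mat])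
    show "c *\<^sub>R u n \<in> orthant" using c(2) eigseq_pos[OF u, of n] by (simp add: less_imp_le)
  qed
next
  fix z assume z: "z \<in> (\<Inter>n. block_mat s n ` orthant)"
  have perp: "z \<bullet> y = 0" if y: "y \<bullet> u 0 = 0" for y
  proof -
    have b: "\<bar>z \<bullet> y\<bar> \<le> coord_sum z * (contr_bound s n * spread y)" for n
    proof -
      obtain x where x: "x \<in> orthant" "z = block_mat s n x" using z by blast
      have "\<bar>z \<bullet> y\<bar> = \<bar>x \<bullet> block_mat_tr s n y\<bar>" by (simp only: x(2) block_mat_inner)
      also have "\<dots> \<le> (\<Sum>k\<in>UNIV. \<bar>x $ k * block_mat_tr s n y $ k\<bar>)" unfolding inner_vec_def by (simp add: sum_abs)
      also have "\<dots> \<le> (\<Sum>k\<in>UNIV. x $ k * (contr_bound s n * spread y))"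
        using x(1) block_mat_tr_coord[OF s u y, of n] by (intro sum_mono) (simp add: abs_mult mult_left_mono)
      also have "\<dots> = coord_sum x * (contr_bound s n * spread y)" by (simp add: sum_3 coord_sum_def algebra_simps)
      also have "\<dots> \<le> coord_sum z * (contr_bound s n * spread y)" unfolding x(2)
        by (intro mult_right_mono coord_sum_block_mat_ge[OF s x(1)] mult_nonneg_nonneg spread_nonneg less_imp_le[OF contr_bound_pos])
      finally show ?thesis .
    qed
    have "(\<lambda>n. coord_sum z * (contr_bound s n * spread y)) \<longlonglongrightarrow> coord_sum z * (0 * spread y)"
      by (intro tendsto_intros contr_bound_tendsto_0[OF i])
    then have "\<bar>z \<bullet> y\<bar> \<le> coord_sum z * (0 * spread y)" by (rule LIMSEQ_le_const) (use b in blast)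
    then show ?thesis by simp
  qed
  define c where "c = (z \<bullet> u 0) / (u 0 \<bullet> u 0)"
  have up: "u 0 \<bullet> u 0 > 0" using eigseq_pos[OF u, of 0 1] by auto
  define y where "y = z - c *\<^sub>R u 0"
  have yu: "y \<bullet> u 0 = 0" using up by (simp add: y_def c_def inner_diff_left)
  have "y \<bullet> y = 0" using perp[OF yu] yu by (simp add: y_def inner_diff_left inner_commute)
  then have zc: "z = c *\<^sub>R u 0" by (simp add: y_def)
  obtain x where x: "x \<in> orthant" "z = block_mat s 0 x" using z by blast
  have "z \<bullet> u 0 \<ge> 0" unfolding inner_vec_def x(2)
    by (rule sum_nonneg) (use x(1) eigseq_pos[OF u, of 0] in \<open>simp add: less_imp_le\<close>)
  then have "c \<ge> 0" using up by (simp add: c_def)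
  then show "z \<in> {c *\<^sub>R u 0 | c. c \<ge> 0}" using zc by blast
qed

lemma generalized_right_eigenvector_iff_cone:
  "generalized_right_eigenvector s v \<longleftrightarrow>
     (\<forall>i. v $ i > 0) \<and> (\<Inter>n. block_mat s n ` orthant) = {c *\<^sub>R v | c. c \<ge> 0}"
  unfolding generalized_right_eigenvector_def block_mat_def[abs_def] ..

text \<open>Compactness yields a vector in all images of the orthant. Its preimages are unique, so
  they form a sequence compatible with the matrices, and a later block makes every entry
  positive.\<close>

lemma eigseq_exists:
  assumes s: "AR_dir s" and i: "blocks_recur s"
  obtains u where "eigseq s u"
proof -
  let ?K = "\<lambda>n. block_mat s n ` orthant \<inter> {v. coord_sum v = 1}"
  have inj: "inj (block_mat s n)" for n using block_mat_inj[OF s] by (rule injI)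
  have sub: "block_mat s n ` orthant \<subseteq> orthant" for n using block_mat_nonneg[OF s] by auto
  have c: "compact (?K n)" for n
  proof -
    have "closed orthant" by (intro closed_Collect_all closed_Collect_le) (auto intro!: continuous_intros)
    then have "closed (block_mat s n ` orthant)" by (rule closed_injective_linear_image[OF _ linear_block_mat inj])
    moreover have "closed {v. coord_sum v = 1}" unfolding coord_sum_def by (intro closed_Collect_eq) (auto intro!: continuous_intros)
    moreover have "?K n \<subseteq> cbox 0 1"
    proof
      fix v assume v: "v \<in> ?K n"
      then have "v \<in> orthant" using sub by blast
      then have "v $ 1 \<ge> 0" "v $ 2 \<ge> 0" "v $ 3 \<ge> 0" by simp_all
      then show "v \<in> cbox 0 1" using v by (simp add: mem_box_cart forall_3 coord_sum_def)
    qed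
    ultimately show ?thesis by (meson bounded_cbox bounded_subset closed_Int compact_eq_bounded_closed)
  qed
  have ne: "?K n \<noteq> {}" for n
  proof -
    let ?x = "axis 1 1 :: real^3"
    have x: "?x \<in> orthant" by (simp add: axis_def)
    have "coord_sum ?x = 1" by (simp add: coord_sum_def axis_def)
    then have p: "coord_sum (block_mat s n ?x) > 0" using coord_sum_block_mat_ge[OF s x, of n] by linarith
    have "(1 / coord_sum (block_mat s n ?x)) *\<^sub>R block_mat s n ?x \<in> ?K n"
    proof
      show "(1 / coord_sum (block_mat s n ?x)) *\<^sub>R block_mat s n ?x \<in> block_mat s n ` orthant"
        by (rule image_eqI[of _ _ "(1 / coord_sum (block_mat s n ?x)) *\<^sub>R ?x"])
          (use p x in \<open>simp_all add: linear_scale[OF linear_block_mat]\<close>)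
      have "coord_sum ((1 / coord_sum w) *\<^sub>R w) = 1" if "coord_sum w > 0" for w
      proof -
        have "coord_sum (c *\<^sub>R w) = c * coord_sum w" for c by (simp add: coord_sum_def distrib_left)
        then show ?thesis using that by simp
      qed
      then show "(1 / coord_sum (block_mat s n ?x)) *\<^sub>R block_mat s n ?x \<in> {v. coord_sum v = 1}" using p by simp
    qed
    then show ?thesis by blast
  qed
  have dec: "block_mat s (Suc n) ` orthant \<subseteq> block_mat s n ` orthant" for n
  proof clarify
    fix x :: "real^3" assume x: "\<forall>i. x $ i \<ge> 0"
    then have "AR_mat (dir_letter s n) x \<in> orthant" by auto
    then show "block_mat s (Suc n) x \<in> block_mat s n ` orthant" unfolding block_mat_Suc[OF s] by blast
  qed
  have "antimono (\<lambda>n. block_mat s n ` orthant)" by (rule decseq_SucI) (rule dec)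
  then have dec': "?K n \<subseteq> ?K m" if "m \<le> n" for m n using that by (blast dest: antimonoD)
  have "\<Inter>(range ?K) \<noteq> {}" by (rule compact_nest[OF c ne dec'])
  then obtain v where v: "v \<in> ?K n" for n by blast
  define w where "w n = (SOME x. x \<in> orthant \<and> block_mat s n x = v)" for n
  have w: "w n \<in> orthant \<and> block_mat s n (w n) = v" for n
    unfolding w_def by (rule someI_ex) (use v[of n] in blast)
  have step: "w n = AR_mat (dir_letter s n) (w (Suc n))" for n
    by (rule block_mat_inj[OF s, of n]) (use w[of n] w[of "Suc n"] in \<open>simp add: block_mat_Suc[OF s]\<close>)
  have pd: "\<forall>i. w n $ i > 0" if p: "\<forall>i. w (Suc n) $ i > 0" for n
    unfolding step[of n] using p by (simp add: add_pos_pos)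
  have pos: "\<forall>i. w n $ i > 0" for n
  proof -
    obtain k where k: "k \<ge> n" "block_at s k" using i by (auto simp: blocks_recur_def)
    have "w (k + 3) \<noteq> 0" using w[of "k + 3"] v[of 0] linear_0[OF linear_block_mat, of s "k + 3"] by (auto simp: coord_sum_def)
    moreover have nn: "w (k + 3) $ i \<ge> 0" for i using w[of "k + 3"] by simp
    ultimately have "w (k + 3) $ 1 + w (k + 3) $ 2 + w (k + 3) $ 3 > 0"
      using nn[of 1] nn[of 2] nn[of 3] unfolding vec_eq_iff forall_3 zero_index by argo
    moreover have "w k = AR_mat 1 (AR_mat 2 (AR_mat 3 (w (k + 3))))"
      using step[of k] step[of "k + 1"] step[of "k + 2"] block_at_dir_letter(1-3)[OF k(2)] by (simp add: eval_nat_numeral)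
    ultimately have "\<forall>i. w k $ i > 0" using nn[of 1] nn[of 2] nn[of 3] by (simp add: forall_3)
    with k(1) show ?thesis by (induction rule: inc_induct) (use pd in blast)+
  qed
  have "eigseq s w" unfolding eigseq_def by (intro conjI allI) (rule pos[THEN spec], rule step)
  then show ?thesis by (rule that)
qed

lemma generalized_right_eigenvector_eigseq:
  assumes s: "AR_dir s" and i: "blocks_recur s" and v: "generalized_right_eigenvector s v"
  obtains u where "eigseq s u" "u 0 = v"
proof -
  obtain w where w: "eigseq s w" by (rule eigseq_exists[OF s i])
  have v': "\<forall>i. v $ i > 0" "(\<Inter>n. block_mat s n ` orthant) = {c *\<^sub>R v | c. c \<ge> 0}"
    using v[unfolded generalized_right_eigenvector_iff_cone] by (rule conjunct1, rule conjunct2)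
  have "v \<in> {c *\<^sub>R v | c. c \<ge> 0}" by (rule CollectI, rule exI[of _ 1]) simp
  then have "v \<in> {c *\<^sub>R w 0 | c. c \<ge> 0}" unfolding v'(2)[symmetric] eigseq_cone[OF s i w] .
  then obtain c where c: "v = c *\<^sub>R w 0" "c \<ge> 0" by blast
  have "c \<noteq> 0" using v'(1) c(1) by auto
  then have cp: "c > 0" using c(2) by simp
  have "eigseq s (\<lambda>n. c *\<^sub>R w n)" unfolding eigseq_def
  proof (intro conjI allI)
    fix n i
    show "(c *\<^sub>R w n) $ i > 0" using cp eigseq_pos[OF w, of n i] by simp
    show "c *\<^sub>R w n = AR_mat (dir_letter s n) (c *\<^sub>R w (Suc n))"
      by (subst eigseq_step[OF w, of n]) (simp add: vec_eq_iff algebra_simps)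
  qed
  then show ?thesis using c(1) that by simp
qed

lemma eigseq_generalized_right_eigenvector:
  assumes s: "AR_dir s" and i: "blocks_recur s" and u: "eigseq s u"
  shows "generalized_right_eigenvector s (u 0)"
  unfolding generalized_right_eigenvector_iff_cone
  using eigseq_pos[OF u] eigseq_cone[OF s i u] by blast

section \<open>Almost every directive sequence\<close>

context
  fixes \<nu> :: "'a stream measure" and S :: "'a set"
  assumes e: "ergodic_shift_measure S \<nu>"
begin

lemma prob_nu: "prob_space \<nu>"
  using e by (simp add: ergodic_shift_measure_def)

lemma sets_nu: "sets \<nu> = sets (stream_space (count_space S))"
  using e by (simp add: ergodic_shift_measure_def)

lemma space_nu: "space \<nu> = streams S"
  using sets_eq_imp_space_eq[OF sets_nu] by (simp add: space_stream_space)

lemma sdrop_nu: "sdrop n \<in> measurable \<nu> \<nu>"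
  using measurable_sdrop[of n "count_space S"] measurable_cong_sets[OF sets_nu sets_nu] by simp

lemma stl_sdrop: "stl = sdrop 1"
  by (simp add: fun_eq_iff)

lemma sdrop_space_nu: "x \<in> space \<nu> \<Longrightarrow> sdrop n x \<in> space \<nu>"
  using measurable_space[OF sdrop_nu] by blast

lemma distr_sdrop_nu: "distr \<nu> \<nu> (sdrop n) = \<nu>"
proof (induction n)
  case 0
  then show ?case by (simp add: distr_id2)
next
  case (Suc n)
  have e1: "distr \<nu> \<nu> stl = \<nu>" using e by (simp add: ergodic_shift_measure_def)
  have stl: "stl \<in> measurable \<nu> \<nu>" unfolding stl_sdrop by (rule sdrop_nu)
  have c: "sdrop (Suc n) = sdrop n \<circ> stl" by (simp add: fun_eq_iff)
  have "distr \<nu> \<nu> (sdrop (Suc n)) = distr \<nu> \<nu> (sdrop n \<circ> stl)" by (simp only: c)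
  also have "\<dots> = distr (distr \<nu> \<nu> stl) \<nu> (sdrop n)" by (rule distr_distr[OF sdrop_nu stl, symmetric])
  also have "\<dots> = \<nu>" by (simp only: e1 Suc.IH)
  finally show ?case .
qed

lemma nn_integral_sdrop:
  assumes "f \<in> borel_measurable \<nu>"
  shows "(\<integral>\<^sup>+x. f (sdrop n x) \<partial>\<nu>) = (\<integral>\<^sup>+x. f x \<partial>\<nu>)"
  using nn_integral_distr[OF sdrop_nu, of f n] assms by (simp add: distr_sdrop_nu)

text \<open>The sets \<open>V m\<close> decrease and, by stationarity, all have the same measure.
  Their intersection is shift invariant with measure at least that of \<open>G\<close>, hence of
  measure 1 by ergodicity.\<close>

lemma AE_infinitely_often:
  assumes G: "G \<in> sets \<nu>" and p: "measure \<nu> G > 0"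
  shows "AE x in \<nu>. \<forall>m. \<exists>k\<ge>m. sdrop k x \<in> G"
proof -
  interpret prob_space \<nu> by (rule prob_nu)
  define V where "V m = (\<Union>k\<in>{m..}. sdrop k -` G \<inter> space \<nu>)" for m
  have Vs: "V m \<in> sets \<nu>" for m
    unfolding V_def by (intro sets.countable_UN'' measurable_sets[OF sdrop_nu G]) simp
  have V_iff: "x \<in> V m \<longleftrightarrow> x \<in> space \<nu> \<and> (\<exists>k\<ge>m. sdrop k x \<in> G)" for x m by (auto simp: V_def)
  have pre: "stl -` V m \<inter> space \<nu> = V (Suc m)" for m
  proof -
    have "stl x \<in> V m \<longleftrightarrow> x \<in> V (Suc m)" if x: "x \<in> space \<nu>" for x
    proof -
      have st: "stl x \<in> space \<nu>" using sdrop_space_nu[OF x, of 1] by simp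
      have "(\<exists>k\<ge>m. sdrop k (stl x) \<in> G) \<longleftrightarrow> (\<exists>k\<ge>Suc m. sdrop k x \<in> G)"
      proof
        assume "\<exists>k\<ge>m. sdrop k (stl x) \<in> G"
        then obtain k where "k \<ge> m" "sdrop k (stl x) \<in> G" by blast
        then show "\<exists>k\<ge>Suc m. sdrop k x \<in> G" by (intro exI[of _ "Suc k"]) simp
      next
        assume "\<exists>k\<ge>Suc m. sdrop k x \<in> G"
        then obtain k where k: "k \<ge> Suc m" "sdrop k x \<in> G" by blast
        then obtain j where "k = Suc j" by (cases k) auto
        then show "\<exists>k\<ge>m. sdrop k (stl x) \<in> G" using k by (intro exI[of _ j]) simp
      qed
      then show ?thesis unfolding V_iff using x st by simp
    qed
    moreover have "V (Suc m) \<subseteq> space \<nu>" by (auto simp: V_def)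
    ultimately show ?thesis by blast
  qed
  have mV: "measure \<nu> (V m) = measure \<nu> (V 0)" for m
  proof (induction m)
    case (Suc m)
    have "emeasure \<nu> (V (Suc m)) = emeasure \<nu> (sdrop 1 -` V m \<inter> space \<nu>)" by (simp only: pre[of m, symmetric] stl_sdrop)
    also have "\<dots> = emeasure (distr \<nu> \<nu> (sdrop 1)) (V m)" by (rule emeasure_distr[OF sdrop_nu Vs, symmetric])
    also have "\<dots> = emeasure \<nu> (V m)" by (simp only: distr_sdrop_nu)
    finally show ?case using Suc.IH by (simp add: measure_def)
  qed simp
  have dec: "decseq V" unfolding V_def by (intro decseq_SucI UN_mono) auto
  have "(\<lambda>m. measure \<nu> (V m)) \<longlonglongrightarrow> measure \<nu> (\<Inter>m. V m)"
    by (rule finite_Lim_measure_decseq[OF _ dec]) (use Vs in blast)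
  moreover have "(\<lambda>m. measure \<nu> (V m)) = (\<lambda>_. measure \<nu> (V 0))" by (rule ext) (rule mV)
  ultimately have "(\<lambda>_. measure \<nu> (V 0)) \<longlonglongrightarrow> measure \<nu> (\<Inter>m. V m)" by argo
  then have I: "measure \<nu> (\<Inter>m. V m) = measure \<nu> (V 0)" by (simp add: LIMSEQ_const_iff)
  have "sdrop 0 -` G \<inter> space \<nu> = G" using sets.sets_into_space[OF G] by auto
  then have "G \<subseteq> V 0" unfolding V_def by auto
  then have p0: "measure \<nu> (\<Inter>m. V m) > 0" unfolding I using finite_measure_mono[OF _ Vs[of 0], of G] p by linarith
  have Is: "(\<Inter>m. V m) \<in> sets \<nu>" using Vs by (intro sets.countable_INT) auto
  have "stl -` (\<Inter>m. V m) \<inter> space \<nu> = (\<Inter>m. stl -` V m \<inter> space \<nu>)" by blast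
  also have "\<dots> = (\<Inter>m. V (Suc m))" unfolding pre ..
  also have "\<dots> = (\<Inter>m. V m)"
  proof (intro equalityI INT_greatest)
    fix m
    have "V (Suc m) \<subseteq> V m" using dec by (simp add: decseq_Suc_iff)
    then show "(\<Inter>m. V (Suc m)) \<subseteq> V m" by blast
  qed blast
  finally have "measure \<nu> (\<Inter>m. V m) = 0 \<or> measure \<nu> (\<Inter>m. V m) = 1"
    using e Is unfolding ergodic_shift_measure_def by blast
  then have "measure \<nu> (\<Inter>m. V m) = 1" using p0 by linarith
  then have "AE x in \<nu>. x \<in> (\<Inter>m. V m)" using AE_prob_1 by blast
  then show ?thesis by (rule AE_mp) (intro AE_I2, use V_iff in blast)
qed

end

section \<open>Summable contraction for almost every sequence\<close>

text \<open>Only finite sums occur on the right, which makes measurability in \<open>s\<close>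
  evident.\<close>

lemma contr_summable_iff: "contr_summable s C \<longleftrightarrow> (\<forall>N. (\<Sum>n<N. contr_bound s n) \<le> C)"
proof
  assume "contr_summable s C"
  then show "\<forall>N. (\<Sum>n<N. contr_bound s n) \<le> C"
    using sum_le_suminf[of "contr_bound s"] contr_bound_pos[of s] unfolding contr_summable_def by (meson finite_lessThan less_imp_le order.trans)
next
  assume b: "\<forall>N. (\<Sum>n<N. contr_bound s n) \<le> C"
  have "summable (contr_bound s)" by (rule summableI_nonneg_bounded[where x=C]) (use b contr_bound_pos[of s] in \<open>auto simp: less_imp_le\<close>)
  then show "contr_summable s C" unfolding contr_summable_def using suminf_le_const b by blast
qed

lemma block_count_add: "block_count s (m + n) = block_count s m + block_count (sdrop m s) n"
  by (induction n) (simp_all add: block_count_Suc)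

context
  fixes \<nu> :: "subst stream measure"
  assumes e: "ergodic_shift_measure AR_substs \<nu>"
    and pos: "\<forall>w\<in>lists AR_substs. emeasure \<nu> (sstart AR_substs w) > 0"
begin

lemma AR_dir_space: "x \<in> space \<nu> \<Longrightarrow> AR_dir x"
  unfolding space_nu[OF e] AR_dir_def by (simp add: snth_in)

lemma measurable_prefix: "stake n \<in> measurable \<nu> (count_space UNIV)"
proof -
  have "(\<lambda>x. x) \<in> measurable \<nu> (stream_space (count_space UNIV))"
  proof (rule measurable_stream_space2)
    fix n
    have "(\<lambda>x. x !! n) \<in> measurable \<nu> (count_space AR_substs)"
      using measurable_snth[of n "count_space AR_substs"] measurable_cong_sets[OF sets_nu[OF e] refl] by blast
    then show "(\<lambda>x. x !! n) \<in> measurable \<nu> (count_space UNIV)"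
      by (rule measurable_compose) simp
  qed
  from measurable_compose[OF this measurable_stake] show ?thesis .
qed

lemma measurable_block_at: "Measurable.pred \<nu> (\<lambda>x. block_at x k)"
  unfolding block_at_def
  by (rule measurable_compose[OF measurable_compose[OF sdrop_nu[OF e] measurable_prefix]]) simp

lemma measurable_contr_rate_block_count: "(\<lambda>x. contr_rate ^ block_count x n) \<in> borel_measurable \<nu>"
proof (induction n)
  case (Suc n)
  have "(\<lambda>x. contr_rate ^ block_count x (Suc n)) = (\<lambda>x. if block_at x n then contr_rate * contr_rate ^ block_count x n else contr_rate ^ block_count x n)"
    by (simp add: block_count_Suc fun_eq_iff)
  then show ?case using Suc measurable_block_at[of n] by simp
qed simp

lemma measurable_contr_summable: "Measurable.pred \<nu> (\<lambda>x. contr_summable x C)"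
proof -
  have [measurable]: "(\<lambda>x. contr_bound x n) \<in> borel_measurable \<nu>" for n
    unfolding contr_bound_def by (rule measurable_contr_rate_block_count)
  show ?thesis unfolding contr_summable_iff by measurable
qed

lemma block_at_positive: "measure \<nu> {x \<in> space \<nu>. block_at x 0} > 0"
proof -
  interpret prob_space \<nu> by (rule prob_nu[OF e])
  have m: "map arnoux_rauzy pattern \<in> lists AR_substs" by (auto simp: pattern_def AR_substs_def)
  have l: "length (map arnoux_rauzy pattern) = 9" by (simp add: pattern_def)
  have "x \<in> sstart AR_substs (map arnoux_rauzy pattern) \<longleftrightarrow> x \<in> streams AR_substs \<and> block_at x 0" for x
  proof (cases "x \<in> streams AR_substs")
    case True
    have "block_at x 0 \<longleftrightarrow> (\<forall>i<9. x !! i = map arnoux_rauzy pattern ! i)"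
      unfolding block_at_def list_eq_iff_nth_eq l by (auto simp: stake_nth)
    then show ?thesis unfolding sstart_eq[OF True] l using True by blast
  next
    case False
    then show ?thesis using sstart_in_streams[OF m] by blast
  qed
  then have "sstart AR_substs (map arnoux_rauzy pattern) = {x \<in> space \<nu>. block_at x 0}"
    unfolding space_nu[OF e] by blast
  then have "emeasure \<nu> {x \<in> space \<nu>. block_at x 0} > 0" using bspec[OF pos m] by simp
  then show ?thesis by (simp add: emeasure_eq_measure)
qed

text \<open>Read backwards in time, the visits to the block are met one after the other, so the weights
  form a geometric series.\<close>

lemma reversed_weights:
  "(\<Sum>k\<le>N. if block_at x k then contr_rate ^ block_count (sdrop k x) (N - k) else 0)
     \<le> (1 - contr_rate ^ Suc (block_count x N)) / (1 - contr_rate)"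
proof (induction N arbitrary: x)
  case 0
  show ?case using contr_rate by (simp cong: if_cong)
next
  case (Suc N)
  let ?c = "block_count (stl x) N"
  have c: "block_count x (Suc N) = (if block_at x 0 then 1 else 0) + ?c"
    using block_count_add[of x 1 N] by (simp add: block_count_Suc)
  have b: "block_at (stl x) k = block_at x (Suc k)" for k using block_at_sdrop[of 1 x k] by simp
  have "(\<Sum>k\<le>Suc N. if block_at x k then contr_rate ^ block_count (sdrop k x) (Suc N - k) else 0) =
      (if block_at x 0 then contr_rate ^ block_count x (Suc N) else 0) +
      (\<Sum>k\<le>N. if block_at (stl x) k then contr_rate ^ block_count (sdrop k (stl x)) (N - k) else 0)"
    unfolding sum.atMost_Suc_shift b by (simp cong: if_cong)
  also have "\<dots> \<le> (if block_at x 0 then contr_rate ^ block_count x (Suc N) else 0) + (1 - contr_rate ^ Suc ?c) / (1 - contr_rate)"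
    by (intro add_left_mono Suc.IH)
  also have "\<dots> = (1 - contr_rate ^ Suc (block_count x (Suc N))) / (1 - contr_rate)"
    unfolding c using contr_rate by (simp add: field_simps)
  finally show ?case .
qed

text \<open>Stationarity allows the integrand with index \<open>N - k\<close> to be read
  \<open>k\<close> steps later. All terms then end at the same time \<open>N\<close>, and
  \<open>reversed_weights\<close> bounds their sum pointwise.\<close>

lemma weights_integral:
  "(\<Sum>n\<le>N. \<integral>\<^sup>+x. (if block_at x 0 then ennreal (contr_rate ^ block_count x n) else 0) \<partial>\<nu>) \<le> ennreal (1 / (1 - contr_rate))"
proof -
  interpret prob_space \<nu> by (rule prob_nu[OF e])
  define f where "f n x = (if block_at x 0 then ennreal (contr_rate ^ block_count x n) else 0)" for n x
  have fm: "f n \<in> borel_measurable \<nu>" for n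
    unfolding f_def using measurable_block_at[of 0] measurable_contr_rate_block_count[of n] by measurable
  have "(\<Sum>n\<le>N. \<integral>\<^sup>+x. f n x \<partial>\<nu>) = (\<Sum>k\<le>N. \<integral>\<^sup>+x. f (N - k) x \<partial>\<nu>)"
    by (rule sum.reindex_bij_witness[of _ "\<lambda>k. N - k" "\<lambda>k. N - k"]) auto
  also have "\<dots> = (\<Sum>k\<le>N. \<integral>\<^sup>+x. f (N - k) (sdrop k x) \<partial>\<nu>)"
    by (intro sum.cong refl nn_integral_sdrop[OF e, symmetric] fm)
  also have "\<dots> = (\<integral>\<^sup>+x. (\<Sum>k\<le>N. f (N - k) (sdrop k x)) \<partial>\<nu>)"
    by (rule nn_integral_sum[symmetric]) (rule measurable_compose[OF sdrop_nu[OF e] fm])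
  also have "\<dots> \<le> (\<integral>\<^sup>+x. ennreal (1 / (1 - contr_rate)) \<partial>\<nu>)"
  proof (rule nn_integral_mono)
    fix x
    have "(\<Sum>k\<le>N. f (N - k) (sdrop k x)) =
        (\<Sum>k\<le>N. ennreal (if block_at x k then contr_rate ^ block_count (sdrop k x) (N - k) else 0))"
      by (intro sum.cong) (auto simp: f_def)
    also have "\<dots> = ennreal (\<Sum>k\<le>N. if block_at x k then contr_rate ^ block_count (sdrop k x) (N - k) else 0)"
      by (rule sum_ennreal) (use contr_rate in auto)
    also have "\<dots> \<le> ennreal (1 / (1 - contr_rate))"
    proof (rule ennreal_leI)
      have "(1 - contr_rate ^ Suc (block_count x N)) / (1 - contr_rate) \<le> 1 / (1 - contr_rate)"
        by (rule divide_right_mono) (use contr_rate in \<open>simp_all add: less_imp_le\<close>)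
      then show "(\<Sum>k\<le>N. if block_at x k then contr_rate ^ block_count (sdrop k x) (N - k) else 0) \<le> 1 / (1 - contr_rate)"
        using reversed_weights[of x N] by linarith
    qed
    finally show "(\<Sum>k\<le>N. f (N - k) (sdrop k x)) \<le> ennreal (1 / (1 - contr_rate))" .
  qed
  also have "\<dots> = ennreal (1 / (1 - contr_rate))" by (simp add: emeasure_space_1)
  finally show ?thesis by (simp add: f_def)
qed

lemma AE_summable_weights: "AE x in \<nu>. block_at x 0 \<longrightarrow> summable (\<lambda>n. contr_rate ^ block_count x n)"
proof -
  define f where "f n x = (if block_at x 0 then ennreal (contr_rate ^ block_count x n) else 0)" for n x
  have fm: "f n \<in> borel_measurable \<nu>" for n
    unfolding f_def using measurable_block_at[of 0] measurable_contr_rate_block_count[of n] by measurable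
  have "(\<integral>\<^sup>+x. (\<Sum>n. f n x) \<partial>\<nu>) = (\<Sum>n. \<integral>\<^sup>+x. f n x \<partial>\<nu>)" by (rule nn_integral_suminf) (rule fm)
  also have "\<dots> \<le> ennreal (1 / (1 - contr_rate))"
  proof (rule suminf_le_const)
    fix n
    have "(\<Sum>k<n. \<integral>\<^sup>+x. f k x \<partial>\<nu>) \<le> (\<Sum>k\<le>n. \<integral>\<^sup>+x. f k x \<partial>\<nu>)" by (rule sum_mono2) auto
    also have "\<dots> \<le> ennreal (1 / (1 - contr_rate))" using weights_integral[of n] by (simp add: f_def)
    finally show "(\<Sum>k<n. \<integral>\<^sup>+x. f k x \<partial>\<nu>) \<le> ennreal (1 / (1 - contr_rate))" .
  qed simp
  finally have "(\<integral>\<^sup>+x. (\<Sum>n. f n x) \<partial>\<nu>) \<noteq> \<infinity>" by (auto simp: top_unique)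
  then have "AE x in \<nu>. (\<Sum>n. f n x) \<noteq> \<infinity>" by (rule nn_integral_PInf_AE[rotated]) (use fm in measurable)
  then show ?thesis
  proof (rule AE_mp, intro AE_I2 impI)
    fix x assume x: "(\<Sum>n. f n x) \<noteq> \<infinity>" "block_at x 0"
    then have "(\<Sum>n. ennreal (contr_rate ^ block_count x n)) \<noteq> top" by (simp add: f_def)
    then show "summable (\<lambda>n. contr_rate ^ block_count x n)" by (intro summable_suminf_not_top) (use contr_rate in simp_all)
  qed
qed

lemma summable_weights_contr_summable:
  assumes "summable (\<lambda>n. contr_rate ^ block_count x n)"
  obtains C :: nat where "contr_summable (sdrop 3 x) (real C)"
proof -
  have "summable (\<lambda>n. contr_rate ^ block_count x (3 + n))" using summable_ignore_initial_segment[OF assms, of 3] by (simp only: add.commute)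
  then have "summable (\<lambda>n. contr_rate ^ block_count (sdrop 3 x) n)"
    unfolding block_count_add power_add using contr_rate by (simp add: summable_cmult_iff)
  \<comment> \<open>The index is shifted by one so that \<open>n - 1\<close> in
    \<open>contr_bound\<close> becomes the plain index.\<close>
  then have "summable (contr_bound (sdrop 3 x))" by (subst summable_Suc_iff[symmetric]) (simp add: contr_bound_def)
  moreover obtain C where "suminf (contr_bound (sdrop 3 x)) \<le> real C" using real_arch_simple by blast
  ultimately show ?thesis using that unfolding contr_summable_def by blast
qed

text \<open>Almost every sequence starting with the block belongs to some \<open>E C\<close>, and
  \<open>C\<close> runs through the naturals. So one \<open>E C\<close> has positive measure and is
  visited infinitely often, with the same \<open>C\<close> at each visit.\<close>

lemma AE_good: "AE x in \<nu>. good x"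
proof -
  interpret prob_space \<nu> by (rule prob_nu[OF e])
  define E where "E C = {x \<in> space \<nu>. block_at x 0 \<and> contr_summable (sdrop 3 x) (real C)}" for C :: nat
  have Es: "E C \<in> sets \<nu>" for C
  proof -
    have "Measurable.pred \<nu> (\<lambda>x. contr_summable (sdrop 3 x) (real C))" by (rule measurable_compose[OF sdrop_nu[OF e] measurable_contr_summable])
    then show ?thesis unfolding E_def using measurable_block_at[of 0] by measurable
  qed
  have "\<exists>C. measure \<nu> (E C) > 0"
  proof (rule ccontr)
    assume "\<not> ?thesis"
    then have "measure \<nu> (E C) = 0" for C by (metis measure_nonneg order.not_eq_order_implies_strict)
    then have "AE x in \<nu>. x \<notin> E C" for C
      by (intro AE_not_in) (simp add: null_sets_def Es emeasure_eq_measure)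
    then have "AE x in \<nu>. \<forall>C. x \<notin> E C" by (simp add: AE_all_countable)
    with AE_summable_weights AE_space have n: "AE x in \<nu>. \<not> block_at x 0"
    proof eventually_elim
      case (elim x)
      show ?case
      proof
        assume b: "block_at x 0"
        then obtain C :: nat where "contr_summable (sdrop 3 x) (real C)" using elim(1) summable_weights_contr_summable by blast
        then show False using elim(2,3) b by (simp add: E_def)
      qed
    qed
    have "{x \<in> space \<nu>. block_at x 0} \<in> sets \<nu>" using measurable_block_at[of 0] by measurable
    then have "measure \<nu> {x \<in> space \<nu>. block_at x 0} = 0" using prob_eq_0[of "{x \<in> space \<nu>. block_at x 0}"] n by simp
    then show False using block_at_positive by simp
  qed
  then obtain C where C: "measure \<nu> (E C) > 0" by blast
  from AE_infinitely_often[OF e Es C] AE_space show ?thesis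
  proof eventually_elim
    case (elim x)
    have "\<exists>k\<ge>m. block_at x k \<and> contr_summable (sdrop (k + 3) x) (real C)" for m
    proof -
      obtain k where k: "k \<ge> m" "sdrop k x \<in> E C" using elim(1) by blast
      then have "block_at x k" "contr_summable (sdrop (k + 3) x) (real C)" by (simp_all add: E_def sdrop_add)
      with k(1) show ?thesis by blast
    qed
    then show "good x" unfolding good_def using AR_dir_space[OF elim(2)] by blast
  qed
qed

end

section \<open>Lyapunov exponents\<close>

text \<open>As \<open>3 = 0\<close> in this type, the indices are ordered 3, 1, 2; the order enters
  through the sorted index lists in \<open>wedge\<close>.\<close>

lemma three_less: "(3::3) < 1" "(1::3) < 2" "(3::3) < 2"
  by (simp_all add: less_bit1_def bit1.Rep_0 bit1.Rep_1 bit1.Rep_numeral)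

lemma sorted_UNIV_3: "sorted_list_of_set (UNIV :: 3 set) = [3, 1, 2]"
proof (rule sorted_distinct_set_unique)
  show "set (sorted_list_of_set (UNIV :: 3 set)) = set [3, 1, 2]" using UNIV_3 by auto
  show "sorted [3::3, 1, 2]" using less_imp_le[OF three_less(1)] less_imp_le[OF three_less(2)] less_imp_le[OF three_less(3)] by simp
qed simp_all

lemma wedge_1: "wedge [v] {i} = v $ i"
  by (simp add: wedge_def lessThan_Suc)

lemma wedge_2_sorted:
  assumes "sorted_list_of_set I = [a, b]"
  shows "wedge [v, w] I = v $ a * w $ b - w $ a * v $ b"
proof -
  have l: "{..<length [v, w]} = insert 0 {1}" by auto
  have f: "finite {1::nat}" "0 \<notin> {1::nat}" by simp_all
  show ?thesis unfolding wedge_def l sum_over_permutations_insert[OF f] permutes_sing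
    by (simp add: assms sign_swap_id sign_id)
qed

lemma wedge_3:
  fixes u v w :: "real^3"
  shows "wedge [u, v, w] UNIV =
    u $ 3 * v $ 1 * w $ 2 + v $ 3 * w $ 1 * u $ 2 + w $ 3 * u $ 1 * v $ 2
    - u $ 3 * w $ 1 * v $ 2 - v $ 3 * u $ 1 * w $ 2 - w $ 3 * v $ 1 * u $ 2"
proof -
  have l: "{..<length [u, v, w]} = insert 0 (insert 1 {2})" by auto
  have f: "finite (insert 1 {2::nat})" "0 \<notin> insert 1 {2::nat}" by simp_all
  have f': "finite {2::nat}" "1 \<notin> {2::nat}" by simp_all
  show ?thesis unfolding wedge_def l sum_over_permutations_insert[OF f] sum_over_permutations_insert[OF f'] permutes_sing
    by (simp add: sorted_UNIV_3 sign_swap_id sign_id sign_compose permutation_swap_id)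
qed

lemma wedge_2_square:
  assumes "a \<noteq> b"
  shows "(wedge [v, w] {a, b})\<^sup>2 = (v $ a * w $ b - w $ a * v $ b)\<^sup>2"
proof (cases "a < b")
  case True
  then show ?thesis by (subst wedge_2_sorted[of _ a b]) (simp_all add: sorted_list_of_set_insert_remove less_imp_le)
next
  case False
  with assms have "b < a" by auto
  then have "wedge [v, w] {a, b} = v $ b * w $ a - w $ b * v $ a"
    by (intro wedge_2_sorted) (simp add: sorted_list_of_set_insert_remove less_imp_le insert_commute[of a b])
  then show ?thesis by (simp only: power2_eq_square) (simp only: algebra_simps)
qed

definition next_index :: "3 \<Rightarrow> 3" where "next_index i = (if i = 1 then 2 else if i = 2 then 3 else 1)"

lemma next_index [simp]: "next_index 1 = 2" "next_index 2 = 3" "next_index 3 = 1"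
  by (simp_all add: next_index_def)

text \<open>The cofactor matrix: with cyclic indices no signs are needed.\<close>

definition cof :: "real^3^3 \<Rightarrow> real^3^3" where
  "cof A = (\<chi> i j. A $ next_index i $ next_index j * A $ next_index (next_index i) $ next_index (next_index j) - A $ next_index i $ next_index (next_index j) * A $ next_index (next_index i) $ next_index j)"

lemma cof_mult: "cof (A ** B) = cof A ** cof B"
  unfolding vec_eq_iff forall_3 by (simp add: cof_def matrix_matrix_mult_def sum_3) (simp add: algebra_simps)

text \<open>With determinant 1 this recovers \<open>A\<close> from its minors. The bound of
  \<open>norm A\<close> by the square of \<open>norm (cof A)\<close> that follows is the source of
  \<open>\<theta> 2 \<ge> \<theta> 3\<close>.\<close>

lemma cof_cof: "cof (cof A) = det A *\<^sub>R A"
  unfolding vec_eq_iff forall_3 by (simp add: cof_def det_3) (simp add: algebra_simps)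

lemma norm_matrix_3: "norm (A :: real^3^3) = sqrt (\<Sum>i\<in>UNIV. \<Sum>j\<in>UNIV. (A $ i $ j)\<^sup>2)"
  by (simp add: norm_vec_def L2_set_def sum_nonneg)

lemma wedge_matrix_1: "wedge_matrix A {i} {j} = A $ i $ j"
  by (simp add: wedge_matrix_def wedge_1 matrix_vector_mult_basis column_def)

lemma wedge_norm_1: "wedge_norm 1 (A :: real^3^3) = norm A"
proof -
  have "{I :: 3 set. card I = 1} = (\<lambda>i. {i}) ` UNIV" by (auto simp: card_1_singleton_iff)
  then show ?thesis
    by (simp add: wedge_norm_def norm_matrix_3 sum.reindex wedge_matrix_1)
qed

lemma wedge_matrix_2_square:
  assumes "a \<noteq> b" "c \<noteq> d"
  shows "(wedge_matrix A {a, b} {c, d})\<^sup>2 = (A $ a $ c * A $ b $ d - A $ a $ d * A $ b $ c)\<^sup>2"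
proof -
  have col: "A *v axis j 1 = column j A" for j by (rule matrix_vector_mult_basis)
  have w: "(wedge_matrix A {a, b} {c, d})\<^sup>2 = (wedge [column c' A, column d' A] {a, b})\<^sup>2"
    if "sorted_list_of_set {c, d} = [c', d']" for c' d'
    using that by (simp add: wedge_matrix_def col)
  show ?thesis
  proof (cases "c < d")
    case True
    then have "sorted_list_of_set {c, d} = [c, d]" by (simp add: sorted_list_of_set_insert_remove less_imp_le)
    from w[OF this] show ?thesis by (simp add: wedge_2_square[OF assms(1)] column_def)
  next
    case False
    with assms have "d < c" by auto
    then have l: "sorted_list_of_set {c, d} = [d, c]" by (simp add: sorted_list_of_set_insert_remove less_imp_le insert_commute[of c d])
    show ?thesis unfolding w[OF l] wedge_2_square[OF assms(1)]
      by (simp add: column_def power2_eq_square algebra_simps)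
  qed
qed

lemma wedge_norm_2: "wedge_norm 2 (A :: real^3^3) = norm (cof A)"
proof -
  have S: "{I :: 3 set. card I = 2} = (\<lambda>i. {next_index i, next_index (next_index i)}) ` UNIV"
  proof (intro equalityI subsetI)
    fix I :: "3 set" assume "I \<in> {I. card I = 2}"
    then obtain a b where ab: "I = {a, b}" "a \<noteq> b" by (auto simp: card_2_iff)
    have "\<not> (\<forall>i. {a, b} \<noteq> {next_index i, next_index (next_index i)})"
      using ab(2) exhaust_3[of a] exhaust_3[of b] unfolding forall_3 by (auto simp: doubleton_eq_iff)
    then show "I \<in> (\<lambda>i. {next_index i, next_index (next_index i)}) ` UNIV" using ab(1) by blast
  next
    fix I :: "3 set" assume "I \<in> (\<lambda>i. {next_index i, next_index (next_index i)}) ` UNIV"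
    then obtain i where "I = {next_index i, next_index (next_index i)}" by blast
    then show "I \<in> {I. card I = 2}" using exhaust_3[of i] by auto
  qed
  have inj: "inj (\<lambda>i. {next_index i, next_index (next_index i)})"
  proof (rule injI)
    fix i j assume "{next_index i, next_index (next_index i)} = {next_index j, next_index (next_index j)}"
    then show "i = j" using exhaust_3[of i] exhaust_3[of j] by (auto simp: doubleton_eq_iff)
  qed
  have ne: "next_index i \<noteq> next_index (next_index i)" for i using exhaust_3[of i] by auto
  show ?thesis
    unfolding wedge_norm_def norm_matrix_3 S sum.reindex[OF inj] comp_def wedge_matrix_2_square[OF ne ne]
    by (simp add: cof_def)
qed

lemma wedge_norm_3: "wedge_norm 3 (A :: real^3^3) = \<bar>det A\<bar>"
proof -
  have S: "{I :: 3 set. card I = 3} = {UNIV}"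
    using card_subset_eq[of "UNIV :: 3 set"] by auto
  have "wedge_matrix A UNIV UNIV = det A"
    by (simp add: wedge_matrix_def sorted_UNIV_3 wedge_3 matrix_vector_mult_basis column_def det_3 algebra_simps)
  then show ?thesis unfolding wedge_norm_def S by simp
qed

lemma matrix_entry_le_norm: "\<bar>A $ i $ j\<bar> \<le> norm (A :: real^3^3)"
  by (rule order.trans[OF component_le_norm_cart Finite_Cartesian_Product.norm_nth_le])

lemma norm_matrix_le:
  assumes "\<And>i j. \<bar>(A :: real^3^3) $ i $ j\<bar> \<le> c"
  shows "norm A \<le> 3 * c"
proof -
  have c: "c \<ge> 0" using assms[of 1 1] by linarith
  have "(\<Sum>i\<in>UNIV. \<Sum>j\<in>UNIV. (A $ i $ j)\<^sup>2) \<le> (\<Sum>i\<in>(UNIV :: 3 set). \<Sum>j\<in>(UNIV :: 3 set). c\<^sup>2)"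
    using assms by (intro sum_mono) (metis abs_le_square_iff abs_of_nonneg c)
  also have "\<dots> = (3 * c)\<^sup>2" by (simp add: power2_eq_square)
  finally show ?thesis unfolding norm_matrix_3 using c by (intro real_le_lsqrt) simp_all
qed

lemma norm_matrix_mult_le: "norm ((A :: real^3^3) ** (B :: real^3^3)) \<le> 9 * (norm A * norm B)"
proof -
  have "\<bar>(A ** B) $ i $ j\<bar> \<le> 3 * (norm A * norm B)" for i j
  proof -
    have "\<bar>(A ** B) $ i $ j\<bar> \<le> (\<Sum>k\<in>UNIV. \<bar>A $ i $ k * B $ k $ j\<bar>)"
      unfolding matrix_matrix_mult_def by (simp add: sum_abs)
    also have "\<dots> \<le> (\<Sum>k\<in>(UNIV :: 3 set). norm A * norm B)"
      unfolding abs_mult by (intro sum_mono mult_mono matrix_entry_le_norm) simp_all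
    finally show ?thesis by simp
  qed
  from norm_matrix_le[OF this] show ?thesis by simp
qed

lemma norm_cof_le: "norm (cof A) \<le> 6 * (norm A)\<^sup>2"
proof -
  have p: "\<bar>A $ a $ b * A $ c $ d\<bar> \<le> (norm A)\<^sup>2" for a b c d
    unfolding abs_mult power2_eq_square by (intro mult_mono matrix_entry_le_norm) simp_all
  have "\<bar>cof A $ i $ j\<bar> \<le> 2 * (norm A)\<^sup>2" for i j
    using p[of "next_index i" "next_index j" "next_index (next_index i)" "next_index (next_index j)"] p[of "next_index i" "next_index (next_index j)" "next_index (next_index i)" "next_index j"]
    by (simp add: cof_def)
  from norm_matrix_le[OF this] show ?thesis by simp
qed

text \<open>The determinant is a sum of six products of three entries; a smaller norm would make it
  less than 1. The logarithms of the norms are thereby bounded from below.\<close>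

lemma norm_ge_of_det:
  assumes "\<bar>det (A :: real^3^3)\<bar> = 1"
  shows "1 / 6 \<le> norm A"
proof (rule ccontr)
  assume n: "\<not> ?thesis"
  have p: "\<bar>A $ a $ b * A $ c $ d * A $ e $ f\<bar> \<le> norm A ^ 3" for a b c d e f
  proof -
    have "\<bar>A $ a $ b * A $ c $ d * A $ e $ f\<bar> \<le> norm A * norm A * norm A"
      unfolding abs_mult by (intro mult_mono matrix_entry_le_norm) simp_all
    then show ?thesis by (simp add: power3_eq_cube)
  qed
  have "\<bar>det A\<bar> \<le> 6 * norm A ^ 3"
    unfolding det_3 using p[of 1 1 2 2 3 3] p[of 1 2 2 3 3 1] p[of 1 3 2 1 3 2] p[of 1 1 2 3 3 2] p[of 1 2 2 1 3 3] p[of 1 3 2 2 3 1]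
    by linarith
  also have "norm A ^ 3 \<le> (1 / 6) ^ 3" using n by (intro power_mono) simp_all
  finally show False using assms by (simp add: power3_eq_cube)
qed

lemma norm_cof_det:
  assumes "\<bar>det A\<bar> = 1"
  shows "norm A \<le> 6 * (norm (cof A))\<^sup>2" "1 / 6 \<le> norm (cof A)"
proof -
  have "norm A = norm (cof (cof A))" using assms by (simp add: cof_cof)
  then show b: "norm A \<le> 6 * (norm (cof A))\<^sup>2" using norm_cof_le[of "cof A"] by simp
  show "1 / 6 \<le> norm (cof A)"
  proof (rule ccontr)
    assume "\<not> ?thesis"
    then have "(norm (cof A))\<^sup>2 < (1 / 6)\<^sup>2" by (intro power_strict_mono) simp_all
    then have "norm A < 1 / 6" using b by (simp add: power2_eq_square)
    then show False using norm_ge_of_det[OF assms] by simp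
  qed
qed

section \<open>Growth of the cocycle and of its minors\<close>

lemma cocycle_iter_block: "cocycle_iter n x = transpose (incidence_block x n)"
  by (induction n) (simp_all add: transpose_mat cocycle_def matrix_transpose_mul)

lemma cocycle_iter_add: "cocycle_iter (m + n) x = cocycle_iter n (sdrop m x) ** cocycle_iter m x"
  by (induction n) (simp_all add: sdrop_add matrix_mul_assoc)

lemma cocycle_iter_prefix: "stake n x = stake n y \<Longrightarrow> cocycle_iter n x = cocycle_iter n y"
proof (induction n)
  case (Suc n)
  have "stake n x = stake n y" and "x !! n = y !! n"
    using Suc.prems unfolding stake_Suc by simp_all
  then show ?case using Suc.IH by (simp add: cocycle_def)
qed simp

lemma cocycle_iter_block_mat_tr: "cocycle_iter n x *v y = block_mat_tr x n y"
  by (simp add: cocycle_iter_block block_mat_tr_def)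

lemma det_cocycle_iter: "AR_dir x \<Longrightarrow> det (cocycle_iter n x) = 1"
proof (induction n)
  case (Suc n)
  have "det (incidence (arnoux_rauzy i)) = 1" for i
    using exhaust_3[of i] by (elim disjE) (simp_all add: det_3 incidence_def arnoux_rauzy_def)
  then show ?case using Suc by (simp add: det_mul cocycle_def det_transpose dir_letter)
qed (simp add: det_I)

text \<open>Replacing column \<open>c\<close> by the image of a vector \<open>y\<close> that is
  orthogonal to \<open>u 0\<close> and supported on \<open>c\<close> and \<open>d\<close> only
  rescales the minor, and that image is contracted.\<close>

lemma cocycle_minor:
  fixes n :: nat
  assumes s: "AR_dir s" and u: "eigseq s u" and cd: "c \<noteq> d"
  defines "A \<equiv> cocycle_iter n s"
  shows "\<bar>A $ a $ c * A $ b $ d - A $ a $ d * A $ b $ c\<bar> \<le> 4 * (contr_bound s n * norm A)"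
proof -
  have main: "\<bar>A $ a $ c * A $ b $ d - A $ a $ d * A $ b $ c\<bar> \<le> 4 * (contr_bound s n * norm A)"
    if cd: "c \<noteq> d" and le: "u 0 $ c \<le> u 0 $ d" for c d
  proof -
    let ?C = "u 0 $ c" and ?D = "u 0 $ d"
    have C: "?C > 0" and D: "?D > 0" using eigseq_pos[OF u] by blast+
    \<comment> \<open>With \<open>?C \<le> ?D\<close> the spread of \<open>y\<close> is at most
      \<open>2 * ?D\<close>, so dividing by \<open>?D\<close> costs a constant factor independent of
      \<open>u\<close>.\<close>
    define y :: "real^3" where "y = ?D *\<^sub>R axis c 1 - ?C *\<^sub>R axis d 1"
    have y: "y \<bullet> u 0 = 0" by (simp add: y_def inner_diff_left inner_axis')
    have yk: "- ?C \<le> y $ k" "y $ k \<le> ?D" for k using cd C D by (auto simp: y_def axis_def)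
    have "spread y \<le> ?C + ?D" unfolding spread_def
      using yk(1)[of 1] yk(2)[of 1] yk(1)[of 2] yk(2)[of 2] yk(1)[of 3] yk(2)[of 3] by auto
    then have sp: "spread y \<le> 2 * ?D" using le by linarith
    have Ay: "(A *v y) $ k = ?D * A $ k $ c - ?C * A $ k $ d" for k
      unfolding y_def by (simp add: matrix_vector_mult_diff_distrib matrix_vector_mult_scaleR
          matrix_vector_mult_basis column_def)
    have b: "\<bar>(A *v y) $ k\<bar> \<le> contr_bound s n * (2 * ?D)" for k
    proof -
      have "\<bar>(A *v y) $ k\<bar> \<le> contr_bound s n * spread y" unfolding A_def cocycle_iter_block_mat_tr by (rule block_mat_tr_coord[OF s u y])
      also have "\<dots> \<le> contr_bound s n * (2 * ?D)" using sp contr_bound_pos[of s n] by (intro mult_left_mono) simp_all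
      finally show ?thesis .
    qed
    have b2: "\<bar>(A *v y) $ k * A $ l $ d\<bar> \<le> contr_bound s n * (2 * ?D) * norm A" for k l
      unfolding abs_mult using contr_bound_pos[of s n] D by (intro mult_mono b matrix_entry_le_norm) simp_all
    have "?D * (A $ a $ c * A $ b $ d - A $ a $ d * A $ b $ c) = (A *v y) $ a * A $ b $ d - (A *v y) $ b * A $ a $ d"
      unfolding Ay by (simp add: algebra_simps)
    then have "\<bar>?D * (A $ a $ c * A $ b $ d - A $ a $ d * A $ b $ c)\<bar> \<le> 2 * (contr_bound s n * (2 * ?D) * norm A)"
      using b2[of a b] b2[of b a] by linarith
    moreover have "\<bar>?D * (A $ a $ c * A $ b $ d - A $ a $ d * A $ b $ c)\<bar> =
        ?D * \<bar>A $ a $ c * A $ b $ d - A $ a $ d * A $ b $ c\<bar>"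
      using D by (simp only: abs_mult abs_of_pos)
    ultimately have "?D * \<bar>A $ a $ c * A $ b $ d - A $ a $ d * A $ b $ c\<bar> \<le> ?D * (4 * (contr_bound s n * norm A))"
      by (simp only: algebra_simps)
    then show ?thesis using D by simp
  qed
  show ?thesis
  proof (cases "u 0 $ c \<le> u 0 $ d")
    case True
    then show ?thesis by (rule main[OF cd])
  next
    case False
    then show ?thesis using main[of d c] cd by (simp add: abs_minus_commute)
  qed
qed

lemma norm_cof_cocycle:
  assumes "AR_dir s" "eigseq s u"
  shows "norm (cof (cocycle_iter n s)) \<le> 12 * (contr_bound s n * norm (cocycle_iter n s))"
proof -
  have ne: "next_index i \<noteq> next_index (next_index i)" for i using exhaust_3[of i] by auto
  have "\<bar>cof (cocycle_iter n s) $ i $ j\<bar> \<le> 4 * (contr_bound s n * norm (cocycle_iter n s))" for i j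
    unfolding cof_def using cocycle_minor[OF assms ne[of j], where n=n and a="next_index i" and b="next_index (next_index i)"] by simp
  from norm_matrix_le[OF this] show ?thesis by simp
qed

text \<open>Fekete's lemma with a bounded error \<open>c\<close>; adding \<open>c\<close> to the
  sequence makes it subadditive, and the lower bound keeps the limit finite.\<close>

lemma fekete:
  fixes a :: "nat \<Rightarrow> real"
  assumes sub: "\<And>m n. a (m + n) \<le> a m + a n + c" and low: "\<And>n. d \<le> a n"
  shows "\<exists>L. (\<lambda>n. 1 / real n * a n) \<longlonglongrightarrow> L"
proof -
  define b where "b n = a n + c" for n
  have bs: "b (m + n) \<le> b m + b n" for m n using sub[of m n] by (simp add: b_def)
  have bq: "b (q * k + r) \<le> real q * b k + b r" for q k r
  proof (induction q)
    case (Suc q)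
    then show ?case using bs[of k "q * k + r"] by (simp add: algebra_simps)
  qed simp
  let ?S = "(\<lambda>n. b n / real n) ` {1..}"
  have "bdd_below ?S"
  proof (rule bdd_belowI2)
    fix n :: nat assume n: "n \<in> {1..}"
    have "- \<bar>d + c\<bar> * real n \<le> - \<bar>d + c\<bar> * 1" using n by (intro mult_left_mono_neg) simp_all
    also have "\<dots> \<le> b n" using low[of n] by (simp add: b_def)
    finally show "- \<bar>d + c\<bar> \<le> b n / real n" using n by (simp add: pos_le_divide_eq)
  qed
  then have low': "Inf ?S \<le> b n / real n" if "n \<ge> 1" for n using that by (intro cInf_lower) auto
  have "(\<lambda>n. b n / real n) \<longlonglongrightarrow> Inf ?S"
  proof (rule order_tendstoI)
    fix y assume "y < Inf ?S"
    then show "\<forall>\<^sub>F n in sequentially. y < b n / real n"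
      using low' by (intro eventually_sequentiallyI[of 1]) (meson order.strict_trans2)
  next
    fix y assume "Inf ?S < y"
    then obtain k where k: "k \<ge> 1" "b k / real k < y" using cInf_lessD[of ?S y] by auto
    define M where "M = Max ((\<lambda>r. \<bar>b r\<bar>) ` {..k})"
    have M: "\<bar>b r\<bar> \<le> M" if "r \<le> k" for r unfolding M_def using that by (intro Max_ge) auto
    have up: "b n / real n \<le> b k / real k + 2 * M * (1 / real n)" if n: "n \<ge> 1" for n
    proof -
      define q r where "q = n div k" and "r = n mod k"
      have nq: "n = q * k + r" by (simp add: q_def r_def)
      have r: "r \<le> k" using k(1) by (simp add: r_def less_imp_le)
      define t where "t = real r / real k * b k"
      have "real q * b k = real n * (b k / real k) - t"
        using k(1) by (simp add: nq t_def field_simps)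
      moreover have "\<bar>t\<bar> \<le> 1 * M"
        unfolding t_def abs_mult by (rule mult_mono) (use r k(1) M[of k] in \<open>simp_all add: divide_le_eq_1\<close>)
      moreover have "b n \<le> real q * b k + b r" unfolding nq by (rule bq)
      ultimately have "b n \<le> real n * (b k / real k) + 2 * M"
        using M[OF r] by argo
      then show ?thesis using n by (simp add: field_simps)
    qed
    have "(\<lambda>n. b k / real k + 2 * M * (1 / real n)) \<longlonglongrightarrow> b k / real k + 2 * M * 0"
      by (intro tendsto_intros lim_const_over_n)
    then have "\<forall>\<^sub>F n in sequentially. b k / real k + 2 * M * (1 / real n) < y"
      by (rule order_tendstoD) (use k(2) in simp)
    then show "\<forall>\<^sub>F n in sequentially. b n / real n < y"
      using eventually_ge_at_top[of 1] by eventually_elim (use up in \<open>meson order.strict_trans1\<close>)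
  qed
  moreover have "(\<lambda>n. c * (1 / real n)) \<longlonglongrightarrow> c * 0" by (intro tendsto_intros lim_const_over_n)
  ultimately have "(\<lambda>n. b n / real n - c * (1 / real n)) \<longlonglongrightarrow> Inf ?S - c * 0" by (rule tendsto_diff)
  moreover have "b n / real n - c * (1 / real n) = 1 / real n * a n" for n
    by (simp add: b_def add_divide_distrib)
  ultimately have "(\<lambda>n. 1 / real n * a n) \<longlonglongrightarrow> Inf ?S - c * 0" by simp
  then show ?thesis by blast
qed

context
  fixes \<nu> :: "subst stream measure"
  assumes e: "ergodic_shift_measure AR_substs \<nu>"
    and pos: "\<forall>w\<in>lists AR_substs. emeasure \<nu> (sstart AR_substs w) > 0"
begin

lemma integral_sdrop:
  fixes f :: "subst stream \<Rightarrow> real"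
  assumes "f \<in> borel_measurable \<nu>"
  shows "(\<integral>x. f (sdrop n x) \<partial>\<nu>) = (\<integral>x. f x \<partial>\<nu>)"
  using integral_distr[OF sdrop_nu[OF e] assms, of n] by (simp add: distr_sdrop_nu[OF e])

text \<open>The iterate depends on the first \<open>n\<close> substitutions only, so finitely many
  values occur.\<close>

lemma integrable_cocycle:
  fixes f :: "real^3^3 \<Rightarrow> real"
  shows "integrable \<nu> (\<lambda>x. f (cocycle_iter n x))"
proof -
  interpret prob_space \<nu> by (rule prob_nu[OF e])
  define F where "F w = f (cocycle_iter n (w @- sconst undefined))" for w
  have F: "f (cocycle_iter n x) = F (stake n x)" for x
    unfolding F_def by (rule arg_cong[where f = f], rule cocycle_iter_prefix) (simp add: stake_shift)
  let ?W = "{w. set w \<subseteq> AR_substs \<and> length w = n}"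
  have fin: "finite ?W" by (rule finite_lists_length_eq) (simp add: AR_substs_def)
  have W: "stake n x \<in> ?W" if "x \<in> space \<nu>" for x
    using that sset_shift[of "stake n x" "sdrop n x"] unfolding stake_sdrop by (auto simp: space_nu[OF e] streams_iff_sset)
  show ?thesis unfolding F
  proof (rule integrable_const_bound)
    show "AE x in \<nu>. norm (F (stake n x)) \<le> Max ((\<lambda>w. norm (F w)) ` ?W)"
      by (intro AE_I2 Max_ge finite_imageI fin imageI W)
    show "(\<lambda>x. F (stake n x)) \<in> borel_measurable \<nu>"
      by (rule measurable_compose[OF measurable_prefix[OF e pos]]) simp
  qed
qed

text \<open>To be used with \<open>\<Phi>\<close> the identity for the first exponent and
  \<open>\<Phi>\<close> the cofactor map for the sum of the first two. The norm is submultiplicative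
  up to the factor 9, whose logarithm is the error in \<open>fekete\<close>.\<close>

lemma lyapunov_limit:
  fixes \<Phi> :: "real^3^3 \<Rightarrow> real^3^3"
  assumes mult: "\<And>A B. \<Phi> (A ** B) = \<Phi> A ** \<Phi> B"
    and low: "\<And>A. \<bar>det A\<bar> = 1 \<Longrightarrow> 1 / 6 \<le> norm (\<Phi> A)"
  shows "\<exists>L. (\<lambda>n. 1 / real n * (\<integral>x. ln (norm (\<Phi> (cocycle_iter n x))) \<partial>\<nu>)) \<longlonglongrightarrow> L"
proof (rule fekete)
  interpret prob_space \<nu> by (rule prob_nu[OF e])
  let ?f = "\<lambda>n x. ln (norm (\<Phi> (cocycle_iter n x)))"
  have i: "integrable \<nu> (?f n)" for n by (rule integrable_cocycle)
  have l: "1 / 6 \<le> norm (\<Phi> (cocycle_iter n x))" if "x \<in> space \<nu>" for n x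
    by (rule low) (simp add: det_cocycle_iter[OF AR_dir_space[OF e pos that]])
  fix m n
  have im: "integrable \<nu> (\<lambda>x. ?f n (sdrop m x))"
    using integrable_distr[OF sdrop_nu[OF e, of m], where f = "?f n"] i[of n] by (simp add: distr_sdrop_nu[OF e])
  have "(\<integral>x. ?f (m + n) x \<partial>\<nu>) \<le> (\<integral>x. ?f m x + ?f n (sdrop m x) + ln 9 \<partial>\<nu>)"
  proof (rule integral_mono)
    show "integrable \<nu> (?f (m + n))" by (rule i)
    show "integrable \<nu> (\<lambda>x. ?f m x + ?f n (sdrop m x) + ln 9)" using i[of m] im by simp
    fix x assume x: "x \<in> space \<nu>"
    let ?A = "\<Phi> (cocycle_iter m x)" and ?B = "\<Phi> (cocycle_iter n (sdrop m x))"
    have A: "norm ?A > 0" and B: "norm ?B > 0" and AB: "norm (\<Phi> (cocycle_iter (m + n) x)) > 0"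
      using l[OF x, of m] l[OF sdrop_space_nu[OF e x], of n m] l[OF x, of "m + n"] by linarith+
    have "norm (\<Phi> (cocycle_iter (m + n) x)) \<le> 9 * (norm ?B * norm ?A)"
      unfolding cocycle_iter_add mult by (rule norm_matrix_mult_le)
    then have "?f (m + n) x \<le> ln (9 * (norm ?B * norm ?A))" using AB by (simp add: ln_mono)
    also have "\<dots> = ln 9 + (ln (norm ?B) + ln (norm ?A))" using A B by (simp add: ln_mult_pos)
    finally show "?f (m + n) x \<le> ?f m x + ?f n (sdrop m x) + ln 9" by simp
  qed
  also have "\<dots> = (\<integral>x. ?f m x \<partial>\<nu>) + (\<integral>x. ?f n (sdrop m x) \<partial>\<nu>) + ln 9"
    using i[of m] im by (simp add: prob_space)
  also have "(\<integral>x. ?f n (sdrop m x) \<partial>\<nu>) = (\<integral>x. ?f n x \<partial>\<nu>)"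
    by (rule integral_sdrop) (use i[of n] in simp)
  finally show "(\<integral>x. ?f (m + n) x \<partial>\<nu>) \<le> (\<integral>x. ?f m x \<partial>\<nu>) + (\<integral>x. ?f n x \<partial>\<nu>) + ln 9" .
next
  interpret prob_space \<nu> by (rule prob_nu[OF e])
  fix n
  have "(\<integral>x. ln (1 / 6) \<partial>\<nu>) \<le> (\<integral>x. ln (norm (\<Phi> (cocycle_iter n x))) \<partial>\<nu>)"
  proof (rule integral_mono)
    fix x assume x: "x \<in> space \<nu>"
    have "1 / 6 \<le> norm (\<Phi> (cocycle_iter n x))"
      by (rule low) (simp add: det_cocycle_iter[OF AR_dir_space[OF e pos x]])
    then show "ln (1 / 6) \<le> ln (norm (\<Phi> (cocycle_iter n x)))" by (intro ln_mono) simp_all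
  next
    show "integrable \<nu> (\<lambda>x. ln (norm (\<Phi> (cocycle_iter n x))))" by (rule integrable_cocycle)
  qed simp
  then show "ln (1 / 6) \<le> (\<integral>x. ln (norm (\<Phi> (cocycle_iter n x))) \<partial>\<nu>)" by (simp add: prob_space)
qed

lemma integral_block_count:
  "integrable \<nu> (\<lambda>x. real (block_count x n))"
  "(\<integral>x. real (block_count x n) \<partial>\<nu>) = real n * measure \<nu> {x \<in> space \<nu>. block_at x 0}"
proof -
  interpret prob_space \<nu> by (rule prob_nu[OF e])
  let ?g = "\<lambda>x. indicator {x \<in> space \<nu>. block_at x 0} x :: real"
  have G: "{x \<in> space \<nu>. block_at x 0} \<in> sets \<nu>" using measurable_block_at[OF e pos, of 0] by measurable
  then have ig: "integrable \<nu> ?g" by (simp add: integrable_indicator_iff emeasure_eq_measure)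
  have igk: "integrable \<nu> (\<lambda>x. ?g (sdrop k x))" for k
    using integrable_distr[OF sdrop_nu[OF e, of k], where f = ?g] ig by (simp add: distr_sdrop_nu[OF e])
  have eg: "(\<integral>x. ?g (sdrop k x) \<partial>\<nu>) = measure \<nu> {x \<in> space \<nu>. block_at x 0}" for k
    using integral_sdrop[where f = ?g and n = k] ig G by simp
  have c: "real (block_count x n) = (\<Sum>k<n. ?g (sdrop k x))" if "x \<in> space \<nu>" for x
  proof (induction n)
    case (Suc n)
    have "?g (sdrop n x) = (if block_at x n then 1 else 0)" using sdrop_space_nu[OF e that, of n] by simp
    then show ?case using Suc by (simp add: block_count_Suc)
  qed simp
  show "integrable \<nu> (\<lambda>x. real (block_count x n))"
    using igk by (subst Bochner_Integration.integrable_cong[OF refl c]) simp_all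
  have "(\<integral>x. real (block_count x n) \<partial>\<nu>) = (\<integral>x. (\<Sum>k<n. ?g (sdrop k x)) \<partial>\<nu>)"
    by (rule Bochner_Integration.integral_cong[OF refl c])
  also have "\<dots> = (\<Sum>k<n. \<integral>x. ?g (sdrop k x) \<partial>\<nu>)" by (rule Bochner_Integration.integral_sum) (rule igk)
  also have "\<dots> = real n * measure \<nu> {x \<in> space \<nu>. block_at x 0}" unfolding eg by simp
  finally show "(\<integral>x. real (block_count x n) \<partial>\<nu>) = real n * measure \<nu> {x \<in> space \<nu>. block_at x 0}" .
qed

text \<open>\<open>L1\<close> and \<open>L2\<close> are the growth rates of the cocycle and of its
  minors. \<open>L1 \<le> 2 * L2\<close> and \<open>L2 < L1\<close> together already imply
  \<open>L1 > 0\<close>; no separate estimate of the growth is made.\<close>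

theorem pisot: "pisot_condition \<nu>"
proof -
  interpret prob_space \<nu> by (rule prob_nu[OF e])
  define p where "p = measure \<nu> {x \<in> space \<nu>. block_at x 0}"
  have p: "p > 0" unfolding p_def by (rule block_at_positive[OF e pos])
  let ?f = "\<lambda>n x. ln (norm (cocycle_iter n x))" and ?g = "\<lambda>n x. ln (norm (cof (cocycle_iter n x)))"
  have if': "integrable \<nu> (?f n)" and ig: "integrable \<nu> (?g n)" for n by (rule integrable_cocycle)+
  obtain L1 where L1: "(\<lambda>n. 1 / real n * (\<integral>x. ?f n x \<partial>\<nu>)) \<longlonglongrightarrow> L1"
    using lyapunov_limit[of "\<lambda>A. A"] norm_ge_of_det by auto
  obtain L2 where L2: "(\<lambda>n. 1 / real n * (\<integral>x. ?g n x \<partial>\<nu>)) \<longlonglongrightarrow> L2"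
    using lyapunov_limit[of cof, OF cof_mult norm_cof_det(2)] by auto
  have d: "\<bar>det (cocycle_iter n x)\<bar> = 1" if "x \<in> space \<nu>" for n x
    by (simp add: det_cocycle_iter[OF AR_dir_space[OF e pos that]])
  have le1: "L1 \<le> 2 * L2"
  proof -
    have "(\<integral>x. ?f n x \<partial>\<nu>) \<le> (\<integral>x. ln 6 + 2 * ?g n x \<partial>\<nu>)" for n
    proof (rule integral_mono[OF if'])
      show "integrable \<nu> (\<lambda>x. ln 6 + 2 * ?g n x)" using ig[of n] by simp
      fix x assume x: "x \<in> space \<nu>"
      have n: "norm (cocycle_iter n x) > 0" "norm (cof (cocycle_iter n x)) > 0"
        using norm_ge_of_det[OF d[OF x]] norm_cof_det(2)[OF d[OF x]] by (meson less_le_trans zero_less_divide_1_iff zero_less_numeral)+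
      have "?f n x \<le> ln (6 * (norm (cof (cocycle_iter n x)))\<^sup>2)"
        using norm_cof_det(1)[OF d[OF x]] n(1) by (simp add: ln_mono)
      also have "\<dots> = ln 6 + 2 * ?g n x" using n(2) by (simp add: ln_mult_pos ln_realpow)
      finally show "?f n x \<le> ln 6 + 2 * ?g n x" .
    qed
    also have "(\<integral>x. ln 6 + 2 * ?g n x \<partial>\<nu>) = ln 6 + 2 * (\<integral>x. ?g n x \<partial>\<nu>)" for n
      using ig[of n] by (simp add: prob_space)
    finally have "1 / real n * (\<integral>x. ?f n x \<partial>\<nu>) \<le> ln 6 * (1 / real n) + 2 * (1 / real n * (\<integral>x. ?g n x \<partial>\<nu>))" for n
      using mult_left_mono[of "\<integral>x. ?f n x \<partial>\<nu>" "ln 6 + 2 * (\<integral>x. ?g n x \<partial>\<nu>)" "1 / real n"] by (simp add: algebra_simps add_divide_distrib)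
    moreover have "(\<lambda>n. ln 6 * (1 / real n) + 2 * (1 / real n * (\<integral>x. ?g n x \<partial>\<nu>))) \<longlonglongrightarrow> ln 6 * 0 + 2 * L2"
      by (intro tendsto_intros L2 lim_const_over_n)
    ultimately have "L1 \<le> ln 6 * 0 + 2 * L2" using L1 by (intro LIMSEQ_le[OF L1]) blast+
    then show ?thesis by simp
  qed
  have le2: "L2 \<le> L1 + ln contr_rate * p"
  proof -
    \<comment> \<open>Taken at \<open>Suc n\<close> because \<open>contr_bound\<close> at
      \<open>Suc n\<close> counts the blocks before \<open>n\<close>; by stationarity their expected
      number is \<open>n * p\<close>.\<close>
    have "(\<integral>x. ?g (Suc n) x \<partial>\<nu>) \<le> (\<integral>x. ln 12 + ln contr_rate * real (block_count x n) + ?f (Suc n) x \<partial>\<nu>)" for n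
    proof (rule integral_mono_AE[OF ig])
      show "integrable \<nu> (\<lambda>x. ln 12 + ln contr_rate * real (block_count x n) + ?f (Suc n) x)"
        using if'[of "Suc n"] integral_block_count(1)[of n] by simp
      show "AE x in \<nu>. ?g (Suc n) x \<le> ln 12 + ln contr_rate * real (block_count x n) + ?f (Suc n) x"
        using AE_good[OF e pos] AE_space
      proof eventually_elim
        case (elim x)
        obtain u where u: "eigseq x u" by (rule eigseq_exists[OF good_AR[OF elim(1)] good_blocks_recur[OF elim(1)]])
        let ?A = "cocycle_iter (Suc n) x"
        have n: "norm ?A > 0" "norm (cof ?A) > 0"
          using norm_ge_of_det[OF d[OF elim(2)]] norm_cof_det(2)[OF d[OF elim(2)]] by (meson less_le_trans zero_less_divide_1_iff zero_less_numeral)+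
        have "norm (cof ?A) \<le> 12 * (contr_rate ^ block_count x n * norm ?A)"
          using norm_cof_cocycle[OF good_AR[OF elim(1)] u, of "Suc n"] by (simp add: contr_bound_def)
        then have "?g (Suc n) x \<le> ln (12 * (contr_rate ^ block_count x n * norm ?A))" using n(2) by (intro ln_mono)
        also have "\<dots> = ln 12 + (ln (contr_rate ^ block_count x n) + ?f (Suc n) x)"
          using n(1) contr_rate(1) by (simp add: ln_mult_pos)
        also have "ln (contr_rate ^ block_count x n) = real (block_count x n) * ln contr_rate" using contr_rate(1) by (simp add: ln_realpow)
        finally show ?case by (simp add: mult.commute)
      qed
    qed
    also have "(\<integral>x. ln 12 + ln contr_rate * real (block_count x n) + ?f (Suc n) x \<partial>\<nu>) =
        ln 12 + ln contr_rate * (real n * p) + (\<integral>x. ?f (Suc n) x \<partial>\<nu>)" for n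
      using if'[of "Suc n"] integral_block_count[of n] by (simp add: prob_space p_def)
    finally have b: "(\<integral>x. ?g (Suc n) x \<partial>\<nu>) \<le> ln 12 + ln contr_rate * (real n * p) + (\<integral>x. ?f (Suc n) x \<partial>\<nu>)" for n .
    have "1 / real (Suc n) * (\<integral>x. ?g (Suc n) x \<partial>\<nu>) \<le> ln 12 * inverse (real (Suc n)) + ln contr_rate * p * (real n / real (Suc n))
        + 1 / real (Suc n) * (\<integral>x. ?f (Suc n) x \<partial>\<nu>)" for n
    proof -
      have "1 / real (Suc n) * (\<integral>x. ?g (Suc n) x \<partial>\<nu>) \<le>
          1 / real (Suc n) * (ln 12 + ln contr_rate * (real n * p) + (\<integral>x. ?f (Suc n) x \<partial>\<nu>))"
        by (rule mult_left_mono[OF b]) simp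
      also have "\<dots> = ln 12 * inverse (real (Suc n)) + ln contr_rate * p * (real n / real (Suc n))
        + 1 / real (Suc n) * (\<integral>x. ?f (Suc n) x \<partial>\<nu>)"
        by (simp add: add_divide_distrib divide_inverse algebra_simps)
      finally show ?thesis .
    qed
    moreover have "(\<lambda>n. ln 12 * inverse (real (Suc n)) + ln contr_rate * p * (real n / real (Suc n))
        + 1 / real (Suc n) * (\<integral>x. ?f (Suc n) x \<partial>\<nu>)) \<longlonglongrightarrow> ln 12 * 0 + ln contr_rate * p * 1 + L1"
      by (intro tendsto_add tendsto_mult_left LIMSEQ_inverse_real_of_nat LIMSEQ_n_over_Suc_n LIMSEQ_Suc[OF L1])
    ultimately have "L2 \<le> ln 12 * 0 + ln contr_rate * p * 1 + L1" by (intro LIMSEQ_le[OF LIMSEQ_Suc[OF L2]]) blast+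
    then show ?thesis by simp
  qed
  have lt: "L2 < L1" using le2 p contr_rate by (smt (verit) ln_less_zero mult_neg_pos)
  \<comment> \<open>The determinant has absolute value 1, so the three exponents add up to
    0.\<close>
  define \<theta> where "\<theta> j = (if j = 1 then L1 else if j = 2 then L2 - L1 else - L2)" for j :: nat
  have s: "(\<Sum>j=1..1. \<theta> j) = L1" "(\<Sum>j=1..2. \<theta> j) = L2" "(\<Sum>j=1..3. \<theta> j) = 0"
    by (simp_all add: \<theta>_def eval_nat_numeral)
  have w3: "ln (wedge_norm 3 (cocycle_iter n x)) = 0" if "x \<in> space \<nu>" for n x
    unfolding wedge_norm_3 d[OF that] by simp
  have "lyapunov_exponents \<nu> \<theta>" unfolding lyapunov_exponents_def
  proof
    fix k :: nat assume "k \<in> {1..3}"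
    then consider "k = 1" | "k = 2" | "k = 3" by force
    then show "(\<forall>n. integrable \<nu> (\<lambda>x. ln (wedge_norm k (cocycle_iter n x)))) \<and>
      (\<lambda>n. 1 / real n * (\<integral>x. ln (wedge_norm k (cocycle_iter n x)) \<partial>\<nu>)) \<longlonglongrightarrow> (\<Sum>j=1..k. \<theta> j)"
    proof cases
      case 1
      show ?thesis unfolding 1 wedge_norm_1 s using if' L1 by blast
    next
      case 2
      show ?thesis unfolding 2 wedge_norm_2 s using ig L2 by blast
    next
      case 3
      have "(\<integral>x. ln (wedge_norm 3 (cocycle_iter n x)) \<partial>\<nu>) = (\<integral>x. 0 \<partial>\<nu>)" for n
        by (rule Bochner_Integration.integral_cong) (simp_all add: w3)
      then show ?thesis unfolding 3 s using integrable_cocycle[of "\<lambda>A. ln (wedge_norm 3 A)"] by simp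
    qed
  qed
  moreover have "\<theta> 1 > 0 \<and> 0 > \<theta> 2 \<and> \<theta> 2 \<ge> \<theta> 3" using lt le1 by (simp add: \<theta>_def)
  ultimately show ?thesis unfolding pisot_condition_def by blast
qed

end

theorem theorem3p7:
  fixes \<nu> :: "subst stream measure"
  assumes "ergodic_shift_measure AR_substs \<nu>"
    and "\<And>w. w \<in> lists AR_substs \<Longrightarrow> emeasure \<nu> (sstart AR_substs w) > 0"
  shows "pisot_condition \<nu> \<and>
    (AE s in \<nu>.
      (\<exists>u. generalized_right_eigenvector s u) \<and>
      (\<forall>u. generalized_right_eigenvector s u \<longrightarrow> tiling_ones_perp (rauzy_collection s u)) \<and>
      (\<exists>!\<mu>. shift_invariant_measure (sadic_shift s) \<mu>) \<and>
      (\<exists>t::real^2.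
        (\<forall>\<mu>. shift_invariant_measure (sadic_shift s) \<mu> \<longrightarrow>
          measurably_conjugate \<mu> stl torus (torus_translation t)) \<and>
        natural_codings integer_lattice t (sadic_shift s)))"
proof
  note e = assms(1)
  have pos: "\<forall>w\<in>lists AR_substs. emeasure \<nu> (sstart AR_substs w) > 0" using assms(2) by blast
  show "pisot_condition \<nu>" by (rule pisot[OF e pos])
  show "AE s in \<nu>.
      (\<exists>u. generalized_right_eigenvector s u) \<and>
      (\<forall>u. generalized_right_eigenvector s u \<longrightarrow> tiling_ones_perp (rauzy_collection s u)) \<and>
      (\<exists>!\<mu>. shift_invariant_measure (sadic_shift s) \<mu>) \<and>
      (\<exists>t::real^2.
        (\<forall>\<mu>. shift_invariant_measure (sadic_shift s) \<mu> \<longrightarrow>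
          measurably_conjugate \<mu> stl torus (torus_translation t)) \<and>
        natural_codings integer_lattice t (sadic_shift s))"
    using AE_good[OF e pos]
  proof eventually_elim
    case (elim s)
    have a: "AR_dir s" and i: "blocks_recur s" using elim by (rule good_AR, rule good_blocks_recur)
    obtain u where u: "eigseq s u" by (rule eigseq_exists[OF a i])
    show ?case
    proof (intro conjI allI impI exI)
      show "generalized_right_eigenvector s (u 0)" by (rule eigseq_generalized_right_eigenvector[OF a i u])
      show "\<exists>!\<mu>. shift_invariant_measure (sadic_shift s) \<mu>" by (rule unique_invariant[OF elim u])
      show "measurably_conjugate \<mu> stl torus (torus_translation (tau (u 0) 1))"
        if "shift_invariant_measure (sadic_shift s) \<mu>" for \<mu> using that by (rule conjugate[OF elim u])
      show "natural_codings integer_lattice (tau (u 0) 1) (sadic_shift s)" by (rule natural_codings_sadic[OF elim u])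
    next
      fix v assume "generalized_right_eigenvector s v"
      \<comment> \<open>Any generalized right eigenvector heads such a sequence, so the tiling
        result covers every normalisation.\<close>
      then obtain u where "eigseq s u" "u 0 = v" by (rule generalized_right_eigenvector_eigseq[OF a i])
      then show "tiling_ones_perp (rauzy_collection s v)" using tiling[OF elim] by blast
    qed
  qed
qed

end
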